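(* Let $D\subset\mathbb{R}^2$ be a compact polygon containing the origin in its interior and star-shaped with respect to the origin, so that its boundary is given in polar coordinates by $r=m(\theta)^{1/2}$ for a continuous, positive, piecewise smooth function $m$ on the unit circle $S^1$. Assume $D$ is an algebraic polygon: for every side of $D$, the ratio of the two direction numbers (coordinates) of its normal vector is an algebraic number of degree $\ge 2$. Let $f$ be a smooth function on $S^1$ and for $\rho>0$ let \[N_D(\rho)=\sum_{N\in\mathbb{Z}^2\setminus\{0\},\ N\in\rho D} f\big(N/|N|\big).\] Then for every $\epsilon>0$, as $\rho\to\infty$, \[\int_{S^1} f(\theta)\,m(\theta)\,d\theta=\frac{2}{\rho^2}N_D(\rho)+O(\rho^{\epsilon-2}).\]
   Context: $d\theta$ denotes arc-length (Lebesgue) measure on $S^1$. $N_D(\rho)$ is the action on $f$ of the discrete measure on $S^1$ obtained by placing unit masses at the radial projections $N/|N|$ of the nonzero integer lattice points in the dilate $\rho D$. The implied constant in the $O$-term may depend on $\epsilon$, $D$ and $f$. *)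

theory Defs
  imports "HOL-Analysis.Analysis" "HOL-Computational_Algebra.Polynomial"
    "HOL-Library.Landau_Symbols"
begin

text \<open>The plane R^2 is identified with the complex numbers; the unit circle S^1 is
  the set of complex numbers of norm 1, parametrised by arc length via cis.\<close>

definition alg_degree :: "real \<Rightarrow> nat" where
  "alg_degree x = (LEAST n. \<exists>p :: int poly. p \<noteq> 0 \<and> degree p = n \<and> poly (map_poly of_int p) x = 0)"

text \<open>Direction numbers of a normal vector of the side from v to w: if w - v = (a,b)
  then (b,-a) is a normal; the ratio of its two coordinates.\<close>
definition normal_ratio :: "complex \<Rightarrow> complex \<Rightarrow> real" where
  "normal_ratio v w = Im (w - v) / (- Re (w - v))"

definition algebraic_polygon :: "complex set \<Rightarrow> bool" where
  "algebraic_polygon D \<longleftrightarrow> (\<exists>vs :: complex list. length vs \<ge> 3 \<and>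
     (\<forall>i < length vs. vs ! i \<noteq> vs ! ((i + 1) mod length vs)) \<and>
     frontier D = (\<Union>i < length vs. closed_segment (vs ! i) (vs ! ((i + 1) mod length vs))) \<and>
     (\<forall>i < length vs. algebraic (normal_ratio (vs ! i) (vs ! ((i + 1) mod length vs))) \<and>
         alg_degree (normal_ratio (vs ! i) (vs ! ((i + 1) mod length vs))) \<ge> 2))"

definition smooth_on_circle :: "(complex \<Rightarrow> real) \<Rightarrow> bool" where
  "smooth_on_circle f \<longleftrightarrow> (\<forall>k x. ((deriv ^^ k) (\<lambda>t. f (cis t))) differentiable at x)"

definition lattice_count :: "(complex \<Rightarrow> real) \<Rightarrow> complex set \<Rightarrow> real \<Rightarrow> real" where
  "lattice_count f D \<rho> = (\<Sum>N \<in> {z. z \<noteq> 0 \<and> Re z \<in> \<int> \<and> Im z \<in> \<int> \<and> z \<in> (\<lambda>x. \<rho> *\<^sub>R x) ` D}.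
       f (N / complex_of_real (norm N)))"

end

theory Submission
  imports "HOL-Library.Poly_Mapping" "Jordan_Normal_Form.Determinant" Defs
begin

text \<open>
  Split the plane into the four quarter-plane cones around the coordinate half-axes and sum over lattice lines
  perpendicular to the axis of each cone. Euler--Maclaurin summation reduces the sum over one line to an integral,
  plus sawtooth terms where the line leaves the cone or crosses a side of \<open>\<rho>D\<close>. The terms at the boundaries
  of the cones cancel between neighbouring cones. A side of slope \<open>a\<close> contributes sums
  \<open>\<Sum>n<N. {na + \<beta>} - 1/2\<close>, which are \<open>O(N powr \<epsilon>)\<close> uniformly in \<open>\<beta>\<close>
  because Roth's theorem bounds \<open>|a - p/q|\<close> from below by a multiple of \<open>q powr (-2-\<epsilon>)\<close>.

  Roth's theorem is proved in the classical way: Siegel's lemma yields an integer polynomial in many variables that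
  vanishes to high index at \<open>(a, ..., a)\<close>; very good approximations with rapidly growing denominators would force a
  high index at a rational point as well, which Roth's lemma excludes.
\<close>

subsection \<open>Multivariate polynomials and Hasse derivatives\<close>

text \<open>The weight of \<open>N\<close> depends only on its slope, so in the column
  \<open>x = n\<close> it is a fixed function of \<open>y / n\<close>: each derivative in
  \<open>y\<close> gains a factor \<open>1 / n\<close>, the Euler-Maclaurin error of a column is
  \<open>O(1 / n)\<close>, and all columns together cost only a logarithm. The sawtooth terms have
  total size \<rho> before cancellation. Their bound must be uniform in the intercept, because the
  intercept of a side of \<open>\<rho>D\<close> moves with \<rho>; and the block argument for it
  loses a power of \<open>N\<close> unless the irrationality exponent is 2, so exponents of
  Liouville or Thue type would not do. In Roth's lemma the last variable is separated from the
  others. Coefficients of a product in disjoint variables are products of coefficients, which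
  controls the heights of factors without Gelfond's inequality. Nonvanishing of the determinant of
  derivatives is reduced to interpolation by products of linear factors. The order of vanishing at a
  point is treated as a lower bound on the exponents of the translated polynomial, a notion that
  passes through products and determinants.\<close>

type_synonym expo = "nat \<Rightarrow>\<^sub>0 nat"
type_synonym mpol = "expo \<Rightarrow>\<^sub>0 real"

abbreviation lookup where "lookup \<equiv> Poly_Mapping.lookup"
abbreviation keys where "keys \<equiv> Poly_Mapping.keys"
abbreviation single where "single \<equiv> Poly_Mapping.single"

lemma mpol_eq_sum_single:
  fixes p :: "'a \<Rightarrow>\<^sub>0 'b::comm_monoid_add"
  assumes "finite S" "keys p \<subseteq> S"
  shows "p = (\<Sum>J\<in>S. single J (lookup p J))"
proof (rule poly_mapping_eqI)
  fix k
  have "lookup (\<Sum>J\<in>S. single J (lookup p J)) k = (\<Sum>J\<in>S. if J = k then lookup p k else 0)"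
    unfolding lookup_sum by (intro sum.cong) (auto simp: lookup_single when_def)
  also have "\<dots> = lookup p k" using assms by (auto simp: in_keys_iff sum.delta)
  finally show "lookup p k = lookup (\<Sum>J\<in>S. single J (lookup p J)) k" by simp
qed

lemma mpol_mult_eq:
  fixes p q :: mpol
  shows "p * q = (\<Sum>a\<in>keys p. \<Sum>b\<in>keys q. single (a + b) (lookup p a * lookup q b))"
proof -
  have "p * q = (\<Sum>a\<in>keys p. single a (lookup p a)) * (\<Sum>b\<in>keys q. single b (lookup q b))"
    using mpol_eq_sum_single[of "keys p" p] mpol_eq_sum_single[of "keys q" q] by simp
  then show ?thesis by (simp add: sum_product mult_single)
qed

lemma lookup_mult_eq:
  fixes p q :: mpol
  shows "lookup (p * q) k = (\<Sum>a\<in>keys p. \<Sum>b\<in>keys q. if a + b = k then lookup p a * lookup q b else 0)"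
  unfolding mpol_mult_eq lookup_sum by (intro sum.cong) (auto simp: lookup_single when_def)

lemma keys_mult_D: 
  fixes p q :: mpol
  assumes "k \<in> keys (p * q)" obtains a b where "a \<in> keys p" "b \<in> keys q" "k = a + b"
  using keys_mult[of p q] assms by blast

definition meval :: "nat \<Rightarrow> (nat \<Rightarrow> 'b::comm_ring_1) \<Rightarrow> expo \<Rightarrow> 'b" where
  "meval M a J = (\<Prod>v<M. a v ^ lookup J v)"

lemma meval_add: "meval M a (J + K) = meval M a J * meval M a K"
  by (simp add: meval_def lookup_add power_add prod.distrib)

lemma meval_zero [simp]: "meval M a 0 = 1"
  by (simp add: meval_def)

text \<open>The coefficient map \<open>h\<close> leaves the target ring free: the reals for values
  at a point, \<open>mpol\<close> itself for translation by a point, univariate polynomials for the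
  order along one variable. One Taylor formula then serves all three. Exponents carry no bound on
  the number of variables, so \<open>M\<close> fixes how many are substituted.\<close>

definition ins :: "nat \<Rightarrow> (real \<Rightarrow> 'b) \<Rightarrow> (nat \<Rightarrow> 'b::comm_ring_1) \<Rightarrow> mpol \<Rightarrow> 'b" where
  "ins M h a p = (\<Sum>J\<in>keys p. h (lookup p J) * meval M a J)"

context
  fixes h :: "real \<Rightarrow> 'b::comm_ring_1"
  assumes h: "comm_ring_hom h"
begin

interpretation h: comm_ring_hom h by (rule h)

lemma ins_superset:
  assumes "finite S" "keys p \<subseteq> S"
  shows "ins M h a p = (\<Sum>J\<in>S. h (lookup p J) * meval M a J)"
  unfolding ins_def by (rule sum.mono_neutral_left) (use assms in \<open>auto simp: in_keys_iff\<close>)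

lemma ins_single: "ins M h a (single J c) = h c * meval M a J"
  by (subst ins_superset[of "{J}"]) auto

lemma ins_add: "ins M h a (p + q) = ins M h a p + ins M h a q"
proof -
  let ?S = "keys p \<union> keys q"
  have "keys (p + q) \<subseteq> ?S" using Poly_Mapping.keys_add[of p q] .
  then show ?thesis
    by (simp add: ins_superset[of ?S] lookup_add h.hom_add ring_distribs sum.distrib)
qed

lemma ins_zero: "ins M h a 0 = 0" by (simp add: ins_def)

lemma ins_sum: "ins M h a (\<Sum>i\<in>S. f i) = (\<Sum>i\<in>S. ins M h a (f i))"
  by (induction S rule: infinite_finite_induct) (auto simp: ins_zero ins_add)

lemma ins_mult: "ins M h a (p * q) = ins M h a p * ins M h a q"
proof -
  have "ins M h a (p * q) = (\<Sum>i\<in>keys p. \<Sum>j\<in>keys q. (h (lookup p i) * meval M a i) * (h (lookup q j) * meval M a j))"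
    by (simp add: mpol_mult_eq ins_sum ins_single meval_add h.hom_mult mult_ac)
  also have "\<dots> = ins M h a p * ins M h a q"
    by (simp add: ins_def sum_product)
  finally show ?thesis .
qed

lemma comm_ring_hom_ins: "comm_ring_hom (ins M h a)"
proof
  show "ins M h a 1 = 1" using ins_single[of M a 0 1] by simp
qed (simp_all add: ins_zero ins_add ins_mult)

end

definition mbinom :: "nat \<Rightarrow> expo \<Rightarrow> expo \<Rightarrow> real" where
  "mbinom M J I = (\<Prod>v<M. real (lookup J v choose lookup I v))"

definition vars_below :: "nat \<Rightarrow> expo \<Rightarrow> bool" where
  "vars_below M J \<longleftrightarrow> (\<forall>v\<ge>M. lookup J v = 0)"

text \<open>The partial derivative divided by the factorials of the entries of \<open>I\<close>:
  integer coefficients stay integral and heights grow only by powers of 2. Where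
  \<open>J - I\<close> is truncated the binomial factor is 0, provided that \<open>I\<close> has no
  entry at or beyond \<open>M\<close>.\<close>

definition hasse :: "nat \<Rightarrow> expo \<Rightarrow> mpol \<Rightarrow> mpol" where
  "hasse M I p = (\<Sum>J\<in>keys p. single (J - I) (mbinom M J I * lookup p J))"

lemma lookup_minus_expo: "lookup (J - I) v = lookup J v - lookup (I::expo) v"
  by (simp add: minus_poly_mapping.rep_eq)

lemma mbinom_eq_0_iff: "mbinom M J I = 0 \<longleftrightarrow> (\<exists>v<M. lookup J v < lookup I v)"
  unfolding mbinom_def by (auto simp: prod_zero_iff not_le intro: not_le_imp_less)

lemma expo_minus_add:
  assumes "vars_below M I" "mbinom M J I \<noteq> 0"
  shows "J - I + I = J"
proof (rule poly_mapping_eqI)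
  fix v show "lookup (J - I + I) v = lookup J v"
  proof (cases "v < M")
    case True
    then have "lookup I v \<le> lookup J v" using assms(2) unfolding mbinom_eq_0_iff by (meson not_le)
    then show ?thesis by (simp add: lookup_add lookup_minus_expo)
  next
    case False then show ?thesis using assms(1)
      by (auto simp: vars_below_def lookup_add lookup_minus_expo)
  qed
qed

lemma lookup_hasse:
  assumes "vars_below M I"
  shows "lookup (hasse M I p) K = mbinom M (K + I) I * lookup p (K + I)"
proof -
  have "lookup (hasse M I p) K = (\<Sum>J\<in>keys p. if J = K + I then mbinom M (K + I) I * lookup p (K + I) else 0)"
    unfolding hasse_def lookup_sum
  proof (rule sum.cong[OF refl])
    fix J assume "J \<in> keys p"
    show "lookup (single (J - I) (mbinom M J I * lookup p J)) K = (if J = K + I then mbinom M (K + I) I * lookup p (K + I) else 0)"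
      using expo_minus_add[OF assms, of J] by (cases "mbinom M J I = 0") (auto simp: lookup_single when_def)
  qed
  also have "\<dots> = mbinom M (K + I) I * lookup p (K + I)"
    by (simp add: sum.delta' sum.delta in_keys_iff)
  finally show ?thesis .
qed

lemma mbinom_0 [simp]: "mbinom M J 0 = 1" by (simp add: mbinom_def)

lemma vars_below_0 [simp]: "vars_below M 0" by (simp add: vars_below_def)
lemma vars_below_add: "vars_below M (I + J) \<longleftrightarrow> vars_below M I \<and> vars_below M J"
  by (auto simp: vars_below_def lookup_add)

lemma vars_below_mono: "vars_below m I \<Longrightarrow> m \<le> M \<Longrightarrow> vars_below M I"
  by (auto simp: vars_below_def)

lemma binom_trinomial: "real (l + k choose k) * real (l + k + i choose i) = real (k + i choose i) * real (l + (k + i) choose (k + i))"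
proof -
  have "(l + k + i choose (k + i)) * (k + i choose i) = (l + k + i choose i) * (l + k + i - i choose (k + i - i))"
    by (rule choose_mult) auto
  then have "(l + k + i choose i) * (l + k choose k) = (l + k + i choose (k + i)) * (k + i choose i)" by simp
  then have "real ((l + k + i choose i) * (l + k choose k)) = real ((l + k + i choose (k + i)) * (k + i choose i))" by simp
  then show ?thesis by (simp add: add.assoc mult_ac)
qed

text \<open>Through this identity the vanishing of \<open>P\<close> up to a given weight passes to
  its derivatives, with the weight already spent subtracted.\<close>

lemma hasse_hasse:
  assumes "vars_below M I" "vars_below M K"
  shows "hasse M K (hasse M I p) = single 0 (mbinom M (K + I) I) * hasse M (K + I) p"
proof (rule poly_mapping_eqI)
  fix L
  have *: "lookup (single 0 c * q) L = c * lookup q L" for c and q :: mpol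
    by (simp add: lookup_mult_eq sum.delta' sum.delta in_keys_iff)
  have "mbinom M (L + K) K * mbinom M (L + K + I) I = mbinom M (K + I) I * mbinom M (L + (K + I)) (K + I)"
    unfolding mbinom_def prod.distrib[symmetric] lookup_add 
    by (intro prod.cong refl binom_trinomial)
  then show "lookup (hasse M K (hasse M I p)) L = lookup (single 0 (mbinom M (K + I) I) * hasse M (K + I) p) L"
    using assms by (simp add: lookup_hasse vars_below_add * add.assoc mult.assoc[symmetric])
qed

section \<open>Exponent boxes and the Taylor formula\<close>

definition ebox :: "nat \<Rightarrow> (nat \<Rightarrow> nat) \<Rightarrow> expo set" where
  "ebox M r = {I. vars_below M I \<and> (\<forall>v<M. lookup I v \<le> r v)}"

lemma box_0: "ebox 0 r = {0}"
  by (auto simp: ebox_def vars_below_def intro: poly_mapping_eqI)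

lemma box_Suc_bij: "bij_betw (\<lambda>(I, i). I + single M i) (ebox M r \<times> {..r M}) (ebox (Suc M) r)"
proof (rule bij_betw_byWitness[where f' = "\<lambda>J. (J - single M (lookup J M), lookup J M)"])
  show "\<forall>a\<in>ebox M r \<times> {..r M}. (\<lambda>J. (J - single M (lookup J M), lookup J M)) ((\<lambda>(I, i). I + single M i) a) = a"
    by (auto simp: ebox_def vars_below_def lookup_add lookup_single)
  show "\<forall>J\<in>ebox (Suc M) r. (\<lambda>(I, i). I + single M i) (J - single M (lookup J M), lookup J M) = J"
    by (auto intro!: poly_mapping_eqI simp: lookup_add lookup_minus_expo lookup_single when_def)
  show "(\<lambda>(I, i). I + single M i) ` (ebox M r \<times> {..r M}) \<subseteq> ebox (Suc M) r"
    by (auto simp: ebox_def vars_below_def lookup_add lookup_single when_def less_Suc_eq)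
  show "(\<lambda>J. (J - single M (lookup J M), lookup J M)) ` ebox (Suc M) r \<subseteq> ebox M r \<times> {..r M}"
    by (auto simp: ebox_def vars_below_def lookup_minus_expo lookup_single when_def less_Suc_eq Suc_le_eq)
qed

lemma finite_box [simp]: "finite (ebox M r)"
proof (induction M)
  case (Suc M) then show ?case using bij_betw_finite[OF box_Suc_bij[of M r]] by simp
qed (simp add: box_0)

lemma sum_box_Suc: "(\<Sum>J\<in>ebox (Suc M) r. F J) = (\<Sum>I\<in>ebox M r. \<Sum>i\<le>r M. F (I + single M i))"
  using sum.reindex_bij_betw[OF box_Suc_bij[of M r], of F] by (simp add: sum.cartesian_product split_def)

lemma sum_prod_box:
  fixes g :: "nat \<Rightarrow> nat \<Rightarrow> 'b::comm_ring_1"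
  shows "(\<Sum>I\<in>ebox M r. \<Prod>v<M. g v (lookup I v)) = (\<Prod>v<M. \<Sum>i\<le>r v. g v i)"
proof (induction M)
  case 0 then show ?case by (simp add: box_0)
next
  case (Suc M)
  have "(\<Sum>I\<in>ebox (Suc M) r. \<Prod>v<Suc M. g v (lookup I v)) = (\<Sum>I\<in>ebox M r. \<Sum>i\<le>r M. (\<Prod>v<M. g v (lookup I v)) * g M i)"
    unfolding sum_box_Suc by (intro sum.cong refl) (auto simp: lookup_add lookup_single ebox_def vars_below_def when_def)
  also have "\<dots> = (\<Prod>v<Suc M. \<Sum>i\<le>r v. g v i)"
    unfolding sum_distrib_left[symmetric] sum_distrib_right[symmetric] Suc.IH by simp
  finally show ?case .
qed

lemma card_box: "card (ebox M r) = (\<Prod>v<M. r v + 1)"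
proof -
  have "int (card (ebox M r)) = int (\<Prod>v<M. r v + 1)" using sum_prod_box[of "\<lambda>_ _. 1::int" M r] by (simp add: add.commute)
  then show ?thesis by linarith
qed

lemma meval_add_binomial:
  fixes a b :: "nat \<Rightarrow> 'b::comm_ring_1"
  assumes h: "comm_ring_hom h" and le: "\<forall>v<M. lookup J v \<le> r v"
  shows "meval M (\<lambda>v. a v + b v) J = (\<Sum>I\<in>ebox M r. h (mbinom M J I) * meval M a (J - I) * meval M b I)"
proof -
  interpret h: comm_ring_hom h by (rule h)
  have hn: "h (real n) = of_nat n" for n by (induction n) (auto simp: h.hom_add)
  have "meval M (\<lambda>v. a v + b v) J = (\<Prod>v<M. \<Sum>i\<le>r v. of_nat (lookup J v choose i) * b v ^ i * a v ^ (lookup J v - i))"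
    unfolding meval_def
  proof (intro prod.cong refl)
    fix v assume "v \<in> {..<M}"
    then have l: "lookup J v \<le> r v" using le by auto
    have "(a v + b v) ^ lookup J v = (\<Sum>i\<le>lookup J v. of_nat (lookup J v choose i) * b v ^ i * a v ^ (lookup J v - i))"
      by (subst add.commute) (rule binomial_ring)
    also have "\<dots> = (\<Sum>i\<le>r v. of_nat (lookup J v choose i) * b v ^ i * a v ^ (lookup J v - i))"
      by (rule sum.mono_neutral_left) (use l in \<open>auto simp: binomial_eq_0\<close>)
    finally show "(a v + b v) ^ lookup J v = \<dots>" .
  qed
  also have "\<dots> = (\<Sum>I\<in>ebox M r. \<Prod>v<M. of_nat (lookup J v choose lookup I v) * b v ^ lookup I v * a v ^ (lookup J v - lookup I v))"
    by (rule sum_prod_box[symmetric])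
  also have "\<dots> = (\<Sum>I\<in>ebox M r. h (mbinom M J I) * meval M a (J - I) * meval M b I)"
    by (simp add: mbinom_def meval_def prod.distrib h.hom_prod hn lookup_minus_expo mult_ac)
  finally show ?thesis .
qed

lemma ins_hasse:
  assumes "comm_ring_hom h"
  shows "ins M h a (hasse M I p) = (\<Sum>J\<in>keys p. h (mbinom M J I * lookup p J) * meval M a (J - I))"
  unfolding hasse_def by (simp add: ins_sum[OF assms] ins_single[OF assms])

theorem mpol_taylor:
  fixes a b :: "nat \<Rightarrow> 'b::comm_ring_1"
  assumes h: "comm_ring_hom h" and le: "\<And>J v. J \<in> keys p \<Longrightarrow> v < M \<Longrightarrow> lookup J v \<le> r v"
  shows "ins M h (\<lambda>v. a v + b v) p = (\<Sum>I\<in>ebox M r. ins M h a (hasse M I p) * meval M b I)"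
proof -
  interpret h: comm_ring_hom h by (rule h)
  have "ins M h (\<lambda>v. a v + b v) p = (\<Sum>J\<in>keys p. \<Sum>I\<in>ebox M r. h (mbinom M J I * lookup p J) * meval M a (J - I) * meval M b I)"
    unfolding ins_def
  proof (intro sum.cong refl)
    fix J assume J: "J \<in> keys p"
    show "h (lookup p J) * meval M (\<lambda>v. a v + b v) J = (\<Sum>I\<in>ebox M r. h (mbinom M J I * lookup p J) * meval M a (J - I) * meval M b I)"
      using meval_add_binomial[OF h, of M J r a b] le[OF J] by (simp add: sum_distrib_left h.hom_mult mult_ac)
  qed
  also have "\<dots> = (\<Sum>I\<in>ebox M r. ins M h a (hasse M I p) * meval M b I)"
    by (subst sum.swap) (simp add: ins_hasse[OF h] sum_distrib_right)
  finally show ?thesis .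
qed

abbreviation "ev M \<equiv> ins M (\<lambda>x::real. x)"

lemma id_hom: "comm_ring_hom (\<lambda>x::real. x)" by unfold_locales auto

lemma const_hom: "comm_ring_hom (\<lambda>x::real. single 0 x :: mpol)"
  by unfold_locales (auto simp: single_add mult_single)

text \<open>The polynomial \<open>p(\<beta> + X)\<close>. Its exponents record the order of
  vanishing of \<open>p\<close> at \<beta>, and since translation is a ring homomorphism it commutes
  with determinants.\<close>

definition shift :: "nat \<Rightarrow> (nat \<Rightarrow> real) \<Rightarrow> mpol \<Rightarrow> mpol" where
  "shift M \<beta> = ins M (\<lambda>x. single 0 x) (\<lambda>v. single 0 (\<beta> v) + single (single v 1) 1)"

lemma shift_hom: "comm_ring_hom (shift M \<beta>)"
  unfolding shift_def by (rule comm_ring_hom_ins[OF const_hom])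

lemma meval_X: 
  assumes "vars_below M I" shows "meval M (\<lambda>v. single (single v 1) 1) I = (single I 1 :: mpol)"
proof -
  have pw: "(single J 1 :: mpol) ^ n = single (\<Sum>i<n. J) 1" for J n
    by (induction n) (auto simp del: sum_constant simp: mult_single add.commute)
  have pr: "(\<Prod>v<m. single (f v) 1 :: mpol) = single (\<Sum>v<m. f v) 1" for f and m :: nat
    by (induction m) (auto simp: mult_single)
  have "(\<Sum>v<M. \<Sum>i<lookup I v. single v 1) = I"
  proof (rule poly_mapping_eqI)
    fix k
    have "lookup (\<Sum>v<M. \<Sum>i<lookup I v. single v 1) k = (\<Sum>v<M. if v = k then lookup I k else 0)"
      unfolding lookup_sum by (intro sum.cong refl) (auto simp: lookup_single when_def)
    also have "\<dots> = lookup I k" using assms by (auto simp: sum.delta vars_below_def)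
    finally show "lookup (\<Sum>v<M. \<Sum>i<lookup I v. single v 1) k = lookup I k" .
  qed
  then show ?thesis unfolding meval_def pw pr by simp
qed

lemma meval_const: "meval M (\<lambda>v. single 0 (\<beta> v)) I = (single 0 (meval M \<beta> I) :: mpol)"
proof -
  have pw: "(single 0 c :: mpol) ^ n = single 0 (c ^ n)" for c n
    by (induction n) (auto simp: mult_single)
  have pr: "(\<Prod>v<m. single 0 (f v) :: mpol) = single 0 (\<Prod>v<m. f v)" for f and m :: nat
    by (induction m) (auto simp: mult_single)
  show ?thesis unfolding meval_def pw pr ..
qed

lemma ins_const: "ins M (\<lambda>x. single 0 x) (\<lambda>v. single 0 (\<beta> v)) p = (single 0 (ev M \<beta> p) :: mpol)"
proof -
  have ss: "(\<Sum>i\<in>S. single 0 (f i) :: mpol) = single 0 (\<Sum>i\<in>S. f i)" for f and S :: "expo set"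
    by (induction S rule: infinite_finite_induct) (auto simp: single_add)
  show ?thesis unfolding ins_def meval_const by (simp add: mult_single ss)
qed

lemma hasse_eq_0:
  assumes "vars_below M I" "\<And>J. J \<in> keys p \<Longrightarrow> \<exists>v<M. lookup J v < lookup I v"
  shows "hasse M I p = 0"
proof -
  have "mbinom M J I = 0" if "J \<in> keys p" for J unfolding mbinom_eq_0_iff using assms(2)[OF that] .
  then show ?thesis by (simp add: hasse_def)
qed

lemma shift_eq_sum:
  obtains r where "\<And>J v. J \<in> keys p \<Longrightarrow> lookup J v \<le> r v"
    "shift M \<beta> p = (\<Sum>I\<in>ebox M r. single I (ev M \<beta> (hasse M I p)))"
proof
  define r where "r v = (\<Sum>J\<in>keys p. lookup J v)" for v
  show le: "lookup J v \<le> r v" if "J \<in> keys p" for J v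
    unfolding r_def by (rule member_le_sum[OF that]) auto
  have "shift M \<beta> p = (\<Sum>I\<in>ebox M r. single 0 (ev M \<beta> (hasse M I p)) * meval M (\<lambda>v. single (single v 1) 1) I)"
    unfolding shift_def by (subst mpol_taylor[OF const_hom, of p M r]) (auto simp: le ins_const)
  also have "\<dots> = (\<Sum>I\<in>ebox M r. single I (ev M \<beta> (hasse M I p)))"
    by (intro sum.cong refl) (simp del: One_nat_def add: meval_X ebox_def mult_single)
  finally show "shift M \<beta> p = \<dots>" .
qed

lemma lookup_shift:
  assumes "vars_below M I"
  shows "lookup (shift M \<beta> p) I = ev M \<beta> (hasse M I p)"
proof -
  obtain r where le: "\<And>J v. J \<in> keys p \<Longrightarrow> lookup J v \<le> r v"
    and eq: "shift M \<beta> p = (\<Sum>I\<in>ebox M r. single I (ev M \<beta> (hasse M I p)))"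
    using shift_eq_sum by blast
  have "lookup (shift M \<beta> p) I = (\<Sum>K\<in>ebox M r. if K = I then ev M \<beta> (hasse M I p) else 0)"
    unfolding eq by (auto simp: lookup_sum lookup_single when_def intro!: sum.cong)
  also have "\<dots> = (if I \<in> ebox M r then ev M \<beta> (hasse M I p) else 0)" by (simp add: sum.delta)
  also have "\<dots> = ev M \<beta> (hasse M I p)"
  proof (cases "I \<in> ebox M r")
    case False
    then obtain v where "v < M" "r v < lookup I v" using assms by (auto simp: ebox_def not_le)
    then have "hasse M I p = 0" using le by (intro hasse_eq_0[OF assms]) (meson le_less_trans)
    then show ?thesis by (simp add: ins_def)
  qed auto
  finally show ?thesis .
qed

lemma keys_shift_vars: "I \<in> keys (shift M \<beta> p) \<Longrightarrow> vars_below M I"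
proof -
  assume I: "I \<in> keys (shift M \<beta> p)"
  obtain r where eq: "shift M \<beta> p = (\<Sum>I\<in>ebox M r. single I (ev M \<beta> (hasse M I p)))"
    using shift_eq_sum by blast
  have "keys (shift M \<beta> p) \<subseteq> ebox M r"
    unfolding eq by (auto simp: in_keys_iff lookup_sum lookup_single when_def elim!: sum.not_neutral_contains_not_neutral split: if_splits)
  then show ?thesis using I by (auto simp: ebox_def)
qed

section \<open>Determinants with entries given by a function\<close>

definition ldet :: "nat \<Rightarrow> (nat \<Rightarrow> nat \<Rightarrow> 'a) \<Rightarrow> 'a::comm_ring_1" where
  "ldet k A = Determinant.det (Matrix.mat k k (\<lambda>(i, j). A i j))"

lemma ldet_eq: "ldet k A = (\<Sum>p | p permutes {0..<k}. signof p * (\<Prod>i=0..<k. A i (p i)))"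
proof -
  have "(\<Prod>i=0..<k. Matrix.mat k k (\<lambda>(i, j). A i j) $$ (i, p i)) = (\<Prod>i=0..<k. A i (p i))"
    if "p permutes {0..<k}" for p
    using permutes_in_image[OF that] by (intro prod.cong refl) auto
  then show ?thesis unfolding ldet_def by (subst det_def'[of _ k]) auto
qed

lemma ldet_hom:
  assumes "comm_ring_hom h" shows "h (ldet k A) = ldet k (\<lambda>i j. h (A i j))"
proof -
  interpret h: comm_ring_hom h by (rule assms)
  have "ldet k (\<lambda>i j. h (A i j)) = Determinant.det (map_mat h (Matrix.mat k k (\<lambda>(i, j). A i j)))"
    unfolding ldet_def by (rule arg_cong[where f = Determinant.det]) (auto intro!: eq_matI)
  then show ?thesis by (simp add: ldet_def)
qed

lemma ldet_mult_transpose: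
  fixes A B :: "nat \<Rightarrow> nat \<Rightarrow> 'a::idom"
  shows "ldet k (\<lambda>i j. \<Sum>l<k. A i l * B j l) = ldet k A * ldet k B"
proof -
  let ?A = "Matrix.mat k k (\<lambda>(i, j). A i j)" and ?B = "Matrix.mat k k (\<lambda>(i, j). B i j)"
  have eq: "Matrix.mat k k (\<lambda>(i, j). \<Sum>l<k. A i l * B j l) = ?A * transpose_mat ?B"
    by (rule eq_matI) (auto simp: scalar_prod_def lessThan_atLeast0)
  show ?thesis
    unfolding ldet_def eq by (subst Determinant.det_mult[of _ k]) (auto simp: Determinant.det_transpose[where n = k])
qed

lemma ldet_expand_last_row:
  "ldet (Suc k) A = (\<Sum>j<Suc k. A k j * ((-1) ^ (k + j) * ldet k (\<lambda>i l. A i (if l < j then l else Suc l))))"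
proof -
  let ?A = "Matrix.mat (Suc k) (Suc k) (\<lambda>(i, j). A i j)"
  have "Determinant.det ?A = (\<Sum>j<Suc k. ?A $$ (k, j) * Determinant.cofactor ?A k j)"
    by (rule laplace_expansion_row[of _ "Suc k"]) auto
  also have "\<dots> = (\<Sum>j<Suc k. A k j * ((-1) ^ (k + j) * ldet k (\<lambda>i l. A i (if l < j then l else Suc l))))"
  proof (intro sum.cong refl)
    fix j assume "j \<in> {..<Suc k}"
    then have "mat_delete ?A k j = Matrix.mat k k (\<lambda>(i, l). A i (if l < j then l else Suc l))"
      by (intro eq_matI) (auto simp: mat_delete_def)
    then show "?A $$ (k, j) * Determinant.cofactor ?A k j = A k j * ((-1) ^ (k + j) * ldet k (\<lambda>i l. A i (if l < j then l else Suc l)))"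
      using \<open>j \<in> _\<close> by (simp add: Determinant.cofactor_def ldet_def)
  qed
  finally show ?thesis by (simp add: ldet_def)
qed

subsection \<open>Norm and weights\<close>

definition l1 :: "mpol \<Rightarrow> real" where "l1 p = (\<Sum>J\<in>keys p. \<bar>lookup p J\<bar>)"

lemma l1_superset: "finite S \<Longrightarrow> keys p \<subseteq> S \<Longrightarrow> l1 p = (\<Sum>J\<in>S. \<bar>lookup p J\<bar>)"
  unfolding l1_def by (rule sum.mono_neutral_left) (auto simp: in_keys_iff)

lemma l1_nonneg: "l1 p \<ge> 0" by (simp add: l1_def sum_nonneg)
lemma l1_zero [simp]: "l1 0 = 0" by (simp add: l1_def)
lemma l1_single [simp]: "l1 (single J c) = \<bar>c\<bar>"
  by (subst l1_superset[of "{J}"]) auto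

lemma l1_add: "l1 (p + q) \<le> l1 p + l1 q"
proof -
  let ?S = "keys p \<union> keys q"
  have "keys (p + q) \<subseteq> ?S" using Poly_Mapping.keys_add[of p q] .
  then have "l1 (p + q) = (\<Sum>J\<in>?S. \<bar>lookup p J + lookup q J\<bar>)" by (simp add: l1_superset[of ?S] lookup_add)
  also have "\<dots> \<le> (\<Sum>J\<in>?S. \<bar>lookup p J\<bar> + \<bar>lookup q J\<bar>)" by (intro sum_mono abs_triangle_ineq)
  also have "\<dots> = l1 p + l1 q" by (simp add: sum.distrib l1_superset[of ?S])
  finally show ?thesis .
qed

lemma l1_sum: "l1 (\<Sum>i\<in>S. f i) \<le> (\<Sum>i\<in>S. l1 (f i))"
proof (induction S rule: infinite_finite_induct)
  case (insert x F) then show ?case using l1_add[of "f x" "\<Sum>i\<in>F. f i"] by simp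
qed auto

lemma l1_mult: "l1 (p * q) \<le> l1 p * l1 q"
proof -
  have "l1 (p * q) \<le> (\<Sum>a\<in>keys p. l1 (\<Sum>b\<in>keys q. single (a + b) (lookup p a * lookup q b)))"
    unfolding mpol_mult_eq by (rule l1_sum)
  also have "\<dots> \<le> (\<Sum>a\<in>keys p. \<Sum>b\<in>keys q. l1 (single (a + b) (lookup p a * lookup q b)))"
    by (intro sum_mono l1_sum)
  also have "\<dots> = l1 p * l1 q" by (simp add: l1_def[of p] l1_def[of q] sum_product abs_mult)
  finally show ?thesis .
qed

lemma l1_prod: "finite S \<Longrightarrow> l1 (\<Prod>i\<in>S. f i) \<le> (\<Prod>i\<in>S. l1 (f i))"
proof (induction S rule: finite_induct)
  case empty
  have "l1 1 = 1" by (simp flip: single_one)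
  then show ?case by simp
next
  case (insert x F)
  have "l1 (f x * prod f F) \<le> l1 (f x) * l1 (prod f F)" by (rule l1_mult)
  also have "\<dots> \<le> l1 (f x) * (\<Prod>i\<in>F. l1 (f i))" by (intro mult_left_mono insert.IH l1_nonneg)
  finally show ?case using insert.hyps by simp
qed

lemma l1_uminus [simp]: "l1 (- p) = l1 p" by (simp add: l1_def)

lemma l1_signof_mult [simp]: "l1 (signof \<sigma> * p) = l1 p"
  by (simp add: sign_def)

lemma l1_ldet:
  assumes "\<And>i j. i < k \<Longrightarrow> j < k \<Longrightarrow> l1 (A i j) \<le> B"
  shows "l1 (ldet k A) \<le> fact k * B ^ k"
proof -
  have "l1 (ldet k A) \<le> (\<Sum>p | p permutes {0..<k}. l1 (\<Prod>i=0..<k. A i (p i)))"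
    unfolding ldet_eq using l1_sum[of "\<lambda>p. signof p * (\<Prod>i=0..<k. A i (p i))" "{p. p permutes {0..<k}}"] by simp
  also have "\<dots> \<le> (\<Sum>p | p permutes {0..<k}. B ^ k)"
  proof (intro sum_mono)
    fix p assume p: "p \<in> {p. p permutes {0..<k}}"
    have "l1 (\<Prod>i=0..<k. A i (p i)) \<le> (\<Prod>i=0..<k. l1 (A i (p i)))" by (rule l1_prod) simp
    also have "\<dots> \<le> (\<Prod>i=0..<k. B)" using p permutes_in_image[of p "{0..<k}"] assms
      by (intro prod_mono) (auto simp: l1_nonneg)
    finally show "l1 (\<Prod>i=0..<k. A i (p i)) \<le> B ^ k" by simp
  qed
  also have "\<dots> = fact k * B ^ k" by (simp add: card_permutations[of _ k])
  finally show ?thesis .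
qed

lemma prod_choose_le: "mbinom M J I \<le> 2 ^ (\<Sum>v<M. lookup J v)"
proof -
  have "real (n choose i) \<le> 2 ^ n" for n i
  proof (cases "i \<le> n")
    case True
    have "(n choose i) \<le> (\<Sum>i\<le>n. n choose i)" by (rule member_le_sum) (use True in auto)
    then have "(n choose i) \<le> 2 ^ n" by (simp add: choose_row_sum)
    then have "real (n choose i) \<le> real (2 ^ n)" using of_nat_le_iff by blast
    then show ?thesis by simp
  qed (simp add: binomial_eq_0)
  then have "mbinom M J I \<le> (\<Prod>v<M. 2 ^ lookup J v)" unfolding mbinom_def by (intro prod_mono) auto
  then show ?thesis by (simp add: power_sum)
qed

lemma mbinom_nonneg: "mbinom M J I \<ge> 0" by (simp add: mbinom_def prod_nonneg)

lemma l1_hasse: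
  assumes "\<And>J. J \<in> keys p \<Longrightarrow> (\<Sum>v<M. lookup J v) \<le> S"
  shows "l1 (hasse M I p) \<le> 2 ^ S * l1 p"
proof -
  have "l1 (hasse M I p) \<le> (\<Sum>J\<in>keys p. mbinom M J I * \<bar>lookup p J\<bar>)"
    unfolding hasse_def by (rule order_trans[OF l1_sum]) (simp add: abs_mult mbinom_nonneg)
  also have "\<dots> \<le> (\<Sum>J\<in>keys p. 2 ^ S * \<bar>lookup p J\<bar>)"
  proof (intro sum_mono mult_right_mono)
    fix J assume "J \<in> keys p"
    have "mbinom M J I \<le> 2 ^ (\<Sum>v<M. lookup J v)" by (rule prod_choose_le)
    also have "\<dots> \<le> 2 ^ S" using assms[OF \<open>J \<in> keys p\<close>] by (intro power_increasing) auto
    finally show "mbinom M J I \<le> 2 ^ S" .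
  qed auto
  finally show ?thesis by (simp add: l1_def sum_distrib_left)
qed

text \<open>For additive \<open>f\<close> one predicate serves two purposes: with a weight and a
  translated polynomial it bounds the order of vanishing from below, with the negative of one
  exponent it bounds a partial degree from above.\<close>

definition keys_ge :: "(expo \<Rightarrow> real) \<Rightarrow> real \<Rightarrow> mpol \<Rightarrow> bool" where
  "keys_ge f t p \<longleftrightarrow> (\<forall>I\<in>keys p. t \<le> f I)"

context
  fixes f :: "expo \<Rightarrow> real"
  assumes f_add: "\<And>I J. f (I + J) = f I + f J"
begin

lemma keys_ge_mult: "keys_ge f s p \<Longrightarrow> keys_ge f t q \<Longrightarrow> keys_ge f (s + t) (p * q)"
  unfolding keys_ge_def by (auto elim!: keys_mult_D simp: f_add intro!: add_mono)

lemma keys_ge_prod: "finite S \<Longrightarrow> (\<And>i. i \<in> S \<Longrightarrow> keys_ge f (t i) (p i)) \<Longrightarrow> keys_ge f (\<Sum>i\<in>S. t i) (\<Prod>i\<in>S. p i)"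
proof (induction S rule: finite_induct)
  case empty
  have "f 0 = 0" using f_add[of 0 0] by simp
  then show ?case by (simp add: keys_ge_def)
qed (auto intro: keys_ge_mult)

text \<open>Each permutation takes exactly one entry from every column, so bounds that depend on the
  column alone add up.\<close>

lemma keys_ge_ldet:
  assumes "\<And>i j. i < k \<Longrightarrow> j < k \<Longrightarrow> keys_ge f (t j) (A i j)"
  shows "keys_ge f (\<Sum>j<k. t j) (ldet k A)"
proof -
  have *: "keys_ge f (\<Sum>j<k. t j) (signof p * (\<Prod>i=0..<k. A i (p i)))" if p: "p permutes {0..<k}" for p
  proof -
    have "keys_ge f (\<Sum>i\<in>{0..<k}. t (p i)) (\<Prod>i=0..<k. A i (p i))"
      using permutes_in_image[OF p] assms by (intro keys_ge_prod) auto
    also have "(\<Sum>i\<in>{0..<k}. t (p i)) = (\<Sum>j<k. t j)"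
      using sum.permute[OF p, of t] by (simp add: lessThan_atLeast0 comp_def)
    finally show ?thesis by (simp add: sign_def keys_ge_def)
  qed
  have sum: "keys_ge f u (\<Sum>p\<in>S. g p)" if "\<And>p. p \<in> S \<Longrightarrow> keys_ge f u (g p)" for S :: "(nat \<Rightarrow> nat) set" and g u
    unfolding keys_ge_def
  proof
    fix I assume "I \<in> keys (\<Sum>p\<in>S. g p)"
    then have "(\<Sum>p\<in>S. lookup (g p) I) \<noteq> 0" by (simp add: in_keys_iff lookup_sum)
    then obtain p where "p \<in> S" "lookup (g p) I \<noteq> 0" by (rule sum.not_neutral_contains_not_neutral)
    then show "u \<le> f I" using that[of p] by (auto simp: keys_ge_def in_keys_iff)
  qed
  show ?thesis unfolding ldet_eq by (rule sum, rule *) simp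
qed

end

subsection \<open>Lowest monomials\<close>

text \<open>The linear order on exponents is compatible with addition, so \<open>a + b\<close>
  arises from exponents above \<open>a\<close> and above \<open>b\<close> in only one way.\<close>

lemma lookup_mult_lowest:
  fixes p q :: mpol
  assumes "\<And>K. K \<in> keys p \<Longrightarrow> a \<le> K" "\<And>K. K \<in> keys q \<Longrightarrow> b \<le> K"
  shows "lookup (p * q) (a + b) = lookup p a * lookup q b"
proof -
  have "lookup (p * q) (a + b) = (\<Sum>x\<in>keys p. \<Sum>y\<in>keys q. if x = a then (if y = b then lookup p a * lookup q b else 0) else 0)"
    unfolding lookup_mult_eq
  proof (intro sum.cong refl)
    fix x y assume x: "x \<in> keys p" and y: "y \<in> keys q"
    have "x + y = a + b \<longleftrightarrow> x = a \<and> y = b"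
    proof
      assume eq: "x + y = a + b"
      have "\<not> a < x" using add_less_le_mono[of a x b y] assms(2)[OF y] eq by auto
      then have "x = a" using assms(1)[OF x] by simp
      then show "x = a \<and> y = b" using eq by simp
    qed auto
    then show "(if x + y = a + b then lookup p x * lookup q y else 0) = (if x = a then (if y = b then lookup p a * lookup q b else 0) else 0)"
      by auto
  qed
  also have "\<dots> = (\<Sum>x\<in>keys p. if x = a then (\<Sum>y\<in>keys q. if y = b then lookup p a * lookup q b else 0) else 0)"
    by (intro sum.cong) auto
  finally show ?thesis by (simp add: sum.delta in_keys_iff)
qed

lemma lookup_prod_lowest:
  fixes p :: "nat \<Rightarrow> mpol"
  assumes "finite S" "\<And>i K. i \<in> S \<Longrightarrow> K \<in> keys (p i) \<Longrightarrow> J i \<le> K"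
  shows "lookup (\<Prod>i\<in>S. p i) (\<Sum>i\<in>S. J i) = (\<Prod>i\<in>S. lookup (p i) (J i)) \<and> (\<forall>K\<in>keys (\<Prod>i\<in>S. p i). (\<Sum>i\<in>S. J i) \<le> K)"
  using assms
proof (induction S rule: finite_induct)
  case (insert x F)
  then have IH: "lookup (\<Prod>i\<in>F. p i) (\<Sum>i\<in>F. J i) = (\<Prod>i\<in>F. lookup (p i) (J i))" "\<And>K. K\<in>keys (\<Prod>i\<in>F. p i) \<Longrightarrow> (\<Sum>i\<in>F. J i) \<le> K"
    by auto
  have x: "\<And>K. K \<in> keys (p x) \<Longrightarrow> J x \<le> K" using insert.prems by auto
  show ?case using insert.hyps lookup_mult_lowest[of "p x" "J x" "\<Prod>i\<in>F. p i" "\<Sum>i\<in>F. J i", OF x IH(2)] IH x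
    by (auto elim!: keys_mult_D intro: add_mono)
qed auto

lemma lookup_signof_mult: "lookup (signof \<sigma> * p) k = signof \<sigma> * lookup (p::mpol) k"
  by (simp add: sign_def)

lemma lookup_ldet_lowest:
  fixes A :: "nat \<Rightarrow> nat \<Rightarrow> mpol"
  assumes "\<And>i j K. i < k \<Longrightarrow> j < k \<Longrightarrow> K \<in> keys (A i j) \<Longrightarrow> J j \<le> K"
  shows "lookup (ldet k A) (\<Sum>j<k. J j) = ldet k (\<lambda>i j. lookup (A i j) (J j))"
  unfolding ldet_eq lookup_sum lookup_signof_mult
proof (intro sum.cong refl arg_cong2[where f = "(*)"])
  fix p assume "p \<in> {p. p permutes {0..<k}}"
  then have p: "p permutes {0..<k}" by simp
  have "(\<Sum>j<k. J j) = (\<Sum>i\<in>{0..<k}. J (p i))"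
    using sum.permute[OF p, of J] by (simp add: lessThan_atLeast0 comp_def)
  moreover have "lookup (\<Prod>i=0..<k. A i (p i)) (\<Sum>i\<in>{0..<k}. J (p i)) = (\<Prod>i=0..<k. lookup (A i (p i)) (J (p i)))"
    using lookup_prod_lowest[of "{0..<k}" "\<lambda>i. A i (p i)" "\<lambda>i. J (p i)"] assms permutes_in_image[OF p] by auto
  ultimately show "lookup (\<Prod>i=0..<k. A i (p i)) (\<Sum>j<k. J j) = (\<Prod>i=0..<k. lookup (A i (p i)) (J (p i)))" by simp
qed

section \<open>Nonsingular matrices of binomial coefficients\<close>

definition tdeg :: "nat \<Rightarrow> expo \<Rightarrow> nat" where "tdeg M I = (\<Sum>v<M. lookup I v)"

text \<open>As functions of \<open>J\<close>, binomial products behave like monomials: a linear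
  factor in coordinate \<open>h\<close> yields the same product and one of total degree higher by
  1.\<close>

lemma mbinom_step:
  assumes "h < M"
  shows "(real (lookup J h) - c) * mbinom M J I
    = (real (lookup I h) + 1) * mbinom M J (I + single h 1) + (real (lookup I h) - c) * mbinom M J I"
proof -
  have split: "mbinom M J I' = real (lookup J h choose lookup I' h) * (\<Prod>v\<in>{..<M} - {h}. real (lookup J v choose lookup I' v))" for I'
    unfolding mbinom_def using assms by (subst prod.remove[of _ h]) auto
  have r: "(\<Prod>v\<in>{..<M} - {h}. real (lookup J v choose lookup (I + single h 1) v)) = (\<Prod>v\<in>{..<M} - {h}. real (lookup J v choose lookup I v))"
    by (intro prod.cong refl) (auto simp: lookup_add lookup_single)
  have g: "real n * real (n choose i) = real i * real (n choose i) + (real i + 1) * real (n choose Suc i)" for n i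
    using gbinomial_mult_1[of "real n" i] by (simp add: binomial_gbinomial add.commute)
  have "(real n - c) * real (n choose i) = (real i + 1) * real (n choose Suc i) + (real i - c) * real (n choose i)" for n i
    using g[of n i] by (simp add: algebra_simps)
  note e = this[of "lookup J h" "lookup I h"]
  let ?P = "\<Prod>v\<in>{..<M} - {h}. real (lookup J v choose lookup I v)"
  have "(real (lookup J h) - c) * mbinom M J I = ((real (lookup J h) - c) * real (lookup J h choose lookup I h)) * ?P"
    unfolding split[of I] by simp
  also have "\<dots> = (real (lookup I h) + 1) * (real (lookup J h choose lookup (I + single h 1) h) * ?P)
      + (real (lookup I h) - c) * (real (lookup J h choose lookup I h) * ?P)"
    unfolding e by (simp add: lookup_add lookup_single distrib_right mult.assoc)
  finally show ?thesis unfolding split[of I] split[of "I + single h 1"] r .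
qed

text \<open>Linear factors are absorbed one at a time by \<open>mbinom_step\<close>. A functional
  that kills all binomial products of degree at most \<open>N\<close> therefore kills every product
  of at most \<open>N\<close> linear factors in the coordinates of the points.\<close>

lemma functional_vanish:
  fixes w :: "nat \<Rightarrow> real" and J :: "nat \<Rightarrow> expo"
  assumes van: "\<And>I. vars_below M I \<Longrightarrow> tdeg M I \<le> N \<Longrightarrow> (\<Sum>j<k. w j * mbinom M (J j) I) = 0"
    and "\<forall>(h, c)\<in>set ts. h < M" "vars_below M I" "tdeg M I + length ts \<le> N"
  shows "(\<Sum>j<k. w j * mbinom M (J j) I * (\<Prod>(h, c)\<leftarrow>ts. real (lookup (J j) h) - c)) = 0"
  using assms(2-)
proof (induction ts arbitrary: I)
  case Nil then show ?case using van by simp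
next
  case (Cons x ts)
  obtain h c where x: "x = (h, c)" by (cases x)
  have h: "h < M" using Cons.prems x by auto
  let ?P = "\<lambda>j. (\<Prod>(h, c)\<leftarrow>ts. real (lookup (J j) h) - c)"
  have vI: "vars_below M (I + single h 1)" using Cons.prems(2) h by (auto simp: vars_below_def lookup_add lookup_single)
  have "tdeg M (I + single h 1) = tdeg M I + 1"
    using h by (simp add: tdeg_def lookup_add sum.distrib lookup_single when_def sum.delta)
  then have 1: "(\<Sum>j<k. w j * mbinom M (J j) (I + single h 1) * ?P j) = 0"
    using Cons.prems by (intro Cons.IH vI) auto
  have 2: "(\<Sum>j<k. w j * mbinom M (J j) I * ?P j) = 0"
    using Cons.prems by (intro Cons.IH) auto
  have "(\<Sum>j<k. w j * mbinom M (J j) I * (\<Prod>(h, c)\<leftarrow>x # ts. real (lookup (J j) h) - c))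
     = (\<Sum>j<k. w j * ((real (lookup (J j) h) - c) * mbinom M (J j) I) * ?P j)"
    unfolding x by (intro sum.cong refl) simp
  also have "\<dots> = (real (lookup I h) + 1) * (\<Sum>j<k. w j * mbinom M (J j) (I + single h 1) * ?P j)
      + (real (lookup I h) - c) * (\<Sum>j<k. w j * mbinom M (J j) I * ?P j)"
    unfolding mbinom_step[OF h] sum_distrib_left sum.distrib[symmetric]
    by (intro sum.cong refl) (simp add: algebra_simps)
  finally show ?case using 1 2 by simp
qed

text \<open>Rows are chosen one at a time. The determinant, expanded along a new last row, is a
  combination of binomial products at the points \<open>J j\<close> whose last coefficient is, up to
  sign, the previous nonzero determinant. It cannot vanish for all row indices of degree at most
  \<open>k\<close>, since some product of \<open>k\<close> linear factors vanishes at the first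
  \<open>k\<close> points but not at the last.\<close>

lemma binom_matrix_nonsingular:
  fixes J :: "nat \<Rightarrow> expo"
  assumes "inj_on J {..<k}" "\<And>j. j < k \<Longrightarrow> vars_below M (J j)"
  shows "\<exists>I. (\<forall>i<k. vars_below M (I i) \<and> tdeg M (I i) \<le> i) \<and> ldet k (\<lambda>i j. mbinom M (J j) (I i)) \<noteq> 0"
  using assms
proof (induction k)
  case 0 then show ?case by (auto simp: ldet_eq)
next
  case (Suc k)
  have "inj_on J {..<k}" using Suc.prems(1) by (rule inj_on_subset) auto
  then obtain I where I: "\<forall>i<k. vars_below M (I i) \<and> tdeg M (I i) \<le> i" "ldet k (\<lambda>i j. mbinom M (J j) (I i)) \<noteq> 0"
    using Suc.IH Suc.prems by auto
  \<comment> \<open>The cofactors of the last row; they depend only on the rows already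
    chosen.\<close>
  define w where "w j = (-1) ^ (k + j) * ldet k (\<lambda>i l. mbinom M (J (if l < j then l else Suc l)) (I i))" for j
  have ex: "ldet (Suc k) (\<lambda>i j. mbinom M (J j) ((I(k := I')) i)) = (\<Sum>j<Suc k. w j * mbinom M (J j) I')" for I'
  proof -
    have "ldet k (\<lambda>i l. mbinom M (J (if l < j then l else Suc l)) ((I(k := I')) i)) = ldet k (\<lambda>i l. mbinom M (J (if l < j then l else Suc l)) (I i))" for j
      unfolding ldet_eq by (intro sum.cong refl arg_cong2[where f = "(*)"] prod.cong) auto
    then show ?thesis unfolding ldet_expand_last_row w_def by (intro sum.cong refl) (simp add: mult_ac)
  qed
  have wk: "w k \<noteq> 0"
  proof -
    have "ldet k (\<lambda>i l. mbinom M (J (if l < k then l else Suc l)) (I i)) = ldet k (\<lambda>i j. mbinom M (J j) (I i))"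
      unfolding ldet_eq
    proof (intro sum.cong refl arg_cong2[where f = "(*)"] prod.cong)
      fix p i assume "p \<in> {p. p permutes {0..<k}}" "i \<in> {0..<k}"
      then have "p i < k" using permutes_in_image[of p "{0..<k}" i] by auto
      then show "mbinom M (J (if p i < k then p i else Suc (p i))) (I i) = mbinom M (J (p i)) (I i)" by simp
    qed
    then show ?thesis using I(2) by (simp add: w_def)
  qed
  have "\<exists>I'. vars_below M I' \<and> tdeg M I' \<le> k \<and> (\<Sum>j<Suc k. w j * mbinom M (J j) I') \<noteq> 0"
  proof (rule ccontr)
    assume "\<not> ?thesis"
    then have van: "\<And>I'. vars_below M I' \<Longrightarrow> tdeg M I' \<le> k \<Longrightarrow> (\<Sum>j<Suc k. w j * mbinom M (J j) I') = 0" by blast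
    have "\<exists>h<M. lookup (J k) h \<noteq> lookup (J j) h" if "j < k" for j
    proof -
      have "J k \<noteq> J j" using that by (simp add: inj_on_eq_iff[OF Suc.prems(1)])
      then obtain h where "lookup (J k) h \<noteq> lookup (J j) h" by (metis poly_mapping_eqI)
      moreover have "h < M" using calculation Suc.prems(2)[of k] Suc.prems(2)[of j] that
        by (auto simp: vars_below_def) (metis not_le)
      ultimately show ?thesis by blast
    qed
    then obtain h where h: "\<And>j. j < k \<Longrightarrow> h j < M \<and> lookup (J k) (h j) \<noteq> lookup (J j) (h j)" by metis
    \<comment> \<open>One linear factor per earlier point: \<open>J j\<close> and \<open>J k\<close>
      differ in coordinate \<open>h j\<close>.\<close>
    define ts where "ts = map (\<lambda>j. (h j, real (lookup (J j) (h j)))) [0..<k]"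
    let ?P = "\<lambda>j. (\<Prod>(h, c)\<leftarrow>ts. real (lookup (J j) h) - c)"
    have "(\<Sum>j<Suc k. w j * mbinom M (J j) 0 * ?P j) = 0"
      by (rule functional_vanish[OF van]) (auto simp: ts_def h tdeg_def)
    moreover have "?P j = 0" if "j < k" for j
      using that by (auto simp: prod_list_zero_iff ts_def image_iff)
    ultimately have "w k * ?P k = 0" by simp
    moreover have "?P k \<noteq> 0" using h by (auto simp: prod_list_zero_iff ts_def)
    ultimately show False using wk by simp
  qed
  then obtain I' where I': "vars_below M I'" "tdeg M I' \<le> k" "(\<Sum>j<Suc k. w j * mbinom M (J j) I') \<noteq> 0" by blast
  show ?case
    by (rule exI[of _ "I(k := I')"]) (use I(1) I' ex[of I'] in \<open>auto simp: less_Suc_eq\<close>)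
qed

lemma ldet_row_nonzero:
  fixes A :: "nat \<Rightarrow> nat \<Rightarrow> 'a::idom"
  assumes "ldet k A \<noteq> 0" "i < k" shows "\<exists>j<k. A i j \<noteq> 0"
proof (rule ccontr)
  assume "\<not> ?thesis"
  then have z: "\<And>j. j < k \<Longrightarrow> A i j = 0" by blast
  have "(\<Prod>l=0..<k. A l (p l)) = 0" if "p permutes {0..<k}" for p
    using permutes_in_image[OF that, of i] assms(2) z by (auto intro!: bexI[of _ i])
  then have "ldet k A = 0" unfolding ldet_eq by (intro sum.neutral ballI) (simp only: mem_Collect_eq mult_zero_right)
  with assms show False by simp
qed

lemma ldet_scale: "ldet k (\<lambda>i j. c i * A i j * d j) = (\<Prod>i<k. c i) * (\<Prod>i<k. d i) * ldet k A"
proof -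
  have "(\<Prod>i=0..<k. c i * A i (p i) * d (p i)) = (\<Prod>i<k. c i) * (\<Prod>i<k. d i) * (\<Prod>i=0..<k. A i (p i))" if "p permutes {0..<k}" for p
    using prod.permute[OF that, of d] by (simp add: prod.distrib comp_def lessThan_atLeast0 mult_ac)
  then show ?thesis unfolding ldet_eq sum_distrib_left by (intro sum.cong refl) (simp add: mult_ac)
qed

text \<open>A substitute for generalised Wronskians: the lowest coefficient of the determinant is a
  determinant of binomial coefficients.\<close>

lemma hasse_det_nonzero:
  fixes p :: "nat \<Rightarrow> mpol" and J :: "nat \<Rightarrow> expo"
  assumes inj: "inj_on J {..<k}" and vb: "\<And>j. j < k \<Longrightarrow> vars_below M (J j)"
    and nz: "\<And>j. j < k \<Longrightarrow> lookup (p j) (J j) \<noteq> 0"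
    and low: "\<And>j K. j < k \<Longrightarrow> K \<in> keys (p j) \<Longrightarrow> J j \<le> K"
  shows "\<exists>I. (\<forall>i<k. vars_below M (I i) \<and> tdeg M (I i) \<le> i \<and> (\<exists>j<k. mbinom M (J j) (I i) \<noteq> 0)) \<and> ldet k (\<lambda>i j. hasse M (I i) (p j)) \<noteq> 0"
proof -
  obtain I where I: "\<forall>i<k. vars_below M (I i) \<and> tdeg M (I i) \<le> i" and d: "ldet k (\<lambda>i j. mbinom M (J j) (I i)) \<noteq> 0"
    using binom_matrix_nonsingular[OF inj vb] by blast
  \<comment> \<open>Multiplying row \<open>i\<close> by the monomial with exponent
    \<open>I i\<close> undoes the lowering of exponents: every coefficient of \<open>p j\<close>
    stays at its exponent and is only scaled by \<open>mbinom\<close>. The lower bound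
    \<open>J j\<close> for the exponents then holds in the whole column.\<close>
  define A where "A i j = single (I i) 1 * hasse M (I i) (p j)" for i j
  have lkA: "lookup (A i j) K = mbinom M K (I i) * lookup (p j) K" if "i < k" for i j K
  proof -
    have v: "vars_below M (I i)" using I that by blast
    have "A i j = (\<Sum>J\<in>keys (p j). single J (mbinom M J (I i) * lookup (p j) J))"
      unfolding A_def hasse_def sum_distrib_left mult_single
    proof (intro sum.cong refl)
      fix J assume "J \<in> keys (p j)"
      show "single (I i + (J - I i)) (1 * (mbinom M J (I i) * lookup (p j) J)) = single J (mbinom M J (I i) * lookup (p j) J)"
        using expo_minus_add[OF v, of J] by (cases "mbinom M J (I i) = 0") (auto simp: add.commute)
    qed
    then show ?thesis by (auto simp: lookup_sum lookup_single when_def sum.delta in_keys_iff)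
  qed
  have "lookup (ldet k A) (\<Sum>j<k. J j) = ldet k (\<lambda>i j. lookup (A i j) (J j))"
    by (rule lookup_ldet_lowest) (use low in \<open>auto simp: lkA in_keys_iff\<close>)
  also have "\<dots> = ldet k (\<lambda>i j. 1 * mbinom M (J j) (I i) * lookup (p j) (J j))"
    unfolding ldet_eq by (intro sum.cong refl arg_cong2[where f = "(*)"] prod.cong) (auto simp: lkA)
  also have "\<dots> \<noteq> 0" unfolding ldet_scale using d nz by auto
  finally have "ldet k A \<noteq> 0" by auto
  moreover have "ldet k A = (\<Prod>i<k. single (I i) 1) * (\<Prod>i<k. 1) * ldet k (\<lambda>i j. hasse M (I i) (p j))"
    unfolding ldet_scale[symmetric] A_def by simp
  ultimately have "ldet k (\<lambda>i j. hasse M (I i) (p j)) \<noteq> 0" by auto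
  moreover have "\<exists>j<k. mbinom M (J j) (I i) \<noteq> 0" if "i < k" for i
    using ldet_row_nonzero[OF d that] .
  ultimately show ?thesis using I by blast
qed

subsection \<open>Separation of variables\<close>

lift_definition lo :: "nat \<Rightarrow> expo \<Rightarrow> expo" is "\<lambda>m f v. if v < m then f v else 0"
  by (rule rev_finite_subset) auto

lift_definition hi :: "nat \<Rightarrow> expo \<Rightarrow> expo" is "\<lambda>m f v. if v < m then 0 else f v"
  by (rule rev_finite_subset) auto

lemma lookup_lo: "lookup (lo m K) v = (if v < m then lookup K v else 0)" by transfer simp
lemma lookup_hi: "lookup (hi m K) v = (if v < m then 0 else lookup K v)" by transfer simp

lemma lo_add_hi: "lo m K + hi m K = K"
  by (rule poly_mapping_eqI) (simp add: lookup_add lookup_lo lookup_hi)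

lemma lo_add: "lo m (K + L) = lo m K + lo m L"
  by (rule poly_mapping_eqI) (simp add: lookup_add lookup_lo)
lemma hi_add: "hi m (K + L) = hi m K + hi m L"
  by (rule poly_mapping_eqI) (simp add: lookup_add lookup_hi)

lemma lo_id_iff: "lo m K = K \<longleftrightarrow> vars_below m K"
  unfolding poly_mapping_eq_iff fun_eq_iff lookup_lo vars_below_def by (auto simp: not_less)

lemma hi_id_iff: "hi m K = K \<longleftrightarrow> (\<forall>v<m. lookup K v = 0)"
  unfolding poly_mapping_eq_iff fun_eq_iff lookup_hi by auto

lemma hi_of_lo: "lo m K = K \<Longrightarrow> hi m K = 0"
  by (metis lo_add_hi add_cancel_right_right)
lemma lo_of_hi: "hi m K = K \<Longrightarrow> lo m K = 0"
  by (metis lo_add_hi add_cancel_left_left)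

lemma lo_lo [simp]: "lo m (lo m K) = lo m K" by (rule poly_mapping_eqI) (simp add: lookup_lo)
lemma hi_hi [simp]: "hi m (hi m K) = hi m K" by (rule poly_mapping_eqI) (simp add: lookup_hi)

definition lo_poly :: "nat \<Rightarrow> mpol \<Rightarrow> bool" where "lo_poly m p \<longleftrightarrow> (\<forall>K\<in>keys p. lo m K = K)"
definition hi_poly :: "nat \<Rightarrow> mpol \<Rightarrow> bool" where "hi_poly m p \<longleftrightarrow> (\<forall>K\<in>keys p. hi m K = K)"

text \<open>An exponent splits uniquely into its low and its high part, so no two terms of the
  product meet.\<close>

lemma lookup_mult_sep:
  assumes "lo_poly m p" "hi_poly m q"
  shows "lookup (p * q) K = lookup p (lo m K) * lookup q (hi m K)"
proof -
  have "lookup (p * q) K = (\<Sum>x\<in>keys p. if x = lo m K then (\<Sum>y\<in>keys q. if y = hi m K then lookup p (lo m K) * lookup q (hi m K) else 0) else 0)"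
    unfolding lookup_mult_eq
  proof (intro sum.cong refl)
    fix x assume x: "x \<in> keys p"
    show "(\<Sum>y\<in>keys q. if x + y = K then lookup p x * lookup q y else 0) = (if x = lo m K then (\<Sum>y\<in>keys q. if y = hi m K then lookup p (lo m K) * lookup q (hi m K) else 0) else 0)"
    proof -
      have "x + y = K \<longleftrightarrow> x = lo m K \<and> y = hi m K" if y: "y \<in> keys q" for y
      proof
        have lx: "lo m x = x" and hy: "hi m y = y" using assms x y by (auto simp: lo_poly_def hi_poly_def)
        assume "x + y = K"
        then show "x = lo m K \<and> y = hi m K"
          using lx hy hi_of_lo[OF lx] lo_of_hi[OF hy] by (auto simp: lo_add hi_add)
      qed (auto simp: lo_add_hi)
      then show ?thesis by (auto intro!: sum.neutral sum.cong)
    qed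
  qed
  then show ?thesis by (simp add: sum.delta in_keys_iff)
qed

lemma mbinom_sep:
  assumes "lo m I = I" "hi m B = B"
  shows "mbinom M (K + (I + B)) (I + B) = mbinom M (lo m K + I) I * mbinom M (hi m K + B) B"
  unfolding mbinom_def prod.distrib[symmetric]
proof (intro prod.cong refl)
  fix v
  have "v \<ge> m \<Longrightarrow> lookup I v = 0" "v < m \<Longrightarrow> lookup B v = 0"
    using assms by (auto simp: lo_id_iff vars_below_def hi_id_iff)
  then show "real (lookup (K + (I + B)) v choose lookup (I + B) v) =
     real (lookup (lo m K + I) v choose lookup I v) * real (lookup (hi m K + B) v choose lookup B v)"
    by (cases "v < m") (auto simp: lookup_add lookup_lo lookup_hi)
qed

lemma lo_poly_hasse: "vars_below M I \<Longrightarrow> lo_poly m p \<Longrightarrow> lo_poly m (hasse M I p)"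
  unfolding lo_poly_def lo_id_iff
proof
  fix K assume "vars_below M I" "\<forall>K\<in>keys p. vars_below m K" "K \<in> keys (hasse M I p)"
  moreover from this have "K + I \<in> keys p" by (simp add: in_keys_iff lookup_hasse)
  ultimately have "vars_below m (K + I)" by blast
  then show "vars_below m K" by (simp add: vars_below_add)
qed

lemma hi_poly_hasse: "vars_below M I \<Longrightarrow> hi_poly m p \<Longrightarrow> hi_poly m (hasse M I p)"
  unfolding hi_poly_def hi_id_iff
proof
  fix K assume "vars_below M I" "\<forall>K\<in>keys p. \<forall>v<m. lookup K v = 0" "K \<in> keys (hasse M I p)"
  moreover from this have "K + I \<in> keys p" by (simp add: in_keys_iff lookup_hasse)
  ultimately have "\<forall>v<m. lookup (K + I) v = 0" by blast
  then show "\<forall>v<m. lookup K v = 0" by (simp add: lookup_add)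
qed

text \<open>Every other term of the Leibniz rule differentiates one of the factors with respect to a
  variable that it does not contain.\<close>

lemma hasse_mult_sep:
  assumes "lo_poly m p" "hi_poly m q" "lo m I = I" "hi m B = B" "vars_below M I" "vars_below M B"
  shows "hasse M (I + B) (p * q) = hasse M I p * hasse M B q"
proof (rule poly_mapping_eqI)
  fix K
  show "lookup (hasse M (I + B) (p * q)) K = lookup (hasse M I p * hasse M B q) K"
    unfolding lookup_mult_sep[OF lo_poly_hasse[OF assms(5,1)] hi_poly_hasse[OF assms(6,2)]]
    using assms by (simp add: lookup_hasse vars_below_add lookup_mult_sep[OF assms(1,2)]
        mbinom_sep lo_add hi_add hi_of_lo lo_of_hi)
qed

lemma hasse_sum: "vars_below M I \<Longrightarrow> hasse M I (\<Sum>i\<in>S. f i) = (\<Sum>i\<in>S. hasse M I (f i))"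
  by (rule poly_mapping_eqI) (simp add: lookup_hasse lookup_sum sum_distrib_left)

lemma keys_sep_add:
  assumes "lo_poly m p" "hi_poly m q" "J \<in> keys p" "L \<in> keys q"
  shows "J + L \<in> keys (p * q)" "lookup (p * q) (J + L) = lookup p J * lookup q L"
proof -
  have "lo m J = J" "hi m L = L" using assms by (auto simp: lo_poly_def hi_poly_def)
  then show "lookup (p * q) (J + L) = lookup p J * lookup q L"
    using assms by (simp add: lookup_mult_sep lo_add hi_add hi_of_lo lo_of_hi)
  then show "J + L \<in> keys (p * q)" using assms by (simp add: in_keys_iff)
qed

text \<open>The products of the coefficients of \<open>p\<close> with one fixed coefficient of
  \<open>q\<close> all occur among the coefficients of \<open>p * q\<close>. For integral
  \<open>q\<close> that coefficient is at least 1 in absolute value, so the height of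
  \<open>p\<close> is at most that of the product.\<close>

lemma l1_sep_left:
  assumes "lo_poly m p" "hi_poly m q" "L \<in> keys q"
  shows "l1 p * \<bar>lookup q L\<bar> \<le> l1 (p * q)"
proof -
  have "l1 p * \<bar>lookup q L\<bar> = (\<Sum>J\<in>keys p. \<bar>lookup (p * q) (J + L)\<bar>)"
    unfolding l1_def sum_distrib_right
    by (intro sum.cong refl) (simp add: keys_sep_add(2)[OF assms(1,2) _ assms(3)] abs_mult)
  also have "\<dots> = (\<Sum>K\<in>(\<lambda>J. J + L) ` keys p. \<bar>lookup (p * q) K\<bar>)"
    by (subst sum.reindex) (auto simp: inj_on_def)
  also have "\<dots> \<le> l1 (p * q)" unfolding l1_def
    by (rule sum_mono2) (auto intro: keys_sep_add(1)[OF assms(1,2) _ assms(3)])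
  finally show ?thesis .
qed

lemma l1_sep_right:
  assumes "lo_poly m p" "hi_poly m q" "J \<in> keys p"
  shows "\<bar>lookup p J\<bar> * l1 q \<le> l1 (p * q)"
proof -
  have "\<bar>lookup p J\<bar> * l1 q = (\<Sum>L\<in>keys q. \<bar>lookup (p * q) (J + L)\<bar>)"
    unfolding l1_def sum_distrib_left
    by (intro sum.cong refl) (simp add: keys_sep_add(2)[OF assms(1,2,3)] abs_mult)
  also have "\<dots> = (\<Sum>K\<in>(\<lambda>L. J + L) ` keys q. \<bar>lookup (p * q) K\<bar>)"
    by (subst sum.reindex) (auto simp: inj_on_def)
  also have "\<dots> \<le> l1 (p * q)" unfolding l1_def
    by (rule sum_mono2) (auto intro: keys_sep_add(1)[OF assms(1,2,3)])
  finally show ?thesis .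
qed

section \<open>Rank decomposition of the coefficient array\<close>

definition row_poly :: "nat \<Rightarrow> expo \<Rightarrow> mpol \<Rightarrow> mpol" where
  "row_poly m J P = Abs_poly_mapping (\<lambda>L. if hi m L = L then lookup P (J + L) else 0)"

definition col_poly :: "nat \<Rightarrow> expo \<Rightarrow> mpol \<Rightarrow> mpol" where
  "col_poly m L P = Abs_poly_mapping (\<lambda>J. if lo m J = J then lookup P (J + L) else 0)"

lemma finite_shifted_support: "finite {L. lookup P (J + L) \<noteq> 0}" for P :: mpol
  using finite_vimageI[of "{k. lookup P k \<noteq> 0}" "(+) J"] by (simp add: vimage_def inj_on_def)

lemma lookup_row_poly: "lookup (row_poly m J P) L = (if hi m L = L then lookup P (J + L) else 0)"
proof -
  have "finite {L. (if hi m L = L then lookup P (J + L) else 0) \<noteq> 0}"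
    by (rule finite_subset[OF _ finite_shifted_support[of P J]]) (auto split: if_splits)
  then show ?thesis by (simp only: row_poly_def lookup_Abs_poly_mapping)
qed

lemma lookup_col_poly: "lookup (col_poly m L P) J = (if lo m J = J then lookup P (J + L) else 0)"
proof -
  have "finite {J. (if lo m J = J then lookup P (J + L) else 0) \<noteq> 0}"
    by (rule finite_subset[OF _ finite_shifted_support[of P L]]) (auto split: if_splits simp: add.commute)
  then show ?thesis by (simp only: col_poly_def lookup_Abs_poly_mapping)
qed

lemma lookup_scale [simp]: "lookup (single 0 c * q) L = c * lookup (q::mpol) L"
  by (simp add: lookup_mult_eq sum.delta' sum.delta in_keys_iff)

text \<open>Gaussian elimination on the coefficient array indexed by low and high monomials.\<close>

definition echelon :: "nat \<Rightarrow> mpol \<Rightarrow> expo set \<Rightarrow> (mpol \<times> mpol \<times> expo \<times> expo) \<Rightarrow> bool" where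
  "echelon m P S = (\<lambda>(\<phi>, \<psi>, J, L). J \<in> lo m ` keys P \<and> L \<in> S \<and> lo_poly m \<phi> \<and> hi_poly m \<psi> \<and>
     lookup \<phi> J \<noteq> 0 \<and> lookup \<psi> L \<noteq> 0 \<and> (\<forall>K\<in>keys \<phi>. J \<le> K) \<and> (\<forall>K\<in>keys \<psi>. L \<le> K))"

text \<open>Each round takes the lowest row \<open>J\<close>, and in it the lowest column
  \<open>L\<close>, as pivot and subtracts a rank-one product that clears this row and this column.
  Later rows lie strictly above \<open>J\<close> and later columns avoid \<open>L\<close>, whence
  the distinctness; the number of rounds is bounded by the number of columns.\<close>

lemma echelon_decomposition:
  assumes "finite S" "\<forall>K\<in>keys P. hi m K \<in> S"
  shows "\<exists>xs. length xs \<le> card S \<and> P = (\<Sum>(\<phi>, \<psi>, J, L)\<leftarrow>xs. \<phi> * \<psi>) \<and>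
     distinct (map (\<lambda>(\<phi>, \<psi>, J, L). J) xs) \<and> distinct (map (\<lambda>(\<phi>, \<psi>, J, L). L) xs) \<and> (\<forall>x\<in>set xs. echelon m P S x)"
  using assms
proof (induction "card S" arbitrary: S P)
  case 0
  then have "keys P = {}" by auto
  then show ?case by (intro exI[of _ "[]"]) auto
next
  case (Suc n)
  show ?case
  proof (cases "P = 0")
    case True then show ?thesis by (intro exI[of _ "[]"]) auto
  next
    case False
    define J where "J = Min (lo m ` keys P)"
    have ne: "keys P \<noteq> {}" using False by simp
    have J_in: "J \<in> lo m ` keys P" unfolding J_def using ne by (intro Min_in) auto
    have J_le: "J \<le> lo m K" if "K \<in> keys P" for K unfolding J_def using that by (intro Min_le) auto
    define \<psi> where "\<psi> = row_poly m J P"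
    have \<psi>k: "K \<in> keys \<psi> \<longleftrightarrow> hi m K = K \<and> J + K \<in> keys P" for K
      by (simp add: \<psi>_def in_keys_iff lookup_row_poly)
    have lJ: "lo m J = J" using J_in by auto
    obtain K0 where K0: "K0 \<in> keys P" "J = lo m K0" using J_in by auto
    have "hi m K0 \<in> keys \<psi>" unfolding \<psi>k K0(2) using K0(1) by (simp add: lo_add_hi)
    then have ne\<psi>: "keys \<psi> \<noteq> {}" by auto
    define L where "L = Min (keys \<psi>)"
    have L_in: "L \<in> keys \<psi>" unfolding L_def using ne\<psi> by (intro Min_in) auto
    have L_le: "L \<le> K" if "K \<in> keys \<psi>" for K unfolding L_def using that by (intro Min_le) auto
    have hL: "hi m L = L" and JL: "J + L \<in> keys P" using L_in \<psi>k by auto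
    have LS: "L \<in> S" using Suc.prems(2) JL hL by (auto simp: hi_add hi_of_lo[OF lJ] dest!: bspec)
    define c where "c = lookup P (J + L)"
    have c0: "c \<noteq> 0" using JL by (simp add: c_def in_keys_iff)
    \<comment> \<open>Scaled to have coefficient 1 at \<open>J\<close>, so that the product agrees
      with \<open>P\<close> on row \<open>J\<close> as well as on column \<open>L\<close>.\<close>
    define \<phi> where "\<phi> = single 0 (1 / c) * col_poly m L P"
    have \<phi>l: "lookup \<phi> K = (if lo m K = K then lookup P (K + L) / c else 0)" for K
      by (simp add: \<phi>_def lookup_col_poly)
    have lo\<phi>: "lo_poly m \<phi>" by (auto simp: lo_poly_def in_keys_iff \<phi>l split: if_splits)
    have hi\<psi>: "hi_poly m \<psi>" by (auto simp: hi_poly_def \<psi>k)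
    define P' where "P' = P - \<phi> * \<psi>"
    have P'l: "lookup P' K = lookup P K - lookup P (lo m K + L) / c * lookup P (J + hi m K)" for K
      unfolding P'_def lookup_minus lookup_mult_sep[OF lo\<phi> hi\<psi>] by (simp add: \<phi>l \<psi>_def lookup_row_poly)
    have P'k: "hi m K \<in> S - {L} \<and> J < lo m K \<and> lo m K \<in> lo m ` keys P" if K: "K \<in> keys P'" for K
    proof -
      have nz: "lookup P' K \<noteq> 0" using K by (simp add: in_keys_iff)
      have 1: "K \<in> keys P \<or> (lo m K + L \<in> keys P \<and> J + hi m K \<in> keys P)"
        using nz unfolding P'l by (auto simp: in_keys_iff)
      have h: "hi m K \<in> S"
      proof -
        have "hi m (J + hi m K) = hi m K" by (simp add: hi_add hi_of_lo[OF lJ])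
        then show ?thesis using 1 Suc.prems(2) by metis
      qed
      have l: "lo m K \<in> lo m ` keys P"
        using 1
      proof
        assume "lo m K + L \<in> keys P \<and> J + hi m K \<in> keys P"
        moreover have "lo m (lo m K + L) = lo m K" by (simp add: lo_add lo_of_hi[OF hL])
        ultimately show ?thesis by (metis imageI)
      qed auto
      have "hi m K \<noteq> L"
      proof
        assume e: "hi m K = L"
        then have "lookup P' K = 0" unfolding P'l e using c0 lo_add_hi[of m K] by (simp add: e c_def)
        with nz show False by simp
      qed
      moreover have "lo m K \<noteq> J"
      proof
        assume e: "lo m K = J"
        then have "lookup P' K = 0" unfolding P'l e using c0 lo_add_hi[of m K] by (simp add: e c_def)
        with nz show False by simp
      qed
      moreover have "J \<le> lo m K" using l J_le by auto
      ultimately show ?thesis using h l by auto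
    qed
    have "n = card (S - {L})" using Suc.hyps(2) LS Suc.prems(1) by simp
    moreover have "finite (S - {L})" using Suc.prems by simp
    ultimately obtain xs where xs: "length xs \<le> card (S - {L})" "P' = (\<Sum>(\<phi>, \<psi>, J, L)\<leftarrow>xs. \<phi> * \<psi>)"
      "distinct (map (\<lambda>(\<phi>, \<psi>, J, L). J) xs)" "distinct (map (\<lambda>(\<phi>, \<psi>, J, L). L) xs)"
      "\<forall>x\<in>set xs. echelon m P' (S - {L}) x"
      using Suc.hyps(1)[of "S - {L}" P'] P'k by blast
    let ?x = "(\<phi>, \<psi>, J, L)"
    have sub: "echelon m P S x" if "x \<in> set xs" for x
    proof -
      obtain a b J' L' where x: "x = (a, b, J', L')" by (cases x)
      have e: "echelon m P' (S - {L}) (a, b, J', L')" using xs(5) that x by blast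
      then obtain K where "K \<in> keys P'" "J' = lo m K" by (auto simp: echelon_def)
      then have "J' \<in> lo m ` keys P" using P'k by blast
      then show ?thesis using e by (simp add: echelon_def x)
    qed
    have "echelon m P S ?x"
    proof -
      have "lookup \<phi> J \<noteq> 0" using c0 lJ by (simp add: \<phi>l c_def)
      moreover have "lookup \<psi> L \<noteq> 0" using L_in by (simp add: in_keys_iff)
      moreover have "J \<le> K" if "K \<in> keys \<phi>" for K
      proof -
        have "lo m K = K" "K + L \<in> keys P" using that by (auto simp: in_keys_iff \<phi>l split: if_splits)
        then show ?thesis using J_le[of "K + L"] by (simp add: lo_add lo_of_hi[OF hL])
      qed
      ultimately show ?thesis using J_in LS lo\<phi> hi\<psi> L_le by (auto simp: echelon_def)
    qed
    moreover have "J \<notin> (\<lambda>(\<phi>, \<psi>, J, L). J) ` set xs"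
    proof
      assume "J \<in> (\<lambda>(\<phi>, \<psi>, J, L). J) ` set xs"
      then obtain \<phi>' \<psi>' L' where "(\<phi>', \<psi>', J, L') \<in> set xs" by auto
      then have "echelon m P' (S - {L}) (\<phi>', \<psi>', J, L')" using xs(5) by blast
      then obtain K where "K \<in> keys P'" "J = lo m K" by (auto simp: echelon_def)
      then show False using P'k[of K] by simp
    qed
    moreover have "L \<notin> (\<lambda>(\<phi>, \<psi>, J, L). L) ` set xs"
    proof
      assume "L \<in> (\<lambda>(\<phi>, \<psi>, J, L). L) ` set xs"
      then obtain \<phi>' \<psi>' J' where "(\<phi>', \<psi>', J', L) \<in> set xs" by auto
      then have "echelon m P' (S - {L}) (\<phi>', \<psi>', J', L)" using xs(5) by blast
      then show False by (auto simp: echelon_def)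
    qed
    moreover have "P = \<phi> * \<psi> + (\<Sum>(\<phi>, \<psi>, J, L)\<leftarrow>xs. \<phi> * \<psi>)" unfolding xs(2)[symmetric] by (simp add: P'_def)
    moreover have "Suc (card (S - {L})) = card S" using LS Suc.prems(1) by (intro card_Suc_Diff1)
    ultimately have "length (?x # xs) \<le> card S" "P = (\<Sum>(\<phi>, \<psi>, J, L)\<leftarrow>?x # xs. \<phi> * \<psi>)"
      "distinct (map (\<lambda>(\<phi>, \<psi>, J, L). J) (?x # xs))" "distinct (map (\<lambda>(\<phi>, \<psi>, J, L). L) (?x # xs))"
      "\<forall>x\<in>set (?x # xs). echelon m P S x"
      using xs(1,3,4) sub by (simp_all del: card_Diff_insert card_Diff_singleton_if)
    then show ?thesis by blast
  qed
qed

subsection \<open>Integer coefficients\<close>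

definition int_coeffs :: "mpol \<Rightarrow> bool" where "int_coeffs p \<longleftrightarrow> (\<forall>J. lookup p J \<in> \<int>)"

lemma int_coeffs_mult: "int_coeffs p \<Longrightarrow> int_coeffs q \<Longrightarrow> int_coeffs (p * q)"
  unfolding int_coeffs_def lookup_mult_eq by (auto intro!: Ints_sum Ints_mult)

lemma int_coeffs_prod: "finite S \<Longrightarrow> (\<And>i. i \<in> S \<Longrightarrow> int_coeffs (f i)) \<Longrightarrow> int_coeffs (\<Prod>i\<in>S. f i)"
proof (induction S rule: finite_induct)
  case empty then show ?case by (simp add: int_coeffs_def lookup_one when_def)
qed (auto intro: int_coeffs_mult)

lemma int_coeffs_ldet:
  assumes "\<And>i j. i < k \<Longrightarrow> j < k \<Longrightarrow> int_coeffs (A i j)"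
  shows "int_coeffs (ldet k A)"
  unfolding int_coeffs_def ldet_eq lookup_sum
proof (intro allI Ints_sum)
  fix K p assume "p \<in> {p. p permutes {0..<k}}"
  then have "int_coeffs (\<Prod>i=0..<k. A i (p i))"
    using permutes_in_image[of p "{0..<k}"] assms by (intro int_coeffs_prod) auto
  then show "lookup (signof p * (\<Prod>i=0..<k. A i (p i))) K \<in> \<int>"
    by (auto simp: lookup_signof_mult int_coeffs_def)
qed

lemma int_coeffs_hasse: "vars_below M I \<Longrightarrow> int_coeffs p \<Longrightarrow> int_coeffs (hasse M I p)"
  by (auto simp: int_coeffs_def lookup_hasse mbinom_def intro!: Ints_mult Ints_prod)

lemma bezout_finite:
  fixes z :: "'a \<Rightarrow> int"
  assumes "finite S"
  shows "\<exists>b. (\<Sum>L\<in>S. b L * z L) = Gcd (z ` S)"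
  using assms
proof (induction S rule: finite_induct)
  case (insert x F)
  then obtain b where b: "(\<Sum>L\<in>F. b L * z L) = Gcd (z ` F)" by blast
  obtain u v where uv: "u * z x + v * Gcd (z ` F) = gcd (z x) (Gcd (z ` F))" using bezout_int by blast
  have "(\<Sum>L\<in>insert x F. (if L = x then u else v * b L) * z L) = u * z x + (\<Sum>L\<in>F. v * (b L * z L))"
  proof -
    have "(\<Sum>L\<in>F. (if L = x then u else v * b L) * z L) = (\<Sum>L\<in>F. v * (b L * z L))"
      using insert.hyps by (intro sum.cong) auto
    then show ?thesis using insert.hyps by simp
  qed
  then have "(\<Sum>L\<in>insert x F. (if L = x then u else v * b L) * z L) = Gcd (z ` insert x F)"
    using uv b by (simp flip: sum_distrib_left)
  then show ?case by (intro exI[of _ "\<lambda>L. if L = x then u else v * b L"])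
qed auto

text \<open>An argument with contents as in Gauss's lemma. Multiplied by one coefficient
  \<open>v0\<close> of \<open>V\<close>, the factor \<open>U\<close> becomes integral, and it stays
  integral after division by the gcd \<open>g\<close> of its coefficients. Writing \<open>g\<close>
  as a Bezout combination of these coefficients shows that the inverse factor \<open>g / v0\<close>
  makes \<open>V\<close> integral.\<close>

lemma int_scaling:
  assumes sep: "lo_poly m V" "hi_poly m U" and nz: "V \<noteq> 0" "U \<noteq> 0" and int: "int_coeffs (V * U)"
  shows "\<exists>c. c \<noteq> 0 \<and> int_coeffs (single 0 (1 / c) * V) \<and> int_coeffs (single 0 c * U)"
proof -
  obtain J0 where J0: "J0 \<in> keys V" using nz(1) by (metis keys_eq_empty ex_in_conv)
  obtain L0 where L0: "L0 \<in> keys U" using nz(2) by (metis keys_eq_empty ex_in_conv)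
  define v0 where "v0 = lookup V J0"
  have v0: "v0 \<noteq> 0" using J0 by (simp add: v0_def in_keys_iff)
  have VU: "lookup V J * lookup U L \<in> \<int>" if "J \<in> keys V" "L \<in> keys U" for J L
    using keys_sep_add(2)[OF sep that] int by (metis int_coeffs_def)
  define z where "z L = \<lfloor>v0 * lookup U L\<rfloor>" for L
  have z: "real_of_int (z L) = v0 * lookup U L" if "L \<in> keys U" for L
    using VU[OF J0 that] unfolding z_def v0_def by simp
  define g where "g = Gcd (z ` keys U)"
  have "z L0 \<noteq> 0" using z[OF L0] v0 L0 by (auto simp: in_keys_iff)
  then have g0: "g \<noteq> 0" unfolding g_def Gcd_0_iff using L0 by auto
  obtain b where b: "(\<Sum>L\<in>keys U. b L * z L) = g" using bezout_finite[of "keys U" z] by (auto simp: g_def)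
  define c where "c = v0 / real_of_int g"
  have c0: "c \<noteq> 0" using v0 g0 by (simp add: c_def)
  have "c * lookup U L \<in> \<int>" for L
  proof (cases "L \<in> keys U")
    case True
    then have "g dvd z L" unfolding g_def by (intro Gcd_dvd) auto
    then obtain d where "z L = g * d" by auto
    then have "c * lookup U L = real_of_int d" using z[OF True] g0 by (simp add: c_def field_simps)
    then show ?thesis by simp
  qed (simp add: in_keys_iff)
  moreover have "1 / c * lookup V J \<in> \<int>" for J
  proof (cases "J \<in> keys V")
    case True
    have "1 / c * lookup V J = real_of_int g * lookup V J / v0" by (simp add: c_def)
    also have "real_of_int g = (\<Sum>L\<in>keys U. real_of_int (b L) * (v0 * lookup U L))"
      unfolding b[symmetric] by (simp add: z)
    also have "\<dots> * lookup V J / v0 = (\<Sum>L\<in>keys U. real_of_int (b L) * (lookup V J * lookup U L))"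
      unfolding sum_distrib_right sum_divide_distrib by (intro sum.cong refl) (use v0 in \<open>simp add: field_simps\<close>)
    also have "\<dots> \<in> \<int>" using VU[OF True] by (intro Ints_sum Ints_mult[OF Ints_of_int]) auto
    finally show ?thesis .
  qed (simp add: in_keys_iff)
  ultimately show ?thesis using c0 by (intro exI[of _ c]) (auto simp: int_coeffs_def)
qed

text \<open>The recursion for the coefficients, read from the constant term upwards, leaves only
  powers of \<open>p\<close> as denominators; read from the degree downwards, only powers of
  \<open>q\<close>. Coprimality leaves the denominator 1.\<close>

lemma int_quotient_linear:
  fixes v :: "real poly" and p q :: int
  assumes int: "\<And>i. coeff ([:- of_int p, of_int q:] * v) i \<in> \<int>" and cop: "coprime p q"
  shows "coeff v i \<in> \<int>"
proof -
  let ?u = "[:- of_int p, of_int q:] * v"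
  have c0: "coeff ?u 0 = - of_int p * coeff v 0" by (simp add: mult_pCons_left)
  have cS: "coeff ?u (Suc i) = of_int q * coeff v i - of_int p * coeff v (Suc i)" for i
    by (simp add: mult_pCons_left)
  have A: "of_int p ^ Suc i * coeff v i \<in> \<int>" for i
  proof (induction i)
    case 0
    have "of_int p ^ Suc 0 * coeff v 0 = - coeff ?u 0" unfolding c0 by simp
    then show ?case using int[of 0] by simp
  next
    case (Suc i)
    have "of_int p ^ Suc (Suc i) * coeff v (Suc i) = of_int q * (of_int p ^ Suc i * coeff v i) - of_int p ^ Suc i * coeff ?u (Suc i)"
      unfolding cS by (simp add: algebra_simps)
    then show ?case
      using Ints_diff[OF Ints_mult[OF Ints_of_int[of q] Suc] Ints_mult[OF Ints_power[OF Ints_of_int[of p], of "Suc i"] int[of "Suc i"]]]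
      by (simp only:)
  qed
  have B: "of_int q ^ j * coeff v i \<in> \<int>" if "i + j > degree v" for i j
    using that
  proof (induction j arbitrary: i)
    case 0 then show ?case by (simp add: coeff_eq_0)
  next
    case (Suc j)
    have "of_int q ^ Suc j * coeff v i = of_int q ^ j * coeff ?u (Suc i) + of_int p * (of_int q ^ j * coeff v (Suc i))"
      unfolding cS by (simp add: algebra_simps)
    moreover have "of_int q ^ j * coeff v (Suc i) \<in> \<int>" using Suc.IH[of "Suc i"] Suc.prems by simp
    ultimately show ?case
      using Ints_add[OF Ints_mult[OF Ints_power[OF Ints_of_int[of q], of j] int[of "Suc i"]] Ints_mult[OF Ints_of_int[of p]]]
      by (simp only:)
  qed
  define j where "j = Suc (degree v)"
  have "coprime (p ^ Suc i) (q ^ j)" using cop by simp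
  then obtain x y where xy: "x * p ^ Suc i + y * q ^ j = 1" 
    using bezout_int[of "p ^ Suc i" "q ^ j"] by (auto simp: coprime_iff_gcd_eq_1)
  have "coeff v i = of_int (x * p ^ Suc i + y * q ^ j) * coeff v i" unfolding xy by simp
  also have "\<dots> = of_int x * (of_int p ^ Suc i * coeff v i) + of_int y * (of_int q ^ j * coeff v i)"
    by (simp add: algebra_simps)
  also have "\<dots> \<in> \<int>" by (intro Ints_add Ints_mult[OF Ints_of_int] A B) (simp add: j_def)
  finally show ?thesis .
qed

text \<open>The primitive polynomial \<open>q X - p\<close> can be divided out \<open>n\<close>
  times with an integral quotient, so the leading coefficient of \<open>u\<close> is a nonzero
  multiple of \<open>q ^ n\<close>.\<close>

lemma int_poly_order_bound:
  fixes u :: "real poly" and p q :: int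
  assumes "\<And>i. coeff u i \<in> \<int>" "coprime p q" "q > 0" "u \<noteq> 0" "[:- (of_int p / of_int q), 1:] ^ n dvd u"
  shows "of_int q ^ n \<le> \<bar>lead_coeff u\<bar>"
proof -
  let ?l = "[:- of_int p, of_int q:] :: real poly"
  have l: "?l = smult (of_int q) [:- (of_int p / of_int q), 1:]" using assms(3) by simp
  have "?l ^ n dvd u" unfolding l smult_power using assms(3,5) by (intro smult_dvd) auto
  then obtain v where v: "u = ?l ^ n * v" by auto
  have main: "(\<And>i. coeff (?l ^ n * w) i \<in> \<int>) \<Longrightarrow> coeff w i \<in> \<int>" for w i
  proof (induction n arbitrary: i)
    case (Suc n)
    have "coeff (?l ^ n * w) i \<in> \<int>" for i
      by (rule int_quotient_linear[OF _ assms(2)]) (use Suc.prems in \<open>simp only: power_Suc mult.assoc\<close>)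
    then show ?case using Suc.IH by blast
  qed simp
  have vi: "coeff v i \<in> \<int>" for i by (rule main) (use assms(1) v in auto)
  have v0: "v \<noteq> 0" using v assms(4) by auto
  obtain z where z: "lead_coeff v = of_int z" using vi[of "degree v"] by (auto elim: Ints_cases)
  have "z \<noteq> 0" using v0 z by auto
  then have "1 \<le> \<bar>lead_coeff v\<bar>" unfolding z by linarith
  moreover have "lead_coeff u = of_int q ^ n * lead_coeff v"
    unfolding v lead_coeff_mult lead_coeff_power using assms(3) by simp
  ultimately show ?thesis using assms(3) by (simp add: abs_mult)
qed

lemma hi_single:
  assumes "hi m K = K" "vars_below (Suc m) K" shows "K = single m (lookup K m)"
proof (rule poly_mapping_eqI)
  fix v
  show "lookup K v = lookup (single m (lookup K m)) v"
    using assms by (cases "v < m"; cases "v = m") (auto simp: hi_id_iff vars_below_def lookup_single when_def)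
qed

lemma mpol_order_bound:
  fixes p q :: int
  assumes U: "U \<noteq> 0" "int_coeffs U" "\<And>K. K \<in> keys U \<Longrightarrow> hi m K = K \<and> vars_below (Suc m) K" and m: "m < M"
    and q: "coprime p q" "q > 0" "\<beta> m = of_int p / of_int q"
    and van: "\<And>l. l < n \<Longrightarrow> ev M \<beta> (hasse M (single m l) U) = 0"
  shows "of_int q ^ n \<le> l1 U"
proof -
  let ?h = "\<lambda>x::real. [:x:]"
  have h: "comm_ring_hom ?h" by unfold_locales (auto simp: one_pCons)
  \<comment> \<open>\<open>[:\<beta> v:] + b v\<close> is the indeterminate for \<open>v = m\<close>
    and a constant otherwise, so \<open>u\<close> is \<open>U\<close> read as a polynomial in its
    only variable. In the Taylor expansion only powers of \<open>X - \<beta> m\<close>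
    survive.\<close>
  define b where "b v = (if v = m then [:- \<beta> m, 1:] else 0)" for v
  define u where "u = ins M ?h (\<lambda>v. [:\<beta> v:] + b v) U"
  have single: "K = single m (lookup K m)" if "K \<in> keys U" for K using hi_single U(3)[OF that] by blast
  have u_eq: "u = (\<Sum>K\<in>keys U. monom (lookup U K) (lookup K m))"
    unfolding u_def ins_def
  proof (intro sum.cong refl)
    fix K assume K: "K \<in> keys U"
    have "meval M (\<lambda>v. [:\<beta> v:] + b v) K = (\<Prod>v<M. if v = m then [:0, 1:] ^ lookup K m else 1)"
      unfolding meval_def
    proof (intro prod.cong refl)
      fix v show "([:\<beta> v:] + b v) ^ lookup K v = (if v = m then [:0, 1:] ^ lookup K m else 1)"
        by (subst single[OF K]) (auto simp: b_def lookup_single)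
    qed
    also have "\<dots> = [:0, 1:] ^ lookup K m" using m by (simp add: prod.delta)
    also have "\<dots> = monom 1 (lookup K m)" by (simp add: monom_altdef)
    finally show "[:lookup U K:] * meval M (\<lambda>v. [:\<beta> v:] + b v) K = monom (lookup U K) (lookup K m)"
      by (simp add: smult_monom)
  qed
  have cu: "coeff u i = lookup U (single m i)" for i
  proof -
    have "coeff u i = (\<Sum>K\<in>keys U. if K = single m i then lookup U (single m i) else 0)"
      unfolding u_eq coeff_sum
    proof (intro sum.cong refl)
      fix K assume K: "K \<in> keys U"
      show "coeff (monom (lookup U K) (lookup K m)) i = (if K = single m i then lookup U (single m i) else 0)"
        using single[OF K] by (auto simp: lookup_single)
    qed
    then show ?thesis by (simp add: sum.delta in_keys_iff)
  qed
  have "u \<noteq> 0"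
  proof
    assume "u = 0"
    obtain K where "K \<in> keys U" using U(1) by (metis keys_eq_empty ex_in_conv)
    then have "coeff u (lookup K m) \<noteq> 0" using single[of K] by (simp add: cu in_keys_iff)
    with \<open>u = 0\<close> show False by simp
  qed
  have "[:- \<beta> m, 1:] ^ n dvd u"
  proof -
    define r where "r v = (\<Sum>J\<in>keys U. lookup J v)" for v
    have le: "lookup J v \<le> r v" if "J \<in> keys U" for J v
      unfolding r_def by (rule member_le_sum[OF that]) auto
    have hc: "ins M ?h (\<lambda>v. [:\<beta> v:]) w = [:ev M \<beta> w:]" for w
    proof -
      interpret h: comm_ring_hom ?h by (rule h)
      have "meval M (\<lambda>v. [:\<beta> v:]) K = [:meval M \<beta> K:]" for K
        unfolding meval_def by (simp add: h.hom_prod h.hom_power)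
      then show ?thesis unfolding ins_def by (simp only: h.hom_sum h.hom_mult)
    qed
    have "u = (\<Sum>I\<in>ebox M r. [:ev M \<beta> (hasse M I U):] * meval M b I)"
      unfolding u_def by (subst mpol_taylor[OF h, of U M r]) (auto simp: le hc)
    also have "[:- \<beta> m, 1:] ^ n dvd \<dots>"
    proof (rule dvd_sum)
      fix I assume I: "I \<in> ebox M r"
      show "[:- \<beta> m, 1:] ^ n dvd [:ev M \<beta> (hasse M I U):] * meval M b I"
      proof (cases "\<exists>v<M. v \<noteq> m \<and> lookup I v \<noteq> 0")
        case True
        then have "meval M b I = 0" unfolding meval_def b_def by (auto intro!: prod_zero)
        then show ?thesis by simp
      next
        case False
        then have Is: "I = single m (lookup I m)" using I
          by (intro poly_mapping_eqI) (auto simp: ebox_def vars_below_def lookup_single when_def not_less)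
        show ?thesis
        proof (cases "lookup I m < n")
          case True
          then have "ev M \<beta> (hasse M I U) = 0" by (subst Is) (rule van)
          then show ?thesis by simp
        next
          case False
          have "meval M b I = [:- \<beta> m, 1:] ^ lookup I m * (\<Prod>v\<in>{..<M} - {m}. b v ^ lookup I v)"
            unfolding meval_def using m by (subst prod.remove[of _ m]) (auto simp: b_def)
          then have "[:- \<beta> m, 1:] ^ n dvd meval M b I"
            using False by (simp add: dvd_mult2 le_imp_power_dvd not_less)
          then show ?thesis by (rule dvd_mult)
        qed
      qed
    qed
    finally show ?thesis .
  qed
  then have "of_int q ^ n \<le> \<bar>lead_coeff u\<bar>"
    using U(2) q \<open>u \<noteq> 0\<close> by (intro int_poly_order_bound[of u p q]) (auto simp: cu int_coeffs_def)
  also have "\<dots> = \<bar>lookup U (single m (degree u))\<bar>" by (simp add: cu)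
  also have "\<dots> \<le> l1 U"
  proof (cases "single m (degree u) \<in> keys U")
    case True then show ?thesis unfolding l1_def by (intro member_le_sum) auto
  qed (simp add: in_keys_iff l1_nonneg)
  finally show ?thesis .
qed

subsection \<open>Roth's lemma\<close>

text \<open>The weight behind Roth's index: the index of \<open>P\<close> at a point is the least
  weight of a derivative that does not vanish there.\<close>

definition wt :: "nat \<Rightarrow> (nat \<Rightarrow> nat) \<Rightarrow> expo \<Rightarrow> real" where
  "wt m r I = (\<Sum>h<m. real (lookup I h) / real (r h))"

lemma wt_add: "wt m r (I + J) = wt m r I + wt m r J"
  by (simp add: wt_def lookup_add add_divide_distrib sum.distrib)

lemma wt_nonneg: "wt m r I \<ge> 0" by (simp add: wt_def sum_nonneg)

text \<open>\<open>R\<close> is the common scale: each \<open>q h ^ r h\<close> is at least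
  \<open>exp R\<close>, while the total degree and the logarithm of the height are at most
  \<open>\<omega> * R\<close>. The conditions on the degrees are homogeneous in \<open>r\<close> and
  \<open>R\<close>, so the induction can pass to \<open>k * r\<close> and
  \<open>k * R\<close>.\<close>

definition roth_hyp :: "nat \<Rightarrow> real \<Rightarrow> (nat \<Rightarrow> nat) \<Rightarrow> (nat \<Rightarrow> int) \<Rightarrow> (nat \<Rightarrow> int) \<Rightarrow> real \<Rightarrow> mpol \<Rightarrow> bool" where
  "roth_hyp m \<omega> r p q R P \<longleftrightarrow> R > 0 \<and>
     (\<forall>h<m. r h > 0 \<and> q h > 1 \<and> coprime (p h) (q h) \<and> R \<le> real (r h) * ln (of_int (q h))) \<and>
     (\<forall>h. Suc h < m \<longrightarrow> real (r (Suc h)) \<le> \<omega> * real (r h)) \<and>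
     real (\<Sum>h<m. r h) \<le> \<omega> * R \<and> P \<noteq> 0 \<and> int_coeffs P \<and>
     (\<forall>J\<in>keys P. vars_below m J \<and> (\<forall>h<m. lookup J h \<le> r h)) \<and> l1 P \<le> exp (\<omega> * R)"

text \<open>More than \<open>k * e / 4\<close> of the terms are at least \<open>e / 2\<close>, since
  \<open>k \<le> 2 * n\<close>. This is where Roth's lemma passes from \<open>e\<close> to a
  multiple of \<open>e\<^sup>2\<close>.\<close>

lemma sum_truncated_lower_bound:
  fixes e :: real
  assumes k: "0 < k" "k \<le> n + 1" and n: "0 < n" and e: "0 < e" "e \<le> 1"
  shows "real k * e\<^sup>2 / 8 \<le> (\<Sum>j<k. max 0 (e - real j / real n))"
proof -
  define n0 where "n0 = nat \<lfloor>real k * e / 4\<rfloor>"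
  have n0: "real n0 \<le> real k * e / 4" "real k * e / 4 < real n0 + 1" 
  proof -
    have "real n0 = of_int \<lfloor>real k * e / 4\<rfloor>" using e by (simp add: n0_def)
    then show "real n0 \<le> real k * e / 4" "real k * e / 4 < real n0 + 1" by linarith+
  qed
  have "real n0 \<le> real k / 4" using n0(1) e mult_left_mono[of e 1 "real k"] by simp
  then have nk: "n0 < k" using k by linarith
  have kn: "real k \<le> 2 * real n" using k n by linarith
  have "real k * e\<^sup>2 / 8 = (real k * e / 4) * (e / 2)" by (simp add: power2_eq_square)
  also have "\<dots> \<le> (real n0 + 1) * (e / 2)" using n0 e by (intro mult_right_mono) auto
  also have "\<dots> = (\<Sum>j<Suc n0. e / 2)" by simp
  also have "\<dots> \<le> (\<Sum>j<Suc n0. max 0 (e - real j / real n))"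
  proof (intro sum_mono)
    fix j assume "j \<in> {..<Suc n0}"
    then have "real j \<le> real k * e / 4" using n0(1) by auto
    also have "\<dots> \<le> (2 * real n) * e / 4" using kn e by (intro divide_right_mono mult_right_mono) auto
    finally have "real j / real n \<le> e / 2" using n by (simp add: field_simps)
    then show "e / 2 \<le> max 0 (e - real j / real n)" by linarith
  qed
  also have "\<dots> \<le> (\<Sum>j<k. max 0 (e - real j / real n))" using nk by (intro sum_mono2) auto
  finally show ?thesis .
qed

lemma keys_shift_iff: "I \<in> keys (shift M \<beta> p) \<longleftrightarrow> vars_below M I \<and> ev M \<beta> (hasse M I p) \<noteq> 0"
  using keys_shift_vars[of I M \<beta> p] lookup_shift[of M I \<beta> p] by (auto simp: in_keys_iff)

text \<open>A derivative lowers the order of vanishing by at most its own weight. The maximum with 0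
  is available because weights are nonnegative; it keeps the columns with high derivatives from
  contributing negatively to the order of a determinant.\<close>

lemma keys_ge_shift_hasse:
  assumes "keys_ge (wt m r) t (shift M \<beta> P)" "vars_below M A"
  shows "keys_ge (wt m r) (max 0 (t - wt m r A)) (shift M \<beta> (hasse M A P))"
  unfolding keys_ge_def
proof
  fix K assume "K \<in> keys (shift M \<beta> (hasse M A P))"
  then have K: "vars_below M K" "ev M \<beta> (hasse M K (hasse M A P)) \<noteq> 0" by (auto simp: keys_shift_iff)
  then have "ev M \<beta> (hasse M (K + A) P) \<noteq> 0"
    unfolding hasse_hasse[OF assms(2) K(1)] ins_mult[OF id_hom] by auto
  then have "K + A \<in> keys (shift M \<beta> P)" using K assms(2) by (simp add: keys_shift_iff vars_below_add)
  then have "t \<le> wt m r (K + A)" using assms(1) by (auto simp: keys_ge_def)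
  then show "max 0 (t - wt m r A) \<le> wt m r K" using wt_nonneg[of m r K] by (simp add: wt_add)
qed

text \<open>Absence of a variable is the lower bound 0 on the negative of its exponent, so
  \<open>keys_ge_ldet\<close> applies.\<close>

lemma lo_poly_ldet:
  assumes "\<And>i j. i < k \<Longrightarrow> j < k \<Longrightarrow> lo_poly m (A i j)"
  shows "lo_poly m (ldet k A)"
proof -
  have "keys_ge (\<lambda>K. - real (lookup K v)) (\<Sum>j<k. 0) (ldet k A)" if "v \<ge> m" for v
    using assms that by (intro keys_ge_ldet) (auto simp: keys_ge_def lo_poly_def lo_id_iff vars_below_def lookup_add)
  then show ?thesis by (auto simp: keys_ge_def lo_poly_def lo_id_iff vars_below_def)
qed

lemma hi_poly_ldet:
  assumes "\<And>i j. i < k \<Longrightarrow> j < k \<Longrightarrow> hi_poly m (A i j)"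
  shows "hi_poly m (ldet k A)"
proof -
  have "keys_ge (\<lambda>K. - real (lookup K v)) (\<Sum>j<k. 0) (ldet k A)" if "v < m" for v
    using assms that by (intro keys_ge_ldet) (auto simp: keys_ge_def hi_poly_def hi_id_iff lookup_add)
  then show ?thesis by (auto simp: keys_ge_def hi_poly_def hi_id_iff)
qed

lemma l1_ge_1:
  assumes "int_coeffs p" "J \<in> keys p" shows "1 \<le> \<bar>lookup p J\<bar>"
proof -
  obtain z where "lookup p J = of_int z" using assms(1) by (auto simp: int_coeffs_def elim: Ints_cases)
  then show ?thesis using assms(2) by (auto simp: in_keys_iff)
qed

lemma mbinom_imp_vars:
  assumes "mbinom M J I \<noteq> 0" "vars_below M I" "lookup J v = 0" shows "lookup I v = 0"
  using assms by (cases "v < M") (auto simp: mbinom_eq_0_iff vars_below_def)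

text \<open>The inductive step: factor a determinant of derivatives of \<open>P\<close> as \<open>V * U\<close> with \<open>V\<close> in the first
  \<open>m\<close> variables and \<open>U\<close> in the last one; its order at the point is large, that of \<open>V\<close> and \<open>U\<close> small.\<close>

lemma roth_lemma_factor:
  assumes mM: "Suc m \<le> M" and hyp: "roth_hyp (Suc m) \<omega> r p q R P"
    and \<omega>: "0 < \<omega>" "\<omega> \<le> e / 2" and e: "0 < e" "e \<le> 1"
    and ord: "keys_ge (wt (Suc m) r) e (shift M \<beta> P)"
  obtains k U V where "k > 0" "lo_poly m V" "hi_poly m U" "V \<noteq> 0" "U \<noteq> 0" "int_coeffs V" "int_coeffs U"
    "\<And>J h. J \<in> keys V \<Longrightarrow> h < m \<Longrightarrow> lookup J h \<le> k * r h" "\<And>J. J \<in> keys U \<Longrightarrow> vars_below (Suc m) J"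
    "l1 V \<le> exp (3 * \<omega> * (k * R))" "l1 U \<le> exp (3 * \<omega> * (k * R))"
    "keys_ge (wt (Suc m) r) (k * e\<^sup>2 / 32) (shift M \<beta> (V * U))"
proof -
  have R0: "R > 0" and r0: "\<And>h. h < Suc m \<Longrightarrow> r h > 0"
    and rat: "\<And>h. Suc h < Suc m \<Longrightarrow> real (r (Suc h)) \<le> \<omega> * real (r h)"
    and sumr: "real (\<Sum>h<Suc m. r h) \<le> \<omega> * R" and P0: "P \<noteq> 0" and intP: "int_coeffs P"
    and Pk: "\<And>J. J \<in> keys P \<Longrightarrow> vars_below (Suc m) J" "\<And>J h. J \<in> keys P \<Longrightarrow> h < Suc m \<Longrightarrow> lookup J h \<le> r h"
    and l1P: "l1 P \<le> exp (\<omega> * R)"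
    using hyp by (auto simp: roth_hyp_def)
  define S where "S = hi m ` keys P"
  have S: "finite S" "\<forall>K\<in>keys P. hi m K \<in> S" by (auto simp: S_def)
  have S_single: "L = single m (lookup L m) \<and> lookup L m \<le> r m \<and> vars_below (Suc m) L" if "L \<in> S" for L
  proof -
    obtain K where K: "K \<in> keys P" "L = hi m K" using \<open>L \<in> S\<close> by (auto simp: S_def)
    have "vars_below (Suc m) L" using Pk(1)[OF K(1)] by (auto simp: K vars_below_def lookup_hi)
    then show ?thesis using hi_single[of m L] Pk(2)[OF K(1), of m] by (auto simp: K lookup_hi)
  qed
  \<comment> \<open>The high part of an exponent of \<open>P\<close> is a power of the last variable
    alone, so there are at most \<open>r m + 1\<close> columns and hence at most that many
    pieces.\<close>
  have "card S \<le> card ((\<lambda>l. single m l) ` {..r m})"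
    using S_single by (intro card_mono) (auto simp: image_iff)
  also have "\<dots> \<le> r m + 1" using card_image_le[of "{..r m}" "\<lambda>l. single m l"] by simp
  finally have cardS: "card S \<le> r m + 1" .
  obtain xs where xs: "length xs \<le> card S" "P = (\<Sum>(\<phi>, \<psi>, J, L)\<leftarrow>xs. \<phi> * \<psi>)"
      "distinct (map (\<lambda>(\<phi>, \<psi>, J, L). J) xs)" "distinct (map (\<lambda>(\<phi>, \<psi>, J, L). L) xs)"
      "\<forall>x\<in>set xs. echelon m P S x"
    using echelon_decomposition[OF S] by blast
  define k where "k = length xs"
  have k: "k \<le> r m + 1" using xs(1) cardS by (simp add: k_def)
  have k0: "k > 0" using xs(2) P0 by (auto simp: k_def)
  define \<phi> where "\<phi> j = fst (xs ! j)" for j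
  define \<psi> where "\<psi> j = fst (snd (xs ! j))" for j
  define J where "J j = fst (snd (snd (xs ! j)))" for j
  define L where "L j = snd (snd (snd (xs ! j)))" for j
  have xsj: "xs ! j = (\<phi> j, \<psi> j, J j, L j)" for j by (simp add: \<phi>_def \<psi>_def J_def L_def)
  have ech: "echelon m P S (\<phi> j, \<psi> j, J j, L j)" if "j < k" for j
    using xs(5) that unfolding xsj[symmetric] k_def by auto
  have P_eq: "P = (\<Sum>l<k. \<phi> l * \<psi> l)"
    unfolding xs(2) sum_list_sum_nth by (simp add: xsj k_def lessThan_atLeast0)
  have injJ: "inj_on J {..<k}"
    using xs(3) by (auto simp: inj_on_def distinct_conv_nth k_def xsj)
  have injL: "inj_on L {..<k}"
    using xs(4) by (auto simp: inj_on_def distinct_conv_nth k_def xsj)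
  have vJ: "vars_below m (J j)" if "j < k" for j
    using ech[OF that] by (auto simp: echelon_def lo_id_iff[symmetric])
  have vL: "L j \<in> S" if "j < k" for j
    using ech[OF that] by (auto simp: echelon_def)
  have lo\<phi>: "lo_poly m (\<phi> j)" and hi\<psi>: "hi_poly m (\<psi> j)" if "j < k" for j
    using ech[OF that] by (auto simp: echelon_def)
  have vLM: "vars_below M (L j)" if "j < k" for j
    using S_single[OF vL[OF that]] mM vars_below_mono by blast
  obtain I where I: "\<And>i. i < k \<Longrightarrow> vars_below M (I i)" "\<And>i. i < k \<Longrightarrow> tdeg M (I i) \<le> i"
      "\<And>i. i < k \<Longrightarrow> \<exists>j<k. mbinom M (J j) (I i) \<noteq> 0" "ldet k (\<lambda>i j. hasse M (I i) (\<phi> j)) \<noteq> 0"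
  proof -
    have "\<exists>I. (\<forall>i<k. vars_below M (I i) \<and> tdeg M (I i) \<le> i \<and> (\<exists>j<k. mbinom M (J j) (I i) \<noteq> 0)) \<and> ldet k (\<lambda>i j. hasse M (I i) (\<phi> j)) \<noteq> 0"
      by (rule hasse_det_nonzero[OF injJ]) (use vars_below_mono[OF vJ] mM ech in \<open>auto simp: echelon_def\<close>)
    then show ?thesis using that by blast
  qed
  obtain B where B: "\<And>i. i < k \<Longrightarrow> vars_below M (B i)" "\<And>i. i < k \<Longrightarrow> tdeg M (B i) \<le> i"
      "\<And>i. i < k \<Longrightarrow> \<exists>j<k. mbinom M (L j) (B i) \<noteq> 0" "ldet k (\<lambda>i j. hasse M (B i) (\<psi> j)) \<noteq> 0"
  proof -
    have "\<exists>I. (\<forall>i<k. vars_below M (I i) \<and> tdeg M (I i) \<le> i \<and> (\<exists>j<k. mbinom M (L j) (I i) \<noteq> 0)) \<and> ldet k (\<lambda>i j. hasse M (I i) (\<psi> j)) \<noteq> 0"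
      by (rule hasse_det_nonzero[OF injL]) (use vLM ech in \<open>auto simp: echelon_def\<close>)
    then show ?thesis using that by blast
  qed
  have vI: "vars_below m (I i)" if i: "i < k" for i
  proof -
    obtain j where j: "j < k" "mbinom M (J j) (I i) \<noteq> 0" using I(3)[OF i] by blast
    show ?thesis using mbinom_imp_vars[OF j(2) I(1)[OF i]] vJ[OF j(1)] by (auto simp: vars_below_def)
  qed
  have vB: "hi m (B i) = B i \<and> vars_below (Suc m) (B i)" if i: "i < k" for i
  proof -
    obtain j where j: "j < k" "mbinom M (L j) (B i) \<noteq> 0" using B(3)[OF i] by blast
    have Lj: "lookup (L j) v = 0" if "v \<noteq> m" for v
      using S_single[OF vL[OF j(1)]] that by (metis lookup_single_not_eq)
    show ?thesis using mbinom_imp_vars[OF j(2) B(1)[OF i]] Lj by (auto simp: vars_below_def hi_id_iff)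
  qed
  define V where "V = ldet k (\<lambda>i j. hasse M (I i) (\<phi> j))"
  define U where "U = ldet k (\<lambda>i j. hasse M (B i) (\<psi> j))"
  define W where "W = ldet k (\<lambda>i j. hasse M (I i + B j) P)"
  have vIB: "vars_below M (I i + B j)" if "i < k" "j < k" for i j
    using I(1) B(1) that by (simp add: vars_below_add)
  \<comment> \<open>Each piece of \<open>P\<close> separates the variables, so an entry of
    \<open>W\<close> is the scalar product of a row of the matrix of \<open>V\<close> and a row of
    the matrix of \<open>U\<close>: the matrix of \<open>W\<close> is a product with a
    transpose.\<close>
  have W_eq: "W = V * U"
  proof -
    have "W = ldet k (\<lambda>i j. \<Sum>l<k. hasse M (I i) (\<phi> l) * hasse M (B j) (\<psi> l))"
      unfolding W_def ldet_eq
    proof (intro sum.cong refl arg_cong2[where f = "(*)"] prod.cong)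
      fix \<sigma> i assume "\<sigma> \<in> {p. p permutes {0..<k}}" and i: "i \<in> {0..<k}"
      then have s: "\<sigma> i < k" using permutes_in_image[of \<sigma> "{0..<k}" i] by auto
      have "hasse M (I i + B (\<sigma> i)) P = (\<Sum>l<k. hasse M (I i + B (\<sigma> i)) (\<phi> l * \<psi> l))"
        unfolding P_eq by (rule hasse_sum) (use vIB i s in auto)
      also have "\<dots> = (\<Sum>l<k. hasse M (I i) (\<phi> l) * hasse M (B (\<sigma> i)) (\<psi> l))"
        using i s lo\<phi> hi\<psi> vI vB I(1) B(1) by (intro sum.cong refl hasse_mult_sep) (auto simp: lo_id_iff)
      finally show "hasse M (I i + B (\<sigma> i)) P = (\<Sum>l<k. hasse M (I i) (\<phi> l) * hasse M (B (\<sigma> i)) (\<psi> l))" .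
    qed
    then show ?thesis unfolding ldet_mult_transpose V_def U_def .
  qed
  have loV: "lo_poly m V" unfolding V_def using lo\<phi> I(1) by (intro lo_poly_ldet lo_poly_hasse) auto
  have hiU: "hi_poly m U" unfolding U_def using hi\<psi> B(1) by (intro hi_poly_ldet hi_poly_hasse) auto
  have V0: "V \<noteq> 0" and U0: "U \<noteq> 0" using I(4) B(4) by (auto simp: V_def U_def)
  have intW: "int_coeffs W" unfolding W_def using vIB intP by (intro int_coeffs_ldet int_coeffs_hasse) auto
  have degW: "keys_ge (\<lambda>K. - real (lookup K h)) (\<Sum>j<k. - real (r h)) W" if "h < Suc m" for h
    unfolding W_def
  proof (intro keys_ge_ldet)
    fix i j assume ij: "i < k" "j < k"
    show "keys_ge (\<lambda>K. - real (lookup K h)) (- real (r h)) (hasse M (I i + B j) P)"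
      unfolding keys_ge_def
    proof
      fix K assume "K \<in> keys (hasse M (I i + B j) P)"
      then have "K + (I i + B j) \<in> keys P" using vIB[OF ij] by (simp add: in_keys_iff lookup_hasse)
      from Pk(2)[OF this that] show "- real (r h) \<le> - real (lookup K h)" by (simp add: lookup_add)
    qed
  qed (simp add: lookup_add)
  have degW2: "keys_ge (\<lambda>K. - real (lookup K h)) (\<Sum>j<k. 0) W" if "h \<ge> Suc m" for h
    unfolding W_def
  proof (intro keys_ge_ldet)
    fix i j assume ij: "i < k" "j < k"
    show "keys_ge (\<lambda>K. - real (lookup K h)) 0 (hasse M (I i + B j) P)"
      unfolding keys_ge_def
    proof
      fix K assume "K \<in> keys (hasse M (I i + B j) P)"
      then have "K + (I i + B j) \<in> keys P" using vIB[OF ij] by (simp add: in_keys_iff lookup_hasse)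
      from Pk(1)[OF this] show "0 \<le> - real (lookup K h)" using that by (simp add: vars_below_def lookup_add)
    qed
  qed (simp add: lookup_add)
  define S0 where "S0 = (\<Sum>h<Suc m. r h)"
  have l1W: "l1 W \<le> exp (3 * \<omega> * (k * R))"
  proof -
    have "(\<Sum>v<M. lookup K v) \<le> S0" if K: "K \<in> keys P" for K
    proof -
      have "(\<Sum>v<M. lookup K v) = (\<Sum>v<Suc m. lookup K v)"
        using Pk(1)[OF K] mM by (intro sum.mono_neutral_right) (auto simp: vars_below_def)
      also have "\<dots> \<le> S0" unfolding S0_def using Pk(2)[OF K] by (intro sum_mono) auto
      finally show ?thesis .
    qed
    then have "l1 (hasse M A P) \<le> 2 ^ S0 * exp (\<omega> * R)" for A
      by (rule order_trans[OF l1_hasse]) (use l1P in auto)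
    then have "l1 W \<le> fact k * (2 ^ S0 * exp (\<omega> * R)) ^ k"
      unfolding W_def by (intro l1_ldet) auto
    \<comment> \<open>The factorial is absorbed because
      \<open>k \<le> r m + 1 \<le> 2 ^ r m\<close>.\<close>
    also have "\<dots> \<le> (2 ^ S0) ^ k * (2 ^ S0 * exp (\<omega> * R)) ^ k"
    proof (intro mult_right_mono)
      have "r m < 2 ^ r m" by simp
      moreover have "(2::nat) ^ r m \<le> 2 ^ S0" unfolding S0_def by (intro power_increasing) auto
      ultimately have "k \<le> 2 ^ S0" using k by linarith
      have "fact k \<le> real k ^ k" using fact_le_power[of k, where 'a = real] by simp
      also have "\<dots> \<le> (2 ^ S0) ^ k"
        using \<open>k \<le> 2 ^ S0\<close> by (intro power_mono) (metis of_nat_le_iff of_nat_numeral of_nat_power, simp)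
      finally show "fact k \<le> (2 ^ S0 :: real) ^ k" .
    qed auto
    also have "\<dots> = (4 ^ S0 * exp (\<omega> * R)) ^ k"
      by (simp add: power_mult_distrib[symmetric] mult.assoc[symmetric])
    also have "\<dots> \<le> (exp (2 * (\<omega> * R)) * exp (\<omega> * R)) ^ k"
    proof (intro power_mono mult_right_mono)
      have "(4::real) \<le> exp 2"
      proof -
        have "(2::real) \<le> exp 1" using exp_ge_add_one_self[of 1] by simp
        then have "2 * 2 \<le> exp 1 * exp (1::real)" by (intro mult_mono) auto
        then show ?thesis by (simp flip: exp_add)
      qed
      then have "4 ^ S0 \<le> exp (2::real) ^ S0" by (intro power_mono) auto
      also have "\<dots> = exp (2 * real S0)" by (simp add: exp_of_nat_mult[symmetric] mult.commute)
      also have "\<dots> \<le> exp (2 * (\<omega> * R))" using sumr by (simp add: S0_def)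
      finally show "(4::real) ^ S0 \<le> exp (2 * (\<omega> * R))" .
    qed auto
    also have "\<dots> = exp (3 * \<omega> * (k * R))"
      by (simp add: exp_add[symmetric] exp_of_nat_mult[symmetric] algebra_simps)
    finally show ?thesis .
  qed
  have decr: "r (Suc h) \<le> r h" if "Suc h < Suc m" for h
  proof -
    have "real (r (Suc h)) \<le> \<omega> * real (r h)" using rat that by blast
    also have "\<dots> \<le> 1 * real (r h)" using \<omega> e by (intro mult_right_mono) auto
    finally show ?thesis by simp
  qed
  \<comment> \<open>One derivative in a variable \<open>h < m\<close> costs \<open>1 / r h\<close>,
    which is at most \<omega> times \<open>1 / r m\<close>. The at most \<open>r m\<close>
    derivatives in \<open>I i\<close> therefore cost at most \<omega> together.\<close>
  have rm: "real (r m) \<le> \<omega> * real (r h)" if h: "h < m" for h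
  proof -
    obtain m' where m': "m = Suc m'" using h by (cases m) auto
    have "r m' \<le> r h" if "h \<le> m'" for h
      using that
    proof (induction "m' - h" arbitrary: h)
      case (Suc n)
      then have "r m' \<le> r (Suc h)" by simp
      also have "\<dots> \<le> r h" using Suc.hyps(2) by (intro decr) (auto simp: m')
      finally show ?case .
    qed auto
    then have "r m' \<le> r h" using h m' by simp
    have "real (r m) \<le> \<omega> * real (r m')" using rat[of m'] by (simp add: m')
    also have "\<dots> \<le> \<omega> * real (r h)" using \<omega> \<open>r m' \<le> r h\<close> by (intro mult_left_mono) auto
    finally show ?thesis .
  qed
  have ordW: "keys_ge (wt (Suc m) r) (\<Sum>j<k. max 0 ((e - \<omega>) - real j / real (r m))) (shift M \<beta> W)"
    unfolding W_def ldet_hom[OF shift_hom]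
  proof (intro keys_ge_ldet)
    fix i j assume ij: "i < k" "j < k"
    have "wt (Suc m) r (I i) \<le> \<omega>"
    proof -
      have "wt (Suc m) r (I i) = (\<Sum>h<m. real (lookup (I i) h) / real (r h))"
        using vI[OF ij(1)] by (simp add: wt_def vars_below_def)
      also have "\<dots> \<le> (\<Sum>h<m. real (lookup (I i) h) * (\<omega> / real (r m)))"
      proof (intro sum_mono)
        fix h assume h: "h \<in> {..<m}"
        then have "1 / real (r h) \<le> \<omega> / real (r m)" using rm[of h] r0[of h] r0[of m] by (simp add: field_simps)
        then have "real (lookup (I i) h) * (1 / real (r h)) \<le> real (lookup (I i) h) * (\<omega> / real (r m))"
          by (rule mult_left_mono) simp
        then show "real (lookup (I i) h) / real (r h) \<le> real (lookup (I i) h) * (\<omega> / real (r m))" by simp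
      qed
      also have "\<dots> = real (\<Sum>h<m. lookup (I i) h) * (\<omega> / real (r m))" by (simp only: sum_distrib_right of_nat_sum)
      also have "\<dots> \<le> real (r m) * (\<omega> / real (r m))"
      proof (intro mult_right_mono)
        have "(\<Sum>h<m. lookup (I i) h) \<le> tdeg M (I i)" unfolding tdeg_def using mM by (intro sum_mono2) auto
        also have "\<dots> \<le> i" using I(2) ij by simp
        finally show "real (\<Sum>h<m. lookup (I i) h) \<le> real (r m)" using ij(1) k by linarith
      qed (use \<omega> in auto)
      finally show ?thesis using r0[of m] by simp
    qed
    moreover have "wt (Suc m) r (B j) \<le> real j / real (r m)"
    proof -
      have "wt (Suc m) r (B j) = real (lookup (B j) m) / real (r m)"
        using vB[OF ij(2)] by (simp add: wt_def hi_id_iff)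
      also have "lookup (B j) m \<le> tdeg M (B j)" unfolding tdeg_def using mM by (intro member_le_sum) auto
      then have "lookup (B j) m \<le> j" using B(2)[OF ij(2)] by linarith
      then have "real (lookup (B j) m) / real (r m) \<le> real j / real (r m)" by (intro divide_right_mono) auto
      finally show ?thesis .
    qed
    ultimately have le: "max 0 ((e - \<omega>) - real j / real (r m)) \<le> max 0 (e - wt (Suc m) r (I i + B j))"
      by (simp add: wt_add)
    show "keys_ge (wt (Suc m) r) (max 0 ((e - \<omega>) - real j / real (r m))) (shift M \<beta> (hasse M (I i + B j) P))"
      using keys_ge_shift_hasse[OF ord vIB[OF ij]] le unfolding keys_ge_def by (meson order_trans)
  qed (simp add: wt_add)
  \<comment> \<open>At least half of \<open>e\<close> survives the subtraction of \<omega>; 32 is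
    the 8 of the truncated sum times the 4 from squaring the half.\<close>
  have "real k * e\<^sup>2 / 32 = real k * (e / 2)\<^sup>2 / 8" by (simp add: power2_eq_square)
  also have "\<dots> \<le> real k * (e - \<omega>)\<^sup>2 / 8"
    using \<omega> e by (intro divide_right_mono mult_left_mono power_mono) auto
  also have "\<dots> \<le> (\<Sum>j<k. max 0 ((e - \<omega>) - real j / real (r m)))"
    using k k0 r0[of m] \<omega> e by (intro sum_truncated_lower_bound) auto
  finally have ordW': "keys_ge (wt (Suc m) r) (k * e\<^sup>2 / 32) (shift M \<beta> W)"
    using ordW unfolding keys_ge_def by (meson order_trans)
  \<comment> \<open>Only the product \<open>W\<close> is known to be integral, since the pieces come
    from divisions by pivots. The height bounds need factors whose nonzero coefficients are at least
    1 in absolute value.\<close>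
  obtain c where c: "c \<noteq> 0" "int_coeffs (single 0 (1 / c) * V)" "int_coeffs (single 0 c * U)"
    using int_scaling[OF loV hiU V0 U0] intW by (auto simp: W_eq)
  define V' where "V' = single 0 (1 / c) * V"
  define U' where "U' = single 0 c * U"
  have kV: "keys V' = keys V" and kU: "keys U' = keys U" using c(1) by (auto simp: V'_def U'_def in_keys_iff)
  have W': "V' * U' = W"
  proof -
    have "V' * U' = (single 0 (1 / c) * single 0 c) * (V * U)" by (simp add: V'_def U'_def mult_ac)
    also have "single 0 (1 / c) * single 0 c = (1::mpol)" using c(1) by (simp add: mult_single)
    finally show ?thesis by (simp add: W_eq)
  qed
  have loV': "lo_poly m V'" and hiU': "hi_poly m U'" using loV hiU by (auto simp: lo_poly_def hi_poly_def kV kU)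
  have V0': "V' \<noteq> 0" and U0': "U' \<noteq> 0" using V0 U0 kV kU by (metis keys_eq_empty)+
  obtain J1 where J1: "J1 \<in> keys V'" using V0' by (metis keys_eq_empty ex_in_conv)
  obtain L1 where L1: "L1 \<in> keys U'" using U0' by (metis keys_eq_empty ex_in_conv)
  show ?thesis
  proof (rule that[of k V' U'])
    show "lookup K h \<le> k * r h" if K: "K \<in> keys V'" "h < m" for K h
    proof -
      have "K + L1 \<in> keys W" using keys_sep_add(1)[OF loV' hiU' K(1) L1] by (simp add: W')
      then have "(\<Sum>j<k. - real (r h)) \<le> - real (lookup (K + L1) h)" using degW[of h] K by (auto simp: keys_ge_def)
      then have "real (lookup K h) \<le> real (k * r h)" by (simp add: lookup_add)
      then show ?thesis by linarith
    qed
    show "vars_below (Suc m) K" if K: "K \<in> keys U'" for K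
    proof -
      have "J1 + K \<in> keys W" using keys_sep_add(1)[OF loV' hiU' J1 K] by (simp add: W')
      then have "0 \<le> - real (lookup (J1 + K) h)" if "h \<ge> Suc m" for h using degW2[OF that] by (auto simp: keys_ge_def)
      then have "lookup K h = 0" if "h \<ge> Suc m" for h using that by (fastforce simp: lookup_add)
      then show ?thesis by (simp add: vars_below_def)
    qed
    have "l1 V' * 1 \<le> l1 V' * \<bar>lookup U' L1\<bar>" using l1_ge_1[OF _ L1] c(3) by (intro mult_left_mono) (auto simp: U'_def l1_nonneg)
    then show "l1 V' \<le> exp (3 * \<omega> * (k * R))" using l1_sep_left[OF loV' hiU' L1] l1W by (simp add: W')
    have "1 * l1 U' \<le> \<bar>lookup V' J1\<bar> * l1 U'" using l1_ge_1[OF _ J1] c(2) by (intro mult_right_mono) (auto simp: V'_def l1_nonneg)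
    then show "l1 U' \<le> exp (3 * \<omega> * (k * R))" using l1_sep_right[OF loV' hiU' J1] l1W by (simp add: W')
    show "keys_ge (wt (Suc m) r) (k * e\<^sup>2 / 32) (shift M \<beta> (V' * U'))" using ordW' by (simp add: W')
  qed (use k0 loV' hiU' V0' U0' c in \<open>auto simp: V'_def U'_def\<close>)
qed

text \<open>Induction on the number of variables. If all derivatives of weight at most
  \<open>e\<close> vanished, \<open>V * U\<close> would vanish up to weight
  \<open>k * e\<^sup>2 / 32\<close>. But \<open>V\<close> has a nonvanishing derivative of small
  weight by induction, \<open>U\<close> has one by Gauss's lemma in its single variable, and the
  joint derivative of the product is the product of the two.\<close>

theorem roth_lemma:
  assumes "m \<le> M" "\<epsilon> > 0"
  shows "\<exists>\<omega>>0. \<omega> \<le> 1 \<and> (\<forall>r p q R P. roth_hyp m \<omega> r p q R P \<longrightarrow>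
     (\<exists>I. vars_below m I \<and> wt m r I \<le> \<epsilon> \<and> ev M (\<lambda>h. of_int (p h) / of_int (q h)) (hasse M I P) \<noteq> 0))"
  using assms
proof (induction m arbitrary: \<epsilon>)
  case 0
  have "ev M \<beta> (hasse M 0 P) \<noteq> 0" if "roth_hyp 0 1 r p q R P" for r p q R P \<beta>
  proof -
    have P: "P \<noteq> 0" "\<And>J. J \<in> keys P \<Longrightarrow> J = 0"
      using that by (auto simp: roth_hyp_def vars_below_def intro: poly_mapping_eqI)
    then have k: "keys P = {0}" by (metis keys_eq_empty is_singletonI' is_singleton_the_elem singletonD ex_in_conv subset_singletonD subsetI singletonI)
    have "hasse M 0 P = P" by (rule poly_mapping_eqI) (simp add: lookup_hasse)
    then have "ev M \<beta> (hasse M 0 P) = lookup P 0" by (simp add: ins_def k)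
    then show ?thesis using k by (auto simp: in_keys_iff[symmetric])
  qed
  then show ?case using 0 by (intro exI[of _ 1]) (auto intro!: exI[of _ 0] simp: wt_def)
next
  case (Suc m)
  define e where "e = min \<epsilon> 1"
  have e: "0 < e" "e \<le> 1" "e \<le> \<epsilon>" using Suc.prems by (auto simp: e_def)
  \<comment> \<open>The two factors contribute at most \<open>k * \<epsilon>1\<close> each, together
    \<open>k * e\<^sup>2 / 64\<close>, which is half of what is forced.\<close>
  define \<epsilon>1 where "\<epsilon>1 = e\<^sup>2 / 128"
  have \<epsilon>1: "\<epsilon>1 > 0" using e by (simp add: \<epsilon>1_def)
  obtain \<omega>1 where \<omega>1: "\<omega>1 > 0" and IH: "\<And>r p q R P. roth_hyp m \<omega>1 r p q R P \<Longrightarrow>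
     (\<exists>I. vars_below m I \<and> wt m r I \<le> \<epsilon>1 \<and> ev M (\<lambda>h. of_int (p h) / of_int (q h)) (hasse M I P) \<noteq> 0)"
    using Suc.IH[of \<epsilon>1] Suc.prems \<epsilon>1 by auto
  \<comment> \<open>\<open>e / 2\<close> is asked for by the factorisation; the thirds arise because
    the heights of \<open>V\<close> and \<open>U\<close> are bounded by
    \<open>exp (3 * \<omega> * (k * R))\<close>.\<close>
  define \<omega> where "\<omega> = min (e / 2) (min (\<omega>1 / 3) (\<epsilon>1 / 3))"
  have \<omega>: "\<omega> > 0" "\<omega> \<le> e / 2" "3 * \<omega> \<le> \<omega>1" "3 * \<omega> \<le> \<epsilon>1" using e \<omega>1 \<epsilon>1 by (auto simp: \<omega>_def)
  have "\<exists>I. vars_below (Suc m) I \<and> wt (Suc m) r I \<le> \<epsilon> \<and> ev M (\<lambda>h. of_int (p h) / of_int (q h)) (hasse M I P) \<noteq> 0"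
    if hyp: "roth_hyp (Suc m) \<omega> r p q R P" for r p q R P
  proof (rule ccontr)
    define \<beta> where "\<beta> = (\<lambda>h. real_of_int (p h) / of_int (q h))"
    assume "\<not> ?thesis"
    then have van: "ev M \<beta> (hasse M I P) = 0" if "vars_below (Suc m) I" "wt (Suc m) r I \<le> e" for I
      using that e by (auto simp: \<beta>_def)
    have Pk: "\<And>J. J \<in> keys P \<Longrightarrow> vars_below (Suc m) J" using hyp by (auto simp: roth_hyp_def)
    have "keys_ge (wt (Suc m) r) e (shift M \<beta> P)"
      unfolding keys_ge_def
    proof (rule ballI, rule ccontr)
      fix I assume I: "I \<in> keys (shift M \<beta> P)" and n: "\<not> e \<le> wt (Suc m) r I"
      have vM: "vars_below M I" and nz: "ev M \<beta> (hasse M I P) \<noteq> 0" using I by (auto simp: keys_shift_iff)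
      have "vars_below (Suc m) I"
      proof (rule ccontr)
        assume "\<not> vars_below (Suc m) I"
        then obtain v where v: "v \<ge> Suc m" "lookup I v \<noteq> 0" by (auto simp: vars_below_def)
        then have "v < M" using vM by (auto simp: vars_below_def not_less[symmetric])
        then have "hasse M I P = 0" using v Pk by (intro hasse_eq_0[OF vM]) (auto simp: vars_below_def intro!: exI[of _ v])
        then show False using nz by (simp add: ins_def)
      qed
      then show False using van n nz by auto
    qed
    then obtain k U V where kUV: "k > 0" "lo_poly m V" "hi_poly m U" "V \<noteq> 0" "U \<noteq> 0" "int_coeffs V" "int_coeffs U"
      "\<And>J h. J \<in> keys V \<Longrightarrow> h < m \<Longrightarrow> lookup J h \<le> k * r h" "\<And>J. J \<in> keys U \<Longrightarrow> vars_below (Suc m) J"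
      "l1 V \<le> exp (3 * \<omega> * (k * R))" "l1 U \<le> exp (3 * \<omega> * (k * R))"
      "keys_ge (wt (Suc m) r) (k * e\<^sup>2 / 32) (shift M \<beta> (V * U))"
      using roth_lemma_factor[OF Suc.prems(1) hyp \<omega>(1,2) e(1,2)] by metis
    have R0: "R > 0" and rq: "\<And>h. h < Suc m \<Longrightarrow> r h > 0 \<and> q h > 1 \<and> coprime (p h) (q h) \<and> R \<le> real (r h) * ln (of_int (q h))"
      and rat: "\<And>h. Suc h < Suc m \<Longrightarrow> real (r (Suc h)) \<le> \<omega> * real (r h)"
      and sumr: "real (\<Sum>h<Suc m. r h) \<le> \<omega> * R" using hyp by (auto simp: roth_hyp_def)
    \<comment> \<open>The degrees of \<open>V\<close> are bounded by \<open>k * r h\<close>, so the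
      induction hypothesis measures weights with the scaled degrees; they differ from the original
      ones by the factor \<open>k\<close>.\<close>
    have "roth_hyp m \<omega>1 (\<lambda>h. k * r h) p q (k * R) V"
      unfolding roth_hyp_def
    proof (intro conjI allI impI ballI)
      fix h assume h: "Suc h < m"
      have "real (k * r (Suc h)) \<le> k * (\<omega> * real (r h))" using rat[of h] h by (simp add: mult_left_mono)
      also have "\<dots> \<le> \<omega>1 * real (k * r h)" using \<omega> by (simp add: mult_right_mono mult_ac)
      finally show "real (k * r (Suc h)) \<le> \<omega>1 * real (k * r h)" .
    next
      have "real (\<Sum>h<m. k * r h) \<le> k * real (\<Sum>h<Suc m. r h)"
        by (simp add: sum_distrib_left distrib_left)
      also have "\<dots> \<le> k * (\<omega> * R)" using sumr by (intro mult_left_mono) auto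
      also have "\<dots> \<le> \<omega>1 * (k * R)" using \<omega> R0 by (simp add: mult_right_mono mult_ac)
      finally show "real (\<Sum>h<m. k * r h) \<le> \<omega>1 * (k * R)" .
    next
      have "3 * \<omega> * (k * R) \<le> \<omega>1 * (k * R)" using \<omega> R0 by (intro mult_right_mono) auto
      then show "l1 V \<le> exp (\<omega>1 * (k * R))" using kUV(10) by (meson exp_le_cancel_iff order_trans)
    next
      fix J assume "J \<in> keys V" then show "vars_below m J" using kUV(2) by (auto simp: lo_poly_def lo_id_iff)
    next
      fix h assume "h < m"
      then have "R \<le> real (r h) * ln (of_int (q h))" using rq[of h] by simp
      then have "k * R \<le> k * (real (r h) * ln (of_int (q h)))" by (rule mult_left_mono) simp
      then show "k * R \<le> real (k * r h) * ln (of_int (q h))" by (simp add: mult_ac)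
    qed (use kUV R0 rq in auto)
    from IH[OF this] obtain I where I: "vars_below m I" "wt m (\<lambda>h. k * r h) I \<le> \<epsilon>1" "ev M \<beta> (hasse M I V) \<noteq> 0"
      unfolding \<beta>_def by blast
    have mM: "m < M" using Suc.prems by simp
    have q1: "q m > 1" and cop: "coprime (p m) (q m)" and Rm: "R \<le> real (r m) * ln (of_int (q m))" and rm: "r m > 0" using rq[of m] by auto
    have bound: "of_int (q m) ^ n \<le> l1 U" if "\<And>l. l < n \<Longrightarrow> ev M \<beta> (hasse M (single m l) U) = 0" for n
      using kUV(3,9) q1 cop that
      by (intro mpol_order_bound[OF kUV(5,7) _ mM, of "p m"]) (auto simp: hi_poly_def \<beta>_def)
    have "\<exists>l. ev M \<beta> (hasse M (single m l) U) \<noteq> 0"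
    proof (rule ccontr)
      assume "\<not> ?thesis"
      then have b: "of_int (q m) ^ n \<le> l1 U" for n using bound by blast
      obtain n where "l1 U < of_int (q m) ^ n" using q1 by (metis of_int_1_less_iff real_arch_pow)
      with b[of n] show False by simp
    qed
    then obtain n where n: "ev M \<beta> (hasse M (single m n) U) \<noteq> 0" "\<And>l. l < n \<Longrightarrow> ev M \<beta> (hasse M (single m l) U) = 0"
      using exists_least_iff[of "\<lambda>l. ev M \<beta> (hasse M (single m l) U) \<noteq> 0"] by auto
    have lnq: "ln (real_of_int (q m)) > 0" using q1 by simp
    \<comment> \<open>The least nonvanishing order \<open>n\<close> satisfies
      \<open>q m ^ n \<le> l1 U\<close>; comparison with \<open>R \<le> r m * ln (q m)\<close> turns
      the height bound into a bound for the weight \<open>n / r m\<close>.\<close>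
    have "exp (real n * ln (of_int (q m))) = of_int (q m) ^ n" using q1 by (simp add: exp_of_nat_mult)
    also have "\<dots> \<le> exp (3 * \<omega> * (k * R))" using order_trans[OF bound[OF n(2)] kUV(11)] .
    finally have "real n * ln (of_int (q m)) \<le> 3 * \<omega> * (k * R)" by simp
    also have "\<dots> \<le> \<epsilon>1 * (k * (real (r m) * ln (of_int (q m))))"
      using \<omega> Rm R0 \<epsilon>1 by (intro mult_mono mult_left_mono) auto
    finally have "real n * ln (of_int (q m)) \<le> (\<epsilon>1 * k * real (r m)) * ln (of_int (q m))" by (simp add: mult_ac)
    then have nb: "real n / real (r m) \<le> k * \<epsilon>1" using lnq rm by (simp add: field_simps)
    have his: "hi m (single m n) = single m n" by (auto simp: hi_id_iff lookup_single when_def)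
    have vs: "vars_below M (single m n)" "vars_below M I" using mM I(1) by (auto simp: vars_below_def lookup_single when_def)
    have "ev M \<beta> (hasse M (I + single m n) (V * U)) = ev M \<beta> (hasse M I V) * ev M \<beta> (hasse M (single m n) U)"
      using hasse_mult_sep[OF kUV(2,3) _ his vs(2,1)] I(1) by (simp add: lo_id_iff ins_mult[OF id_hom])
    then have "I + single m n \<in> keys (shift M \<beta> (V * U))" using I n vs by (simp add: keys_shift_iff vars_below_add)
    then have "k * e\<^sup>2 / 32 \<le> wt (Suc m) r (I + single m n)" using kUV(12) by (auto simp: keys_ge_def)
    also have "\<dots> = wt m r I + real n / real (r m)"
    proof -
      have "wt (Suc m) r I = wt m r I" using I(1) by (simp add: wt_def vars_below_def)
      moreover have "wt (Suc m) r (single m n) = real n / real (r m)" by (simp add: wt_def lookup_single)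
      ultimately show ?thesis by (simp add: wt_add)
    qed
    also have "wt m r I = k * wt m (\<lambda>h. k * r h) I"
      unfolding wt_def sum_distrib_left using kUV(1) by (intro sum.cong refl) simp
    also have "\<dots> + real n / real (r m) \<le> k * \<epsilon>1 + k * \<epsilon>1" using I(2) nb kUV(1) by (intro add_mono mult_left_mono) auto
    also have "\<dots> = k * (e\<^sup>2 / 64)" by (simp add: \<epsilon>1_def)
    finally have "k * e\<^sup>2 / 32 \<le> k * e\<^sup>2 / 64" by simp
    moreover have "k * e\<^sup>2 > 0" using kUV(1) e by simp
    ultimately show False by simp
  qed
  then show ?case using \<omega> e by (intro exI[of _ \<omega>]) auto
qed

subsection \<open>Siegel's lemma and the auxiliary polynomial\<close>

text \<open>Pigeonhole on vectors with entries in \<open>{0..B}\<close>: each equation takes at most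
  \<open>B * B + 1\<close> values, and \<open>(B * B + 1) ^ card E < (B + 1) ^ N\<close> because
  there are at least twice as many unknowns as equations. The solution is the difference of two
  vectors with equal images.\<close>

lemma siegel:
  fixes a :: "'e \<Rightarrow> 'x \<Rightarrow> int" and A :: int
  assumes fin: "finite X" "finite E" and N: "card X > 0" "2 * card E \<le> card X"
    and A: "A \<ge> 1" "\<And>e j. e \<in> E \<Longrightarrow> j \<in> X \<Longrightarrow> \<bar>a e j\<bar> \<le> A"
  shows "\<exists>x. (\<exists>j\<in>X. x j \<noteq> 0) \<and> (\<forall>j\<in>X. \<bar>x j\<bar> \<le> int (card X) * A) \<and> (\<forall>e\<in>E. (\<Sum>j\<in>X. a e j * x j) = 0)"
proof -
  define N where "N = card X"
  \<comment> \<open>The spread of one equation is at most \<open>N * A * B\<close>; this choice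
    makes it \<open>B * B\<close>, and \<open>B * B + 1\<close> is still below
    \<open>(B + 1)\<^sup>2\<close>.\<close>
  define B where "B = int N * A"
  have B: "B \<ge> 1" using N(1) A(1) by (simp add: B_def N_def) (smt (verit) mult_le_cancel_right1 of_nat_0_less_iff)
  define F where "F x = (\<lambda>e\<in>E. \<Sum>j\<in>X. a e j * x j)" for x
  define D where "D = X \<rightarrow>\<^sub>E {0..B}"
  \<comment> \<open>Positive coefficients push only upwards and negative ones only downwards, so the
    range has length \<open>B\<close> times the sum of the absolute values of the
    coefficients.\<close>
  define lo' where "lo' e = - (\<Sum>j\<in>X. max 0 (- a e j)) * B" for e
  define hi' where "hi' e = (\<Sum>j\<in>X. max 0 (a e j)) * B" for e
  have FD: "F ` D \<subseteq> (\<Pi>\<^sub>E e\<in>E. {lo' e..hi' e})"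
  proof
    fix y assume "y \<in> F ` D"
    then obtain x where x: "x \<in> D" "y = F x" by auto
    have xj: "0 \<le> x j" "x j \<le> B" if "j \<in> X" for j using x(1) that by (auto simp: D_def)
    have "lo' e \<le> (\<Sum>j\<in>X. a e j * x j) \<and> (\<Sum>j\<in>X. a e j * x j) \<le> hi' e" for e
      unfolding lo'_def hi'_def sum_negf[symmetric] sum_distrib_right
    proof (intro conjI sum_mono)
      fix j assume j: "j \<in> X"
      show "- max 0 (- a e j) * B \<le> a e j * x j"
      proof (cases "a e j \<ge> 0")
        case False then show ?thesis using mult_left_mono_neg[OF xj(2)[OF j], of "a e j"] by (simp add: max_def)
      qed (use xj[OF j] in \<open>simp add: max_def\<close>)
      show "a e j * x j \<le> max 0 (a e j) * B"
      proof (cases "a e j \<ge> 0")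
        case True then show ?thesis using mult_left_mono[OF xj(2)[OF j], of "a e j"] by (simp add: max_def)
      next
        case False then show ?thesis using xj[OF j] by (simp add: max_def mult_nonpos_nonneg)
      qed
    qed
    then show "y \<in> (\<Pi>\<^sub>E e\<in>E. {lo' e..hi' e})" by (auto simp: x(2) F_def)
  qed
  have "card (F ` D) \<le> card (\<Pi>\<^sub>E e\<in>E. {lo' e..hi' e})" by (rule card_mono[OF _ FD]) (use fin in \<open>auto intro: finite_PiE\<close>)
  also have "\<dots> = (\<Prod>e\<in>E. card {lo' e..hi' e})" by (rule card_PiE[OF fin(2)])
  also have "\<dots> \<le> (\<Prod>e\<in>E. nat (B * B + 1))"
  proof (intro prod_mono conjI)
    fix e assume e: "e \<in> E"
    have "hi' e - lo' e = (\<Sum>j\<in>X. \<bar>a e j\<bar>) * B"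
    proof -
      have "(\<Sum>j\<in>X. \<bar>a e j\<bar>) = (\<Sum>j\<in>X. max 0 (a e j)) + (\<Sum>j\<in>X. max 0 (- a e j))"
        unfolding sum.distrib[symmetric] by (intro sum.cong) auto
      then show ?thesis by (simp add: lo'_def hi'_def distrib_right)
    qed
    also have "\<dots> \<le> (\<Sum>j\<in>X. A) * B" using A(2)[OF e] B by (intro mult_right_mono sum_mono) auto
    finally have "hi' e - lo' e \<le> B * B" by (simp add: B_def N_def)
    then show "card {lo' e..hi' e} \<le> nat (B * B + 1)" by simp
  qed auto
  also have "\<dots> = nat (B * B + 1) ^ card E" by simp
  also have "\<dots> < nat (B + 1) ^ N"
  proof -
    have l: "nat (B * B + 1) < nat (B + 1) ^ 2" 
    proof -
      have "B * B + 1 < (B + 1)\<^sup>2" using B by (simp add: power2_eq_square algebra_simps)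
      then show ?thesis using B by (simp add: nat_power_eq[symmetric])
    qed
    show ?thesis
    proof (cases "card E = 0")
      case True
      have "1 < nat (B + 1) ^ N" using B N(1) by (intro one_less_power) (auto simp: N_def)
      then show ?thesis using True by simp
    next
      case False
      have "nat (B * B + 1) ^ card E < (nat (B + 1) ^ 2) ^ card E" using l False by (intro power_strict_mono) auto
      also have "\<dots> = nat (B + 1) ^ (2 * card E)" by (simp add: power_mult)
      also have "\<dots> \<le> nat (B + 1) ^ N" using B N(2) by (intro power_increasing) (auto simp: N_def)
      finally show ?thesis .
    qed
  qed
  also have "\<dots> = card D" unfolding D_def using fin by (simp add: card_PiE N_def)
  finally have "\<not> inj_on F D" by (rule pigeonhole)
  then obtain x y where xy: "x \<in> D" "y \<in> D" "F x = F y" "x \<noteq> y" by (auto simp: inj_on_def)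
  have "\<exists>j\<in>X. x j - y j \<noteq> 0"
  proof (rule ccontr)
    assume "\<not> ?thesis"
    then have "x = y" using xy by (intro PiE_ext[of x X "\<lambda>_. {0..B}" y]) (auto simp: D_def)
    then show False using xy by simp
  qed
  moreover have "\<bar>x j - y j\<bar> \<le> B" if "j \<in> X" for j
    using PiE_mem[of x X "\<lambda>_. {0..B}" j] PiE_mem[of y X "\<lambda>_. {0..B}" j] xy that by (auto simp: D_def)
  moreover have "(\<Sum>j\<in>X. a e j * (x j - y j)) = 0" if "e \<in> E" for e
    using fun_cong[OF xy(3), of e] that by (simp add: F_def right_diff_distrib sum_subtractf)
  ultimately show ?thesis by (intro exI[of _ "\<lambda>j. x j - y j"]) (auto simp: B_def N_def)
qed

text \<open>Multiplication by \<open>a0 * \<alpha>\<close> shifts the coefficient vector and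
  replaces \<open>a0 * \<alpha> ^ d\<close> by lower powers, where \<open>a0\<close> is the leading
  coefficient of an integer polynomial with root \<alpha>; each step enlarges the coefficients at
  most by a factor \<open>C\<close>. A linear equation with coefficients in powers of \<alpha> can
  thus be enforced by \<open>d\<close> integer equations.\<close>

lemma algebraic_power_reduction:
  fixes \<alpha> :: real
  assumes "algebraic \<alpha>"
  obtains d :: nat and a0 C :: int and c :: "nat \<Rightarrow> nat \<Rightarrow> int"
  where "d > 0" "a0 \<noteq> 0" "C \<ge> 1" "\<And>s. of_int a0 ^ s * \<alpha> ^ s = (\<Sum>i<d. of_int (c s i) * \<alpha> ^ i)"
    "\<And>s i. \<bar>c s i\<bar> \<le> C ^ s"
proof -
  obtain p :: "int poly" where p': "p \<noteq> 0" "poly (map_poly of_int p) \<alpha> = 0"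
    by (rule algebraicE'[OF assms])
  note p = p'(2,1)
  define d where "d = degree p"
  define a0 where "a0 = lead_coeff p"
  have a0: "a0 \<noteq> 0" using p by (simp add: a0_def)
  have d0: "d > 0"
  proof (rule ccontr)
    assume "\<not> d > 0"
    then obtain k where "p = [:k:]" unfolding d_def by (metis degree_eq_zeroE gr0I)
    then show False using p by (auto simp: map_poly_pCons)
  qed
  have rel: "of_int a0 * \<alpha> ^ d = - (\<Sum>i<d. of_int (coeff p i) * \<alpha> ^ i)"
  proof -
    have "0 = (\<Sum>i\<le>d. of_int (coeff p i) * \<alpha> ^ i)" using p(1) by (simp add: poly_altdef d_def coeff_map_poly degree_map_poly)
    also have "\<dots> = (\<Sum>i<d. of_int (coeff p i) * \<alpha> ^ i) + of_int a0 * \<alpha> ^ d"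
      by (simp add: lessThan_Suc_atMost[symmetric] a0_def d_def)
    finally show ?thesis by simp
  qed
  define C where "C = \<bar>a0\<bar> + (\<Sum>i\<le>d. \<bar>coeff p i\<bar>)"
  have C1: "C \<ge> 1" using a0 sum_nonneg[of "{..d}" "\<lambda>i. \<bar>coeff p i\<bar>"] unfolding C_def by linarith
  define c where "c = rec_nat (\<lambda>i::nat. if i = 0 then 1 else 0)
     (\<lambda>_ f i. if i < d then (if i = 0 then 0 else a0 * f (i - 1)) - f (d - 1) * coeff p i else 0)"
  have cS: "c (Suc s) i = (if i < d then (if i = 0 then 0 else a0 * c s (i - 1)) - c s (d - 1) * coeff p i else 0)"
    and c0: "c 0 i = (if i = 0 then 1 else 0)" for s i by (simp_all add: c_def)
  have "of_int a0 ^ s * \<alpha> ^ s = (\<Sum>i<d. of_int (c s i) * \<alpha> ^ i)" for s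
  proof (induction s)
    case 0
    have "(\<Sum>i<d. of_int (c 0 i) * \<alpha> ^ i) = (\<Sum>i<d. if i = 0 then 1 else 0)"
      by (intro sum.cong) (auto simp: c0)
    then show ?case using d0 by (simp add: sum.delta)
  next
    case (Suc s)
    obtain d' where d': "d = Suc d'" using d0 gr0_implies_Suc by blast
    have "of_int a0 ^ Suc s * \<alpha> ^ Suc s = of_int a0 * \<alpha> * (\<Sum>i<d. of_int (c s i) * \<alpha> ^ i)"
      unfolding Suc[symmetric] by simp
    also have "\<dots> = (\<Sum>i<d'. of_int a0 * of_int (c s i) * \<alpha> ^ Suc i) + of_int (c s d') * (of_int a0 * \<alpha> ^ d)"
      unfolding d' by (simp add: distrib_left sum_distrib_left mult_ac)
    also have "(\<Sum>i<d'. of_int a0 * of_int (c s i) * \<alpha> ^ Suc i) = (\<Sum>i<d. of_int (if i = 0 then 0 else a0 * c s (i - 1)) * \<alpha> ^ i)"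
      unfolding d' by (subst sum.lessThan_Suc_shift) simp
    also have "\<dots> + of_int (c s d') * (of_int a0 * \<alpha> ^ d) = (\<Sum>i<d. of_int (c (Suc s) i) * \<alpha> ^ i)"
    proof -
      have "(\<Sum>i<d. of_int (c (Suc s) i) * \<alpha> ^ i) = (\<Sum>i<d. of_int (if i = 0 then 0 else a0 * c s (i - 1)) * \<alpha> ^ i - of_int (c s d') * (of_int (coeff p i) * \<alpha> ^ i))"
        by (intro sum.cong refl) (auto simp: cS d' algebra_simps)
      then show ?thesis unfolding rel by (simp add: sum_subtractf sum_distrib_left)
    qed
    finally show ?case .
  qed
  moreover have "\<bar>c s i\<bar> \<le> C ^ s" for s i
  proof (induction s arbitrary: i)
    case (Suc s)
    show ?case
    proof (cases "i < d")
      case True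
      have "\<bar>c (Suc s) i\<bar> \<le> \<bar>if i = 0 then 0 else a0 * c s (i - 1)\<bar> + \<bar>c s (d - 1) * coeff p i\<bar>"
        unfolding cS using True by (simp add: abs_triangle_ineq4)
      also have "\<dots> \<le> \<bar>a0\<bar> * C ^ s + C ^ s * (\<Sum>i\<le>d. \<bar>coeff p i\<bar>)"
      proof (intro add_mono)
        show "\<bar>if i = 0 then 0 else a0 * c s (i - 1)\<bar> \<le> \<bar>a0\<bar> * C ^ s"
          using Suc[of "i - 1"] C1 by (auto simp: abs_mult intro!: mult_left_mono)
        have "\<bar>coeff p i\<bar> \<le> (\<Sum>i\<le>d. \<bar>coeff p i\<bar>)" using True by (intro member_le_sum) auto
        then show "\<bar>c s (d - 1) * coeff p i\<bar> \<le> C ^ s * (\<Sum>i\<le>d. \<bar>coeff p i\<bar>)"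
          unfolding abs_mult using Suc[of "d - 1"] C1 by (intro mult_mono) auto
      qed
      also have "\<dots> = C ^ Suc s" by (simp add: C_def algebra_simps)
      finally show ?thesis .
    next
      case False then show ?thesis using C1 by (simp add: cS)
    qed
  qed (simp add: c0)
  ultimately show ?thesis using that[OF d0 a0 C1] by blast
qed

section \<open>Distribution of the weights in a box\<close>

lemma sum_centered:
  fixes n :: nat assumes "n > 0"
  shows "(\<Sum>i\<le>n. (real i / real n - 1 / 2)) = 0" "(\<Sum>i\<le>n. (real i / real n - 1 / 2)\<^sup>2) \<le> (real n + 1) / 4"
proof -
  have "(\<Sum>i\<le>n. real i) = real n * (real n + 1) / 2"
    by (induction n) (auto simp: field_simps)
  then have "(\<Sum>i\<le>n. real i / real n) = (real n + 1) / 2"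
    using assms by (simp add: sum_divide_distrib[symmetric] field_simps)
  then show "(\<Sum>i\<le>n. (real i / real n - 1 / 2)) = 0" by (simp add: sum_subtractf)
  have "(\<Sum>i\<le>n. (real i / real n - 1 / 2)\<^sup>2) \<le> (\<Sum>i\<le>n. 1 / 4)"
  proof (intro sum_mono)
    fix i assume "i \<in> {..n}"
    then have "\<bar>real i / real n - 1 / 2\<bar> \<le> 1 / 2" using assms by (simp add: abs_le_iff field_simps)
    then have "\<bar>real i / real n - 1 / 2\<bar>\<^sup>2 \<le> (1 / 2)\<^sup>2" by (intro power_mono) auto
    then show "(real i / real n - 1 / 2)\<^sup>2 \<le> 1 / 4" by (simp add: power2_eq_square)
  qed
  then show "(\<Sum>i\<le>n. (real i / real n - 1 / 2)\<^sup>2) \<le> (real n + 1) / 4" by simp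
qed

text \<open>For a uniformly random exponent in the box the coordinates divided by \<open>r h\<close>
  are independent, each with mean 1/2 and variance at most 1/4. The mixed terms vanish in the
  induction.\<close>

lemma wt_moments:
  assumes "\<And>h. h < m \<Longrightarrow> r h > 0"
  shows "(\<Sum>I\<in>ebox m r. wt m r I - m / 2) = 0 \<and> (\<Sum>I\<in>ebox m r. (wt m r I - m / 2)\<^sup>2) \<le> card (ebox m r) * m / 4"
  using assms
proof (induction m)
  case 0 then show ?case by (simp add: box_0 wt_def)
next
  case (Suc m)
  define f where "f I = wt m r I - m / 2" for I
  define g where "g i = real i / real (r m) - 1 / 2" for i
  have r: "r m > 0" using Suc.prems by simp
  have IH: "(\<Sum>I\<in>ebox m r. f I) = 0" "(\<Sum>I\<in>ebox m r. (f I)\<^sup>2) \<le> card (ebox m r) * m / 4"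
    using Suc by (auto simp: f_def)
  have g: "(\<Sum>i\<le>r m. g i) = 0" "(\<Sum>i\<le>r m. (g i)\<^sup>2) \<le> (real (r m) + 1) / 4"
    using sum_centered[OF r] by (auto simp: g_def)
  have split: "wt (Suc m) r (I + single m i) - (Suc m) / 2 = f I + g i" if "I \<in> ebox m r" for I i
  proof -
    have "wt (Suc m) r I = wt m r I" using that by (simp add: wt_def ebox_def vars_below_def)
    moreover have "wt (Suc m) r (single m i) = real i / real (r m)" by (simp add: wt_def lookup_single)
    ultimately show ?thesis by (simp add: wt_add f_def g_def field_simps)
  qed
  have "(\<Sum>I\<in>ebox (Suc m) r. wt (Suc m) r I - (Suc m) / 2) = (\<Sum>I\<in>ebox m r. \<Sum>i\<le>r m. f I + g i)"
    unfolding sum_box_Suc by (intro sum.cong refl split)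
  also have "\<dots> = 0" by (simp add: sum.distrib g IH sum_distrib_left[symmetric])
  finally have 1: "(\<Sum>I\<in>ebox (Suc m) r. wt (Suc m) r I - (Suc m) / 2) = 0" .
  have "(\<Sum>I\<in>ebox (Suc m) r. (wt (Suc m) r I - (Suc m) / 2)\<^sup>2) = (\<Sum>I\<in>ebox m r. \<Sum>i\<le>r m. (f I + g i)\<^sup>2)"
    unfolding sum_box_Suc by (intro sum.cong refl) (subst split, simp_all)
  also have "\<dots> = (\<Sum>I\<in>ebox m r. \<Sum>i\<le>r m. (f I)\<^sup>2 + 2 * f I * g i + (g i)\<^sup>2)"
    by (simp add: power2_sum algebra_simps)
  also have "\<dots> = (\<Sum>I\<in>ebox m r. (real (r m) + 1) * (f I)\<^sup>2 + 2 * f I * (\<Sum>i\<le>r m. g i) + (\<Sum>i\<le>r m. (g i)\<^sup>2))"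
    by (simp add: sum.distrib sum_distrib_left add.commute)
  also have "\<dots> = (real (r m) + 1) * (\<Sum>I\<in>ebox m r. (f I)\<^sup>2) + card (ebox m r) * (\<Sum>i\<le>r m. (g i)\<^sup>2)"
    unfolding g(1) by (simp add: sum.distrib sum_distrib_left)
  also have "\<dots> \<le> (real (r m) + 1) * (card (ebox m r) * m / 4) + card (ebox m r) * ((real (r m) + 1) / 4)"
    using IH(2) g(2) by (intro add_mono mult_left_mono) auto
  also have "\<dots> = card (ebox (Suc m) r) * (Suc m) / 4"
    by (simp add: card_box field_simps)
  finally show ?case using 1 by simp
qed

text \<open>Chebyshev's inequality for the lower tail.\<close>

lemma card_small_weight:
  assumes "\<And>h. h < m \<Longrightarrow> r h > 0" "\<eta> > 0" "m > 0"
  shows "real (card {I\<in>ebox m r. wt m r I \<le> m / 2 - m * \<eta>}) \<le> card (ebox m r) / (4 * m * \<eta>\<^sup>2)"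
proof -
  let ?S = "{I\<in>ebox m r. wt m r I \<le> m / 2 - m * \<eta>}"
  have "real (card ?S) * (m * \<eta>)\<^sup>2 = (\<Sum>I\<in>?S. (m * \<eta>)\<^sup>2)" by simp
  also have "\<dots> \<le> (\<Sum>I\<in>?S. (wt m r I - m / 2)\<^sup>2)"
  proof (intro sum_mono)
    fix I assume "I \<in> ?S"
    then have "m * \<eta> \<le> - (wt m r I - m / 2)" by simp
    then have "(m * \<eta>)\<^sup>2 \<le> (- (wt m r I - m / 2))\<^sup>2" using assms by (intro power_mono) auto
    then show "(m * \<eta>)\<^sup>2 \<le> (wt m r I - m / 2)\<^sup>2" by (simp only: power2_minus)
  qed
  also have "\<dots> \<le> (\<Sum>I\<in>ebox m r. (wt m r I - m / 2)\<^sup>2)" by (intro sum_mono2) auto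
  also have "\<dots> \<le> card (ebox m r) * m / 4" by (rule wt_moments[OF assms(1), THEN conjunct2])
  finally have "real (card ?S) * (m * \<eta>)\<^sup>2 \<le> card (ebox m r) * m / 4" .
  then have "real (card ?S) * (4 * m * \<eta>\<^sup>2) * m \<le> card (ebox m r) * m" by (simp add: power2_eq_square algebra_simps)
  then have "real (card ?S) * (4 * m * \<eta>\<^sup>2) \<le> card (ebox m r)" using assms(3) by (simp add: mult_ac)
  then show ?thesis using assms(2,3) by (simp add: pos_le_divide_eq)
qed

lemma card_box_le: "card (ebox m r) \<le> 2 ^ (\<Sum>h<m. r h)"
proof -
  have "card (ebox m r) \<le> (\<Prod>h<m. 2 ^ r h)" unfolding card_box
    by (intro prod_mono) (auto simp: Suc_leI)
  then show ?thesis by (simp add: power_sum)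
qed

text \<open>The condition on \<open>d\<close> and \<eta> makes the equations at most half as many as
  the unknown coefficients: derivatives of small weight form a fraction of at most
  \<open>1 / (4 * m * \<eta>\<^sup>2)\<close> of the box, and each gives \<open>d\<close> integer
  equations.\<close>

definition has_aux_polys :: "real \<Rightarrow> real \<Rightarrow> nat \<Rightarrow> bool" where
  "has_aux_polys \<alpha> K d \<longleftrightarrow> (\<forall>m r \<eta>. (\<forall>h<m. r h > 0) \<longrightarrow> \<eta> > 0 \<longrightarrow> real d \<le> 2 * real m * \<eta>\<^sup>2 \<longrightarrow>
       (\<exists>P. P \<noteq> 0 \<and> int_coeffs P \<and> keys P \<subseteq> ebox m r \<and> l1 P \<le> K ^ (\<Sum>h<m. r h) \<and>
         (\<forall>I. vars_below m I \<longrightarrow> wt m r I \<le> real m / 2 - real m * \<eta> \<longrightarrow> ev m (\<lambda>_. \<alpha>) (hasse m I P) = 0)))"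

lemma auxiliary_polynomial:
  fixes \<alpha> :: real
  assumes "algebraic \<alpha>"
  shows "\<exists>K\<ge>1. \<exists>d>0. has_aux_polys \<alpha> K d"
proof -
  obtain d a0 C c where d: "d > 0" and a0: "a0 \<noteq> 0" and C: "C \<ge> 1"
    and pw: "\<And>s. of_int a0 ^ s * \<alpha> ^ s = (\<Sum>i<d. of_int (c s i) * \<alpha> ^ i)"
    and cb: "\<And>s i. \<bar>c s i\<bar> \<le> C ^ s"
    using algebraic_power_reduction[OF assms] by blast
  \<comment> \<open>The number of coefficients, at most \<open>2 ^ T\<close>, enters twice, in
    Siegel's bound and in the sum over the coefficients; the remaining factor
    \<open>2 * |a0| * C\<close> bounds the entries of the system.\<close>
  define K where "K = 8 * \<bar>real_of_int a0\<bar> * real_of_int C"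
  have a01: "\<bar>a0\<bar> \<ge> 1" using a0 by simp
  have K1: "K \<ge> 1"
  proof -
    have "1 * 1 \<le> \<bar>a0\<bar> * C" using a01 C by (intro mult_mono) auto
    then have "1 \<le> \<bar>real_of_int a0\<bar> * real_of_int C" by (metis mult_1 of_int_1_le_iff of_int_abs of_int_mult)
    then show ?thesis by (simp add: K_def)
  qed
  have main: "\<exists>P. P \<noteq> 0 \<and> int_coeffs P \<and> keys P \<subseteq> ebox m r \<and> l1 P \<le> K ^ (\<Sum>h<m. r h) \<and>
         (\<forall>I. vars_below m I \<longrightarrow> wt m r I \<le> m / 2 - m * \<eta> \<longrightarrow> ev m (\<lambda>_. \<alpha>) (hasse m I P) = 0)"
    if r: "\<And>h. h < m \<Longrightarrow> r h > 0" and \<eta>: "\<eta> > 0" and dm: "real d \<le> 2 * real m * \<eta>\<^sup>2" for m r \<eta>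
  proof -
    define T where "T = (\<Sum>h<m. r h)"
    define X where "X = ebox m r"
    define S where "S = {I\<in>ebox m r. wt m r I \<le> m / 2 - m * \<eta>}"
    define E where "E = S \<times> {..<d}"
    define zb where "zb J I = (\<Prod>v<m. int (lookup J v choose lookup I v))" for J I
    have zb: "real_of_int (zb J I) = mbinom m J I" for J I by (simp add: zb_def mbinom_def)
    \<comment> \<open>The equations are multiplied by the common factor \<open>a0 ^ T\<close>. The
      part with exponent \<open>tdeg m (J - I)\<close>, which is at most \<open>T\<close>, goes into
      the reduction of the power of \<alpha>; the rest stays as a coefficient.\<close>
    define a where "a = (\<lambda>(I, i) J. zb J I * a0 ^ (T - tdeg m (J - I)) * c (tdeg m (J - I)) i)"
    define A where "A = (2 * \<bar>a0\<bar> * C) ^ T"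
    have td: "tdeg m (J - I) \<le> T" "tdeg m J \<le> T" if "J \<in> X" for J I
    proof -
      have "tdeg m (J - I) \<le> tdeg m J" unfolding tdeg_def by (intro sum_mono) (simp add: lookup_minus_expo)
      also show "tdeg m J \<le> T" unfolding tdeg_def T_def using that by (intro sum_mono) (auto simp: X_def ebox_def)
      finally show "tdeg m (J - I) \<le> T" .
    qed
    have m0: "m > 0" using dm d by (cases m) auto
    have N0: "card X > 0" using r by (simp add: X_def card_box prod_pos)
    have card: "2 * card E \<le> card X"
    proof -
      have "real (card S) \<le> real (card X) / (4 * real m * \<eta>\<^sup>2)" using card_small_weight[OF r \<eta> m0] unfolding S_def X_def by simp
      also have "\<dots> \<le> real (card X) / (2 * real d)" using dm d m0 \<eta> by (intro divide_left_mono) auto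
      finally have "2 * (real (card S) * d) \<le> card X" using d by (simp add: field_simps)
      then have "real (2 * card E) \<le> real (card X)" by (simp add: E_def card_cartesian_product)
      then show ?thesis by linarith
    qed
    have A1: "A \<ge> 1"
    proof -
      have "1 * 1 \<le> \<bar>a0\<bar> * C" using a01 C by (intro mult_mono) auto
      then show ?thesis unfolding A_def by (intro one_le_power) simp
    qed
    have aA: "\<bar>a e J\<bar> \<le> A" if "e \<in> E" "J \<in> X" for e J
    proof -
      obtain I i where e: "e = (I, i)" by (cases e)
      let ?s = "tdeg m (J - I)"
      have "real_of_int (zb J I) \<le> 2 ^ tdeg m J" unfolding zb tdeg_def by (rule prod_choose_le)
      also have "\<dots> \<le> 2 ^ T" using td(2)[OF that(2)] by (intro power_increasing) auto
      finally have "real_of_int (zb J I) \<le> real_of_int (2 ^ T)" by simp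
      then have z: "zb J I \<le> 2 ^ T" by (simp only: of_int_le_iff)
      have z0: "zb J I \<ge> 0" by (simp add: zb_def prod_nonneg)
      have "\<bar>a e J\<bar> = zb J I * \<bar>a0\<bar> ^ (T - ?s) * \<bar>c ?s i\<bar>" using z0 by (simp add: a_def e abs_mult power_abs)
      also have "\<dots> \<le> 2 ^ T * \<bar>a0\<bar> ^ T * C ^ T"
      proof (intro mult_mono)
        show "\<bar>a0\<bar> ^ (T - ?s) \<le> \<bar>a0\<bar> ^ T" using a01 by (intro power_increasing) auto
        have "\<bar>c ?s i\<bar> \<le> C ^ ?s" by (rule cb)
        also have "\<dots> \<le> C ^ T" using C td(1)[OF that(2)] by (intro power_increasing) auto
        finally show "\<bar>c ?s i\<bar> \<le> C ^ T" .
      qed (use z z0 a01 in auto)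
      finally show ?thesis by (simp add: A_def power_mult_distrib)
    qed
    have "finite X" "finite E" by (simp_all add: X_def E_def S_def)
    from siegel[OF this N0 card A1 aA]
    obtain x where "(\<exists>J\<in>X. x J \<noteq> 0) \<and> (\<forall>J\<in>X. \<bar>x J\<bar> \<le> int (card X) * A) \<and> (\<forall>e\<in>E. (\<Sum>J\<in>X. a e J * x J) = 0)" ..
    then have x: "\<exists>J\<in>X. x J \<noteq> 0" "\<And>J. J \<in> X \<Longrightarrow> \<bar>x J\<bar> \<le> int (card X) * A"
      "\<And>e. e \<in> E \<Longrightarrow> (\<Sum>J\<in>X. a e J * x J) = 0" by simp_all
    define P :: mpol where "P = (\<Sum>J\<in>X. single J (real_of_int (x J)))"
    have lP: "lookup P J = (if J \<in> X then of_int (x J) else 0)" for J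
    proof -
      have "lookup P J = (\<Sum>K\<in>X. if K = J then of_int (x J) else 0)"
        unfolding P_def lookup_sum by (intro sum.cong refl) (auto simp: lookup_single when_def)
      then show ?thesis by (simp add: X_def sum.delta)
    qed
    have kP: "keys P \<subseteq> X" by (auto simp: in_keys_iff lP split: if_splits)
    have "P \<noteq> 0" using x(1) lP by (metis lookup_zero of_int_eq_0_iff)
    moreover have "int_coeffs P" by (simp add: int_coeffs_def lP)
    moreover have "l1 P \<le> K ^ T"
    proof -
      have "l1 P = (\<Sum>J\<in>X. \<bar>real_of_int (x J)\<bar>)" by (subst l1_superset[OF _ kP]) (auto simp: X_def lP)
      also have "\<dots> \<le> (\<Sum>J\<in>X. real (card X) * of_int A)"
      proof (intro sum_mono)
        fix J assume "J \<in> X"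
        then have "real_of_int \<bar>x J\<bar> \<le> real_of_int (int (card X) * A)" using x(2) by (simp only: of_int_le_iff)
        then show "\<bar>real_of_int (x J)\<bar> \<le> real (card X) * of_int A" by simp
      qed
      also have "\<dots> = real (card X) * real (card X) * of_int A" by simp
      also have "\<dots> \<le> 2 ^ T * 2 ^ T * of_int A"
      proof (intro mult_mono)
        have "real (card X) \<le> real (2 ^ T)" using card_box_le[of m r] by (simp only: of_nat_le_iff X_def T_def)
        then show "real (card X) \<le> 2 ^ T" "real (card X) \<le> 2 ^ T" by simp_all
      qed (use A1 in auto)
      also have "real_of_int A = (2 * \<bar>real_of_int a0\<bar> * real_of_int C) ^ T" by (simp add: A_def)
      also have "2 ^ T * 2 ^ T * \<dots> = (2 * 2 * (2 * \<bar>real_of_int a0\<bar> * real_of_int C)) ^ T" by (simp only: power_mult_distrib)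
      also have "2 * 2 * (2 * \<bar>real_of_int a0\<bar> * real_of_int C) = K" by (simp add: K_def)
      finally show ?thesis .
    qed
    moreover have "ev m (\<lambda>_. \<alpha>) (hasse m I P) = 0" if I: "vars_below m I" "wt m r I \<le> m / 2 - m * \<eta>" for I
    proof (cases "I \<in> ebox m r")
      case False
      then obtain v where "v < m" "r v < lookup I v" using I(1) by (auto simp: ebox_def not_le)
      then have "hasse m I P = 0" using kP by (intro hasse_eq_0[OF I(1)]) (force simp: X_def ebox_def)
      then show ?thesis by (simp add: ins_def)
    next
      case True
      then have IS: "I \<in> S" using I by (simp add: S_def)
      have me: "meval m (\<lambda>_. \<alpha>) K = \<alpha> ^ tdeg m K" for K by (simp add: meval_def tdeg_def power_sum)
      have "ev m (\<lambda>_. \<alpha>) (hasse m I P) = (\<Sum>J\<in>keys P. mbinom m J I * lookup P J * \<alpha> ^ tdeg m (J - I))"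
        by (simp add: ins_hasse[OF id_hom] me)
      also have "\<dots> = (\<Sum>J\<in>X. mbinom m J I * lookup P J * \<alpha> ^ tdeg m (J - I))"
        by (rule sum.mono_neutral_left) (use kP in \<open>auto simp: X_def in_keys_iff\<close>)
      finally have "of_int a0 ^ T * ev m (\<lambda>_. \<alpha>) (hasse m I P) = (\<Sum>J\<in>X. \<Sum>i<d. of_int (a (I, i) J * x J) * \<alpha> ^ i)"
      proof (simp only: sum_distrib_left, intro sum.cong refl)
        fix J assume J: "J \<in> X"
        let ?s = "tdeg m (J - I)"
        have "of_int a0 ^ T = of_int a0 ^ (T - ?s) * (of_int a0 :: real) ^ ?s"
          using td(1)[OF J] by (simp flip: power_add)
        then have "of_int a0 ^ T * (mbinom m J I * lookup P J * \<alpha> ^ ?s) = mbinom m J I * of_int (x J) * of_int a0 ^ (T - ?s) * (of_int a0 ^ ?s * \<alpha> ^ ?s)"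
          using J by (simp add: lP mult_ac)
        also have "\<dots> = (\<Sum>i<d. of_int (a (I, i) J * x J) * \<alpha> ^ i)"
          unfolding pw by (simp add: sum_distrib_left a_def zb[symmetric] mult_ac)
        finally show "of_int a0 ^ T * (mbinom m J I * lookup P J * \<alpha> ^ ?s) = (\<Sum>i<d. of_int (a (I, i) J * x J) * \<alpha> ^ i)" .
      qed
      also have "\<dots> = (\<Sum>i<d. of_int (\<Sum>J\<in>X. a (I, i) J * x J) * \<alpha> ^ i)"
        by (subst sum.swap) (simp add: sum_distrib_right)
      also have "\<dots> = 0" using IS by (intro sum.neutral) (auto simp: x(3) E_def)
      finally show ?thesis using a0 by simp
    qed
    ultimately show ?thesis using kP unfolding T_def X_def by blast
  qed
  have "has_aux_polys \<alpha> K d" unfolding has_aux_polys_def by (intro allI impI main) simp_all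
  then show ?thesis using K1 d by blast
qed

subsection \<open>Roth's theorem\<close>

lemma ev_rational_integer:
  fixes p q :: "nat \<Rightarrow> int"
  assumes "int_coeffs Q" "\<And>J v. J \<in> keys Q \<Longrightarrow> v < m \<Longrightarrow> lookup J v \<le> r v" "\<And>v. v < m \<Longrightarrow> q v > 0"
  shows "(\<Prod>v<m. of_int (q v) ^ r v) * ev m (\<lambda>v. of_int (p v) / of_int (q v)) Q \<in> \<int>"
proof -
  have "(\<Prod>v<m. of_int (q v) ^ r v) * (lookup Q J * meval m (\<lambda>v. of_int (p v) / of_int (q v)) J) \<in> \<int>" if J: "J \<in> keys Q" for J
  proof -
    have "(\<Prod>v<m. of_int (q v) ^ r v) * meval m (\<lambda>v. of_int (p v) / of_int (q v)) J
        = (\<Prod>v<m. of_int (q v ^ (r v - lookup J v) * p v ^ lookup J v) :: real)"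
      unfolding meval_def prod.distrib[symmetric]
    proof (intro prod.cong refl)
      fix v assume "v \<in> {..<m}"
      then have "lookup J v \<le> r v" "q v > 0" using assms J by auto
      moreover from this have "real_of_int (q v) ^ r v = of_int (q v) ^ (r v - lookup J v) * of_int (q v) ^ lookup J v"
        by (simp flip: power_add)
      ultimately show "of_int (q v) ^ r v * (of_int (p v) / of_int (q v)) ^ lookup J v = (of_int (q v ^ (r v - lookup J v) * p v ^ lookup J v) :: real)"
        by (simp add: power_divide)
    qed
    also have "\<dots> \<in> \<int>" by (intro Ints_prod Ints_of_int)
    finally have "lookup Q J * ((\<Prod>v<m. of_int (q v) ^ r v) * meval m (\<lambda>v. of_int (p v) / of_int (q v)) J) \<in> \<int>"
      by (rule Ints_mult[rotated]) (use assms(1) in \<open>simp add: int_coeffs_def\<close>)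
    then show ?thesis by (simp only: mult_ac)
  qed
  then show ?thesis unfolding ins_def sum_distrib_left by (intro Ints_sum)
qed

lemma ev_abs_le:
  assumes "A \<ge> 1" "\<bar>\<alpha>\<bar> \<le> A" "\<And>J. J \<in> keys Q \<Longrightarrow> tdeg m J \<le> T"
  shows "\<bar>ev m (\<lambda>_. \<alpha>) Q\<bar> \<le> l1 Q * A ^ T"
proof -
  have me: "meval m (\<lambda>_. \<alpha>) K = \<alpha> ^ tdeg m K" for K by (simp add: meval_def tdeg_def power_sum)
  have "\<bar>ev m (\<lambda>_. \<alpha>) Q\<bar> \<le> (\<Sum>J\<in>keys Q. \<bar>lookup Q J * \<alpha> ^ tdeg m J\<bar>)"
    unfolding ins_def me by (rule sum_abs)
  also have "\<dots> \<le> (\<Sum>J\<in>keys Q. \<bar>lookup Q J\<bar> * A ^ T)"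
  proof (intro sum_mono)
    fix J assume "J \<in> keys Q"
    have "\<bar>\<alpha>\<bar> ^ tdeg m J \<le> A ^ tdeg m J" using assms by (intro power_mono) auto
    also have "\<dots> \<le> A ^ T" using assms(1,3) \<open>J \<in> keys Q\<close> by (intro power_increasing) auto
    finally show "\<bar>lookup Q J * \<alpha> ^ tdeg m J\<bar> \<le> \<bar>lookup Q J\<bar> * A ^ T"
      unfolding abs_mult power_abs by (intro mult_left_mono) auto
  qed
  finally show ?thesis by (simp add: l1_def sum_distrib_right)
qed

lemma keys_hasse_le:
  assumes "vars_below m I" "J \<in> keys (hasse m I P)"
  shows "J + I \<in> keys P"
  using assms by (simp add: in_keys_iff lookup_hasse)

text \<open>A derivative of the auxiliary polynomial takes at the rational point a nonzero value
  with denominator about \<open>exp (m * R)\<close>. Its Taylor expansion at \<alpha> starts only at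
  weight near \<open>m / 2\<close>, and each unit of weight gains
  \<open>exp (- (2 + \<delta>) * R)\<close>. So the value is below about
  \<open>exp (- (1 + \<delta> / 2) * m * R)\<close>, which is too small.\<close>

lemma roth_eventually:
  fixes \<alpha> \<delta> :: real
  assumes alg: "algebraic \<alpha>" and \<delta>: "0 < \<delta>" "\<delta> \<le> 1"
  shows "\<exists>Q. \<forall>p q::int. q > Q \<longrightarrow> coprime p q \<longrightarrow> of_int q powr (- (2 + \<delta>)) \<le> \<bar>\<alpha> - of_int p / of_int q\<bar>"
proof (rule ccontr)
  assume contra: "\<not> ?thesis"
  define good where "good = (\<lambda>(p::int, q::int). q > 1 \<and> coprime p q \<and> \<bar>\<alpha> - of_int p / of_int q\<bar> < of_int q powr (- (2 + \<delta>)))"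
  define lq where "lq = (\<lambda>(p::int, q::int). ln (real_of_int q))"
  have large: "\<exists>x. good x \<and> X \<le> lq x" for X
  proof -
    obtain p q :: int where pq: "q > max 1 \<lceil>exp X\<rceil>" "coprime p q" "\<bar>\<alpha> - of_int p / of_int q\<bar> < of_int q powr (- (2 + \<delta>))"
      using contra by (meson not_le)
    have "exp X \<le> of_int q" using pq(1) by linarith
    moreover have q1: "1 < q" using pq(1) unfolding max_less_iff_conj by blast
    then have "0 < real_of_int q" by simp
    ultimately have "X \<le> ln (of_int q)" using \<open>0 < real_of_int q\<close> by (simp add: ln_ge_iff)
    then show ?thesis using pq q1 by (intro exI[of _ "(p, q)"]) (auto simp: good_def lq_def)
  qed
  obtain K d where K: "K \<ge> 1" and d: "d > 0" and aux: "has_aux_polys \<alpha> K d"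
    using auxiliary_polynomial[OF alg] by blast
  \<comment> \<open>Chosen so that at the end \<open>(2 + \<delta>) * (1 / 2 - 2 * \<eta>)\<close>,
    which equals \<open>1 + 6 * \<eta> - 40 * \<eta> * \<eta>\<close>, exceeds
    \<open>1 + 2 * \<eta>\<close>.\<close>
  define \<eta> where "\<eta> = \<delta> / 20"
  have \<eta>: "\<eta> > 0" "\<eta> \<le> 1" using \<delta> by (auto simp: \<eta>_def)
  obtain m :: nat where m: "real m \<ge> d / (2 * \<eta>\<^sup>2)" using real_arch_simple by blast
  have dm: "real d \<le> 2 * real m * \<eta>\<^sup>2" using m \<eta> by (simp add: field_simps)
  have m0: "m > 0" using dm d by (cases m) auto
  obtain \<omega> where \<omega>: "\<omega> > 0" "\<omega> \<le> 1" and roth: "\<And>r p q R P. roth_hyp m \<omega> r p q R P \<Longrightarrow>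
     (\<exists>I. vars_below m I \<and> wt m r I \<le> m * \<eta> \<and> ev m (\<lambda>h. of_int (p h) / of_int (q h)) (hasse m I P) \<noteq> 0)"
    using roth_lemma[of m m "m * \<eta>"] m0 \<eta> by auto
  define A where "A = max 1 \<bar>\<alpha>\<bar>"
  \<comment> \<open>The loss per unit of total degree: 2 for the number of Taylor terms, 2 for each
    of two derivatives, \<open>A\<close> for the evaluation at \<alpha> and \<open>K\<close> for the
    height of \<open>P\<close>.\<close>
  define K2 where "K2 = 8 * A * K"
  have K2: "K2 \<ge> K" "K2 \<ge> 1"
  proof -
    have "1 * K \<le> (8 * A) * K" using K by (intro mult_right_mono) (auto simp: A_def)
    then show "K2 \<ge> K" by (simp add: K2_def)
    then show "K2 \<ge> 1" using K by simp
  qed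
  \<comment> \<open>A lower bound for the logarithms of all denominators. The three quotients ensure
    in turn that \<open>T\<close> is at most \<open>\<omega> * R\<close>, that \<open>K2 ^ T\<close>
    is at most \<open>exp (\<omega> * R)\<close>, and that \<open>K2 ^ T\<close> is at most
    \<open>exp (m * \<eta> * R)\<close>.\<close>
  define X0 where "X0 = 1 + 2 * m / \<omega> + 2 * m * ln K2 / \<omega> + 2 * ln K2 / \<eta>"
  have lnK2: "ln K2 \<ge> 0" using K2 by simp
  have pos: "2 * m / \<omega> \<ge> 0" "2 * m * ln K2 / \<omega> \<ge> 0" "2 * ln K2 / \<eta> \<ge> 0" using \<omega> \<eta> lnK2 by auto
  have X0: "X0 \<ge> 1" "2 * m / \<omega> \<le> X0" "2 * m * ln K2 / \<omega> \<le> X0" "2 * ln K2 / \<eta> \<le> X0"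
    unfolding X0_def using pos by linarith+
  \<comment> \<open>The logarithms of successive denominators grow so fast that the degrees, roughly
    \<open>R / l h\<close>, fall by the factor \<omega> of Roth's lemma; the 2 pays for
    rounding.\<close>
  have "\<exists>f. \<forall>n. (good (f n) \<and> X0 \<le> lq (f n)) \<and> 2 / \<omega> * lq (f n) \<le> lq (f (Suc n))"
  proof (rule dependent_nat_choice)
    show "\<exists>x. good x \<and> X0 \<le> lq x" by (rule large)
    show "\<exists>y. (good y \<and> X0 \<le> lq y) \<and> 2 / \<omega> * lq x \<le> lq y" if "good x \<and> X0 \<le> lq x" for x n
      using large[of "max X0 (2 / \<omega> * lq x)"] by auto
  qed
  then obtain f where f: "\<And>n. good (f n)" "\<And>n. X0 \<le> lq (f n)" "\<And>n. 2 / \<omega> * lq (f n) \<le> lq (f (Suc n))" by blast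
  define p where "p h = fst (f h)" for h
  define q where "q h = snd (f h)" for h
  define l where "l h = ln (real_of_int (q h))" for h
  have lf: "lq (f h) = l h" for h by (simp add: lq_def l_def q_def split_def)
  have q1: "q h > 1" and cop: "coprime (p h) (q h)" and app: "\<bar>\<alpha> - of_int (p h) / of_int (q h)\<bar> < of_int (q h) powr (- (2 + \<delta>))" for h
    using f(1)[of h] by (auto simp: good_def p_def q_def split_def)
  have l: "X0 \<le> l h" "2 / \<omega> * l h \<le> l (Suc h)" "l h \<ge> 1" "l h > 0" for h
    using f(2,3)[of h] X0(1) by (auto simp: lf)
  \<comment> \<open>So large that \<open>l h \<le> \<eta> * R\<close> for all \<open>h < m\<close>.
    The degrees \<open>R / l h\<close> make all \<open>q h ^ r h\<close> about \<open>exp R\<close>,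
    and rounding them up then costs at most a factor \<open>1 + \<eta>\<close> in the
    exponent.\<close>
  define R where "R = 1 + (\<Sum>h<m. l h) / \<eta>"
  have "(\<Sum>h<m. l h) / \<eta> \<ge> 0" using l(4) \<eta> by (intro divide_nonneg_pos sum_nonneg) (auto intro: less_imp_le)
  then have R0: "R > 0" by (simp add: R_def)
  have lR: "l h \<le> \<eta> * R" if "h < m" for h
  proof -
    have "l h \<le> (\<Sum>h<m. l h)" using that l(4) by (intro member_le_sum) (auto intro: less_imp_le)
    also have "\<dots> \<le> \<eta> * R" using \<eta> by (simp add: R_def distrib_left)
    finally show ?thesis .
  qed
  define r where "r h = nat \<lceil>R / l h\<rceil>" for h
  have rge: "R / l h \<le> real (r h)" for h unfolding r_def by (rule real_nat_ceiling_ge)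
  have rge': "R \<le> real (r h) * l h" for h using rge[of h] l(4)[of h] by (simp add: field_simps)
  have r0: "r h > 0" for h
  proof -
    have "0 < R / l h" using R0 l(4)[of h] by simp
    then show ?thesis using rge[of h] by linarith
  qed
  have rle': "real (r h) * l h \<le> (1 + \<eta>) * R" if "h < m" for h
  proof -
    have "0 \<le> R / l h" using R0 l(4)[of h] by simp
    then have "real (r h) \<le> R / l h + 1" unfolding r_def by linarith
    then have "real (r h) * l h \<le> (R / l h + 1) * l h" using l(4)[of h] by (intro mult_right_mono) auto
    also have "\<dots> = R + l h" using l(4)[of h] by (simp add: field_simps)
    also have "\<dots> \<le> (1 + \<eta>) * R" using lR[OF that] by (simp add: algebra_simps)
    finally show ?thesis .
  qed
  have rle2: "real (r h) \<le> 2 * R / l h" if "h < m" for h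
  proof -
    have "real (r h) * l h \<le> (1 + \<eta>) * R" by (rule rle'[OF that])
    also have "\<dots> \<le> 2 * R" using \<eta> R0 by (intro mult_right_mono) auto
    finally show ?thesis using l(4)[of h] by (simp add: field_simps)
  qed
  define T where "T = (\<Sum>h<m. r h)"
  have T: "real T \<le> 2 * m * R / X0"
  proof -
    have "real T \<le> (\<Sum>h<m. 2 * R / X0)"
      unfolding T_def of_nat_sum
    proof (intro sum_mono)
      fix h assume "h \<in> {..<m}"
      then have "real (r h) \<le> 2 * R / l h" using rle2 by auto
      also have "\<dots> \<le> 2 * R / X0" using l(1)[of h] X0(1) R0 by (intro divide_left_mono) auto
      finally show "real (r h) \<le> 2 * R / X0" .
    qed
    then show ?thesis by (simp add: mult_ac)
  qed
  have T1: "real T \<le> \<omega> * R"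
  proof -
    have "2 * m / X0 \<le> \<omega>" using X0 \<omega> by (simp add: field_simps)
    then have "2 * m / X0 * R \<le> \<omega> * R" using R0 by (intro mult_right_mono) auto
    then show ?thesis using T by simp
  qed
  have T2: "K2 ^ T \<le> exp (\<omega> * R)" and T3: "K2 ^ T \<le> exp (m * \<eta> * R)"
  proof -
    have e: "K2 ^ T = exp (real T * ln K2)" using K2 by (simp add: exp_of_nat_mult)
    have "real T * ln K2 \<le> 2 * m * R / X0 * ln K2" using T lnK2 by (rule mult_right_mono)
    also have "\<dots> = (2 * m * ln K2 / X0) * R" by simp
    finally have t: "real T * ln K2 \<le> (2 * m * ln K2 / X0) * R" .
    have "2 * m * ln K2 / X0 \<le> \<omega>" using X0(1,3) \<omega> by (simp add: field_simps)
    then have "(2 * m * ln K2 / X0) * R \<le> \<omega> * R" using R0 by (intro mult_right_mono) auto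
    then show "K2 ^ T \<le> exp (\<omega> * R)" unfolding e using t by simp
    have "2 * ln K2 / X0 \<le> \<eta>" using X0(1,4) \<eta> by (simp add: field_simps)
    then have "m * (2 * ln K2 / X0) * R \<le> m * \<eta> * R" using R0 by (intro mult_right_mono mult_left_mono) auto
    then show "K2 ^ T \<le> exp (m * \<eta> * R)" unfolding e using t by (simp add: mult_ac)
  qed
  have "\<exists>P. P \<noteq> 0 \<and> int_coeffs P \<and> keys P \<subseteq> ebox m r \<and> l1 P \<le> K ^ T \<and>
      (\<forall>I. vars_below m I \<longrightarrow> wt m r I \<le> real m / 2 - real m * \<eta> \<longrightarrow> ev m (\<lambda>_. \<alpha>) (hasse m I P) = 0)"
    using aux[unfolded has_aux_polys_def, rule_format, of m r \<eta>] r0 \<eta>(1) dm unfolding T_def by simp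
  then obtain P where "P \<noteq> 0 \<and> int_coeffs P \<and> keys P \<subseteq> ebox m r \<and> l1 P \<le> K ^ T \<and>
      (\<forall>I. vars_below m I \<longrightarrow> wt m r I \<le> real m / 2 - real m * \<eta> \<longrightarrow> ev m (\<lambda>_. \<alpha>) (hasse m I P) = 0)" ..
  then have P: "P \<noteq> 0" "int_coeffs P" "keys P \<subseteq> ebox m r" "l1 P \<le> K ^ T"
    and van: "\<And>I. vars_below m I \<Longrightarrow> wt m r I \<le> real m / 2 - real m * \<eta> \<Longrightarrow> ev m (\<lambda>_. \<alpha>) (hasse m I P) = 0"
    by simp_all
  have "K ^ T \<le> K2 ^ T" using K2 K by (intro power_mono) auto
  then have l1P: "l1 P \<le> exp (\<omega> * R)" using P(4) T2 by linarith
  have "roth_hyp m \<omega> r p q R P"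
    unfolding roth_hyp_def
  proof (intro conjI allI impI ballI)
    fix h assume h: "Suc h < m"
    have "real (r (Suc h)) \<le> 2 * R / l (Suc h)" by (rule rle2[OF h])
    also have "\<dots> \<le> 2 * R / (2 / \<omega> * l h)" using l(2)[of h] l(4)[of h] \<omega> R0 l(4)[of "Suc h"] by (intro divide_left_mono) auto
    also have "\<dots> = \<omega> * (R / l h)" using \<omega> by simp
    also have "\<dots> \<le> \<omega> * real (r h)" using rge \<omega> by (intro mult_left_mono) auto
    finally show "real (r (Suc h)) \<le> \<omega> * real (r h)" .
  next
    fix h show "R \<le> real (r h) * ln (of_int (q h))" using rge'[of h] by (simp add: l_def)
  qed (use R0 r0 q1 cop T1 P l1P in \<open>auto simp: T_def ebox_def\<close>)
  from roth[OF this] obtain I where I: "vars_below m I" "wt m r I \<le> m * \<eta>"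
      and nz: "ev m (\<lambda>h. of_int (p h) / of_int (q h)) (hasse m I P) \<noteq> 0" by blast
  define \<beta> where "\<beta> = (\<lambda>h. real_of_int (p h) / of_int (q h))"
  define Q where "Q = hasse m I P"
  have kQ: "lookup J v \<le> r v" if "J \<in> keys Q" "v < m" for J v
  proof -
    have "J + I \<in> ebox m r" using keys_hasse_le[OF I(1)] that P(3) by (auto simp: Q_def)
    then have "lookup (J + I) v \<le> r v" using that by (auto simp: ebox_def)
    then show ?thesis by (simp add: lookup_add)
  qed
  have tP: "tdeg m J \<le> T" if "J \<in> keys P" for J
    unfolding tdeg_def T_def using that P(3) by (intro sum_mono) (auto simp: ebox_def)
  have tQ: "tdeg m J \<le> T" if "J \<in> keys Q" for J
    unfolding tdeg_def T_def using kQ that by (intro sum_mono) auto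
  have l1Q: "l1 Q \<le> 2 ^ T * l1 P" unfolding Q_def by (rule l1_hasse) (use tP in \<open>auto simp: tdeg_def\<close>)
  have lower: "exp (- (m * ((1 + \<eta>) * R))) \<le> \<bar>ev m \<beta> Q\<bar>"
  proof -
    let ?D = "\<Prod>v<m. real_of_int (q v) ^ r v"
    have q0: "q h > 0" for h using q1[of h] by simp
    then have D0: "?D > 0" by (intro prod_pos) simp
    have "?D * ev m \<beta> Q \<in> \<int>" unfolding \<beta>_def
      using P(2) I(1) kQ q0 by (intro ev_rational_integer) (auto simp: Q_def int_coeffs_hasse)
    moreover have "?D * ev m \<beta> Q \<noteq> 0" using D0 nz[folded \<beta>_def Q_def] by (metis less_irrefl mult_eq_0_iff)
    ultimately have "1 \<le> \<bar>?D * ev m \<beta> Q\<bar>" by (metis Ints_nonzero_abs_ge1)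
    then have "1 / ?D \<le> \<bar>ev m \<beta> Q\<bar>" using D0 by (simp add: abs_mult field_simps)
    moreover have "?D \<le> exp (m * ((1 + \<eta>) * R))"
    proof -
      have "?D = (\<Prod>v<m. exp (real (r v) * l v))"
      proof (intro prod.cong refl)
        fix v
        have "real_of_int (q v) > 0" using q1[of v] by simp
        then show "real_of_int (q v) ^ r v = exp (real (r v) * l v)" by (simp add: exp_of_nat_mult l_def)
      qed
      also have "\<dots> \<le> (\<Prod>v<m. exp ((1 + \<eta>) * R))" using rle' by (intro prod_mono) auto
      also have "\<dots> = exp (m * ((1 + \<eta>) * R))" by (simp add: exp_of_nat_mult)
      finally show ?thesis .
    qed
    then have "inverse (exp (m * ((1 + \<eta>) * R))) \<le> inverse ?D" by (rule le_imp_inverse_le[OF _ D0])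
    then have "exp (- (m * ((1 + \<eta>) * R))) \<le> 1 / ?D" by (simp add: exp_minus inverse_eq_divide)
    ultimately show ?thesis by linarith
  qed
  \<comment> \<open>\<open>P\<close> vanishes at \<alpha> up to weight
    \<open>m / 2 - m * \<eta>\<close>, and the derivative \<open>I\<close> spends at most
    \<open>m * \<eta>\<close> of it.\<close>
  define \<gamma> where "\<gamma> = (2 + \<delta>) * (m / 2 - 2 * m * \<eta>) * R"
  have term_bound: "\<bar>ev m (\<lambda>_. \<alpha>) (hasse m J Q) * meval m (\<lambda>v. \<beta> v - \<alpha>) J\<bar> \<le> (2 ^ T * (2 ^ T * l1 P) * A ^ T) * exp (- \<gamma>)"
    if J: "J \<in> ebox m r" for J
  proof (cases "wt m r (J + I) \<le> m / 2 - m * \<eta>")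
    case True
    have vJ: "vars_below m J" using J by (simp add: ebox_def)
    have "ev m (\<lambda>_. \<alpha>) (hasse m (J + I) P) = 0" using True vJ I by (intro van) (auto simp: vars_below_add)
    then have "ev m (\<lambda>_. \<alpha>) (hasse m J Q) = 0" unfolding Q_def hasse_hasse[OF I(1) vJ] ins_mult[OF id_hom] by simp
    moreover have "0 \<le> (2 ^ T * (2 ^ T * l1 P) * A ^ T) * exp (- \<gamma>)"
      by (intro mult_nonneg_nonneg zero_le_power l1_nonneg) (auto simp: A_def)
    ultimately show ?thesis by simp
  next
    case False
    then have wJ: "m / 2 - 2 * m * \<eta> \<le> wt m r J" using I(2) by (simp add: wt_add)
    have vJ: "vars_below m J" using J by (simp add: ebox_def)
    have "\<bar>meval m (\<lambda>v. \<beta> v - \<alpha>) J\<bar> = (\<Prod>v<m. \<bar>\<beta> v - \<alpha>\<bar> ^ lookup J v)"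
      by (simp add: meval_def abs_prod power_abs)
    also have "\<dots> \<le> (\<Prod>v<m. exp (- (2 + \<delta>) * (R * (real (lookup J v) / real (r v)))))"
    proof (intro prod_mono conjI)
      fix v assume v: "v \<in> {..<m}"
      have "\<bar>\<beta> v - \<alpha>\<bar> \<le> of_int (q v) powr (- (2 + \<delta>))" using app[of v] by (simp add: \<beta>_def abs_minus_commute)
      also have "\<dots> = exp (- (2 + \<delta>) * l v)" using q1[of v] by (simp add: powr_def l_def)
      finally have "\<bar>\<beta> v - \<alpha>\<bar> ^ lookup J v \<le> exp (- (2 + \<delta>) * l v) ^ lookup J v" by (intro power_mono) auto
      also have "\<dots> = exp (real (lookup J v) * (- (2 + \<delta>) * l v))" by (rule exp_of_nat_mult[symmetric])
      also have "\<dots> \<le> exp (- (2 + \<delta>) * (R * (real (lookup J v) / real (r v))))"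
      proof -
        have "R * (real (lookup J v) / real (r v)) = (R / real (r v)) * real (lookup J v)" by simp
        also have "\<dots> \<le> l v * real (lookup J v)" using rge'[of v] r0[of v] by (intro mult_right_mono) (auto simp: field_simps)
        finally have "(2 + \<delta>) * (R * (real (lookup J v) / real (r v))) \<le> (2 + \<delta>) * (l v * real (lookup J v))"
          using \<delta> by (intro mult_left_mono) auto
        moreover have "real (lookup J v) * (- (2 + \<delta>) * l v) = - ((2 + \<delta>) * (l v * real (lookup J v)))" by (simp add: algebra_simps)
        moreover have "- (2 + \<delta>) * (R * (real (lookup J v) / real (r v))) = - ((2 + \<delta>) * (R * (real (lookup J v) / real (r v))))" by (rule mult_minus_left)
        ultimately show ?thesis by (simp only: exp_le_cancel_iff neg_le_iff_le)
      qed
      finally show "\<bar>\<beta> v - \<alpha>\<bar> ^ lookup J v \<le> exp (- (2 + \<delta>) * (R * (real (lookup J v) / real (r v))))" .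
    qed auto
    also have "\<dots> = exp (- (2 + \<delta>) * (R * wt m r J))"
      by (simp only: exp_sum[symmetric] finite_lessThan sum_distrib_left[symmetric] wt_def)
    also have "\<dots> \<le> exp (- \<gamma>)"
    proof -
      have "(2 + \<delta>) * (R * (m / 2 - 2 * m * \<eta>)) \<le> (2 + \<delta>) * (R * wt m r J)"
        using wJ R0 \<delta> by (intro mult_left_mono) auto
      moreover have "- (2 + \<delta>) * (R * wt m r J) = - ((2 + \<delta>) * (R * wt m r J))" by (rule mult_minus_left)
      moreover have "\<gamma> = (2 + \<delta>) * (R * (m / 2 - 2 * m * \<eta>))" by (simp add: \<gamma>_def mult_ac)
      ultimately show ?thesis by (simp only: exp_le_cancel_iff neg_le_iff_le)
    qed
    finally have 1: "\<bar>meval m (\<lambda>v. \<beta> v - \<alpha>) J\<bar> \<le> exp (- \<gamma>)" .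
    have "\<bar>ev m (\<lambda>_. \<alpha>) (hasse m J Q)\<bar> \<le> l1 (hasse m J Q) * A ^ T"
    proof (rule ev_abs_le)
      fix L assume "L \<in> keys (hasse m J Q)"
      then have "L + J \<in> keys Q" by (rule keys_hasse_le[OF vJ])
      then have "tdeg m (L + J) \<le> T" by (rule tQ)
      then show "tdeg m L \<le> T" by (simp add: tdeg_def lookup_add sum.distrib)
    qed (auto simp: A_def)
    also have "\<dots> \<le> (2 ^ T * (2 ^ T * l1 P)) * A ^ T"
    proof (intro mult_right_mono)
      have "l1 (hasse m J Q) \<le> 2 ^ T * l1 Q" by (rule l1_hasse) (use tQ in \<open>auto simp: tdeg_def\<close>)
      also have "\<dots> \<le> 2 ^ T * (2 ^ T * l1 P)" using l1Q by (intro mult_left_mono) auto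
      finally show "l1 (hasse m J Q) \<le> 2 ^ T * (2 ^ T * l1 P)" .
    qed (auto simp: A_def)
    finally show ?thesis unfolding abs_mult using 1 by (intro mult_mono) (auto simp: l1_nonneg A_def)
  qed
  have "ev m \<beta> Q = ev m (\<lambda>v. \<alpha> + (\<beta> v - \<alpha>)) Q" by simp
  also have "\<dots> = (\<Sum>J\<in>ebox m r. ev m (\<lambda>_. \<alpha>) (hasse m J Q) * meval m (\<lambda>v. \<beta> v - \<alpha>) J)"
    by (rule mpol_taylor[OF id_hom]) (rule kQ)
  finally have "\<bar>ev m \<beta> Q\<bar> \<le> (\<Sum>J\<in>ebox m r. \<bar>ev m (\<lambda>_. \<alpha>) (hasse m J Q) * meval m (\<lambda>v. \<beta> v - \<alpha>) J\<bar>)" by simp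
  also have "\<dots> \<le> (\<Sum>J\<in>ebox m r. (2 ^ T * (2 ^ T * l1 P) * A ^ T) * exp (- \<gamma>))" by (intro sum_mono term_bound)
  also have "\<dots> = real (card (ebox m r)) * ((2 ^ T * (2 ^ T * l1 P) * A ^ T) * exp (- \<gamma>))" by simp
  also have "\<dots> \<le> 2 ^ T * ((2 ^ T * (2 ^ T * K ^ T) * A ^ T) * exp (- \<gamma>))"
  proof (intro mult_mono mult_left_mono mult_right_mono)
    have "real (card (ebox m r)) \<le> real (2 ^ T)" using card_box_le[of m r] by (simp only: of_nat_le_iff T_def)
    then show "real (card (ebox m r)) \<le> 2 ^ T" by simp
  qed (use P(4) K in \<open>auto simp: A_def l1_nonneg\<close>)
  also have "\<dots> = K2 ^ T * exp (- \<gamma>)"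
  proof -
    have "2 ^ T * (2 ^ T * (2 ^ T * K ^ T) * A ^ T) = (2 * (2 * (2 * K) * A)) ^ T" by (simp only: power_mult_distrib)
    also have "2 * (2 * (2 * K) * A) = K2" by (simp add: K2_def)
    finally show ?thesis by (simp only: mult.assoc[symmetric])
  qed
  also have "\<dots> \<le> exp (m * \<eta> * R) * exp (- \<gamma>)" using T3 by (intro mult_right_mono) auto
  finally have "exp (- (m * ((1 + \<eta>) * R))) \<le> exp (m * \<eta> * R) * exp (- \<gamma>)" by (rule order_trans[OF lower])
  then have "exp (- (m * ((1 + \<eta>) * R))) \<le> exp (m * \<eta> * R + - \<gamma>)" by (simp only: mult_exp_exp)
  then have "\<gamma> \<le> m * \<eta> * R + m * ((1 + \<eta>) * R)" by simp
  then have "(2 + \<delta>) * (1 / 2 - 2 * \<eta>) * (m * R) \<le> (1 + 2 * \<eta>) * (m * R)" by (simp add: \<gamma>_def algebra_simps)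
  then have "(2 + \<delta>) * (1 / 2 - 2 * \<eta>) \<le> 1 + 2 * \<eta>" using m0 R0 by (simp add: mult_le_cancel_right)
  moreover have \<delta>\<eta>: "\<delta> = 20 * \<eta>" by (simp add: \<eta>_def)
  have "(2 + \<delta>) * (1 / 2 - 2 * \<eta>) = 1 + 6 * \<eta> - 40 * \<eta> * \<eta>" unfolding \<delta>\<eta> by (simp add: algebra_simps)
  moreover have "40 * \<eta> * \<eta> \<le> 40 * \<eta> * (1 / 20)" using \<delta> \<eta> by (intro mult_left_mono) (auto simp: \<delta>\<eta>)
  ultimately show False using \<eta> by linarith
qed

text \<open>The finitely many denominators up to \<open>Q\<close> are absorbed into the constant,
  since an irrational number keeps a positive distance from the fractions with a given denominator.
  Fractions not in lowest terms follow because the bound only weakens as the denominator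
  grows.\<close>

theorem roth:
  fixes \<alpha> \<delta> :: real
  assumes alg: "algebraic \<alpha>" and irr: "\<alpha> \<notin> \<rat>" and \<delta>: "0 < \<delta>" "\<delta> \<le> 1"
  shows "\<exists>c>0. \<forall>p q::int. q > 0 \<longrightarrow> c * of_int q powr (- (2 + \<delta>)) \<le> \<bar>\<alpha> - of_int p / of_int q\<bar>"
proof -
  obtain Q where Q: "\<And>p q::int. q > Q \<Longrightarrow> coprime p q \<Longrightarrow> of_int q powr (- (2 + \<delta>)) \<le> \<bar>\<alpha> - of_int p / of_int q\<bar>"
    using roth_eventually[OF alg \<delta>] by blast
  define g where "g q = \<bar>of_int q * \<alpha> - of_int (round (of_int q * \<alpha>))\<bar> / of_int q" for q :: int
  have g_le: "g q \<le> \<bar>\<alpha> - of_int p / of_int q\<bar>" if "q > 0" for p q :: int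
  proof -
    have "\<bar>of_int q * \<alpha> - of_int (round (of_int q * \<alpha>))\<bar> \<le> \<bar>of_int q * \<alpha> - of_int p\<bar>" by (rule round_diff_minimal)
    also have "of_int q * \<alpha> - of_int p = of_int q * (\<alpha> - of_int p / of_int q)" using that by (simp add: right_diff_distrib)
    also have "\<bar>\<dots>\<bar> = of_int q * \<bar>\<alpha> - of_int p / of_int q\<bar>" using that by (simp add: abs_mult)
    finally show ?thesis using that by (simp add: g_def field_simps)
  qed
  have g_pos: "g q > 0" if "q > 0" for q
  proof -
    have "of_int q * \<alpha> \<noteq> of_int k" for k
    proof
      assume "of_int q * \<alpha> = of_int k"
      then have "\<alpha> = of_int k / of_int q" using that by (simp add: field_simps)
      then show False using irr by auto
    qed
    then show ?thesis using that by (simp add: g_def)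
  qed
  \<comment> \<open>The inserted 1 covers the denominators beyond \<open>Q\<close> and keeps the set
    nonempty.\<close>
  define c where "c = Min (insert 1 (g ` {1..Q}))"
  have c: "c > 0" "c \<le> 1" using g_pos by (auto simp: c_def Min_gr_iff)
  have cg: "c \<le> g q" if "q \<in> {1..Q}" for q unfolding c_def by (rule Min_le) (use that in auto)
  have cop: "c * of_int q powr (- (2 + \<delta>)) \<le> \<bar>\<alpha> - of_int p / of_int q\<bar>" if "q > 0" "coprime p q" for p q :: int
  proof (cases "q \<le> Q")
    case True
    have "real_of_int q powr (- (2 + \<delta>)) \<le> real_of_int q powr 0" using that \<delta> by (intro powr_mono) auto
    then have "real_of_int q powr (- (2 + \<delta>)) \<le> 1" using that by simp
    then have "c * of_int q powr (- (2 + \<delta>)) \<le> c * 1" using c by (intro mult_left_mono) auto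
    also have "\<dots> \<le> g q" using cg[of q] True that by simp
    also have "\<dots> \<le> \<bar>\<alpha> - of_int p / of_int q\<bar>" by (rule g_le[OF that(1)])
    finally show ?thesis .
  next
    case False
    have "c * real_of_int q powr (- (2 + \<delta>)) \<le> 1 * real_of_int q powr (- (2 + \<delta>))" using c by (intro mult_right_mono) auto
    moreover have "real_of_int q powr (- (2 + \<delta>)) \<le> \<bar>\<alpha> - of_int p / of_int q\<bar>" using Q[of q p] False that by linarith
    ultimately show ?thesis by linarith
  qed
  have "c * of_int q powr (- (2 + \<delta>)) \<le> \<bar>\<alpha> - of_int p / of_int q\<bar>" if q: "q > 0" for p q :: int
  proof -
    define d where "d = gcd p q"
    have d: "d > 0" using q by (simp add: d_def)
    obtain p' q' where pq: "p = p' * d" "q = q' * d" "coprime p' q'"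
      using gcd_coprime_exists[of p q] d unfolding d_def by auto
    have q': "q' > 0" "q' \<le> q" using q d pq by (auto simp: zero_less_mult_iff)
    have "of_int q powr (- (2 + \<delta>)) \<le> of_int q' powr (- (2 + \<delta>))" using q' \<delta> by (intro powr_mono2') auto
    then have "c * of_int q powr (- (2 + \<delta>)) \<le> c * of_int q' powr (- (2 + \<delta>))" using c by (intro mult_left_mono) auto
    also have "\<dots> \<le> \<bar>\<alpha> - of_int p' / of_int q'\<bar>" by (rule cop[OF q'(1) pq(3)])
    also have "of_int p' / of_int q' = (of_int p / of_int q :: real)" using d by (simp add: pq)
    finally show ?thesis .
  qed
  then show ?thesis using c(1) by blast
qed

subsection \<open>Sawtooth sums\<close>

definition sawtooth :: "real \<Rightarrow> real" where "sawtooth x = frac x - 1 / 2"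

lemma sum_shifted_div:
  fixes q :: nat and m :: int assumes "q > 0"
  shows "(\<Sum>k<q. (m + int k) div int q) = m"
proof -
  let ?f = "\<lambda>m. \<Sum>k<q. (m + int k) div int q"
  have step: "?f (m + 1) = ?f m + 1" for m
  proof -
    have "?f (m + 1) + m div int q = (\<Sum>k<Suc q. (m + int k) div int q)"
      by (subst sum.lessThan_Suc_shift) (simp add: add_ac)
    also have "\<dots> = ?f m + (m + int q) div int q" by simp
    also have "(m + int q) div int q = m div int q + 1" using assms by simp
    finally show ?thesis by simp
  qed
  have zero: "?f 0 = 0" by (intro sum.neutral) auto
  show ?thesis
  proof (induction m rule: int_induct[of _ 0])
    case base then show ?case using zero by simp
  next
    case (step1 i) then show ?case using step[of i] by simp
  next
    case (step2 i) then show ?case using step[of "i - 1"] by simp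
  qed
qed

lemma hermite_floor_identity:
  assumes "q > (0::nat)"
  shows "(\<Sum>k<q. \<lfloor>real k / real q + y\<rfloor>) = \<lfloor>real q * y\<rfloor>"
proof -
  have "\<lfloor>real k / real q + y\<rfloor> = (\<lfloor>real q * y\<rfloor> + int k) div int q" for k
  proof -
    have "real k / real q + y = (real q * y + of_int (int k)) / real_of_int (int q)" using assms by (simp add: field_simps)
    then have "\<lfloor>real k / real q + y\<rfloor> = \<lfloor>real q * y + of_int (int k)\<rfloor> div int q"
      by (simp only: floor_divide_real_eq_div[OF of_nat_0_le_iff])
    then show ?thesis by simp
  qed
  then show ?thesis using sum_shifted_div[OF assms] by simp
qed

lemma sum_residues:
  fixes p :: int and q :: nat and F :: "nat \<Rightarrow> 'a::comm_monoid_add"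
  assumes "q > 0" "coprime p (int q)"
  shows "(\<Sum>n<q. F (nat ((int n * p) mod int q))) = (\<Sum>k<q. F k)"
proof -
  let ?g = "\<lambda>n. nat ((int n * p) mod int q)"
  have "inj_on ?g {..<q}"
  proof (rule inj_onI)
    fix a b assume ab: "a \<in> {..<q}" "b \<in> {..<q}" "?g a = ?g b"
    have "(int a * p) mod int q = (int b * p) mod int q" using ab(3) assms(1) by (simp add: nat_eq_iff)
    then have "int q dvd int a * p - int b * p" by (simp add: mod_eq_dvd_iff)
    then have "int q dvd (int a - int b) * p" by (simp add: left_diff_distrib)
    then have "int q dvd int a - int b" using assms(2) by (simp add: coprime_dvd_mult_left_iff coprime_commute)
    moreover have "\<bar>int a - int b\<bar> < int q" using ab by auto
    ultimately show "a = b" using dvd_imp_le_int[of "int a - int b" "int q"] by fastforce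
  qed
  moreover have "?g ` {..<q} \<subseteq> {..<q}" using assms(1) by (auto simp: nat_less_iff)
  ultimately have "bij_betw ?g {..<q} {..<q}" by (simp add: bij_betw_def endo_inj_surj)
  then show ?thesis by (rule sum.reindex_bij_betw)
qed

text \<open>For \<open>n < q\<close> the value \<open>n * \<alpha>\<close> is within
  \<open>1 / q\<close> of \<open>n * p / q\<close>, and the residues of \<open>n * p\<close> run
  through all classes. By monotonicity the floors lie between those for the rational slope with
  \<beta> shifted by \<open>1 / q\<close> either way, and Hermite's identity shows that this shift
  changes the floor sum by only 1.\<close>

lemma sawtooth_block:
  fixes p :: int and q :: nat
  assumes q: "q > 0" and cop: "coprime p (int q)" and \<alpha>: "\<bar>\<alpha> - of_int p / real q\<bar> \<le> 1 / (real q)\<^sup>2"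
  shows "\<bar>\<Sum>n<q. sawtooth (real n * \<alpha> + \<beta>)\<bar> \<le> 4"
proof -
  define c0 where "c0 = (\<Sum>n<q. (int n * p) div int q)"
  have split: "real n * of_int p / real q = of_int ((int n * p) div int q) + real (nat ((int n * p) mod int q)) / real q" for n
  proof -
    have "real_of_int (int n * p) = of_int (((int n * p) div int q) * int q + (int n * p) mod int q)" by (simp only: div_mult_mod_eq)
    then have "real n * of_int p = of_int ((int n * p) div int q) * real q + of_int ((int n * p) mod int q)"
      by (simp only: of_int_add of_int_mult of_int_of_nat_eq)
    moreover have "real_of_int ((int n * p) mod int q) = real (nat ((int n * p) mod int q))" using q by simp
    ultimately show ?thesis using q by (simp add: field_simps)
  qed
  have floors: "(\<Sum>n<q. \<lfloor>real n * of_int p / real q + y\<rfloor>) = c0 + \<lfloor>real q * y\<rfloor>" for y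
  proof -
    have "(\<Sum>n<q. \<lfloor>real n * of_int p / real q + y\<rfloor>) = (\<Sum>n<q. (int n * p) div int q + \<lfloor>real (nat ((int n * p) mod int q)) / real q + y\<rfloor>)"
      unfolding split by (intro sum.cong refl) (simp add: add.assoc)
    also have "\<dots> = c0 + (\<Sum>k<q. \<lfloor>real k / real q + y\<rfloor>)"
      unfolding sum.distrib c0_def sum_residues[OF q cop, of "\<lambda>k. \<lfloor>real k / real q + y\<rfloor>"] ..
    finally show ?thesis by (simp add: hermite_floor_identity[OF q])
  qed
  have sumy: "(\<Sum>n<q. real n * of_int p / real q) = of_int c0 + (real q - 1) / 2"
  proof -
    have "(\<Sum>n<q. real n * of_int p / real q) = of_int c0 + (\<Sum>k<q. real k / real q)"
      unfolding split sum.distrib c0_def sum_residues[OF q cop, of "\<lambda>k. real k / real q"] by simp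
    also have "(\<Sum>k<q. real k / real q) = (real q - 1) / 2"
    proof -
      have "(\<Sum>k<n. real k) = real n * (real n - 1) / 2" for n by (induction n) (auto simp: field_simps)
      then show ?thesis using q by (simp add: sum_divide_distrib[symmetric])
    qed
    finally show ?thesis .
  qed
  have near: "\<bar>(real n * \<alpha> + \<beta>) - (real n * of_int p / real q + \<beta>)\<bar> \<le> 1 / real q" if "n < q" for n
  proof -
    have "(real n * \<alpha> + \<beta>) - (real n * of_int p / real q + \<beta>) = real n * (\<alpha> - of_int p / real q)"
      by (simp add: right_diff_distrib)
    then have "\<bar>(real n * \<alpha> + \<beta>) - (real n * of_int p / real q + \<beta>)\<bar> = real n * \<bar>\<alpha> - of_int p / real q\<bar>"
      by (simp add: abs_mult)
    also have "\<dots> \<le> real q * (1 / (real q)\<^sup>2)" using that \<alpha> by (intro mult_mono) auto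
    also have "\<dots> = 1 / real q" using q by (simp add: power2_eq_square)
    finally show ?thesis .
  qed
  have up: "(\<Sum>n<q. \<lfloor>real n * \<alpha> + \<beta>\<rfloor>) \<le> c0 + \<lfloor>real q * \<beta>\<rfloor> + 1"
  proof -
    have "(\<Sum>n<q. \<lfloor>real n * \<alpha> + \<beta>\<rfloor>) \<le> (\<Sum>n<q. \<lfloor>real n * of_int p / real q + (\<beta> + 1 / real q)\<rfloor>)"
      using near by (intro sum_mono floor_mono) (fastforce simp: abs_le_iff)
    also have "\<dots> = c0 + \<lfloor>real q * \<beta>\<rfloor> + 1" unfolding floors using q by (simp add: distrib_left)
    finally show ?thesis .
  qed
  have lo: "c0 + \<lfloor>real q * \<beta>\<rfloor> - 1 \<le> (\<Sum>n<q. \<lfloor>real n * \<alpha> + \<beta>\<rfloor>)"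
  proof -
    have "c0 + \<lfloor>real q * \<beta>\<rfloor> - 1 = (\<Sum>n<q. \<lfloor>real n * of_int p / real q + (\<beta> - 1 / real q)\<rfloor>)"
      unfolding floors using q by (simp add: right_diff_distrib)
    also have "\<dots> \<le> (\<Sum>n<q. \<lfloor>real n * \<alpha> + \<beta>\<rfloor>)"
      using near by (intro sum_mono floor_mono) (fastforce simp: abs_le_iff)
    finally show ?thesis .
  qed
  have err: "\<bar>(\<Sum>n<q. real n * \<alpha> + \<beta>) - (\<Sum>n<q. real n * of_int p / real q + \<beta>)\<bar> \<le> 1"
  proof -
    have "\<bar>\<Sum>n<q. (real n * \<alpha> + \<beta>) - (real n * of_int p / real q + \<beta>)\<bar> \<le> (\<Sum>n<q. 1 / real q)"
      using near by (intro order_trans[OF sum_abs] sum_mono) auto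
    moreover have "(\<Sum>n<q. 1 / real q) = 1" using q by simp
    ultimately show ?thesis by (simp only: sum_subtractf)
  qed
  have "(\<Sum>n<q. sawtooth (real n * \<alpha> + \<beta>)) = (\<Sum>n<q. real n * \<alpha> + \<beta>) - of_int (\<Sum>n<q. \<lfloor>real n * \<alpha> + \<beta>\<rfloor>) - real q / 2"
    by (simp add: sawtooth_def frac_def sum_subtractf)
  moreover have "(\<Sum>n<q. real n * of_int p / real q + \<beta>) = of_int c0 + (real q - 1) / 2 + real q * \<beta>"
    by (simp only: sum.distrib sumy) simp
  moreover have "real_of_int (\<Sum>n<q. \<lfloor>real n * \<alpha> + \<beta>\<rfloor>) \<le> of_int c0 + of_int \<lfloor>real q * \<beta>\<rfloor> + 1"
    using of_int_le_iff[where 'a = real, THEN iffD2, OF up] by simp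
  moreover have "of_int c0 + of_int \<lfloor>real q * \<beta>\<rfloor> - 1 \<le> real_of_int (\<Sum>n<q. \<lfloor>real n * \<alpha> + \<beta>\<rfloor>)"
    using of_int_le_iff[where 'a = real, THEN iffD2, OF lo] by simp
  moreover have "real_of_int \<lfloor>real q * \<beta>\<rfloor> \<le> real q * \<beta>" "real q * \<beta> < real_of_int \<lfloor>real q * \<beta>\<rfloor> + 1" by linarith+
  ultimately show ?thesis using err by (simp only: abs_le_iff) argo
qed

text \<open>Dirichlet gives a denominator \<open>q \<le> N\<close> with error below
  \<open>1 / (N * q)\<close>, and the hypothesis then forces
  \<open>N / q \<le> N powr \<delta> / c\<close>. The blocks of length \<open>q\<close> cost 4 each;
  the remainder has at most half the length, so the induction sums a geometric series.\<close>

lemma sawtooth_sum_bound: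
  assumes c: "c > 0" and \<delta>: "\<delta> > 0"
    and dio: "\<And>p q::int. q > 0 \<Longrightarrow> c * of_int q powr (- (2 + \<delta>)) \<le> \<bar>\<alpha> - of_int p / of_int q\<bar>"
  shows "\<exists>C\<ge>0. \<forall>N \<beta>. \<bar>\<Sum>n<N. sawtooth (real n * \<alpha> + \<beta>)\<bar> \<le> C * real N powr \<delta>"
proof -
  \<comment> \<open>Solves \<open>4 / c + C * (1 / 2) powr \<delta> = C\<close>: the cost of the
    blocks plus that of the remainder.\<close>
  define C where "C = (4 / c) / (1 - (1 / 2) powr \<delta>)"
  have half: "(1 / 2 :: real) powr \<delta> < 1" using powr_less_mono2[of \<delta> "1 / 2" 1] \<delta> by simp
  have C0: "C \<ge> 0" using half c by (simp add: C_def)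
  have ne: "1 - (1 / 2) powr \<delta> \<noteq> 0" using half by linarith
  have "C * (1 - (1 / 2) powr \<delta>) = 4 / c" using C_def nonzero_eq_divide_eq[OF ne, of C "4 / c"] by blast
  then have C_eq: "4 / c + C * (1 / 2) powr \<delta> = C" by (simp add: right_diff_distrib)
  have "\<bar>\<Sum>n<N. sawtooth (real n * \<alpha> + \<beta>)\<bar> \<le> C * real N powr \<delta>" for N \<beta>
  proof (induction N arbitrary: \<beta> rule: less_induct)
    case (less N)
    show ?case
    proof (cases "N = 0")
      case False
      then have N: "N > 0" by simp
      obtain p k where k: "coprime p k" "0 < k" "k \<le> int N" "\<bar>of_int k * \<alpha> - of_int p\<bar> < 1 / N"
        by (rule Dirichlet_approx_coprime[OF N])
      define q where "q = nat k"
      have q: "q > 0" "int q = k" "q \<le> N" using k by (auto simp: q_def)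
      have kq: "real_of_int k = real q" using q(2) by (metis of_int_of_nat_eq)
      have "real q * \<alpha> - of_int p = real q * (\<alpha> - of_int p / real q)" using q(1) by (simp add: right_diff_distrib)
      then have eq: "real q * \<bar>\<alpha> - of_int p / real q\<bar> = \<bar>real q * \<alpha> - of_int p\<bar>" by (simp add: abs_mult)
      have near: "real q * \<bar>\<alpha> - of_int p / real q\<bar> < 1 / N" unfolding eq using k(4) by (simp add: kq)
      have "\<bar>\<alpha> - of_int p / real q\<bar> \<le> 1 / (real q)\<^sup>2"
      proof -
        have "real q * \<bar>\<alpha> - of_int p / real q\<bar> \<le> 1 / real q"
          using near q N by (smt (verit) frac_le of_nat_0_less_iff of_nat_mono)
        then show ?thesis using q(1) by (simp add: field_simps power2_eq_square)
      qed
      then have block: "\<bar>\<Sum>n<q. sawtooth (real n * \<alpha> + \<beta>')\<bar> \<le> 4" for \<beta>'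
        using sawtooth_block[of q p \<alpha> \<beta>'] q k(1) by simp
      have Nq: "real N / real q \<le> real N powr \<delta> / c"
      proof -
        have "c * real q powr (- (2 + \<delta>)) \<le> \<bar>\<alpha> - of_int p / real q\<bar>" using dio[OF k(2), of p] by (simp add: kq)
        then have "real q * (c * real q powr (- (2 + \<delta>))) \<le> real q * \<bar>\<alpha> - of_int p / real q\<bar>" by (rule mult_left_mono) simp
        then have "c * (real q * real q powr (- (2 + \<delta>))) < 1 / N" using near by (simp add: mult_ac)
        also have "real q * real q powr (- (2 + \<delta>)) = real q powr (1 + - (2 + \<delta>))"
          using q(1) by (subst powr_add) simp
        also have "\<dots> = inverse (real q * real q powr \<delta>)"
        proof -
          have "1 + - (2 + \<delta>) = - (1 + \<delta>)" by simp
          then show ?thesis using q(1) by (simp only: powr_minus powr_add) simp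
        qed
        finally have "c * N < real q * real q powr \<delta>" using N q(1) by (simp add: field_simps)
        also have "\<dots> \<le> real q * real N powr \<delta>" using q \<delta> by (intro mult_left_mono powr_mono2) auto
        finally show ?thesis using q(1) c by (simp add: field_simps)
      qed
      define a where "a = N div q"
      define b where "b = N mod q"
      have N_eq: "N = a * q + b" by (simp add: a_def b_def)
      have b: "b < q" "b < N" "2 * b \<le> N"
      proof -
        show "b < q" using q(1) by (simp add: b_def)
        then show "b < N" using q(3) by linarith
        have "a \<ge> 1" using q by (simp add: a_def div_greater_zero_iff Suc_leI)
        then have "q \<le> a * q" by simp
        then show "2 * b \<le> N" using N_eq \<open>b < q\<close> by linarith
      qed
      have split: "(\<Sum>n<a' * q + b'. sawtooth (real n * \<alpha> + \<beta>)) = (\<Sum>i<a'. \<Sum>n<q. sawtooth (real n * \<alpha> + (\<beta> + real (i * q) * \<alpha>))) + (\<Sum>n<b'. sawtooth (real n * \<alpha> + (\<beta> + real (a' * q) * \<alpha>)))" for a' b'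
      proof (induction a' arbitrary: b')
        case (Suc a')
        have "(\<Sum>n<Suc a' * q + b'. sawtooth (real n * \<alpha> + \<beta>)) = (\<Sum>n<a' * q + (q + b'). sawtooth (real n * \<alpha> + \<beta>))"
          by (simp add: add_ac)
        also have "\<dots> = (\<Sum>i<a'. \<Sum>n<q. sawtooth (real n * \<alpha> + (\<beta> + real (i * q) * \<alpha>))) + (\<Sum>n<q + b'. sawtooth (real n * \<alpha> + (\<beta> + real (a' * q) * \<alpha>)))"
          by (rule Suc.IH)
        also have "(\<Sum>n<q + b'. sawtooth (real n * \<alpha> + (\<beta> + real (a' * q) * \<alpha>))) = (\<Sum>n<q. sawtooth (real n * \<alpha> + (\<beta> + real (a' * q) * \<alpha>))) + (\<Sum>n<b'. sawtooth (real n * \<alpha> + (\<beta> + real (Suc a' * q) * \<alpha>)))"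
          by (induction b') (auto simp: algebra_simps)
        finally show ?case by simp
      qed simp
      have "\<bar>\<Sum>n<N. sawtooth (real n * \<alpha> + \<beta>)\<bar> \<le> \<bar>\<Sum>i<a. \<Sum>n<q. sawtooth (real n * \<alpha> + (\<beta> + real (i * q) * \<alpha>))\<bar> + \<bar>\<Sum>n<b. sawtooth (real n * \<alpha> + (\<beta> + real (a * q) * \<alpha>))\<bar>"
        by (subst (1) N_eq, subst split) (rule abs_triangle_ineq)
      also have "\<dots> \<le> (\<Sum>i<a. 4) + C * real b powr \<delta>"
        by (intro add_mono order_trans[OF sum_abs] sum_mono block less.IH b(2))
      also have "\<dots> \<le> 4 * (real N powr \<delta> / c) + C * (real N / 2) powr \<delta>"
      proof (intro add_mono mult_left_mono powr_mono2)
        have "real a \<le> real N / real q" unfolding a_def by (rule of_nat_div_le_of_nat)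
        then show "(\<Sum>i<a. 4) \<le> 4 * (real N powr \<delta> / c)" using Nq by simp
      qed (use b C0 \<delta> in auto)
      also have "(real N / 2) powr \<delta> = real N powr \<delta> * (1 / 2) powr \<delta>"
        by (subst powr_mult[symmetric]) simp_all
      also have "4 * (real N powr \<delta> / c) + C * (real N powr \<delta> * (1 / 2) powr \<delta>) = (4 / c + C * (1 / 2) powr \<delta>) * real N powr \<delta>"
        by (simp add: algebra_simps)
      finally show ?thesis unfolding C_eq .
    qed simp
  qed
  then show ?thesis using C0 by blast
qed

section \<open>Partial summation\<close>

lemma abel_summation:
  fixes w a :: "nat \<Rightarrow> real"
  shows "(\<Sum>i<k. w i * a i) = w k * (\<Sum>i<k. a i) - (\<Sum>i<k. (w (Suc i) - w i) * (\<Sum>j<Suc i. a j))"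
  by (induction k) (simp_all add: algebra_simps)

lemma abel_bound:
  fixes w a :: "nat \<Rightarrow> real"
  assumes A: "\<And>j. j \<le> k \<Longrightarrow> \<bar>\<Sum>i<j. a i\<bar> \<le> A" and w: "\<bar>w k\<bar> \<le> W" "(\<Sum>i<k. \<bar>w (Suc i) - w i\<bar>) \<le> V" and A0: "A \<ge> 0"
  shows "\<bar>\<Sum>i<k. w i * a i\<bar> \<le> (W + V) * A"
proof -
  have "\<bar>\<Sum>i<k. w i * a i\<bar> \<le> \<bar>w k * (\<Sum>i<k. a i)\<bar> + \<bar>\<Sum>i<k. (w (Suc i) - w i) * (\<Sum>j<Suc i. a j)\<bar>"
    by (subst abel_summation) (rule abs_triangle_ineq4)
  also have "\<dots> \<le> W * A + (\<Sum>i<k. \<bar>w (Suc i) - w i\<bar> * A)"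
  proof (intro add_mono)
    show "\<bar>w k * (\<Sum>i<k. a i)\<bar> \<le> W * A" unfolding abs_mult using A[of k] w(1) by (intro mult_mono) auto
    show "\<bar>\<Sum>i<k. (w (Suc i) - w i) * (\<Sum>j<Suc i. a j)\<bar> \<le> (\<Sum>i<k. \<bar>w (Suc i) - w i\<bar> * A)"
      using A by (intro order_trans[OF sum_abs] sum_mono) (auto simp: abs_mult Suc_leI simp del: sum.lessThan_Suc intro!: mult_left_mono)
  qed
  also have "\<dots> \<le> W * A + V * A" using w(2) A0 by (simp add: sum_distrib_right[symmetric] mult_right_mono)
  finally show ?thesis by (simp add: distrib_right)
qed

subsection \<open>Euler--Maclaurin summation\<close>

text \<open>The error, taken as a function \<phi> of the interval length, vanishes at 0, and its
  derivative compares two values of \<open>G'\<close> at distance at most 1. The Lipschitz constant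
  thus stands in for a bound on a second derivative.\<close>

lemma trapezoid_unit:
  fixes H G G' :: "real \<Rightarrow> real"
  assumes H: "\<And>x. (H has_real_derivative G x) (at x)" and G: "\<And>x. (G has_real_derivative G' x) (at x)"
    and lip: "\<And>x y. \<bar>G' x - G' y\<bar> \<le> M2 * \<bar>x - y\<bar>"
  shows "\<bar>H (y + 1) - H y - (G y + G (y + 1)) / 2\<bar> \<le> M2 / 2"
proof -
  have M2: "M2 \<ge> 0" using lip[of 1 0] by simp
  define \<phi> where "\<phi> t = H (y + t) - H y - t * (G y + G (y + t)) / 2" for t
  define \<phi>' where "\<phi>' t = (G (y + t) - G y) / 2 - t * G' (y + t) / 2" for t
  have d: "(\<phi> has_real_derivative \<phi>' t) (at t)" for t
  proof -
    have sh: "((\<lambda>t. y + t) has_real_derivative 1) (at t)" by (auto intro!: derivative_eq_intros)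
    have H': "((\<lambda>t. H (y + t)) has_real_derivative G (y + t)) (at t)" using DERIV_chain2[OF H sh] by simp
    have G'': "((\<lambda>t. G (y + t)) has_real_derivative G' (y + t)) (at t)" using DERIV_chain2[OF G sh] by simp
    have "(\<phi> has_real_derivative (G (y + t) - 0 - (1 * (G y + G (y + t)) + (0 + G' (y + t)) * t) / 2)) (at t)"
      unfolding \<phi>_def[abs_def] by (intro DERIV_diff DERIV_cdivide DERIV_mult DERIV_ident DERIV_add DERIV_const H' G'')
    then show ?thesis by (rule DERIV_cong) (simp add: \<phi>'_def field_simps)
  qed
  obtain z where z: "0 < z" "z < 1" "\<phi> 1 - \<phi> 0 = (1 - 0) * \<phi>' z"
    using MVT2[of 0 1 \<phi> \<phi>'] d by auto
  obtain w where w: "y < w" "w < y + z" "G (y + z) - G y = (y + z - y) * G' w"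
    using MVT2[of y "y + z" G G'] G z by auto
  have eq: "\<phi>' z = z / 2 * (G' w - G' (y + z))" unfolding \<phi>'_def using w(3) by (simp add: algebra_simps)
  have "\<bar>\<phi>' z\<bar> = z / 2 * \<bar>G' w - G' (y + z)\<bar>" unfolding eq abs_mult using z by simp
  also have "\<dots> \<le> z / 2 * (M2 * \<bar>w - (y + z)\<bar>)" using z lip by (intro mult_left_mono) auto
  also have "\<dots> \<le> 1 / 2 * (M2 * 1)" using z w M2 by (intro mult_mono) auto
  finally have "\<bar>\<phi>' z\<bar> \<le> M2 / 2" by simp
  moreover have "\<phi> 0 = 0" by (simp add: \<phi>_def)
  ultimately show ?thesis using z(3) by (simp add: \<phi>_def)
qed

text \<open>The real ends \<open>A\<close> and \<open>B\<close> are kept apart from the integers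
  \<open>L\<close> and \<open>U\<close> that delimit the sum, so that the end corrections become
  sawtooth values: for \<open>U = \<lfloor>B\<rfloor> + 1\<close> the factor
  \<open>B - U + 1 / 2\<close> is exactly \<open>sawtooth B\<close>.\<close>

lemma euler_maclaurin:
  fixes H G G' :: "real \<Rightarrow> real" and L U :: int
  assumes H: "\<And>x. (H has_real_derivative G x) (at x)" and G: "\<And>x. (G has_real_derivative G' x) (at x)"
    and G'b: "\<And>x. \<bar>G' x\<bar> \<le> M1" and lip: "\<And>x y. \<bar>G' x - G' y\<bar> \<le> M2 * \<bar>x - y\<bar>"
    and LU: "L \<le> U" "\<bar>A - of_int L\<bar> \<le> 1" "\<bar>B - of_int U\<bar> \<le> 1"
  shows "\<bar>(\<Sum>y=L..<U. G (of_int y)) - (H B - H A + (A - of_int L + 1 / 2) * G A - (B - of_int U + 1 / 2) * G B)\<bar>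
     \<le> M2 * of_int (U - L) + 3 * M1"
proof -
  have M: "M1 \<ge> 0" "M2 \<ge> 0" using G'b[of 0] lip[of 1 0] by auto
  have Glip: "\<bar>G x - G y\<bar> \<le> M1 * \<bar>x - y\<bar>" for x y
  proof (cases x y rule: linorder_cases)
    case less
    then obtain z where "G y - G x = (y - x) * G' z" using MVT2[of x y G G'] G by auto
    then have "\<bar>G x - G y\<bar> = \<bar>G' z\<bar> * \<bar>x - y\<bar>" by (metis abs_minus_commute abs_mult mult.commute)
    then show ?thesis using G'b by (simp add: mult_right_mono)
  next
    case greater
    then obtain z where "G x - G y = (x - y) * G' z" using MVT2[of y x G G'] G by auto
    then have "\<bar>G x - G y\<bar> = \<bar>G' z\<bar> * \<bar>x - y\<bar>" by (metis abs_mult mult.commute)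
    then show ?thesis using G'b by (simp add: mult_right_mono)
  qed simp
  have Hend: "\<bar>H x - H y - (x - y) * G x\<bar> \<le> M1" if "\<bar>x - y\<bar> \<le> 1" for x y
  proof -
    have "\<exists>z. \<bar>x - z\<bar> \<le> 1 \<and> H x - H y = (x - y) * G z"
    proof (cases x y rule: linorder_cases)
      case less
      then obtain z where "x < z" "z < y" "H y - H x = (y - x) * G z" using MVT2[of x y H G] H by auto
      then show ?thesis using that by (intro exI[of _ z]) (auto simp: algebra_simps)
    next
      case greater
      then obtain z where "y < z" "z < x" "H x - H y = (x - y) * G z" using MVT2[of y x H G] H by auto
      then show ?thesis using that by (intro exI[of _ z]) (auto simp: algebra_simps)
    qed (auto intro!: exI[of _ y])
    then obtain z where z: "\<bar>x - z\<bar> \<le> 1" "H x - H y = (x - y) * G z" by blast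
    have "\<bar>H x - H y - (x - y) * G x\<bar> = \<bar>x - y\<bar> * \<bar>G z - G x\<bar>" unfolding z(2) by (simp add: abs_mult flip: right_diff_distrib)
    also have "\<dots> \<le> 1 * (M1 * 1)"
    proof (intro mult_mono that)
      have "\<bar>G z - G x\<bar> \<le> M1 * \<bar>z - x\<bar>" by (rule Glip)
      also have "\<dots> \<le> M1 * 1" using z(1) M by (intro mult_left_mono) (auto simp: abs_minus_commute)
      finally show "\<bar>G z - G x\<bar> \<le> M1 * 1" .
    qed auto
    finally show ?thesis by simp
  qed
  have trap: "\<bar>(\<Sum>y=L..<L + int n. G (of_int y)) - (H (of_int (L + int n)) - H (of_int L) + (G (of_int L) - G (of_int (L + int n))) / 2)\<bar> \<le> M2 * real n" for n
  proof (induction n)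
    case (Suc n)
    have set: "{L..<L + int (Suc n)} = insert (L + int n) {L..<L + int n}" by auto
    have "\<bar>H (of_int (L + int n) + 1) - H (of_int (L + int n)) - (G (of_int (L + int n)) + G (of_int (L + int n) + 1)) / 2\<bar> \<le> M2 / 2"
      by (rule trapezoid_unit[OF H G lip])
    moreover have "real_of_int (L + int (Suc n)) = of_int (L + int n) + 1" by simp
    moreover have "(\<Sum>y=L..<L + int (Suc n). G (of_int y)) = G (of_int (L + int n)) + (\<Sum>y=L..<L + int n. G (of_int y))"
      unfolding set by (subst sum.insert) auto
    moreover have "M2 * real (Suc n) = M2 * real n + M2" by (simp add: algebra_simps)
    ultimately show ?case using Suc.IH M(2) by (simp only:) argo
  qed simp
  obtain n where n: "U = L + int n" using LU(1) by (metis zle_iff_zadd)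
  have t: "\<bar>(\<Sum>y=L..<U. G (of_int y)) - (H (of_int U) - H (of_int L) + (G (of_int L) - G (of_int U)) / 2)\<bar> \<le> M2 * of_int (U - L)"
    using trap[of n] by (simp add: n)
  have hA: "\<bar>H A - H (of_int L) - (A - of_int L) * G A\<bar> \<le> M1" by (rule Hend[OF LU(2)])
  have hB: "\<bar>H B - H (of_int U) - (B - of_int U) * G B\<bar> \<le> M1" by (rule Hend[OF LU(3)])
  have "\<bar>A - of_int L\<bar> * M1 \<le> 1 * M1" "\<bar>B - of_int U\<bar> * M1 \<le> 1 * M1" using mult_right_mono[OF LU(2) M(1)] mult_right_mono[OF LU(3) M(1)] by simp_all
  then have gA: "\<bar>G A - G (of_int L)\<bar> \<le> M1" and gB: "\<bar>G B - G (of_int U)\<bar> \<le> M1"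
    using Glip[of A "of_int L"] Glip[of B "of_int U"] by (auto simp: mult.commute)
  have gen: "\<lbrakk>\<bar>x\<bar> \<le> Y; \<bar>a\<bar> \<le> M; \<bar>b\<bar> \<le> M; \<bar>c\<bar> \<le> M; \<bar>d\<bar> \<le> M\<rbrakk> \<Longrightarrow> \<bar>x + a - b - c / 2 + d / 2\<bar> \<le> Y + 3 * M" for x a b c d Y M :: real
    by linarith
  have "(\<Sum>y=L..<U. G (of_int y)) - (H B - H A + (A - of_int L + 1 / 2) * G A - (B - of_int U + 1 / 2) * G B)
    = ((\<Sum>y=L..<U. G (of_int y)) - (H (of_int U) - H (of_int L) + (G (of_int L) - G (of_int U)) / 2))
      + (H A - H (of_int L) - (A - of_int L) * G A) - (H B - H (of_int U) - (B - of_int U) * G B)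
      - (G A - G (of_int L)) / 2 + (G B - G (of_int U)) / 2"
    by (simp add: algebra_simps add_divide_distrib diff_divide_distrib)
  then show ?thesis using gen[OF t hA hB gA gB] by (simp only:)
qed

subsection \<open>The main term\<close>

text \<open>The continuous antiderivative of \<open>sawtooth\<close> that vanishes at the integers:
  half the periodic second Bernoulli polynomial without its constant term.\<close>

definition P2 :: "real \<Rightarrow> real" where "P2 u = ((frac u)\<^sup>2 - frac u) / 2"

lemma P2_bound: "\<bar>P2 u\<bar> \<le> 1"
proof -
  have f: "0 \<le> frac u" "frac u \<le> 1" using frac_lt_1[of u] by auto
  then have "(frac u)\<^sup>2 \<le> 1" "(frac u)\<^sup>2 \<ge> 0" by (simp_all add: power_le_one)
  moreover have "\<bar>(s - f) / 2\<bar> \<le> 1" if "0 \<le> f" "f \<le> 1" "0 \<le> s" "s \<le> 1" for s f :: real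
    using that by (simp add: abs_le_iff)
  ultimately show ?thesis unfolding P2_def using f by blast
qed

lemma P2_lipschitz: "\<bar>P2 x - P2 y\<bar> \<le> \<bar>x - y\<bar>"
proof -
  have *: "\<bar>P2 x - P2 y\<bar> \<le> y - x" if "x \<le> y" for x y
  proof (cases "\<lfloor>x\<rfloor> = \<lfloor>y\<rfloor>")
    case True
    have d: "frac y - frac x = y - x" using True by (simp add: frac_def)
    have eq: "P2 x - P2 y = (y - x) * ((1 - frac x - frac y) / 2)"
      unfolding d[symmetric] by (simp add: P2_def power2_eq_square field_simps)
    have "\<bar>P2 x - P2 y\<bar> = (y - x) * \<bar>(1 - frac x - frac y) / 2\<bar>" unfolding eq abs_mult using that by simp
    also have "\<dots> \<le> (y - x) * 1"
    proof (intro mult_left_mono)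
      have "\<bar>(1 - a - b) / 2\<bar> \<le> 1" if "0 \<le> a" "a < 1" "0 \<le> b" "b < 1" for a b :: real
        using that by (simp add: abs_le_iff)
      then show "\<bar>(1 - frac x - frac y) / 2\<bar> \<le> 1"
        using frac_ge_0[of x] frac_ge_0[of y] frac_lt_1[of x] frac_lt_1[of y] by blast
    qed (use that in simp)
    finally show ?thesis by simp
  next
    case False
    have "\<lfloor>x\<rfloor> < \<lfloor>y\<rfloor>" using False floor_mono[OF that] by linarith
    then have "real_of_int \<lfloor>x\<rfloor> + 1 \<le> real_of_int \<lfloor>y\<rfloor>" by linarith
    then have yx: "(1 - frac x) + frac y \<le> y - x" by (simp add: frac_def)
    have f: "0 \<le> frac x" "frac x < 1" "0 \<le> frac y" "frac y < 1" using frac_lt_1 by auto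
    have x: "P2 x = - (frac x * (1 - frac x) / 2)" and y: "P2 y = - (frac y * (1 - frac y) / 2)"
      by (simp_all add: P2_def power2_eq_square field_simps)
    have "frac x * (1 - frac x) \<le> 1 * (1 - frac x)" "frac y * (1 - frac y) \<le> frac y * 1" 
      using mult_right_mono[of "frac x" 1 "1 - frac x"] mult_left_mono[of "1 - frac y" 1 "frac y"] f by simp_all
    moreover have "0 \<le> frac x * (1 - frac x)" "0 \<le> frac y * (1 - frac y)" using f by auto
    ultimately show ?thesis using yx unfolding x y by (simp add: abs_le_iff)
  qed
  show ?thesis
  proof (cases "x \<le> y")
    case True then show ?thesis using *[OF True] by simp
  next
    case False then show ?thesis using *[of y x] by (simp add: abs_minus_commute)
  qed
qed

lemma continuous_on_P2: "continuous_on UNIV P2"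
  unfolding continuous_on_iff
proof (intro ballI allI impI)
  fix x e :: real assume "e > 0"
  then show "\<exists>d>0. \<forall>x'\<in>UNIV. dist x' x < d \<longrightarrow> dist (P2 x') (P2 x) < e"
    by (intro exI[of _ e]) (auto simp: dist_real_def intro: le_less_trans[OF P2_lipschitz])
qed

lemma P2_deriv:
  assumes "u \<notin> \<int>" shows "(P2 has_real_derivative sawtooth u) (at u)"
proof -
  have fl: "((\<lambda>x. real_of_int \<lfloor>x\<rfloor>) has_real_derivative 0) (at u)"
    using floor_has_real_derivative[of u "\<lambda>x. x"] assms by auto
  show ?thesis unfolding P2_def[abs_def] frac_def sawtooth_def
    by (auto intro!: derivative_eq_intros fl simp: field_simps)
qed

text \<open>The sum of the positive integers up to \<open>u\<close>, for \<open>u \<ge> 0\<close>,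
  split into a main term, an oscillation of size \<open>u\<close> and a bounded rest.\<close>

lemma triangular_floor:
  "of_int (\<lfloor>u\<rfloor> * (\<lfloor>u\<rfloor> + 1)) / 2 = u\<^sup>2 / 2 - u * sawtooth u + P2 u"
proof -
  have gen: "k * (k + 1) / 2 = (k + f)\<^sup>2 / 2 - (k + f) * (f - 1 / 2) + (f\<^sup>2 - f) / 2" for k f :: real
    by (simp add: power2_eq_square field_simps)
  have ku: "of_int \<lfloor>u\<rfloor> + frac u = u" by (simp add: frac_def)
  have "of_int (\<lfloor>u\<rfloor> * (\<lfloor>u\<rfloor> + 1)) / 2 = real_of_int \<lfloor>u\<rfloor> * (real_of_int \<lfloor>u\<rfloor> + 1) / 2" by simp
  also have "\<dots> = u\<^sup>2 / 2 - u * sawtooth u + P2 u"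
    unfolding gen[of "of_int \<lfloor>u\<rfloor>" "frac u"] ku sawtooth_def P2_def ..
  finally show ?thesis .
qed

text \<open>With \<open>u s = \<rho> * b / (s - a)\<close> the derivative of \<open>u\<close> is
  \<open>- u / (s - a)\<close>. So the oscillating part \<open>g * u * sawtooth u\<close>, of size
  \<rho>, is minus \<open>g * (s - a)\<close> times the derivative of \<open>P2 (u s)\<close>, and
  integration by parts leaves a bound free of \<rho>.\<close>

lemma main_integral:
  fixes g g' :: "real \<Rightarrow> real"
  assumes g: "\<And>x. (g has_real_derivative g' x) (at x)" and g'c: "continuous_on UNIV g'"
    and gb: "\<And>x. \<bar>g x\<bar> \<le> B0" "\<And>x. \<bar>g' x\<bar> \<le> B1"
    and ab: "b > 0" "a < \<sigma>" "\<sigma> < \<tau>"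
  shows "\<exists>C. \<forall>\<rho>>0. \<exists>I. ((\<lambda>s. g s * (of_int (\<lfloor>\<rho> * b / (s - a)\<rfloor> * (\<lfloor>\<rho> * b / (s - a)\<rfloor> + 1)) / 2)) has_integral I) {\<sigma>..\<tau>} \<and>
     \<bar>I - \<rho>\<^sup>2 / 2 * integral {\<sigma>..\<tau>} (\<lambda>s. g s * (b / (s - a))\<^sup>2)\<bar> \<le> C"
proof -
  define w where "w s = g s * (s - a)" for s
  define w' where "w' s = g' s * (s - a) + g s" for s
  have B: "B0 \<ge> 0" "B1 \<ge> 0" using gb[of 0] by auto
  have gc: "continuous_on UNIV g" using g by (meson DERIV_isCont continuous_at_imp_continuous_on)
  define C where "C = 2 * (B0 * (\<tau> - a)) + (\<tau> - \<sigma>) * (B0 + (B1 * (\<tau> - a) + B0))"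
  have "\<exists>I. ((\<lambda>s. g s * (of_int (\<lfloor>\<rho> * b / (s - a)\<rfloor> * (\<lfloor>\<rho> * b / (s - a)\<rfloor> + 1)) / 2)) has_integral I) {\<sigma>..\<tau>} \<and>
     \<bar>I - \<rho>\<^sup>2 / 2 * integral {\<sigma>..\<tau>} (\<lambda>s. g s * (b / (s - a))\<^sup>2)\<bar> \<le> C" if \<rho>: "\<rho> > 0" for \<rho>
  proof -
    define u where "u s = \<rho> * b / (s - a)" for s
    have uc: "continuous_on {\<sigma>..\<tau>} u" unfolding u_def using ab by (intro continuous_intros) auto
    have ud: "(u has_real_derivative (- u s / (s - a))) (at s)" if "s \<in> {\<sigma>..\<tau>}" for s
    proof -
      have "s - a \<noteq> 0" using that ab by auto
      then show ?thesis unfolding u_def[abs_def]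
        by (auto intro!: derivative_eq_intros simp: field_simps power2_eq_square)
    qed
    have P2c: "continuous_on {\<sigma>..\<tau>} (\<lambda>s. P2 (u s))"
      by (rule continuous_on_compose2[OF continuous_on_P2 uc]) auto
    \<comment> \<open>Where \<open>u\<close> is an integer, \<open>P2 (u s)\<close> has a corner;
      the fundamental theorem allows finitely many such points.\<close>
    define S where "S = {s \<in> {\<sigma>..\<tau>}. u s \<in> \<int>}"
    have "finite S"
    proof (rule finite_subset)
      define N where "N = \<lceil>\<rho> * b / (\<sigma> - a)\<rceil>"
      show "S \<subseteq> (\<lambda>k. a + \<rho> * b / of_int k) ` {0..N}"
      proof
        fix s assume s: "s \<in> S"
        then obtain k where k: "u s = of_int k" by (auto simp: S_def elim: Ints_cases)
        have sa: "s - a > 0" "\<sigma> \<le> s" using s ab by (auto simp: S_def)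
        have u0: "u s > 0" using sa \<rho> ab by (simp add: u_def)
        have "u s \<le> \<rho> * b / (\<sigma> - a)" unfolding u_def using sa \<rho> ab by (intro divide_left_mono) auto
        then have "k \<le> N" unfolding N_def k by linarith
        moreover have "k \<ge> 0" using u0 k by simp
        moreover have "s = a + \<rho> * b / of_int k"
        proof -
          have "of_int k * (s - a) = \<rho> * b" using k sa by (simp add: u_def field_simps)
          moreover have "real_of_int k \<noteq> 0" using u0 k by simp
          ultimately show ?thesis by (simp add: field_simps)
        qed
        ultimately show "s \<in> (\<lambda>k. a + \<rho> * b / of_int k) ` {0..N}" by auto
      qed
    qed simp
    have gcS: "continuous_on {\<sigma>..\<tau>} g" "continuous_on {\<sigma>..\<tau>} g'" using gc g'c continuous_on_subset by blast+
    have wc: "continuous_on {\<sigma>..\<tau>} w" "continuous_on {\<sigma>..\<tau>} w'"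
      unfolding w_def w'_def using gcS by (auto intro!: continuous_intros)
    have 1: "((\<lambda>s. w' s * P2 (u s) - g s * u s * sawtooth (u s)) has_integral (w \<tau> * P2 (u \<tau>) - w \<sigma> * P2 (u \<sigma>))) {\<sigma>..\<tau>}"
    proof (rule fundamental_theorem_of_calculus_interior_strong[OF \<open>finite S\<close>])
      show "\<sigma> \<le> \<tau>" using ab by simp
      show "continuous_on {\<sigma>..\<tau>} (\<lambda>s. w s * P2 (u s))" using wc P2c by (intro continuous_intros)
      fix s assume s: "s \<in> {\<sigma><..<\<tau>} - S"
      then have ni: "u s \<notin> \<int>" and sI: "s \<in> {\<sigma>..\<tau>}" by (auto simp: S_def)
      have sa: "s - a \<noteq> 0" using sI ab by auto
      have pd: "((\<lambda>s. P2 (u s)) has_real_derivative (sawtooth (u s) * (- u s / (s - a)))) (at s)"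
        by (rule DERIV_chain2[OF P2_deriv[OF ni] ud[OF sI]])
      have wd: "(w has_real_derivative w' s) (at s)"
        unfolding w_def[abs_def] w'_def by (auto intro!: derivative_eq_intros g)
      have "((\<lambda>s. w s * P2 (u s)) has_real_derivative (w' s * P2 (u s) + sawtooth (u s) * (- u s / (s - a)) * w s)) (at s)"
        by (rule DERIV_mult[OF wd pd])
      moreover have "sawtooth (u s) * (- u s / (s - a)) * w s = - (g s * u s * sawtooth (u s))"
        using sa by (simp add: w_def)
      ultimately show "((\<lambda>s. w s * P2 (u s)) has_vector_derivative (w' s * P2 (u s) - g s * u s * sawtooth (u s))) (at s)"
        by (simp add: has_real_derivative_iff_has_vector_derivative)
    qed
    define rest where "rest s = (g s - w' s) * P2 (u s)" for s
    have "continuous_on {\<sigma>..\<tau>} rest" unfolding rest_def using gcS wc P2c by (intro continuous_intros)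
    then have ri: "rest integrable_on {\<sigma>..\<tau>}" by (rule integrable_continuous_real)
    have sq: "continuous_on {\<sigma>..\<tau>} (\<lambda>s. g s * (b / (s - a))\<^sup>2)" using gcS ab by (intro continuous_intros) auto
    then have si: "(\<lambda>s. g s * (b / (s - a))\<^sup>2) integrable_on {\<sigma>..\<tau>}" by (rule integrable_continuous_real)
    have rb: "\<bar>rest s\<bar> \<le> B0 + (B1 * (\<tau> - a) + B0)" if "s \<in> {\<sigma>..\<tau>}" for s
    proof -
      have "\<bar>g' s * (s - a)\<bar> \<le> B1 * (\<tau> - a)" unfolding abs_mult using that ab gb B by (intro mult_mono) auto
      then have "\<bar>g s - w' s\<bar> \<le> B0 + (B1 * (\<tau> - a) + B0)" using gb(1)[of s] unfolding w'_def by linarith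
      then have "\<bar>g s - w' s\<bar> * \<bar>P2 (u s)\<bar> \<le> (B0 + (B1 * (\<tau> - a) + B0)) * 1" using P2_bound by (intro mult_mono) auto
      then show ?thesis by (simp add: rest_def abs_mult)
    qed
    have rI: "\<bar>integral {\<sigma>..\<tau>} rest\<bar> \<le> (\<tau> - \<sigma>) * (B0 + (B1 * (\<tau> - a) + B0))"
    proof -
      have "norm (integral (cbox \<sigma> \<tau>) rest) \<le> (B0 + (B1 * (\<tau> - a) + B0)) * content (cbox \<sigma> \<tau>)"
        using ri rb B ab by (intro has_integral_bound[OF _ integrable_integral]) auto
      then show ?thesis using ab by (simp add: mult.commute)
    qed
    have wb: "\<bar>w s * P2 (u s)\<bar> \<le> B0 * (\<tau> - a)" if "s \<in> {\<sigma>..\<tau>}" for s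
    proof -
      have "\<bar>w s\<bar> * \<bar>P2 (u s)\<bar> \<le> (B0 * (\<tau> - a)) * 1"
        unfolding w_def abs_mult using that ab gb B P2_bound by (intro mult_mono) auto
      then show ?thesis by (simp add: abs_mult)
    qed
    define I where "I = \<rho>\<^sup>2 / 2 * integral {\<sigma>..\<tau>} (\<lambda>s. g s * (b / (s - a))\<^sup>2) + (w \<tau> * P2 (u \<tau>) - w \<sigma> * P2 (u \<sigma>)) + integral {\<sigma>..\<tau>} rest"
    have "((\<lambda>s. \<rho>\<^sup>2 / 2 * (g s * (b / (s - a))\<^sup>2) + (w' s * P2 (u s) - g s * u s * sawtooth (u s)) + rest s) has_integral I) {\<sigma>..\<tau>}"
      unfolding I_def by (intro has_integral_add has_integral_mult_right 1 integrable_integral ri si)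
    moreover have "\<rho>\<^sup>2 / 2 * (g s * (b / (s - a))\<^sup>2) + (w' s * P2 (u s) - g s * u s * sawtooth (u s)) + rest s
        = g s * (of_int (\<lfloor>\<rho> * b / (s - a)\<rfloor> * (\<lfloor>\<rho> * b / (s - a)\<rfloor> + 1)) / 2)" for s
    proof -
      have "(u s)\<^sup>2 = \<rho>\<^sup>2 * (b / (s - a))\<^sup>2" by (simp add: u_def power_mult_distrib[symmetric])
      then show ?thesis unfolding u_def[symmetric] triangular_floor rest_def by (simp add: algebra_simps)
    qed
    ultimately have "((\<lambda>s. g s * (of_int (\<lfloor>\<rho> * b / (s - a)\<rfloor> * (\<lfloor>\<rho> * b / (s - a)\<rfloor> + 1)) / 2)) has_integral I) {\<sigma>..\<tau>}"
      by (simp only:)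
    moreover have "\<bar>I - \<rho>\<^sup>2 / 2 * integral {\<sigma>..\<tau>} (\<lambda>s. g s * (b / (s - a))\<^sup>2)\<bar> \<le> C"
      using wb[of \<sigma>] wb[of \<tau>] rI ab unfolding I_def C_def by (simp add: abs_le_iff)
    ultimately show ?thesis by blast
  qed
  then show ?thesis by blast
qed

subsection \<open>Sectors\<close>

lemma le_nat_floor_iff: "x \<ge> 0 \<Longrightarrow> n \<le> nat \<lfloor>x\<rfloor> \<longleftrightarrow> real n \<le> x"
  using le_nat_iff[of "\<lfloor>x\<rfloor>" n] by (simp add: le_floor_iff)

lemma harmonic_sum_le: "N > 0 \<Longrightarrow> (\<Sum>n=1..N. 1 / real n) \<le> ln (real N) + 1"
proof (induction N rule: nat_induct_non_zero)
  case (Suc N)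
  define x where "x = real N / real (Suc N)"
  have x: "x > 0" using Suc.hyps by (simp add: x_def)
  have "ln x \<le> x - 1" using x by (rule ln_le_minus_one)
  also have "x - 1 = - (1 / real (Suc N))" by (simp add: x_def field_simps)
  also have "ln x = ln (real N) - ln (real (Suc N))" unfolding x_def using Suc.hyps by (simp add: ln_div)
  finally have "1 / real (Suc N) \<le> ln (real (Suc N)) - ln (real N)" by simp
  then show ?case using Suc.IH by simp
qed simp

text \<open>The logarithm is absorbed through \<open>\<epsilon> * ln x = ln (x powr \<epsilon>)
  \<le> x powr \<epsilon>\<close>.\<close>

lemma harm_bound_powr:
  fixes x :: real and N :: nat
  assumes "\<epsilon> > 0" "real N \<le> x" "x > 0"
  shows "(\<Sum>n=1..N. 1 / real n) \<le> 1 + x powr \<epsilon> / \<epsilon>"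
proof (cases "N = 0")
  case False
  have "(\<Sum>n=1..N. 1 / real n) \<le> ln (real N) + 1" using harmonic_sum_le False by simp
  also have "ln (real N) \<le> ln x" using assms False by simp
  also have "ln x = ln (x powr \<epsilon>) / \<epsilon>" using assms by (simp add: ln_powr)
  also have "\<dots> \<le> x powr \<epsilon> / \<epsilon>" using assms ln_le_minus_one[of "x powr \<epsilon>"] by (intro divide_right_mono) auto
  finally show ?thesis by simp
qed (use assms in simp)

lemma scaled_derivs:
  fixes g g' H :: "real \<Rightarrow> real" and n :: nat
  assumes H: "\<And>x. (H has_real_derivative g x) (at x)" and g: "\<And>x. (g has_real_derivative g' x) (at x)" and n: "n > 0"
  shows "((\<lambda>y. real n * H (y / n)) has_real_derivative g (x / n)) (at x)"
    "((\<lambda>y. g (y / n)) has_real_derivative g' (x / n) / n) (at x)"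
proof -
  have d: "((\<lambda>y. y / real n) has_real_derivative 1 / n) (at x)" using n by (auto intro!: derivative_eq_intros)
  show "((\<lambda>y. real n * H (y / n)) has_real_derivative g (x / n)) (at x)"
    using DERIV_cmult[OF DERIV_chain2[OF H d], of "real n"] n by simp
  show "((\<lambda>y. g (y / n)) has_real_derivative g' (x / n) / n) (at x)"
    using DERIV_chain2[OF g d] by simp
qed

text \<open>As a function of \<open>y\<close> the summand has a derivative of size
  \<open>1 / n\<close> with a Lipschitz constant of size \<open>1 / n\<^sup>2\<close>, and the
  column has at most \<open>n * w\<close> points, which gives the error
  \<open>O(1 / n)\<close>.\<close>

lemma column_sum:
  fixes g g' H :: "real \<Rightarrow> real" and n :: nat and L V :: int and s e w B1 B2 :: real
  assumes H: "\<And>x. (H has_real_derivative g x) (at x)" and g: "\<And>x. (g has_real_derivative g' x) (at x)"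
    and g'b: "\<And>x. \<bar>g' x\<bar> \<le> B1" and lip: "\<And>x y. \<bar>g' x - g' y\<bar> \<le> B2 * \<bar>x - y\<bar>" and n: "n > 0"
    and LV: "L \<le> V" "\<bar>n * s - of_int L\<bar> \<le> 1" "\<bar>n * e - of_int V\<bar> \<le> 1" and w: "of_int (V - L) \<le> n * w"
  shows "\<bar>(\<Sum>y=L..<V. g (of_int y / n)) - (n * (H e - H s) + (n * s - of_int L + 1 / 2) * g s - (n * e - of_int V + 1 / 2) * g e)\<bar>
    \<le> (B2 * w + 3 * B1) / n"
proof -
  have B2: "B2 \<ge> 0" using lip[of 1 0] by simp
  have "\<bar>(\<Sum>y=L..<V. g (of_int y / n)) - (real n * H (n * e / n) - real n * H (n * s / n) + (n * s - of_int L + 1 / 2) * g (n * s / n) - (n * e - of_int V + 1 / 2) * g (n * e / n))\<bar>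
      \<le> B2 / (real n)\<^sup>2 * of_int (V - L) + 3 * (B1 / n)"
  proof (rule euler_maclaurin[OF scaled_derivs(1)[OF H g n] scaled_derivs(2)[OF H g n] _ _ LV])
    fix x y
    show "\<bar>g' (x / n) / n\<bar> \<le> B1 / n" using g'b n by (simp add: divide_right_mono)
    have "\<bar>g' (x / n) / n - g' (y / n) / n\<bar> = \<bar>g' (x / n) - g' (y / n)\<bar> / n" using n by (simp flip: diff_divide_distrib)
    also have "\<dots> \<le> (B2 * \<bar>x / n - y / n\<bar>) / n" using lip by (intro divide_right_mono) auto
    also have "\<dots> = B2 / (real n)\<^sup>2 * \<bar>x - y\<bar>" by (simp flip: diff_divide_distrib) (simp add: power2_eq_square)
    finally show "\<bar>g' (x / n) / n - g' (y / n) / n\<bar> \<le> B2 / (real n)\<^sup>2 * \<bar>x - y\<bar>" .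
  qed
  also have "\<dots> \<le> B2 / (real n)\<^sup>2 * (n * w) + 3 * (B1 / n)" using w B2 by (intro add_right_mono mult_left_mono) auto
  also have "\<dots> = (B2 * w + 3 * B1) / n" using n by (simp add: power2_eq_square field_simps)
  finally show ?thesis using n by (simp add: right_diff_distrib)
qed

text \<open>The end corrections along a ray of slope \<open>s\<close>. They are carried along
  unestimated because a ray may have rational slope, where the sawtooth does not average out: for
  \<open>s = 1\<close> and \<open>L n = n\<close> every term is half of \<open>g 1\<close>. They
  disappear only against the same ray of the adjacent sector.\<close>

definition edge_term :: "(real \<Rightarrow> real) \<Rightarrow> (nat \<Rightarrow> int) \<Rightarrow> real \<Rightarrow> real \<Rightarrow> real" where
  "edge_term g L s x = (\<Sum>n=1..nat \<lfloor>x\<rfloor>. (real n * s - of_int (L n) + 1 / 2) * g s)"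

text \<open>The region is the triangle cut from the cone of slopes \<sigma> to \<tau> by the line
  \<open>y = a * x + \<rho> * b\<close>; the ray of slope \<open>s\<close> reaches this line at
  abscissa \<open>\<rho> * b / (s - a)\<close>. Column ends on the line give sawtooth values along a
  progression of step \<open>a\<close>, those on the rays go into \<open>edge_term\<close>.\<close>

lemma sector_asymptotics:
  fixes g g' H :: "real \<Rightarrow> real" and L U :: "nat \<Rightarrow> int" and a b \<sigma> \<tau> \<epsilon> A B0 B1 B2 :: real
  assumes H: "\<And>x. (H has_real_derivative g x) (at x)" and g: "\<And>x. (g has_real_derivative g' x) (at x)"
    and gb: "\<And>x. \<bar>g x\<bar> \<le> B0" and g'b: "\<And>x. \<bar>g' x\<bar> \<le> B1" and lip: "\<And>x y. \<bar>g' x - g' y\<bar> \<le> B2 * \<bar>x - y\<bar>"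
    and ab: "b > 0" "a < \<sigma>" "\<sigma> < \<tau>" and \<epsilon>: "\<epsilon> > 0"
    and saw: "\<And>N \<beta>. \<bar>\<Sum>n<N. sawtooth (real n * a + \<beta>)\<bar> \<le> A * real N powr \<epsilon>" and A: "A \<ge> 0"
    and L: "\<And>n. real n * \<sigma> \<le> of_int (L n)" "\<And>n. of_int (L n) \<le> real n * \<sigma> + 1"
    and U: "\<And>n. real n * \<tau> \<le> of_int (U n)" "\<And>n. of_int (U n) \<le> real n * \<tau> + 1"
  shows "\<exists>C. \<forall>\<rho>\<ge>1. \<bar>(\<Sum>n=1..nat \<lfloor>\<rho> * (b / (\<sigma> - a))\<rfloor>. \<Sum>y=L n..<U n. if of_int y \<le> a * n + \<rho> * b then g (of_int y / n) else 0)
     - (\<rho>\<^sup>2 / 2 * integral {\<sigma>..\<tau>} (\<lambda>s. g s * (b / (s - a))\<^sup>2)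
        + edge_term g L \<sigma> (\<rho> * (b / (\<sigma> - a))) - edge_term g U \<tau> (\<rho> * (b / (\<tau> - a))))\<bar> \<le> C * \<rho> powr \<epsilon>"
proof -
  have B: "B0 \<ge> 0" "B1 \<ge> 0" "B2 \<ge> 0" using gb[of 0] g'b[of 0] lip[of 1 0] by auto
  have g'c: "continuous_on UNIV g'" 
  proof (rule lipschitz_on_continuous_on[of B2])
    show "B2-lipschitz_on UNIV g'" using lip B by (auto simp: lipschitz_on_def dist_real_def)
  qed
  obtain Cm where Cm: "\<And>\<rho>. \<rho> > 0 \<Longrightarrow> \<exists>I. ((\<lambda>s. g s * (of_int (\<lfloor>\<rho> * b / (s - a)\<rfloor> * (\<lfloor>\<rho> * b / (s - a)\<rfloor> + 1)) / 2)) has_integral I) {\<sigma>..\<tau>} \<and>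
     \<bar>I - \<rho>\<^sup>2 / 2 * integral {\<sigma>..\<tau>} (\<lambda>s. g s * (b / (s - a))\<^sup>2)\<bar> \<le> Cm"
    using main_integral[OF g g'c gb g'b ab] by auto
  define X where "X s = b / (s - a)" for s
  define C1 where "C1 = B2 * (\<tau> - \<sigma> + 1) + 3 * B1"
  define C2 where "C2 = (B0 + B1 * (\<tau> - a)) * (A * X \<sigma> powr \<epsilon>)"
  define C3 where "C3 = C1 * (1 + X \<sigma> powr \<epsilon> / \<epsilon>)"
  have X0: "X \<sigma> > 0" "X \<tau> > 0" "X \<tau> \<le> X \<sigma>" using ab by (auto simp: X_def intro!: divide_left_mono)
  have C1: "C1 \<ge> 0" using B ab by (simp add: C1_def)
  show ?thesis
  proof (intro exI allI impI)
    fix \<rho> :: real assume \<rho>: "\<rho> \<ge> 1"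
    define N where "N = nat \<lfloor>\<rho> * X \<sigma>\<rfloor>"
    define N1 where "N1 = nat \<lfloor>\<rho> * X \<tau>\<rfloor>"
    \<comment> \<open>The slope at which column \<open>n\<close> meets the side;
      \<open>n * t n\<close> is an arithmetic progression of step \<open>a\<close>.\<close>
    define t where "t n = a + \<rho> * b / real n" for n
    have pos: "\<rho> * X \<sigma> > 0" "\<rho> * X \<tau> > 0" using \<rho> X0 by auto
    have N1N: "N1 \<le> N" unfolding N1_def N_def using X0 \<rho> by (intro nat_mono floor_mono mult_left_mono) auto
    have Nle: "real N \<le> \<rho> * X \<sigma>" using pos unfolding N_def by linarith
    have n_N: "n \<le> N \<longleftrightarrow> real n \<le> \<rho> * X \<sigma>" and n_N1: "n \<le> N1 \<longleftrightarrow> real n \<le> \<rho> * X \<tau>" for n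
      unfolding N_def N1_def using pos by (simp_all add: le_nat_floor_iff)
    have tX: "s \<le> t n \<longleftrightarrow> real n \<le> \<rho> * X s" if "s > a" "n > 0" for s n
      using that by (simp add: t_def X_def field_simps)
    define col where "col n = (\<Sum>y=L n..<U n. if of_int y \<le> a * n + \<rho> * b then g (of_int y / n) else 0)" for n
    \<comment> \<open>Columns up to \<open>N1\<close> end on the upper ray, the later ones on the
      side.\<close>
    define osc where "osc n = (if n \<le> N1 then (n * \<tau> - of_int (U n) + 1 / 2) * g \<tau> else sawtooth (n * t n) * g (t n))" for n
    have col: "\<bar>col n - (n * (H (min \<tau> (t n)) - H \<sigma>) + (n * \<sigma> - of_int (L n) + 1 / 2) * g \<sigma> - osc n)\<bar> \<le> C1 / n"
      if n: "n \<in> {1..N}" for n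
    proof -
      have n0: "n > 0" using n by auto
      have nt: "n * t n = a * n + \<rho> * b" using n0 by (simp add: t_def field_simps)
      have \<sigma>t: "\<sigma> \<le> t n" using tX[of \<sigma> n] n_N[of n] n n0 ab by auto
      have Ln: "\<bar>n * \<sigma> - of_int (L n)\<bar> \<le> 1" using L[of n] by (simp add: abs_le_iff)
      show ?thesis
      proof (cases "n \<le> N1")
        case True
        then have \<tau>t: "\<tau> \<le> t n" using tX[of \<tau> n] n_N1[of n] n0 ab by auto
        have "of_int y \<le> a * n + \<rho> * b" if "y \<in> {L n..<U n}" for y
        proof -
          have "real_of_int y \<le> of_int (U n) - 1" using that by auto
          also have "\<dots> \<le> n * \<tau>" using U(2)[of n] by simp
          also have "\<dots> \<le> n * t n" using \<tau>t by (intro mult_left_mono) auto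
          finally show ?thesis by (simp add: nt)
        qed
        then have "col n = (\<Sum>y=L n..<U n. g (of_int y / n))" unfolding col_def by (intro sum.cong) auto
        moreover have "\<bar>(\<Sum>y=L n..<U n. g (of_int y / n)) - (n * (H \<tau> - H \<sigma>) + (n * \<sigma> - of_int (L n) + 1 / 2) * g \<sigma> - (n * \<tau> - of_int (U n) + 1 / 2) * g \<tau>)\<bar> \<le> C1 / n"
          unfolding C1_def
        proof (rule column_sum[OF H g g'b lip n0 _ Ln])
          have "real n * \<sigma> < real n * \<tau>" using ab n0 by simp
          then have "real_of_int (L n) < of_int (U n) + 1" using L(2)[of n] U(1)[of n] by linarith
          then show "L n \<le> U n" by linarith
          show "\<bar>n * \<tau> - of_int (U n)\<bar> \<le> 1" using U[of n] by (simp add: abs_le_iff)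
          have "real_of_int (U n - L n) \<le> n * (\<tau> - \<sigma>) + 1" using U(2)[of n] L(1)[of n] by (simp add: algebra_simps)
          also have "\<dots> \<le> n * (\<tau> - \<sigma> + 1)" using n0 by (simp add: distrib_left)
          finally show "real_of_int (U n - L n) \<le> n * (\<tau> - \<sigma> + 1)" .
        qed
        ultimately show ?thesis using True \<tau>t by (simp add: osc_def min_def)
      next
        case False
        then have t\<tau>: "t n < \<tau>" using tX[of \<tau> n] n_N1[of n] n0 ab by auto
        define V where "V = \<lfloor>n * t n\<rfloor> + 1"
        have "{y \<in> {L n..<U n}. of_int y \<le> a * n + \<rho> * b} = {L n..<V}"
        proof -
          have "y < U n" if "real_of_int y \<le> n * t n" for y
          proof -
            have "n * t n < n * \<tau>" using t\<tau> n0 by simp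
            then show ?thesis using that U(1)[of n] by linarith
          qed
          moreover have "y < V \<longleftrightarrow> real_of_int y \<le> n * t n" for y unfolding V_def by (simp add: le_floor_iff flip: zle_iff_zadd add1_zle_eq)
          ultimately show ?thesis unfolding nt[symmetric] by auto
        qed
        then have "col n = (\<Sum>y=L n..<V. g (of_int y / n))"
          unfolding col_def by (subst sum.inter_filter[symmetric]) auto
        moreover have "\<bar>(\<Sum>y=L n..<V. g (of_int y / n)) - (n * (H (t n) - H \<sigma>) + (n * \<sigma> - of_int (L n) + 1 / 2) * g \<sigma> - (n * t n - of_int V + 1 / 2) * g (t n))\<bar> \<le> C1 / n"
          unfolding C1_def
        proof (rule column_sum[OF H g g'b lip n0 _ Ln])
          have "real n * \<sigma> \<le> real n * t n" using \<sigma>t by (intro mult_left_mono) auto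
          then have "real_of_int (L n) - 1 \<le> n * t n" using L(2)[of n] by linarith
          then show "L n \<le> V" unfolding V_def by linarith
          show "\<bar>n * t n - of_int V\<bar> \<le> 1" unfolding V_def by linarith
          have "n * t n \<le> n * \<tau>" using t\<tau> by (intro mult_left_mono) auto
          then have "real_of_int (V - L n) \<le> n * (\<tau> - \<sigma>) + 1" using L(1)[of n] unfolding V_def right_diff_distrib by linarith
          also have "\<dots> \<le> n * (\<tau> - \<sigma> + 1)" using n0 by (simp add: distrib_left)
          finally show "real_of_int (V - L n) \<le> n * (\<tau> - \<sigma> + 1)" .
        qed
        moreover have "n * t n - of_int V + 1 / 2 = sawtooth (n * t n)" by (simp add: V_def sawtooth_def frac_def)
        ultimately show ?thesis using False t\<tau> by (simp add: osc_def min_def)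
      qed
    qed
    obtain I where I: "((\<lambda>s. g s * (of_int (\<lfloor>\<rho> * b / (s - a)\<rfloor> * (\<lfloor>\<rho> * b / (s - a)\<rfloor> + 1)) / 2)) has_integral I) {\<sigma>..\<tau>}"
      "\<bar>I - \<rho>\<^sup>2 / 2 * integral {\<sigma>..\<tau>} (\<lambda>s. g s * (b / (s - a))\<^sup>2)\<bar> \<le> Cm"
      using Cm[of \<rho>] \<rho> by auto
    \<comment> \<open>Exchange of the sum over columns with the integral over slopes: the ray of
      slope \<open>s\<close> crosses the columns up to
      \<open>\<lfloor>\<rho> * X s\<rfloor>\<close>, and column \<open>n\<close> enters with weight
      \<open>n\<close>.\<close>
    have main: "(\<Sum>n=1..N. n * (H (min \<tau> (t n)) - H \<sigma>)) = I"
    proof -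
      have one: "((\<lambda>s. if s \<in> {\<sigma>..min \<tau> (t n)} then g s else 0) has_integral (H (min \<tau> (t n)) - H \<sigma>)) {\<sigma>..\<tau>}" if n: "n \<in> {1..N}" for n
      proof -
        have "\<sigma> \<le> t n" using tX[of \<sigma> n] n_N[of n] n ab by auto
        then have "(g has_integral (H (min \<tau> (t n)) - H \<sigma>)) {\<sigma>..min \<tau> (t n)}" using ab
          by (intro fundamental_theorem_of_calculus) (auto intro!: has_field_derivative_at_within H simp: has_real_derivative_iff_has_vector_derivative[symmetric])
        then show ?thesis by (subst has_integral_restrict) auto
      qed
      have sumI: "((\<lambda>s. \<Sum>n=1..N. n * (if s \<in> {\<sigma>..min \<tau> (t n)} then g s else 0)) has_integral (\<Sum>n=1..N. n * (H (min \<tau> (t n)) - H \<sigma>))) {\<sigma>..\<tau>}"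
        by (intro has_integral_sum has_integral_mult_right one) auto
      have eqs: "(\<Sum>n=1..N. n * (if s \<in> {\<sigma>..min \<tau> (t n)} then g s else 0)) = g s * (of_int (\<lfloor>\<rho> * b / (s - a)\<rfloor> * (\<lfloor>\<rho> * b / (s - a)\<rfloor> + 1)) / 2)"
        if s: "s \<in> {\<sigma>..\<tau>}" for s
      proof -
        define K where "K = nat \<lfloor>\<rho> * X s\<rfloor>"
        have sa: "s > a" using s ab by auto
        have Xs: "X s \<le> X \<sigma>" "X s > 0" using s ab by (auto simp: X_def intro!: divide_left_mono)
        then have p: "\<rho> * X s > 0" using \<rho> by simp
        have KN: "K \<le> N" unfolding K_def N_def using Xs \<rho> by (intro nat_mono floor_mono mult_left_mono) auto
        have nK: "n \<le> K \<longleftrightarrow> real n \<le> \<rho> * X s" for n unfolding K_def using p by (simp add: le_nat_floor_iff)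
        have "(\<Sum>n=1..N. n * (if s \<in> {\<sigma>..min \<tau> (t n)} then g s else 0)) = (\<Sum>n=1..N. if n \<le> K then n * g s else 0)"
          using s sa by (intro sum.cong refl) (auto simp: nK tX)
        also have "\<dots> = (\<Sum>n\<in>{n\<in>{1..N}. n \<le> K}. n * g s)" by (rule sum.inter_filter[symmetric]) simp
        also have "{n\<in>{1..N}. n \<le> K} = {1..K}" using KN by auto
        also have "(\<Sum>n=1..K. n * g s) = g s * (real K * (real K + 1) / 2)"
          by (induction K) (auto simp: field_simps)
        also have "real K = of_int \<lfloor>\<rho> * b / (s - a)\<rfloor>" using p by (simp add: K_def X_def)
        finally show ?thesis by simp
      qed
      have "((\<lambda>s. g s * (of_int (\<lfloor>\<rho> * b / (s - a)\<rfloor> * (\<lfloor>\<rho> * b / (s - a)\<rfloor> + 1)) / 2)) has_integral (\<Sum>n=1..N. n * (H (min \<tau> (t n)) - H \<sigma>))) {\<sigma>..\<tau>}"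
        by (rule has_integral_eq[OF eqs sumI])
      then show ?thesis using I(1) has_integral_unique by blast
    qed
    have Nb: "real N powr \<epsilon> \<le> X \<sigma> powr \<epsilon> * \<rho> powr \<epsilon>"
    proof -
      have "real N powr \<epsilon> \<le> (\<rho> * X \<sigma>) powr \<epsilon>" using Nle \<epsilon> by (intro powr_mono2) auto
      then show ?thesis using \<rho> X0 by (simp add: powr_mult mult.commute)
    qed
    \<comment> \<open>Partial summation: \<open>t n\<close> decreases and stays between
      \<open>a\<close> and \<tau>, so the weights \<open>g (t n)\<close> have variation at most
      \<open>B1 * (\<tau> - a)\<close>.\<close>
    have osc: "\<bar>\<Sum>n=Suc N1..N. sawtooth (n * t n) * g (t n)\<bar> \<le> C2 * \<rho> powr \<epsilon>"
    proof -
      define k where "k = N - N1"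
      define w where "w i = g (t (Suc N1 + i))" for i
      define aa where "aa i = sawtooth (real i * a + (a * real (Suc N1) + \<rho> * b))" for i :: nat
      have "(\<Sum>n=Suc N1..N. sawtooth (n * t n) * g (t n)) = (\<Sum>i<k. w i * aa i)"
      proof (rule sum.reindex_bij_witness[of _ "\<lambda>i. Suc N1 + i" "\<lambda>n. n - Suc N1"])
        fix n assume n: "n \<in> {Suc N1..N}"
        then have nn: "n = Suc N1 + (n - Suc N1)" by simp
        have "n * t n = real (n - Suc N1) * a + (a * real (Suc N1) + \<rho> * b)"
          using n by (simp add: t_def field_simps of_nat_diff)
        then show "w (n - Suc N1) * aa (n - Suc N1) = sawtooth (n * t n) * g (t n)"
          using nn by (simp add: w_def aa_def)
      qed (auto simp: k_def)
      also have "\<bar>\<dots>\<bar> \<le> (B0 + B1 * (\<tau> - a)) * (A * (X \<sigma> powr \<epsilon> * \<rho> powr \<epsilon>))"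
      proof (rule abel_bound)
        fix j assume j: "j \<le> k"
        have "\<bar>\<Sum>i<j. aa i\<bar> \<le> A * real j powr \<epsilon>" unfolding aa_def by (rule saw)
        also have "\<dots> \<le> A * real N powr \<epsilon>" using j A \<epsilon> by (intro mult_left_mono powr_mono2) (auto simp: k_def)
        also have "\<dots> \<le> A * (X \<sigma> powr \<epsilon> * \<rho> powr \<epsilon>)" using Nb A by (intro mult_left_mono)
        finally show "\<bar>\<Sum>i<j. aa i\<bar> \<le> A * (X \<sigma> powr \<epsilon> * \<rho> powr \<epsilon>)" .
      next
        show "\<bar>w k\<bar> \<le> B0" by (simp add: w_def gb)
        have glip: "\<bar>g x - g y\<bar> \<le> B1 * \<bar>x - y\<bar>" for x y
        proof (cases x y rule: linorder_cases)
          case less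
          then obtain z where "g y - g x = (y - x) * g' z" using MVT2[of x y g g'] g by auto
          then have "\<bar>g x - g y\<bar> = \<bar>g' z\<bar> * \<bar>x - y\<bar>" by (metis abs_minus_commute abs_mult mult.commute)
          then show ?thesis using g'b by (simp add: mult_right_mono)
        next
          case greater
          then obtain z where "g x - g y = (x - y) * g' z" using MVT2[of y x g g'] g by auto
          then have "\<bar>g x - g y\<bar> = \<bar>g' z\<bar> * \<bar>x - y\<bar>" by (metis abs_mult mult.commute)
          then show ?thesis using g'b by (simp add: mult_right_mono)
        qed simp
        have dec: "t (Suc n) \<le> t n" if "n > 0" for n
          using that \<rho> ab by (auto simp: t_def intro!: divide_left_mono)
        have "(\<Sum>i<k. \<bar>w (Suc i) - w i\<bar>) \<le> (\<Sum>i<k. B1 * (t (Suc N1 + i) - t (Suc N1 + Suc i)))"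
        proof (intro sum_mono)
          fix i
          have "\<bar>w (Suc i) - w i\<bar> \<le> B1 * \<bar>t (Suc N1 + Suc i) - t (Suc N1 + i)\<bar>" unfolding w_def by (rule glip)
          then show "\<bar>w (Suc i) - w i\<bar> \<le> B1 * (t (Suc N1 + i) - t (Suc N1 + Suc i))" using dec[of "Suc N1 + i"] by simp
        qed
        also have "\<dots> = B1 * (t (Suc N1) - t (Suc N1 + k))"
          unfolding sum_distrib_left[symmetric] by (induction k) auto
        also have "\<dots> \<le> B1 * (\<tau> - a)"
        proof (intro mult_left_mono diff_mono)
          show "t (Suc N1) \<le> \<tau>" using tX[of \<tau> "Suc N1"] n_N1[of "Suc N1"] ab by auto
          show "a \<le> t (Suc N1 + k)" using \<rho> ab by (simp add: t_def)
        qed (use B in auto)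
        finally show "(\<Sum>i<k. \<bar>w (Suc i) - w i\<bar>) \<le> B1 * (\<tau> - a)" .
      qed (use A in auto)
      finally show ?thesis by (simp add: C2_def mult_ac)
    qed
    have oscs: "(\<Sum>n=1..N. osc n) = edge_term g U \<tau> (\<rho> * X \<tau>) + (\<Sum>n=Suc N1..N. sawtooth (n * t n) * g (t n))"
    proof -
      have "{1..N} = {1..N1} \<union> {Suc N1..N}" using N1N by auto
      then have "(\<Sum>n=1..N. osc n) = (\<Sum>n=1..N1. osc n) + (\<Sum>n=Suc N1..N. osc n)" by (simp add: sum.union_disjoint)
      moreover have "(\<Sum>n=1..N1. osc n) = edge_term g U \<tau> (\<rho> * X \<tau>)" unfolding edge_term_def N1_def[symmetric] by (intro sum.cong) (auto simp: osc_def)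
      moreover have "(\<Sum>n=Suc N1..N. osc n) = (\<Sum>n=Suc N1..N. sawtooth (n * t n) * g (t n))" by (intro sum.cong) (auto simp: osc_def)
      ultimately show ?thesis by simp
    qed
    have "\<bar>(\<Sum>n=1..N. col n) - (I + edge_term g L \<sigma> (\<rho> * X \<sigma>) - (\<Sum>n=1..N. osc n))\<bar> \<le> C3 * \<rho> powr \<epsilon>"
    proof -
      have "(\<Sum>n=1..N. col n) - (I + edge_term g L \<sigma> (\<rho> * X \<sigma>) - (\<Sum>n=1..N. osc n)) = (\<Sum>n=1..N. col n - (n * (H (min \<tau> (t n)) - H \<sigma>) + (n * \<sigma> - of_int (L n) + 1 / 2) * g \<sigma> - osc n))"
        unfolding main[symmetric] edge_term_def N_def[symmetric] by (simp add: sum_subtractf sum.distrib)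
      also have "\<bar>\<dots>\<bar> \<le> (\<Sum>n=1..N. C1 / n)" by (intro order_trans[OF sum_abs] sum_mono col)
      also have "\<dots> = C1 * (\<Sum>n=1..N. 1 / n)" by (simp add: sum_distrib_left)
      also have "\<dots> \<le> C1 * (1 + (\<rho> * X \<sigma>) powr \<epsilon> / \<epsilon>)" using C1 harm_bound_powr[OF \<epsilon> Nle pos(1)] by (intro mult_left_mono)
      also have "(\<rho> * X \<sigma>) powr \<epsilon> = X \<sigma> powr \<epsilon> * \<rho> powr \<epsilon>" using \<rho> X0 by (simp add: powr_mult mult.commute)
      also have "1 + X \<sigma> powr \<epsilon> * \<rho> powr \<epsilon> / \<epsilon> \<le> (1 + X \<sigma> powr \<epsilon> / \<epsilon>) * \<rho> powr \<epsilon>"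
        using ge_one_powr_ge_zero[OF \<rho>, of \<epsilon>] \<epsilon> by (simp add: distrib_right)
      finally show ?thesis using C1 by (simp add: C3_def mult.assoc mult_left_mono)
    qed
    moreover have "\<bar>Cm\<bar> \<le> \<bar>Cm\<bar> * \<rho> powr \<epsilon>" using ge_one_powr_ge_zero[OF \<rho>, of \<epsilon>] \<epsilon> by (simp add: mult_le_cancel_left1)
    ultimately have "\<bar>(\<Sum>n=1..N. col n) - (\<rho>\<^sup>2 / 2 * integral {\<sigma>..\<tau>} (\<lambda>s. g s * (b / (s - a))\<^sup>2)
        + edge_term g L \<sigma> (\<rho> * X \<sigma>) - edge_term g U \<tau> (\<rho> * X \<tau>))\<bar> \<le> C3 * \<rho> powr \<epsilon> + C2 * \<rho> powr \<epsilon> + \<bar>Cm\<bar> * \<rho> powr \<epsilon>"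
      using osc I(2) unfolding oscs by linarith
    then show "\<bar>(\<Sum>n=1..nat \<lfloor>\<rho> * (b / (\<sigma> - a))\<rfloor>. \<Sum>y=L n..<U n. if of_int y \<le> a * n + \<rho> * b then g (of_int y / n) else 0)
     - (\<rho>\<^sup>2 / 2 * integral {\<sigma>..\<tau>} (\<lambda>s. g s * (b / (s - a))\<^sup>2)
        + edge_term g L \<sigma> (\<rho> * (b / (\<sigma> - a))) - edge_term g U \<tau> (\<rho> * (b / (\<tau> - a))))\<bar> \<le> (C3 + C2 + \<bar>Cm\<bar>) * \<rho> powr \<epsilon>"
      by (simp add: col_def N_def X_def distrib_right)
  qed
qed

subsection \<open>Cones\<close>

text \<open>The cutoff \<open>XM\<close> is common to all sectors, and slopes run from \<sigma>
  inclusive to \<tau> exclusive, so that the sums over adjacent sectors add up exactly.\<close>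

definition csum :: "real \<Rightarrow> (real \<Rightarrow> real) \<Rightarrow> (real \<Rightarrow> real) \<Rightarrow> real \<Rightarrow> real \<Rightarrow> real \<Rightarrow> real" where
  "csum XM g X \<sigma> \<tau> \<rho> = (\<Sum>n=1..nat \<lfloor>\<rho> * XM\<rfloor>. \<Sum>y=\<lceil>real n * \<sigma>\<rceil>..<\<lceil>real n * \<tau>\<rceil>.
     if real n \<le> \<rho> * X (of_int y / real n) then g (of_int y / real n) else 0)"

definition edge :: "(real \<Rightarrow> real) \<Rightarrow> (real \<Rightarrow> real) \<Rightarrow> real \<Rightarrow> real \<Rightarrow> real" where
  "edge g X \<rho> s = edge_term g (\<lambda>n. \<lceil>real n * s\<rceil>) s (\<rho> * X s)"

text \<open>The edge terms enter with opposite signs at the two ends, so that they telescope when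
  sectors are joined.\<close>

definition sector_ok :: "real \<Rightarrow> real \<Rightarrow> (real \<Rightarrow> real) \<Rightarrow> (real \<Rightarrow> real) \<Rightarrow> real \<Rightarrow> real \<Rightarrow> bool" where
  "sector_ok \<epsilon> XM g X \<sigma> \<tau> \<longleftrightarrow> (\<exists>C. \<forall>\<rho>\<ge>1. \<bar>csum XM g X \<sigma> \<tau> \<rho> -
     (\<rho>\<^sup>2 / 2 * integral {\<sigma>..\<tau>} (\<lambda>s. g s * (X s)\<^sup>2) + edge g X \<rho> \<sigma> - edge g X \<rho> \<tau>)\<bar> \<le> C * \<rho> powr \<epsilon>)"

definition weight_fun :: "(real \<Rightarrow> real) \<Rightarrow> bool" where
  "weight_fun g \<longleftrightarrow> (\<exists>H g' B0 B1 B2. (\<forall>x. (H has_real_derivative g x) (at x)) \<and> (\<forall>x. (g has_real_derivative g' x) (at x)) \<and>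
     (\<forall>x. \<bar>g x\<bar> \<le> B0) \<and> (\<forall>x. \<bar>g' x\<bar> \<le> B1) \<and> (\<forall>x y. \<bar>g' x - g' y\<bar> \<le> B2 * \<bar>x - y\<bar>))"

definition small_sums :: "real \<Rightarrow> real \<Rightarrow> bool" where
  "small_sums \<epsilon> a \<longleftrightarrow> (\<exists>A\<ge>0. \<forall>N \<beta>. \<bar>\<Sum>n<N. sawtooth (real n * a + \<beta>)\<bar> \<le> A * real N powr \<epsilon>)"

lemma column_slope:
  fixes y :: int
  assumes "n > 0" "y \<in> {\<lceil>real n * \<sigma>\<rceil>..<\<lceil>real n * \<tau>\<rceil>}"
  shows "of_int y / real n \<in> {\<sigma>..<\<tau>}"
proof -
  have "real n * \<sigma> \<le> of_int y" "of_int y < real n * \<tau>" using assms(2) by (auto simp: ceiling_le_iff less_ceiling_iff)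
  then show ?thesis using assms(1) by (simp add: field_simps)
qed

lemma csum_cut:
  assumes "\<And>s. s \<in> {\<sigma>..<\<tau>} \<Longrightarrow> X s \<le> X1" "X1 \<le> XM" "\<rho> \<ge> 1"
  shows "csum XM g X \<sigma> \<tau> \<rho> = csum X1 g X \<sigma> \<tau> \<rho>"
  unfolding csum_def
proof (rule sum.mono_neutral_right)
  show "{1..nat \<lfloor>\<rho> * X1\<rfloor>} \<subseteq> {1..nat \<lfloor>\<rho> * XM\<rfloor>}"
  proof -
    have "nat \<lfloor>\<rho> * X1\<rfloor> \<le> nat \<lfloor>\<rho> * XM\<rfloor>" using assms by (intro nat_mono floor_mono mult_left_mono) auto
    then show ?thesis by auto
  qed
  show "\<forall>n\<in>{1..nat \<lfloor>\<rho> * XM\<rfloor>} - {1..nat \<lfloor>\<rho> * X1\<rfloor>}. (\<Sum>y=\<lceil>real n * \<sigma>\<rceil>..<\<lceil>real n * \<tau>\<rceil>.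
     if real n \<le> \<rho> * X (of_int y / real n) then g (of_int y / real n) else 0) = 0"
  proof (intro ballI sum.neutral)
    fix n y assume n: "n \<in> {1..nat \<lfloor>\<rho> * XM\<rfloor>} - {1..nat \<lfloor>\<rho> * X1\<rfloor>}" and y: "y \<in> {\<lceil>real n * \<sigma>\<rceil>..<\<lceil>real n * \<tau>\<rceil>}"
    have "nat \<lfloor>\<rho> * X1\<rfloor> < n" using n by auto
    then have "\<rho> * X1 < real n" by linarith
    moreover have "\<rho> * X (of_int y / real n) \<le> \<rho> * X1" using column_slope[OF _ y] n assms by (intro mult_left_mono) auto
    ultimately show "(if real n \<le> \<rho> * X (of_int y / real n) then g (of_int y / real n) else 0) = 0" by auto
  qed
qed simp

lemma sector_ok_pos:
  assumes g: "weight_fun g" and ab: "b > 0" "a < \<sigma>" "\<sigma> < \<tau>" and \<epsilon>: "\<epsilon> > 0" and saw: "small_sums \<epsilon> a"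
    and X: "\<And>s. s \<in> {\<sigma>..\<tau>} \<Longrightarrow> X s = b / (s - a)" and XM: "X \<sigma> \<le> XM"
  shows "sector_ok \<epsilon> XM g X \<sigma> \<tau>"
proof -
  obtain H g' B0 B1 B2 where H: "\<And>x. (H has_real_derivative g x) (at x)" and g': "\<And>x. (g has_real_derivative g' x) (at x)"
    and b: "\<And>x. \<bar>g x\<bar> \<le> B0" "\<And>x. \<bar>g' x\<bar> \<le> B1" "\<And>x y. \<bar>g' x - g' y\<bar> \<le> B2 * \<bar>x - y\<bar>"
    using g unfolding weight_fun_def by metis
  obtain A where A: "A \<ge> 0" "\<And>N \<beta>. \<bar>\<Sum>n<N. sawtooth (real n * a + \<beta>)\<bar> \<le> A * real N powr \<epsilon>"
    using saw unfolding small_sums_def by metis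
  have "\<exists>C. \<forall>\<rho>\<ge>1. \<bar>(\<Sum>n=1..nat \<lfloor>\<rho> * (b / (\<sigma> - a))\<rfloor>. \<Sum>y=\<lceil>real n * \<sigma>\<rceil>..<\<lceil>real n * \<tau>\<rceil>. if of_int y \<le> a * n + \<rho> * b then g (of_int y / n) else 0)
     - (\<rho>\<^sup>2 / 2 * integral {\<sigma>..\<tau>} (\<lambda>s. g s * (b / (s - a))\<^sup>2)
        + edge_term g (\<lambda>n. \<lceil>real n * \<sigma>\<rceil>) \<sigma> (\<rho> * (b / (\<sigma> - a))) - edge_term g (\<lambda>n. \<lceil>real n * \<tau>\<rceil>) \<tau> (\<rho> * (b / (\<tau> - a))))\<bar> \<le> C * \<rho> powr \<epsilon>"
    by (rule sector_asymptotics[OF H g' b ab \<epsilon> A(2,1)]) linarith+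
  then obtain C where C: "\<And>\<rho>. \<rho> \<ge> 1 \<Longrightarrow> \<bar>(\<Sum>n=1..nat \<lfloor>\<rho> * (b / (\<sigma> - a))\<rfloor>. \<Sum>y=\<lceil>real n * \<sigma>\<rceil>..<\<lceil>real n * \<tau>\<rceil>. if of_int y \<le> a * n + \<rho> * b then g (of_int y / n) else 0)
     - (\<rho>\<^sup>2 / 2 * integral {\<sigma>..\<tau>} (\<lambda>s. g s * (b / (s - a))\<^sup>2)
        + edge_term g (\<lambda>n. \<lceil>real n * \<sigma>\<rceil>) \<sigma> (\<rho> * (b / (\<sigma> - a))) - edge_term g (\<lambda>n. \<lceil>real n * \<tau>\<rceil>) \<tau> (\<rho> * (b / (\<tau> - a))))\<bar> \<le> C * \<rho> powr \<epsilon>"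
    by blast
  have int: "integral {\<sigma>..\<tau>} (\<lambda>s. g s * (X s)\<^sup>2) = integral {\<sigma>..\<tau>} (\<lambda>s. g s * (b / (s - a))\<^sup>2)"
    by (intro integral_cong) (simp add: X)
  have cs: "csum XM g X \<sigma> \<tau> \<rho> = (\<Sum>n=1..nat \<lfloor>\<rho> * (b / (\<sigma> - a))\<rfloor>. \<Sum>y=\<lceil>real n * \<sigma>\<rceil>..<\<lceil>real n * \<tau>\<rceil>. if of_int y \<le> a * n + \<rho> * b then g (of_int y / n) else 0)"
    if \<rho>: "\<rho> \<ge> 1" for \<rho>
  proof -
    have "csum XM g X \<sigma> \<tau> \<rho> = csum (X \<sigma>) g X \<sigma> \<tau> \<rho>"
      by (rule csum_cut[OF _ XM \<rho>]) (use ab X in \<open>auto intro!: divide_left_mono\<close>)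
    also have "X \<sigma> = b / (\<sigma> - a)" using X ab by simp
    also have "csum (b / (\<sigma> - a)) g X \<sigma> \<tau> \<rho> = (\<Sum>n=1..nat \<lfloor>\<rho> * (b / (\<sigma> - a))\<rfloor>. \<Sum>y=\<lceil>real n * \<sigma>\<rceil>..<\<lceil>real n * \<tau>\<rceil>. if of_int y \<le> a * n + \<rho> * b then g (of_int y / n) else 0)"
      unfolding csum_def
    proof (intro sum.cong refl if_cong)
      fix n y assume n: "n \<in> {1..nat \<lfloor>\<rho> * (b / (\<sigma> - a))\<rfloor>}" and y: "y \<in> {\<lceil>real n * \<sigma>\<rceil>..<\<lceil>real n * \<tau>\<rceil>}"
      have n0: "real n > 0" using n by auto
      have s: "of_int y / real n \<in> {\<sigma>..<\<tau>}" using column_slope[OF _ y] n by auto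
      have "of_int y / real n - a > 0" using s ab by auto
      moreover have "X (of_int y / real n) = b / (of_int y / real n - a)" using X s by auto
      ultimately have "real n \<le> \<rho> * X (of_int y / real n) \<longleftrightarrow> real n * (of_int y / real n - a) \<le> \<rho> * b"
        by (simp add: pos_le_divide_eq)
      also have "real n * (of_int y / real n - a) = of_int y - a * n" using n0 by (simp add: right_diff_distrib)
      finally show "(real n \<le> \<rho> * X (of_int y / real n)) = (of_int y \<le> a * real n + \<rho> * b)" by linarith
    qed
    finally show ?thesis .
  qed
  have e: "edge g X \<rho> \<sigma> = edge_term g (\<lambda>n. \<lceil>real n * \<sigma>\<rceil>) \<sigma> (\<rho> * (b / (\<sigma> - a)))"
    "edge g X \<rho> \<tau> = edge_term g (\<lambda>n. \<lceil>real n * \<tau>\<rceil>) \<tau> (\<rho> * (b / (\<tau> - a)))" for \<rho>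
    using X[of \<sigma>] X[of \<tau>] ab by (simp_all add: edge_def)
  show ?thesis unfolding sector_ok_def using C by (intro exI[of _ C] allI impI) (simp only: cs int e)
qed

lemma weight_fun_reflect:
  assumes "weight_fun g" shows "weight_fun (\<lambda>s. g (- s))"
proof -
  obtain H g' B0 B1 B2 where H: "\<And>x. (H has_real_derivative g x) (at x)" and g': "\<And>x. (g has_real_derivative g' x) (at x)"
    and b: "\<And>x. \<bar>g x\<bar> \<le> B0" "\<And>x. \<bar>g' x\<bar> \<le> B1" "\<And>x y. \<bar>g' x - g' y\<bar> \<le> B2 * \<bar>x - y\<bar>"
    using assms unfolding weight_fun_def by metis
  have m: "((\<lambda>x::real. - x) has_real_derivative - 1) (at x)" for x by (auto intro!: derivative_eq_intros)
  show ?thesis unfolding weight_fun_def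
  proof (rule exI[of _ "\<lambda>x. - H (- x)"], rule exI[of _ "\<lambda>x. - g' (- x)"], rule exI[of _ B0], rule exI[of _ B1], rule exI[of _ B2], intro conjI allI)
    fix x y
    show "((\<lambda>x. - H (- x)) has_real_derivative g (- x)) (at x)"
      using DERIV_minus[OF DERIV_chain2[OF H m]] by simp
    show "((\<lambda>x. g (- x)) has_real_derivative - g' (- x)) (at x)"
      using DERIV_chain2[OF g' m] by simp
    show "\<bar>g (- x)\<bar> \<le> B0" "\<bar>- g' (- x)\<bar> \<le> B1" using b by auto
    show "\<bar>- g' (- x) - - g' (- y)\<bar> \<le> B2 * \<bar>x - y\<bar>" using b(3)[of "- y" "- x"] by (simp add: abs_minus_commute add.commute)
  qed
qed

text \<open>The line passes below the origin; reflection in the horizontal axis brings it above,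
  with slope \<open>- a\<close>.\<close>

lemma sector_ok_neg:
  assumes g: "weight_fun g" and ab: "b < 0" "\<tau> < a" "\<sigma> < \<tau>" and \<epsilon>: "\<epsilon> > 0" and saw: "small_sums \<epsilon> (- a)"
    and X: "\<And>s. s \<in> {\<sigma>..\<tau>} \<Longrightarrow> X s = b / (s - a)" and XM: "X \<tau> \<le> XM"
  shows "sector_ok \<epsilon> XM g X \<sigma> \<tau>"
proof -
  define h where "h s = g (- s)" for s
  obtain H g' B0 B1 B2 where H: "\<And>x. (H has_real_derivative h x) (at x)" and g': "\<And>x. (h has_real_derivative g' x) (at x)"
    and b: "\<And>x. \<bar>h x\<bar> \<le> B0" "\<And>x. \<bar>g' x\<bar> \<le> B1" "\<And>x y. \<bar>g' x - g' y\<bar> \<le> B2 * \<bar>x - y\<bar>"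
    using weight_fun_reflect[OF g] unfolding weight_fun_def h_def[symmetric] by metis
  obtain A where A: "A \<ge> 0" "\<And>N \<beta>. \<bar>\<Sum>n<N. sawtooth (real n * (- a) + \<beta>)\<bar> \<le> A * real N powr \<epsilon>"
    using saw unfolding small_sums_def by metis
  \<comment> \<open>Reflection exchanges the closed and the open end of an integer interval, hence
    the added 1. This is why \<open>sector_asymptotics\<close> allows any \<open>L n\<close> between
    \<open>n * \<sigma>\<close> and \<open>n * \<sigma> + 1\<close>.\<close>
  define L where "L n = 1 - \<lceil>real n * \<tau>\<rceil>" for n
  define U where "U n = 1 - \<lceil>real n * \<sigma>\<rceil>" for n
  have nb: "- b > 0" "- a < - \<tau>" "- \<tau> < - \<sigma>" using ab by auto
  have LU: "real n * (- \<tau>) \<le> of_int (L n)" "of_int (L n) \<le> real n * (- \<tau>) + 1" "real n * (- \<sigma>) \<le> of_int (U n)" "of_int (U n) \<le> real n * (- \<sigma>) + 1" for n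
    unfolding L_def U_def by (simp_all, linarith+)
  have "\<exists>C. \<forall>\<rho>\<ge>1. \<bar>(\<Sum>n=1..nat \<lfloor>\<rho> * (- b / (- \<tau> - - a))\<rfloor>. \<Sum>y=L n..<U n. if of_int y \<le> - a * n + \<rho> * - b then h (of_int y / n) else 0)
     - (\<rho>\<^sup>2 / 2 * integral {- \<tau>..- \<sigma>} (\<lambda>s. h s * (- b / (s - - a))\<^sup>2)
        + edge_term h L (- \<tau>) (\<rho> * (- b / (- \<tau> - - a))) - edge_term h U (- \<sigma>) (\<rho> * (- b / (- \<sigma> - - a))))\<bar> \<le> C * \<rho> powr \<epsilon>"
    by (rule sector_asymptotics[OF H g' b nb \<epsilon> A(2,1) LU])
  then obtain C where C: "\<And>\<rho>. \<rho> \<ge> 1 \<Longrightarrow> \<bar>(\<Sum>n=1..nat \<lfloor>\<rho> * (- b / (- \<tau> - - a))\<rfloor>. \<Sum>y=L n..<U n. if of_int y \<le> - a * n + \<rho> * - b then h (of_int y / n) else 0)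
     - (\<rho>\<^sup>2 / 2 * integral {- \<tau>..- \<sigma>} (\<lambda>s. h s * (- b / (s - - a))\<^sup>2)
        + edge_term h L (- \<tau>) (\<rho> * (- b / (- \<tau> - - a))) - edge_term h U (- \<sigma>) (\<rho> * (- b / (- \<sigma> - - a))))\<bar> \<le> C * \<rho> powr \<epsilon>"
    by blast
  have Xr: "- b / (- s - - a) = X s" if "s \<in> {\<sigma>..\<tau>}" for s
  proof -
    have "- b / (- s - - a) = - b / - (s - a)" by simp
    also have "\<dots> = X s" using X[OF that] by (simp only: minus_divide_divide)
    finally show ?thesis .
  qed
  have int: "integral {- \<tau>..- \<sigma>} (\<lambda>s. h s * (- b / (s - - a))\<^sup>2) = integral {\<sigma>..\<tau>} (\<lambda>s. g s * (X s)\<^sup>2)"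
  proof -
    have "integral {- \<tau>..- \<sigma>} (\<lambda>s. h s * (- b / (s - - a))\<^sup>2) = integral {- \<tau>..- \<sigma>} (\<lambda>s. (\<lambda>s. g s * (X s)\<^sup>2) (- s))"
    proof (intro integral_cong)
      fix s assume "s \<in> {- \<tau>..- \<sigma>}"
      then have "- s \<in> {\<sigma>..\<tau>}" by auto
      from Xr[OF this] show "h s * (- b / (s - - a))\<^sup>2 = g (- s) * (X (- s))\<^sup>2" by (simp add: h_def)
    qed
    also have "\<dots> = integral {\<sigma>..\<tau>} (\<lambda>s. g s * (X s)\<^sup>2)"
      by (rule Henstock_Kurzweil_Integration.integral_reflect_real)
    finally show ?thesis .
  qed
  have cs: "csum XM g X \<sigma> \<tau> \<rho> = (\<Sum>n=1..nat \<lfloor>\<rho> * (- b / (- \<tau> - - a))\<rfloor>. \<Sum>y=L n..<U n. if of_int y \<le> - a * n + \<rho> * - b then h (of_int y / n) else 0)"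
    if \<rho>: "\<rho> \<ge> 1" for \<rho>
  proof -
    have le: "X s \<le> X \<tau>" if "s \<in> {\<sigma>..<\<tau>}" for s
    proof -
      have "- b / (- s - - a) \<le> - b / (- \<tau> - - a)" using that ab by (intro divide_left_mono mult_pos_pos) auto
      then show ?thesis using Xr[of s] Xr[of \<tau>] that ab by auto
    qed
    have "csum XM g X \<sigma> \<tau> \<rho> = csum (X \<tau>) g X \<sigma> \<tau> \<rho>"
      by (rule csum_cut[OF _ XM \<rho>]) (rule le)
    also have "X \<tau> = - b / (- \<tau> - - a)" using Xr[of \<tau>] ab by simp
    also have "csum (- b / (- \<tau> - - a)) g X \<sigma> \<tau> \<rho> = (\<Sum>n=1..nat \<lfloor>\<rho> * (- b / (- \<tau> - - a))\<rfloor>. \<Sum>y=L n..<U n. if of_int y \<le> - a * n + \<rho> * - b then h (of_int y / n) else 0)"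
      unfolding csum_def
    proof (rule sum.cong, rule refl)
      fix n assume n: "n \<in> {1..nat \<lfloor>\<rho> * (- b / (- \<tau> - - a))\<rfloor>}"
      show "(\<Sum>y=\<lceil>real n * \<sigma>\<rceil>..<\<lceil>real n * \<tau>\<rceil>. if real n \<le> \<rho> * X (of_int y / real n) then g (of_int y / real n) else 0)
        = (\<Sum>y=L n..<U n. if of_int y \<le> - a * n + \<rho> * - b then h (of_int y / n) else 0)"
      proof (rule sum.reindex_bij_witness[of _ uminus uminus])
        fix y assume y: "y \<in> {\<lceil>real n * \<sigma>\<rceil>..<\<lceil>real n * \<tau>\<rceil>}"
        have n0: "real n > 0" using n by auto
        have s: "of_int y / real n \<in> {\<sigma>..<\<tau>}" using column_slope[OF _ y] n by auto
        have "- (of_int y / real n) - - a > 0" using s ab by auto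
        moreover have "X (of_int y / real n) = - b / (- (of_int y / real n) - - a)" using Xr s by auto
        ultimately have "real n \<le> \<rho> * X (of_int y / real n) \<longleftrightarrow> real n * (- (of_int y / real n) - - a) \<le> \<rho> * - b"
          by (simp only: times_divide_eq_right pos_le_divide_eq)
        also have "real n * (- (of_int y / real n) - - a) = - of_int y + a * n" using n0 by (simp add: right_diff_distrib)
        finally have "real n \<le> \<rho> * X (of_int y / real n) \<longleftrightarrow> - of_int y \<le> - a * n + \<rho> * - b" by (simp add: algebra_simps)
        then show "(if of_int (- y) \<le> - a * n + \<rho> * - b then h (of_int (- y) / n) else 0) = (if real n \<le> \<rho> * X (of_int y / real n) then g (of_int y / real n) else 0)"
          by (simp add: h_def)
      qed (auto simp: L_def U_def)
    qed
    finally show ?thesis .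
  qed
  have e1: "edge_term h L (- \<tau>) (\<rho> * (- b / (- \<tau> - - a))) = - edge g X \<rho> \<tau>" for \<rho>
    using Xr[of \<tau>] ab by (simp add: edge_def edge_term_def h_def L_def sum_negf[symmetric] algebra_simps)
  have e2: "edge_term h U (- \<sigma>) (\<rho> * (- b / (- \<sigma> - - a))) = - edge g X \<rho> \<sigma>" for \<rho>
    using Xr[of \<sigma>] ab by (simp add: edge_def edge_term_def h_def U_def sum_negf[symmetric] algebra_simps)
  have "\<bar>csum XM g X \<sigma> \<tau> \<rho> - (\<rho>\<^sup>2 / 2 * integral {\<sigma>..\<tau>} (\<lambda>s. g s * (X s)\<^sup>2) + edge g X \<rho> \<sigma> - edge g X \<rho> \<tau>)\<bar> \<le> C * \<rho> powr \<epsilon>" if "\<rho> \<ge> 1" for \<rho>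
  proof -
    have "\<rho>\<^sup>2 / 2 * integral {\<sigma>..\<tau>} (\<lambda>s. g s * (X s)\<^sup>2) + - edge g X \<rho> \<tau> - - edge g X \<rho> \<sigma> = \<rho>\<^sup>2 / 2 * integral {\<sigma>..\<tau>} (\<lambda>s. g s * (X s)\<^sup>2) + edge g X \<rho> \<sigma> - edge g X \<rho> \<tau>" by simp
    then show ?thesis using C[OF that] by (simp only: cs[OF that] int e1 e2)
  qed
  then show ?thesis unfolding sector_ok_def by blast
qed

text \<open>The sign of \<open>b\<close> tells on which side of the origin the line passes. For
  \<open>b = 0\<close> it would pass through the origin, and every slope in the interval would equal
  \<open>a\<close>.\<close>

lemma sector_ok_line:
  assumes g: "weight_fun g" and \<sigma>\<tau>: "\<sigma> < \<tau>" and \<epsilon>: "\<epsilon> > 0" and saw: "small_sums \<epsilon> a" "small_sums \<epsilon> (- a)"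
    and X: "\<And>s. s \<in> {\<sigma>..\<tau>} \<Longrightarrow> X s * (s - a) = b" "\<And>s. s \<in> {\<sigma>..\<tau>} \<Longrightarrow> 0 < X s \<and> X s \<le> XM"
  shows "sector_ok \<epsilon> XM g X \<sigma> \<tau>"
proof (cases b "0::real" rule: linorder_cases)
  case equal
  have "\<sigma> = a" using X(1)[of \<sigma>] X(2)[of \<sigma>] \<sigma>\<tau> equal by auto
  moreover have "\<tau> = a" using X(1)[of \<tau>] X(2)[of \<tau>] \<sigma>\<tau> equal by auto
  ultimately show ?thesis using \<sigma>\<tau> by simp
next
  case greater
  have pos: "s - a > 0" if "s \<in> {\<sigma>..\<tau>}" for s
    using X(1)[OF that] X(2)[OF that] greater by (metis zero_less_mult_pos)
  show ?thesis
    by (rule sector_ok_pos[OF g greater _ \<sigma>\<tau> \<epsilon> saw(1)])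
       (use pos X \<sigma>\<tau> in \<open>force simp: field_simps\<close>)+
next
  case less
  have neg: "s - a < 0" if "s \<in> {\<sigma>..\<tau>}" for s
  proof -
    have "X s * (a - s) > 0" using X(1)[OF that] less by (simp add: algebra_simps)
    then show ?thesis using X(2)[OF that] by (metis diff_gt_0_iff_gt diff_less_0_iff_less zero_less_mult_pos)
  qed
  show ?thesis
  proof (rule sector_ok_neg[OF g less _ \<sigma>\<tau> \<epsilon> saw(2)])
    show "\<tau> < a" using neg[of \<tau>] \<sigma>\<tau> by simp
    show "X \<tau> \<le> XM" using X(2)[of \<tau>] \<sigma>\<tau> by simp
    fix s assume s: "s \<in> {\<sigma>..\<tau>}"
    show "X s = b / (s - a)" using X(1)[OF s] neg[OF s] by (simp add: eq_divide_eq)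
  qed
qed

lemma sector_ok_join:
  assumes ok: "sector_ok \<epsilon> XM g X \<sigma> \<tau>" "sector_ok \<epsilon> XM g X \<tau> \<upsilon>" and le: "\<sigma> \<le> \<tau>" "\<tau> \<le> \<upsilon>"
    and int: "(\<lambda>s. g s * (X s)\<^sup>2) integrable_on {\<sigma>..\<upsilon>}"
  shows "sector_ok \<epsilon> XM g X \<sigma> \<upsilon>"
proof -
  obtain C1 where C1: "\<And>\<rho>. \<rho> \<ge> 1 \<Longrightarrow> \<bar>csum XM g X \<sigma> \<tau> \<rho> - (\<rho>\<^sup>2 / 2 * integral {\<sigma>..\<tau>} (\<lambda>s. g s * (X s)\<^sup>2) + edge g X \<rho> \<sigma> - edge g X \<rho> \<tau>)\<bar> \<le> C1 * \<rho> powr \<epsilon>"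
    using ok(1) unfolding sector_ok_def by blast
  obtain C2 where C2: "\<And>\<rho>. \<rho> \<ge> 1 \<Longrightarrow> \<bar>csum XM g X \<tau> \<upsilon> \<rho> - (\<rho>\<^sup>2 / 2 * integral {\<tau>..\<upsilon>} (\<lambda>s. g s * (X s)\<^sup>2) + edge g X \<rho> \<tau> - edge g X \<rho> \<upsilon>)\<bar> \<le> C2 * \<rho> powr \<epsilon>"
    using ok(2) unfolding sector_ok_def by blast
  have c: "csum XM g X \<sigma> \<upsilon> \<rho> = csum XM g X \<sigma> \<tau> \<rho> + csum XM g X \<tau> \<upsilon> \<rho>" for \<rho>
    unfolding csum_def sum.distrib[symmetric]
  proof (intro sum.cong refl)
    fix n
    have "\<lceil>real n * \<sigma>\<rceil> \<le> \<lceil>real n * \<tau>\<rceil>" "\<lceil>real n * \<tau>\<rceil> \<le> \<lceil>real n * \<upsilon>\<rceil>" using le by (auto intro!: ceiling_mono mult_left_mono)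
    then have "{\<lceil>real n * \<sigma>\<rceil>..<\<lceil>real n * \<upsilon>\<rceil>} = {\<lceil>real n * \<sigma>\<rceil>..<\<lceil>real n * \<tau>\<rceil>} \<union> {\<lceil>real n * \<tau>\<rceil>..<\<lceil>real n * \<upsilon>\<rceil>}" by auto
    then show "(\<Sum>y=\<lceil>real n * \<sigma>\<rceil>..<\<lceil>real n * \<upsilon>\<rceil>. if real n \<le> \<rho> * X (of_int y / real n) then g (of_int y / real n) else 0)
      = (\<Sum>y=\<lceil>real n * \<sigma>\<rceil>..<\<lceil>real n * \<tau>\<rceil>. if real n \<le> \<rho> * X (of_int y / real n) then g (of_int y / real n) else 0)
      + (\<Sum>y=\<lceil>real n * \<tau>\<rceil>..<\<lceil>real n * \<upsilon>\<rceil>. if real n \<le> \<rho> * X (of_int y / real n) then g (of_int y / real n) else 0)"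
      by (simp add: sum.union_disjoint ivl_disj_int_two(3))
  qed
  have i: "integral {\<sigma>..\<upsilon>} (\<lambda>s. g s * (X s)\<^sup>2) = integral {\<sigma>..\<tau>} (\<lambda>s. g s * (X s)\<^sup>2) + integral {\<tau>..\<upsilon>} (\<lambda>s. g s * (X s)\<^sup>2)"
    using Henstock_Kurzweil_Integration.integral_combine[OF le int] by simp
  have "\<bar>csum XM g X \<sigma> \<upsilon> \<rho> - (\<rho>\<^sup>2 / 2 * integral {\<sigma>..\<upsilon>} (\<lambda>s. g s * (X s)\<^sup>2) + edge g X \<rho> \<sigma> - edge g X \<rho> \<upsilon>)\<bar> \<le> (C1 + C2) * \<rho> powr \<epsilon>" if "\<rho> \<ge> 1" for \<rho>
    using C1[OF that] C2[OF that] unfolding c i distrib_left distrib_right by linarith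
  then show ?thesis unfolding sector_ok_def by blast
qed

lemma sector_ok_partition:
  assumes P: "finite P" and base: "\<And>\<sigma> \<tau>. \<lbrakk>-1 \<le> \<sigma>; \<sigma> < \<tau>; \<tau> \<le> 1; P \<inter> {\<sigma><..<\<tau>} = {}\<rbrakk> \<Longrightarrow> sector_ok \<epsilon> XM g X \<sigma> \<tau>"
    and int: "(\<lambda>s. g s * (X s)\<^sup>2) integrable_on {-1..1}"
    and "-1 \<le> \<sigma>" "\<sigma> < \<tau>" "\<tau> \<le> 1"
  shows "sector_ok \<epsilon> XM g X \<sigma> \<tau>"
  using assms(4-)
proof (induction "card (P \<inter> {\<sigma><..<\<tau>})" arbitrary: \<sigma> \<tau> rule: less_induct)
  case less
  show ?case
  proof (cases "P \<inter> {\<sigma><..<\<tau>} = {}")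
    case True then show ?thesis using base less.prems by blast
  next
    case False
    then obtain p where p: "p \<in> P" "\<sigma> < p" "p < \<tau>" by auto
    have "card (P \<inter> {\<sigma><..<p}) < card (P \<inter> {\<sigma><..<\<tau>})"
      by (intro psubset_card_mono) (use P p in auto)
    then have 1: "sector_ok \<epsilon> XM g X \<sigma> p" using less.hyps less.prems p by auto
    have "card (P \<inter> {p<..<\<tau>}) < card (P \<inter> {\<sigma><..<\<tau>})"
      by (intro psubset_card_mono) (use P p in auto)
    then have 2: "sector_ok \<epsilon> XM g X p \<tau>" using less.hyps less.prems p by auto
    show ?thesis
      by (rule sector_ok_join[OF 1 2]) (use p less.prems integrable_on_subinterval[OF int] in auto)
  qed
qed

subsection \<open>The boundary curve\<close>

text \<open>The abscissa of the boundary point on the ray of slope \<open>s\<close>, with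
  \<open>r\<close> the polar radius: the cosine of \<open>arctan s\<close> is
  \<open>1 / sqrt (1 + s\<^sup>2)\<close>.\<close>

definition Xr :: "(complex \<Rightarrow> real) \<Rightarrow> real \<Rightarrow> real" where
  "Xr r s = r (cis (arctan s)) / sqrt (1 + s\<^sup>2)"

text \<open>The sides form an unordered set, so that a rotation acts by taking images. Since every
  point of a side lies on the polar graph, no side can run along a ray from the origin.\<close>

definition boundary_data :: "(complex \<Rightarrow> real) \<Rightarrow> (complex \<times> complex) set \<Rightarrow> bool" where
  "boundary_data r Seg \<longleftrightarrow> continuous_on (sphere 0 1) r \<and> (\<forall>u\<in>sphere 0 1. r u > 0) \<and> finite Seg \<and>
     (\<forall>u\<in>sphere 0 1. \<exists>(v, w)\<in>Seg. of_real (r u) * u \<in> closed_segment v w) \<and>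
     (\<forall>(v, w)\<in>Seg. v \<noteq> w \<and> (\<forall>z\<in>closed_segment v w. z \<noteq> 0 \<and> z = of_real (r (sgn z)) * sgn z))"

lemma one_plus_square_pos: "1 + s\<^sup>2 > (0::real)" using zero_le_power2[of s] by linarith

lemma slope_point: "Complex 1 s = of_real (sqrt (1 + s\<^sup>2)) * cis (arctan s)"
  using one_plus_square_pos[of s] by (simp add: complex_eq_iff cos_arctan sin_arctan)

lemma sgn_of_real_mult:
  assumes "c > 0" "cmod u = 1" shows "sgn (of_real c * u) = u"
  using assms by (simp add: sgn_eq norm_mult)

lemma sgn_slope_point:
  assumes "c > 0" shows "sgn (of_real c * Complex 1 s) = cis (arctan s)"
proof -
  have e: "of_real c * Complex 1 s = of_real (c * sqrt (1 + s\<^sup>2)) * cis (arctan s)" by (simp add: slope_point)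
  have "c * sqrt (1 + s\<^sup>2) > 0" using assms one_plus_square_pos[of s] by simp
  then show ?thesis unfolding e by (rule sgn_of_real_mult[OF _ norm_cis])
qed

lemma Xr_point: "of_real (Xr r s) * Complex 1 s = of_real (r (cis (arctan s))) * cis (arctan s)"
proof -
  have "sqrt (1 + s\<^sup>2) \<noteq> 0" using one_plus_square_pos[of s] by simp
  then show ?thesis unfolding slope_point Xr_def by simp
qed

lemma Xr_pos: "boundary_data r Seg \<Longrightarrow> Xr r s > 0"
  unfolding boundary_data_def Xr_def using one_plus_square_pos[of s] by simp

lemma Xr_continuous:
  assumes "continuous_on (sphere 0 1) r" shows "continuous_on S (Xr r)"
proof -
  have "continuous_on S (\<lambda>s. r (cis (arctan s)))"
    by (rule continuous_on_compose2[OF assms]) (auto intro!: continuous_intros)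
  moreover have "sqrt (1 + s\<^sup>2) \<noteq> 0" for s using one_plus_square_pos[of s] by simp
  ultimately show ?thesis unfolding Xr_def by (auto intro!: continuous_intros)
qed

lemma closed_segment_combination:
  fixes v w :: complex
  assumes "\<alpha> \<ge> 0" "\<beta> \<ge> 0" "\<alpha> + \<beta> > 0"
  shows "of_real (1 / (\<alpha> + \<beta>)) * (of_real \<alpha> * v + of_real \<beta> * w) \<in> closed_segment v w"
proof -
  define t where "t = \<beta> / (\<alpha> + \<beta>)"
  have t: "0 \<le> t" "t \<le> 1" using assms by (auto simp: t_def)
  have eq1: "\<alpha> / (\<alpha> + \<beta>) = 1 - t" using assms by (simp add: t_def field_simps)
  have "of_real (1 / (\<alpha> + \<beta>)) * (of_real \<alpha> * v + of_real \<beta> * w) = of_real (\<alpha> / (\<alpha> + \<beta>)) * v + of_real (\<beta> / (\<alpha> + \<beta>)) * w"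
    by (simp add: add_divide_distrib)
  also have "\<dots> = (1 - t) *\<^sub>R v + t *\<^sub>R w"
    by (simp only: eq1 t_def[symmetric] scaleR_conv_of_real)
  finally have "of_real (1 / (\<alpha> + \<beta>)) * (of_real \<alpha> * v + of_real \<beta> * w) = (1 - t) *\<^sub>R v + t *\<^sub>R w" .
  then show ?thesis using t by (auto simp: closed_segment_def)
qed

lemma affine_sign:
  fixes p q :: real
  assumes nz: "\<And>s. s \<in> {\<sigma><..<\<tau>} \<Longrightarrow> p + q * s \<noteq> 0" and s0: "s0 \<in> {\<sigma><..<\<tau>}" "p + q * s0 \<ge> 0" and s: "s \<in> {\<sigma>..\<tau>}"
  shows "p + q * s \<ge> 0"
proof (rule ccontr)
  assume neg: "\<not> p + q * s \<ge> 0"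
  have pos: "p + q * s0 > 0" using nz[OF s0(1)] s0(2) by simp
  define l where "l = (p + q * s0) / ((p + q * s0) - (p + q * s))"
  have l: "0 < l" "l < 1" using pos neg by (auto simp: l_def)
  define c where "c = (1 - l) * s0 + l * s"
  have "\<sigma> < c"
  proof -
    have "(1 - l) * \<sigma> + l * \<sigma> < (1 - l) * s0 + l * s" using l s0 s by (intro add_less_le_mono mult_strict_left_mono mult_left_mono) auto
    then show ?thesis by (simp add: c_def algebra_simps)
  qed
  moreover have "c < \<tau>"
  proof -
    have "(1 - l) * s0 + l * s < (1 - l) * \<tau> + l * \<tau>" using l s0 s by (intro add_less_le_mono mult_strict_left_mono mult_left_mono) auto
    then show ?thesis by (simp add: c_def algebra_simps)
  qed
  moreover have "p + q * c = 0"
  proof -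
    have ne: "(p + q * s0) - (p + q * s) \<noteq> 0" using pos neg by linarith
    have "p + q * c = (p + q * s0) - l * ((p + q * s0) - (p + q * s))" by (simp add: c_def algebra_simps)
    also have "\<dots> = 0" using ne by (simp add: l_def)
    finally show ?thesis .
  qed
  ultimately show False using nz[of c] by simp
qed

text \<open>In the basis \<open>v\<close>, \<open>w\<close> the coordinates of
  \<open>Complex 1 s\<close> are affine in \<open>s\<close> and vanish only at the slopes of
  \<open>w\<close> and \<open>v\<close>. Nonnegative at the midpoint and without zeros in the open
  interval, they stay nonnegative up to its ends, so the side met by the middle ray is met by all
  rays of the interval.\<close>

lemma segment_over_interval:
  assumes bd: "boundary_data r Seg" and \<sigma>\<tau>: "\<sigma> < \<tau>"
    and free: "\<And>v w. (v, w) \<in> Seg \<Longrightarrow> (Re v \<noteq> 0 \<longrightarrow> Im v / Re v \<notin> {\<sigma><..<\<tau>}) \<and> (Re w \<noteq> 0 \<longrightarrow> Im w / Re w \<notin> {\<sigma><..<\<tau>})"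
  shows "\<exists>(v, w)\<in>Seg. \<forall>s\<in>{\<sigma>..\<tau>}. of_real (Xr r s) * Complex 1 s \<in> closed_segment v w"
proof -
  define s0 where "s0 = (\<sigma> + \<tau>) / 2"
  have s0: "s0 \<in> {\<sigma><..<\<tau>}" using \<sigma>\<tau> by (auto simp: s0_def)
  have "cis (arctan s0) \<in> sphere 0 1" by simp
  then obtain v w where vw: "(v, w) \<in> Seg" and in_seg: "of_real (r (cis (arctan s0))) * cis (arctan s0) \<in> closed_segment v w"
    using bd unfolding boundary_data_def by blast
  have vnw: "v \<noteq> w" and onb: "\<And>z. z \<in> closed_segment v w \<Longrightarrow> z \<noteq> 0 \<and> z = of_real (r (sgn z)) * sgn z"
    using bd vw unfolding boundary_data_def by blast+
  have v0: "v \<noteq> 0" "v = of_real (r (sgn v)) * sgn v" and w0: "w \<noteq> 0" "w = of_real (r (sgn w)) * sgn w"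
    using onb[of v] onb[of w] by auto
  define d where "d = Re v * Im w - Im v * Re w"
  \<comment> \<open>Linearly dependent end points would lie on one ray, hence be the same boundary
    point, or on opposite rays, with the origin between them.\<close>
  have d0: "d \<noteq> 0"
  proof
    assume "d = 0"
    then have "Im (cnj v * w) = 0" by (simp add: d_def)
    define k where "k = Re (cnj v * w) / (cmod v)\<^sup>2"
    have "cnj v * w = of_real (Re (cnj v * w))" using \<open>Im (cnj v * w) = 0\<close> by (simp add: complex_eq_iff)
    then have "v * cnj v * w = of_real (Re (cnj v * w)) * v" by (simp add: mult_ac)
    then have "of_real ((cmod v)\<^sup>2) * w = of_real (Re (cnj v * w)) * v" by (simp only: complex_norm_square)
    then have wk: "w = of_real k * v" using v0(1) by (simp add: k_def field_simps)
    show False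
    proof (cases "k > 0")
      case True
      then have "sgn w = sgn v" unfolding wk by (simp add: sgn_mult sgn_of_real)
      then show False using v0(2) w0(2) vnw by metis
    next
      case False
      have "0 \<in> closed_segment v w"
      proof -
        have "of_real (1 / (- k + 1)) * (of_real (- k) * v + of_real 1 * w) \<in> closed_segment v w"
          by (rule closed_segment_combination) (use False in auto)
        then show ?thesis by (simp add: wk)
      qed
      then show False using onb by blast
    qed
  qed
  define \<alpha> where "\<alpha> s = Im w / d + (- Re w / d) * s" for s
  define \<beta> where "\<beta> s = - Im v / d + (Re v / d) * s" for s
  have comb: "Complex 1 s = of_real (\<alpha> s) * v + of_real (\<beta> s) * w" for s
  proof -
    have "\<alpha> s * Re v + \<beta> s * Re w = (Re v * Im w - Im v * Re w) / d"
      by (simp add: \<alpha>_def \<beta>_def algebra_simps add_divide_distrib diff_divide_distrib)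
    moreover have "\<alpha> s * Im v + \<beta> s * Im w = s * (Re v * Im w - Im v * Re w) / d"
      by (simp add: \<alpha>_def \<beta>_def algebra_simps add_divide_distrib diff_divide_distrib)
    ultimately show ?thesis using d0 by (simp add: complex_eq_iff d_def)
  qed
  have uniq: "a = \<alpha> s * c \<and> b = \<beta> s * c" if "of_real a * v + of_real b * w = of_real c * Complex 1 s" for a b c s
  proof -
    have "of_real (a - \<alpha> s * c) * v + of_real (b - \<beta> s * c) * w = 0"
      using that unfolding comb[of s] by (simp add: algebra_simps)
    then have e: "(a - \<alpha> s * c) * Re v + (b - \<beta> s * c) * Re w = 0" "(a - \<alpha> s * c) * Im v + (b - \<beta> s * c) * Im w = 0"
      by (simp_all add: complex_eq_iff)
    have "(a - \<alpha> s * c) * d = ((a - \<alpha> s * c) * Re v + (b - \<beta> s * c) * Re w) * Im w - ((a - \<alpha> s * c) * Im v + (b - \<beta> s * c) * Im w) * Re w"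
      unfolding d_def by (simp add: algebra_simps)
    then have "(a - \<alpha> s * c) * d = 0" using e by simp
    moreover have "(b - \<beta> s * c) * d = ((a - \<alpha> s * c) * Im v + (b - \<beta> s * c) * Im w) * Re v - ((a - \<alpha> s * c) * Re v + (b - \<beta> s * c) * Re w) * Im v"
      unfolding d_def by (simp add: algebra_simps)
    then have "(b - \<beta> s * c) * d = 0" using e by simp
    ultimately show ?thesis using d0 by simp
  qed
  have X0: "Xr r s > 0" for s by (rule Xr_pos[OF bd])
  obtain t where t: "0 \<le> t" "t \<le> 1" "of_real (Xr r s0) * Complex 1 s0 = (1 - t) *\<^sub>R v + t *\<^sub>R w"
    using in_seg unfolding Xr_point[symmetric] closed_segment_def by auto
  have "1 - t = \<alpha> s0 * Xr r s0 \<and> t = \<beta> s0 * Xr r s0"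
    by (rule uniq) (simp only: t(3) scaleR_conv_of_real)
  then have \<alpha>\<beta>0: "\<alpha> s0 \<ge> 0" "\<beta> s0 \<ge> 0" using t X0[of s0] by (metis diff_ge_0_iff_ge zero_le_mult_iff not_le order_less_imp_le order_less_le_trans, metis zero_le_mult_iff not_le order_less_imp_le order_less_le_trans)
  have nz\<alpha>: "\<alpha> s \<noteq> 0" if "s \<in> {\<sigma><..<\<tau>}" for s
  proof
    assume "\<alpha> s = 0"
    then have e: "Im w = Re w * s" using d0 by (simp add: \<alpha>_def field_simps)
    have "Re w \<noteq> 0" using e w0(1) by (auto simp: complex_eq_iff)
    then have "Im w / Re w = s" using e by simp
    then show False using free[OF vw] \<open>Re w \<noteq> 0\<close> that by auto
  qed
  have nz\<beta>: "\<beta> s \<noteq> 0" if "s \<in> {\<sigma><..<\<tau>}" for s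
  proof
    assume "\<beta> s = 0"
    then have e: "Im v = Re v * s" using d0 by (simp add: \<beta>_def field_simps)
    have "Re v \<noteq> 0" using e v0(1) by (auto simp: complex_eq_iff)
    then have "Im v / Re v = s" using e by simp
    then show False using free[OF vw] \<open>Re v \<noteq> 0\<close> that by auto
  qed
  have "of_real (Xr r s) * Complex 1 s \<in> closed_segment v w" if s: "s \<in> {\<sigma>..\<tau>}" for s
  proof -
    have a: "\<alpha> s \<ge> 0" using affine_sign[of \<sigma> \<tau> "Im w / d" "- Re w / d" s0 s] nz\<alpha> \<alpha>\<beta>0(1) s s0 unfolding \<alpha>_def by blast
    have b: "\<beta> s \<ge> 0" using affine_sign[of \<sigma> \<tau> "- Im v / d" "Re v / d" s0 s] nz\<beta> \<alpha>\<beta>0(2) s s0 unfolding \<beta>_def by blast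
    have ab: "\<alpha> s + \<beta> s > 0"
    proof (rule ccontr)
      assume "\<not> ?thesis"
      then have "\<alpha> s = 0" "\<beta> s = 0" using a b by auto
      then show False using comb[of s] by (simp add: complex_eq_iff)
    qed
    define z where "z = of_real (1 / (\<alpha> s + \<beta> s)) * Complex 1 s"
    have "z \<in> closed_segment v w" unfolding z_def comb by (rule closed_segment_combination[OF a b ab])
    then have "z = of_real (r (sgn z)) * sgn z" using onb by blast
    moreover have "sgn z = cis (arctan s)" unfolding z_def using ab by (intro sgn_slope_point) simp
    ultimately have "z = of_real (Xr r s) * Complex 1 s" by (simp add: Xr_point)
    then show ?thesis using \<open>z \<in> closed_segment v w\<close> by simp
  qed
  then show ?thesis using vw by blast
qed

lemma cone_asymptotics:
  assumes bd: "boundary_data r Seg" and \<epsilon>: "\<epsilon> > 0" and g: "weight_fun g"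
    and slopes: "\<And>v w. (v, w) \<in> Seg \<Longrightarrow> Re (w - v) \<noteq> 0 \<and> small_sums \<epsilon> (Im (w - v) / Re (w - v)) \<and> small_sums \<epsilon> (- (Im (w - v) / Re (w - v)))"
    and XM: "\<And>s. Xr r s \<le> XM"
  shows "sector_ok \<epsilon> XM g (Xr r) (-1) 1"
proof -
  \<comment> \<open>Slopes of the end points of all sides, in whatever direction; an end point with
    real part 0 yields the value 0 of a division by 0, which only adds a cut.\<close>
  define P where "P = (\<lambda>(v, w). Im v / Re v) ` Seg \<union> (\<lambda>(v, w). Im w / Re w) ` Seg"
  have "finite P" using bd by (auto simp: P_def boundary_data_def)
  have rc: "continuous_on (sphere 0 1) r" using bd by (simp add: boundary_data_def)
  have gc: "continuous_on UNIV g"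
  proof -
    obtain g' where "\<And>x. (g has_real_derivative g' x) (at x)" using g unfolding weight_fun_def by blast
    then show ?thesis by (meson DERIV_isCont continuous_at_imp_continuous_on)
  qed
  show ?thesis
  proof (rule sector_ok_partition[OF \<open>finite P\<close>])
    show "(\<lambda>s. g s * (Xr r s)\<^sup>2) integrable_on {-1..1}"
      by (intro integrable_continuous_real continuous_intros continuous_on_subset[OF gc] Xr_continuous[OF rc]) auto
    fix \<sigma> \<tau> :: real assume \<sigma>\<tau>: "-1 \<le> \<sigma>" "\<sigma> < \<tau>" "\<tau> \<le> 1" and disj: "P \<inter> {\<sigma><..<\<tau>} = {}"
    have "\<exists>(v, w)\<in>Seg. \<forall>s\<in>{\<sigma>..\<tau>}. of_real (Xr r s) * Complex 1 s \<in> closed_segment v w"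
    proof (rule segment_over_interval[OF bd \<sigma>\<tau>(2)])
      fix v w assume "(v, w) \<in> Seg"
      then have "Im v / Re v \<in> P" "Im w / Re w \<in> P" by (auto simp: P_def intro: rev_image_eqI)
      then show "(Re v \<noteq> 0 \<longrightarrow> Im v / Re v \<notin> {\<sigma><..<\<tau>}) \<and> (Re w \<noteq> 0 \<longrightarrow> Im w / Re w \<notin> {\<sigma><..<\<tau>})"
        using disj by blast
    qed
    then obtain v w where vw: "(v, w) \<in> Seg" and seg: "\<And>s. s \<in> {\<sigma>..\<tau>} \<Longrightarrow> of_real (Xr r s) * Complex 1 s \<in> closed_segment v w"
      by blast
    define a where "a = Im (w - v) / Re (w - v)"
    have R0: "Re (w - v) \<noteq> 0" and sm: "small_sums \<epsilon> a" "small_sums \<epsilon> (- a)" using slopes[OF vw] by (auto simp: a_def)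
    show "sector_ok \<epsilon> XM g (Xr r) \<sigma> \<tau>"
    proof (rule sector_ok_line[OF g \<sigma>\<tau>(2) \<epsilon> sm, where b = "Im v - a * Re v"])
      fix s assume "s \<in> {\<sigma>..\<tau>}"
      then obtain t where t: "of_real (Xr r s) * Complex 1 s = (1 - t) *\<^sub>R v + t *\<^sub>R w"
        using seg unfolding closed_segment_def by blast
      have "Xr r s = Re v + t * Re (w - v)" "Xr r s * s = Im v + t * Im (w - v)"
        using arg_cong[OF t, of Re] arg_cong[OF t, of Im] by (simp_all add: algebra_simps)
      moreover have "Im (w - v) = a * Re (w - v)" using R0 by (simp add: a_def)
      ultimately show "Xr r s * (s - a) = Im v - a * Re v" by (simp only: right_diff_distrib) (simp add: algebra_simps)
      show "0 < Xr r s \<and> Xr r s \<le> XM" using Xr_pos[OF bd] XM by blast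
    qed
  qed auto
qed

lemma boundary_data_rotate:
  assumes "boundary_data r Seg"
  shows "boundary_data (\<lambda>u. r (\<i> * u)) ((\<lambda>(v, w). (- \<i> * v, - \<i> * w)) ` Seg)"
proof -
  have seg: "closed_segment (- \<i> * v) (- \<i> * w) = (\<lambda>z. - \<i> * z) ` closed_segment v w" for v w
    by (rule closed_segment_linear_image) (auto intro!: linearI simp: algebra_simps)
  have iz: "\<i> * (- \<i> * z) = z" "- \<i> * (\<i> * z) = z" for z by (simp_all flip: mult.assoc)
  have b: "continuous_on (sphere 0 1) r" "\<And>u. u \<in> sphere 0 1 \<Longrightarrow> r u > 0" "finite Seg"
    "\<And>u. u \<in> sphere 0 1 \<Longrightarrow> \<exists>(v, w)\<in>Seg. of_real (r u) * u \<in> closed_segment v w"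
    "\<And>v w. (v, w) \<in> Seg \<Longrightarrow> v \<noteq> w \<and> (\<forall>z\<in>closed_segment v w. z \<noteq> 0 \<and> z = of_real (r (sgn z)) * sgn z)"
    using assms unfolding boundary_data_def by blast+
  have sp: "\<i> * u \<in> sphere 0 1" if "u \<in> sphere 0 1" for u using that by (simp add: norm_mult)
  show ?thesis unfolding boundary_data_def
  proof (intro conjI ballI)
    show "continuous_on (sphere 0 1) (\<lambda>u. r (\<i> * u))"
      by (rule continuous_on_compose2[OF b(1)]) (use sp in \<open>auto intro!: continuous_intros\<close>)
    show "finite ((\<lambda>(v, w). (- \<i> * v, - \<i> * w)) ` Seg)" using b(3) by simp
  next
    fix u :: complex assume u: "u \<in> sphere 0 1"
    show "r (\<i> * u) > 0" using b(2)[OF sp[OF u]] .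
    obtain v w where vw: "(v, w) \<in> Seg" "of_real (r (\<i> * u)) * (\<i> * u) \<in> closed_segment v w" using b(4)[OF sp[OF u]] by blast
    have "- \<i> * (of_real (r (\<i> * u)) * (\<i> * u)) \<in> closed_segment (- \<i> * v) (- \<i> * w)" unfolding seg using vw(2) by (rule imageI)
    moreover have "- \<i> * (of_real (r (\<i> * u)) * (\<i> * u)) = of_real (r (\<i> * u)) * u" using iz(2)[of u] by (simp add: mult.left_commute)
    ultimately show "\<exists>(v, w)\<in>(\<lambda>(v, w). (- \<i> * v, - \<i> * w)) ` Seg. of_real (r (\<i> * u)) * u \<in> closed_segment v w"
      using vw(1) by (intro bexI[of _ "(- \<i> * v, - \<i> * w)"]) (auto intro: rev_image_eqI)
  next
    fix x assume "x \<in> (\<lambda>(v, w). (- \<i> * v, - \<i> * w)) ` Seg"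
    then obtain v w where vw: "(v, w) \<in> Seg" "x = (- \<i> * v, - \<i> * w)" by auto
    have "z \<noteq> 0 \<and> z = of_real (r (\<i> * sgn z)) * sgn z" if "z \<in> closed_segment (- \<i> * v) (- \<i> * w)" for z
    proof -
      obtain y where y: "y \<in> closed_segment v w" "z = - \<i> * y" using \<open>z \<in> _\<close> unfolding seg by auto
      have y0: "y \<noteq> 0" "y = of_real (r (sgn y)) * sgn y" using b(5)[OF vw(1)] y(1) by blast+
      have "sgn z = - \<i> * sgn y" by (simp add: y(2) sgn_eq norm_mult)
      then show ?thesis using y0 iz(1)[of "sgn y"] by (simp add: y(2))
    qed
    then show "case x of (v, w) \<Rightarrow> v \<noteq> w \<and> (\<forall>z\<in>closed_segment v w. z \<noteq> 0 \<and> z = of_real (r (\<i> * sgn z)) * sgn z)"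
      using b(5)[OF vw(1)] vw(2) by auto
  qed
qed

subsection \<open>Lattice points in cones\<close>

text \<open>The ray of slope -1 belongs to the cone and the ray of slope 1 does not, so that the
  four rotated cones partition the punctured plane.\<close>

definition cone_points :: "(complex \<Rightarrow> real) \<Rightarrow> real \<Rightarrow> complex set" where
  "cone_points r \<rho> = {w. Re w \<in> \<int> \<and> Im w \<in> \<int> \<and> 0 < Re w \<and> - Re w \<le> Im w \<and> Im w < Re w \<and> cmod w \<le> \<rho> * r (sgn w)}"

lemma cone_sum_eq_csum:
  assumes XM: "\<And>s. Xr r s \<le> XM" and \<rho>: "\<rho> \<ge> 1"
  shows "(\<Sum>w\<in>cone_points r \<rho>. F (sgn w)) = csum XM (\<lambda>s. F (cis (arctan s))) (Xr r) (-1) 1 \<rho>"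
proof -
  define B where "B = (SIGMA n:{1..nat \<lfloor>\<rho> * XM\<rfloor>}. {- int n..<int n})"
  define Q where "Q = (\<lambda>(n::nat, y::int). real n \<le> \<rho> * Xr r (of_int y / real n))"
  have "csum XM (\<lambda>s. F (cis (arctan s))) (Xr r) (-1) 1 \<rho> = (\<Sum>n=1..nat \<lfloor>\<rho> * XM\<rfloor>. \<Sum>y=- int n..<int n. if Q (n, y) then F (cis (arctan (of_int y / real n))) else 0)"
    unfolding csum_def Q_def
  proof (intro sum.cong refl)
    fix n show "{\<lceil>real n * - 1\<rceil>..<\<lceil>real n * 1\<rceil>} = {- int n..<int n}" by (simp add: ceiling_minus)
  qed simp_all
  also have "\<dots> = (\<Sum>p\<in>B. if Q p then F (cis (arctan (of_int (snd p) / real (fst p)))) else 0)"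
    unfolding B_def by (subst sum.Sigma) (auto simp: split_def)
  also have "\<dots> = (\<Sum>p\<in>{p\<in>B. Q p}. F (cis (arctan (of_int (snd p) / real (fst p)))))"
    by (rule sum.inter_filter[symmetric]) (simp add: B_def)
  also have "\<dots> = (\<Sum>w\<in>cone_points r \<rho>. F (sgn w))"
  proof (rule sum.reindex_bij_witness[of _ "\<lambda>w. (nat \<lfloor>Re w\<rfloor>, \<lfloor>Im w\<rfloor>)" "\<lambda>(n, y). Complex (real n) (of_int y)"])
    have pt: "Complex (real n) (of_int y) = of_real (real n) * Complex 1 (of_int y / real n)" if "n > 0" for n y
      using that by (simp add: complex_eq_iff)
    have sg: "sgn (Complex (real n) (of_int y)) = cis (arctan (of_int y / real n))" if "n > 0" for n y
      unfolding pt[OF that] using that by (intro sgn_slope_point) simp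
    have nm: "cmod (Complex (real n) (of_int y)) \<le> \<rho> * r (sgn (Complex (real n) (of_int y))) \<longleftrightarrow> Q (n, y)" if n: "n > 0" for n y
    proof -
      let ?s = "of_int y / real n"
      have q: "sqrt (1 + ?s\<^sup>2) > 0" using one_plus_square_pos by simp
      have "cmod (Complex (real n) (of_int y)) = real n * sqrt (1 + ?s\<^sup>2)"
        unfolding pt[OF n] slope_point using q by (simp add: norm_mult)
      then have "cmod (Complex (real n) (of_int y)) \<le> \<rho> * r (sgn (Complex (real n) (of_int y))) \<longleftrightarrow> real n * sqrt (1 + ?s\<^sup>2) \<le> \<rho> * r (cis (arctan ?s))"
        by (simp only: sg[OF n])
      also have "\<dots> \<longleftrightarrow> real n \<le> \<rho> * r (cis (arctan ?s)) / sqrt (1 + ?s\<^sup>2)" using q by (simp only: pos_le_divide_eq)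
      finally show ?thesis by (simp add: Q_def Xr_def)
    qed
    fix p assume p: "p \<in> {p\<in>B. Q p}"
    obtain n y where py: "p = (n, y)" by (cases p)
    have n: "n > 0" "- int n \<le> y" "y < int n" "Q (n, y)" using p by (auto simp: py B_def)
    show "(\<lambda>w. (nat \<lfloor>Re w\<rfloor>, \<lfloor>Im w\<rfloor>)) ((\<lambda>(n, y). Complex (real n) (of_int y)) p) = p" by (simp add: py)
    have "real_of_int (- int n) \<le> of_int y" "real_of_int y < of_int (int n)" using n by (simp_all only: of_int_le_iff of_int_less_iff)
    then show "(\<lambda>(n, y). Complex (real n) (of_int y)) p \<in> cone_points r \<rho>"
      using n nm[OF n(1), of y] by (simp add: cone_points_def py)
    show "F (sgn ((\<lambda>(n, y). Complex (real n) (of_int y)) p)) = F (cis (arctan (of_int (snd p) / real (fst p))))"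
      using sg[OF n(1)] by (simp add: py)
  next
    fix w assume w: "w \<in> cone_points r \<rho>"
    obtain a b where ab: "Re w = of_int a" "Im w = of_int b" using w by (auto simp: cone_points_def elim!: Ints_cases)
    have a: "a > 0" "- a \<le> b" "b < a"
    proof -
      have "of_int 0 < real_of_int a" "real_of_int (- a) \<le> of_int b" "real_of_int b < of_int a" using w ab by (auto simp: cone_points_def)
      then show "a > 0" "- a \<le> b" "b < a" by (simp_all only: of_int_le_iff of_int_less_iff)
    qed
    define n where "n = nat a"
    have n: "n > 0" "int n = a" using a by (auto simp: n_def)
    have "real n = of_int a" using n(2) by (metis of_int_of_nat_eq)
    then have wn: "w = Complex (real n) (of_int b)" using ab by (simp add: complex_eq_iff)
    show "(\<lambda>(n, y). Complex (real n) (of_int y)) (nat \<lfloor>Re w\<rfloor>, \<lfloor>Im w\<rfloor>) = w" by (simp add: wn)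
    let ?s = "of_int b / real n"
    have q: "sqrt (1 + ?s\<^sup>2) > 0" using one_plus_square_pos by simp
    have pt: "w = of_real (real n) * Complex 1 ?s" using n(1) by (simp add: wn complex_eq_iff)
    have "cmod w = real n * sqrt (1 + ?s\<^sup>2)" unfolding pt slope_point using q by (simp add: norm_mult)
    moreover have "sgn w = cis (arctan ?s)" unfolding pt using n(1) by (intro sgn_slope_point) simp
    ultimately have "real n * sqrt (1 + ?s\<^sup>2) \<le> \<rho> * r (cis (arctan ?s))" using w by (simp add: cone_points_def)
    then have "real n \<le> \<rho> * r (cis (arctan ?s)) / sqrt (1 + ?s\<^sup>2)" using q by (simp only: pos_le_divide_eq)
    then have Qn: "Q (n, b)" by (simp add: Q_def Xr_def)
    have "\<rho> * Xr r ?s \<le> \<rho> * XM" using XM \<rho> by (intro mult_left_mono) auto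
    then have "real n \<le> \<rho> * XM" using Qn by (simp add: Q_def)
    then have "n \<le> nat \<lfloor>\<rho> * XM\<rfloor>" by (simp add: le_nat_floor)
    then show "(nat \<lfloor>Re w\<rfloor>, \<lfloor>Im w\<rfloor>) \<in> {p\<in>B. Q p}" using Qn n a by (auto simp: wn B_def)
  qed
  finally show ?thesis ..
qed

lemma exactly_one_cone:
  fixes z :: complex assumes "z \<noteq> 0"
  shows "(\<Sum>k<4::nat. if (let w = (- \<i>) ^ k * z in 0 < Re w \<and> - Re w \<le> Im w \<and> Im w < Re w) then 1 else 0 :: real) = 1"
proof -
  have nz: "Re z \<noteq> 0 \<or> Im z \<noteq> 0" using assms by (auto simp: complex_eq_iff)
  have p: "(- \<i>) ^ 0 * z = z" "(- \<i>) ^ 1 * z = Complex (Im z) (- Re z)" "(- \<i>) ^ 2 * z = Complex (- Re z) (- Im z)" "(- \<i>) ^ 3 * z = Complex (- Im z) (Re z)"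
    by (simp_all add: complex_eq_iff eval_nat_numeral)
  have s4: "(\<Sum>k<4. h k) = h 0 + h 1 + h 2 + h 3" for h :: "nat \<Rightarrow> real" by (simp add: eval_nat_numeral)
  show ?thesis unfolding s4 p Let_def complex.sel using nz by (smt (verit))
qed

text \<open>Multiplication by \<open>\<i>\<close> preserves the lattice, so each cone can be turned
  into the one around the positive real axis, with \<open>r\<close> and \<open>f\<close> rotated in
  its place.\<close>

lemma lattice_sum_cones:
  fixes f :: "complex \<Rightarrow> real"
  assumes fin: "finite A" and A: "A = {z. z \<noteq> 0 \<and> Re z \<in> \<int> \<and> Im z \<in> \<int> \<and> cmod z \<le> \<rho> * r (sgn z)}"
  shows "(\<Sum>z\<in>A. f (sgn z)) = (\<Sum>k<4. \<Sum>w\<in>cone_points (\<lambda>u. r (\<i> ^ k * u)) \<rho>. f (\<i> ^ k * sgn w))"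
proof -
  define c where "c k z \<longleftrightarrow> (let w = (- \<i>) ^ k * z in 0 < Re w \<and> - Re w \<le> Im w \<and> Im w < Re w)" for k :: nat and z
  have ii: "\<i> ^ k * ((- \<i>) ^ k * z) = z" "(- \<i>) ^ k * (\<i> ^ k * z) = z" for k z
    by (simp_all add: mult.assoc[symmetric] power_mult_distrib[symmetric])
  have "(\<Sum>z\<in>A. f (sgn z)) = (\<Sum>z\<in>A. \<Sum>k<4. if c k z then f (sgn z) else 0)"
  proof (intro sum.cong refl)
    fix z assume "z \<in> A"
    then have "z \<noteq> 0" using A by auto
    have "(\<Sum>k<4. if c k z then f (sgn z) else 0) = f (sgn z) * (\<Sum>k<4::nat. if c k z then 1 else 0)"
      unfolding sum_distrib_left by (intro sum.cong) auto
    also have "\<dots> = f (sgn z)" unfolding c_def exactly_one_cone[OF \<open>z \<noteq> 0\<close>] by simp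
    finally show "f (sgn z) = (\<Sum>k<4. if c k z then f (sgn z) else 0)" ..
  qed
  also have "\<dots> = (\<Sum>k<4. \<Sum>z\<in>{z\<in>A. c k z}. f (sgn z))"
    by (subst sum.swap) (simp add: sum.inter_filter[OF fin])
  also have "\<dots> = (\<Sum>k<4. \<Sum>w\<in>cone_points (\<lambda>u. r (\<i> ^ k * u)) \<rho>. f (\<i> ^ k * sgn w))"
  proof (rule sum.cong[OF refl])
    fix k :: nat
    have sgi: "sgn (\<i> ^ k * w) = \<i> ^ k * sgn w" for w by (simp add: sgn_eq norm_mult norm_power)
    have ints: "Re (\<i> ^ k * w) \<in> \<int> \<and> Im (\<i> ^ k * w) \<in> \<int> \<longleftrightarrow> Re w \<in> \<int> \<and> Im w \<in> \<int>" for w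
    proof (induction k)
      case (Suc k)
      have step: "Re (\<i> * y) \<in> \<int> \<and> Im (\<i> * y) \<in> \<int> \<longleftrightarrow> Re y \<in> \<int> \<and> Im y \<in> \<int>" for y by auto
      show ?case unfolding power_Suc mult.assoc step by (rule Suc)
    qed simp
    show "(\<Sum>z\<in>{z\<in>A. c k z}. f (sgn z)) = (\<Sum>w\<in>cone_points (\<lambda>u. r (\<i> ^ k * u)) \<rho>. f (\<i> ^ k * sgn w))"
    proof (rule sum.reindex_bij_witness[of _ "\<lambda>w. \<i> ^ k * w" "\<lambda>z. (- \<i>) ^ k * z"])
      fix z assume z: "z \<in> {z\<in>A. c k z}"
      show "\<i> ^ k * ((- \<i>) ^ k * z) = z" by (rule ii)
      have sz: "\<i> ^ k * sgn ((- \<i>) ^ k * z) = sgn z" using sgi[of "(- \<i>) ^ k * z"] by (simp add: ii)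
      show "f (\<i> ^ k * sgn ((- \<i>) ^ k * z)) = f (sgn z)" by (simp only: sz)
      show "(- \<i>) ^ k * z \<in> cone_points (\<lambda>u. r (\<i> ^ k * u)) \<rho>"
        using z ints[of "(- \<i>) ^ k * z"] unfolding cone_points_def A c_def Let_def by (simp add: ii sz norm_mult norm_power)
    next
      fix w assume w: "w \<in> cone_points (\<lambda>u. r (\<i> ^ k * u)) \<rho>"
      show "(- \<i>) ^ k * (\<i> ^ k * w) = w" by (rule ii)
      have "w \<noteq> 0" using w by (auto simp: cone_points_def)
      then have w0: "\<i> ^ k * w \<noteq> 0" by simp
      have nm: "cmod (\<i> ^ k * w) = cmod w" by (simp add: norm_mult norm_power)
      have "c k (\<i> ^ k * w)" using w unfolding c_def Let_def ii cone_points_def by blast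
      moreover have "\<i> ^ k * w \<in> A" using w ints[of w] w0 unfolding cone_points_def A mem_Collect_eq sgi nm by blast
      ultimately show "\<i> ^ k * w \<in> {z\<in>A. c k z}" by blast
    qed
  qed
  finally show ?thesis .
qed

subsection \<open>Smooth weights\<close>

lemma periodic_bounded:
  fixes h :: "real \<Rightarrow> real"
  assumes cont: "continuous_on UNIV h" and per: "\<And>t. h (t + 2 * pi) = h t"
  shows "\<exists>B. \<forall>t. \<bar>h t\<bar> \<le> B"
proof -
  have pern: "h (t + 2 * pi * real n) = h t" for t n
  proof (induction n)
    case (Suc n)
    have "h (t + 2 * pi * real (Suc n)) = h ((t + 2 * pi * real n) + 2 * pi)" by (simp add: algebra_simps)
    then show ?case by (simp only: per Suc)
  qed simp
  have peri: "h (t + 2 * pi * of_int k) = h t" for t and k :: int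
  proof (cases "k \<ge> 0")
    case True then show ?thesis using pern[of t "nat k"] by simp
  next
    case False
    then have e: "(t + 2 * pi * of_int k) + 2 * pi * real (nat (- k)) = t" by simp
    show ?thesis using pern[of "t + 2 * pi * of_int k" "nat (- k)"] unfolding e by (rule sym)
  qed
  have "compact (h ` {0..2 * pi})" by (intro compact_continuous_image continuous_on_subset[OF cont]) auto
  then obtain B where B: "\<And>t. t \<in> {0..2 * pi} \<Longrightarrow> norm (h t) \<le> B" using compact_imp_bounded bounded_iff by (metis imageI)
  have "\<bar>h t\<bar> \<le> B" for t
  proof -
    define k where "k = \<lfloor>t / (2 * pi)\<rfloor>"
    have "of_int k \<le> t / (2 * pi)" "t / (2 * pi) \<le> of_int k + 1" unfolding k_def by linarith+
    then have "0 \<le> t - 2 * pi * of_int k" "t - 2 * pi * of_int k \<le> 2 * pi" by (simp_all add: field_simps)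
    then have "\<bar>h (t - 2 * pi * of_int k)\<bar> \<le> B" using B[of "t - 2 * pi * of_int k"] by simp
    moreover have "h (t - 2 * pi * of_int k) = h t" using peri[of t "- k"] by simp
    ultimately show ?thesis by simp
  qed
  then show ?thesis by blast
qed

lemma periodic_deriv:
  fixes h h1 :: "real \<Rightarrow> real"
  assumes d: "\<And>t. (h has_real_derivative h1 t) (at t)" and per: "\<And>t. h (t + 2 * pi) = h t"
  shows "h1 (t + 2 * pi) = h1 t"
proof -
  have "((\<lambda>t. h (t + 2 * pi)) has_real_derivative h1 (t + 2 * pi)) (at t)"
    using DERIV_shift[of h "h1 (t + 2 * pi)" t "2 * pi"] d by simp
  then have "(h has_real_derivative h1 (t + 2 * pi)) (at t)" by (simp add: per)
  then show ?thesis using d DERIV_unique by blast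
qed

text \<open>Periodicity bounds the derivatives of \<open>f\<close> along the circle, and the factor
  \<open>1 / (1 + s\<^sup>2)\<close> from \<open>arctan\<close> keeps the first two derivatives in
  \<open>s\<close> bounded on the whole line.\<close>

lemma weight_fun_circle:
  assumes smooth: "smooth_on_circle f"
  shows "weight_fun (\<lambda>s. f (cis (arctan s + c)))"
proof -
  define h where "h t = f (cis t)" for t
  define h1 where "h1 = deriv h"
  define h2 where "h2 = deriv h1"
  have "(deriv ^^ k) h differentiable at x" for k x using smooth unfolding smooth_on_circle_def h_def[abs_def] by blast
  from this[of 0] this[of 1] this[of 2]
  have diff: "h differentiable at x" "h1 differentiable at x" "h2 differentiable at x" for x
    by (simp_all add: h1_def h2_def eval_nat_numeral)
  have d: "(h has_real_derivative h1 x) (at x)" "(h1 has_real_derivative h2 x) (at x)" for x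
    using diff unfolding h1_def h2_def by (simp_all add: DERIV_deriv_iff_real_differentiable)
  have c2: "continuous_on UNIV h2" using diff(3) by (meson continuous_at_imp_continuous_on differentiable_imp_continuous_within)
  have c1: "continuous_on UNIV h1" "continuous_on UNIV h" using d by (meson DERIV_isCont continuous_at_imp_continuous_on)+
  have per: "h (t + 2 * pi) = h t" for t by (simp add: h_def cis.ctr)
  have per1: "h1 (t + 2 * pi) = h1 t" for t by (rule periodic_deriv[OF d(1) per])
  have per2: "h2 (t + 2 * pi) = h2 t" for t by (rule periodic_deriv[OF d(2) per1])
  obtain B0 where B0: "\<And>t. \<bar>h t\<bar> \<le> B0" using periodic_bounded[OF c1(2) per] by blast
  obtain B1 where B1: "\<And>t. \<bar>h1 t\<bar> \<le> B1" using periodic_bounded[OF c1(1) per1] by blast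
  obtain B2 where B2: "\<And>t. \<bar>h2 t\<bar> \<le> B2" using periodic_bounded[OF c2 per2] by blast
  define g where "g s = h (arctan s + c)" for s
  define g' where "g' s = h1 (arctan s + c) * inverse (1 + s\<^sup>2)" for s
  define g'' where "g'' s = (h2 (arctan s + c) * inverse (1 + s\<^sup>2)) * inverse (1 + s\<^sup>2) + (- (2 * s) * (inverse (1 + s\<^sup>2) * inverse (1 + s\<^sup>2))) * h1 (arctan s + c)" for s
  have ad: "((\<lambda>s. arctan s + c) has_real_derivative inverse (1 + s\<^sup>2)) (at s)" for s
    by (auto intro!: derivative_eq_intros)
  have gd: "(g has_real_derivative g' s) (at s)" for s
    unfolding g_def[abs_def] g'_def by (rule DERIV_chain2[OF d(1) ad])
  have id: "((\<lambda>s. inverse (1 + s\<^sup>2)) has_real_derivative (- (2 * s) * (inverse (1 + s\<^sup>2) * inverse (1 + s\<^sup>2)))) (at s)" for s :: real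
    using one_plus_square_pos[of s] by (auto intro!: derivative_eq_intros simp: power2_eq_square)
  have g'd: "(g' has_real_derivative g'' s) (at s)" for s
    unfolding g'_def[abs_def] g''_def by (rule DERIV_mult[OF DERIV_chain2[OF d(2) ad] id])
  have inv: "0 \<le> inverse (1 + s\<^sup>2)" "inverse (1 + s\<^sup>2) \<le> 1" "\<bar>2 * s\<bar> * inverse (1 + s\<^sup>2) \<le> 1" for s :: real
  proof -
    show "0 \<le> inverse (1 + s\<^sup>2)" "inverse (1 + s\<^sup>2) \<le> 1" using one_plus_square_pos[of s] by (auto simp: inverse_le_1_iff)
    have "0 \<le> (\<bar>s\<bar> - 1)\<^sup>2" by simp
    then have "\<bar>2 * s\<bar> \<le> 1 + s\<^sup>2" by (simp add: power2_diff abs_mult)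
    then show "\<bar>2 * s\<bar> * inverse (1 + s\<^sup>2) \<le> 1" using one_plus_square_pos[of s] by (simp add: field_simps)
  qed
  have g'b: "\<bar>g' s\<bar> \<le> B1" for s
  proof -
    have "\<bar>g' s\<bar> = \<bar>h1 (arctan s + c)\<bar> * inverse (1 + s\<^sup>2)" unfolding g'_def abs_mult using inv(1)[of s] by simp
    also have "\<dots> \<le> B1 * 1" using inv(1,2)[of s] B1 by (intro mult_mono) (auto intro: order_trans[OF abs_ge_zero])
    finally show ?thesis by simp
  qed
  have g''b: "\<bar>g'' s\<bar> \<le> B2 + B1" for s
  proof -
    have 1: "\<bar>(h2 (arctan s + c) * inverse (1 + s\<^sup>2)) * inverse (1 + s\<^sup>2)\<bar> \<le> B2 * 1 * 1"
      unfolding abs_mult using inv(1,2)[of s] B2 by (intro mult_mono) (auto intro: order_trans[OF abs_ge_zero])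
    have "\<bar>- (2 * s) * (inverse (1 + s\<^sup>2) * inverse (1 + s\<^sup>2))\<bar> = (\<bar>2 * s\<bar> * inverse (1 + s\<^sup>2)) * inverse (1 + s\<^sup>2)"
      unfolding abs_mult abs_minus_cancel using inv(1)[of s] by simp
    also have "\<dots> \<le> 1 * 1" using inv[of s] by (intro mult_mono) auto
    finally have "\<bar>- (2 * s) * (inverse (1 + s\<^sup>2) * inverse (1 + s\<^sup>2))\<bar> * \<bar>h1 (arctan s + c)\<bar> \<le> (1 * 1) * B1"
      using B1 by (intro mult_mono) auto
    then have 2: "\<bar>(- (2 * s) * (inverse (1 + s\<^sup>2) * inverse (1 + s\<^sup>2))) * h1 (arctan s + c)\<bar> \<le> B1" by (simp only: abs_mult mult_1)
    show ?thesis unfolding g''_def using 1 2 by (intro order_trans[OF abs_triangle_ineq]) simp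
  qed
  have lip: "\<bar>g' x - g' y\<bar> \<le> (B2 + B1) * \<bar>x - y\<bar>" for x y
  proof (cases x y rule: linorder_cases)
    case less
    then obtain z where "g' y - g' x = (y - x) * g'' z" using MVT2[of x y g' g''] g'd by auto
    then have "\<bar>g' x - g' y\<bar> = \<bar>g'' z\<bar> * \<bar>x - y\<bar>" by (metis abs_minus_commute abs_mult mult.commute)
    then show ?thesis using g''b by (simp add: mult_right_mono)
  next
    case greater
    then obtain z where "g' x - g' y = (x - y) * g'' z" using MVT2[of y x g' g''] g'd by auto
    then have "\<bar>g' x - g' y\<bar> = \<bar>g'' z\<bar> * \<bar>x - y\<bar>" by (metis abs_mult mult.commute)
    then show ?thesis using g''b by (simp add: mult_right_mono)
  qed simp
  have "\<exists>H. \<forall>x::real. - \<infinity> < ereal x \<longrightarrow> ereal x < \<infinity> \<longrightarrow> (H has_vector_derivative g x) (at x)"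
    by (rule einterval_antiderivative) (use gd DERIV_isCont in auto)
  then obtain H where H: "\<And>x. (H has_real_derivative g x) (at x)"
    by (auto simp: has_real_derivative_iff_has_vector_derivative)
  have "weight_fun g" unfolding weight_fun_def
    by (rule exI[of _ H], rule exI[of _ g'], rule exI[of _ B0], rule exI[of _ B1], rule exI[of _ "B2 + B1"])
       (use H gd B0 g'b lip in \<open>auto simp: g_def\<close>)
  then show ?thesis by (simp add: g_def[abs_def] h_def)
qed

subsection \<open>Polar coordinates\<close>

text \<open>Under \<open>t = arctan s + k * pi / 2\<close> each cone becomes the quarter arc centred
  at \<open>k * pi / 2\<close>; the piece from \<open>- pi / 4\<close> to 0 is moved by a
  period.\<close>

lemma circle_integral_cones:
  fixes \<phi> :: "real \<Rightarrow> real"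
  assumes cont: "continuous_on UNIV \<phi>" and per: "\<And>t. \<phi> (t + 2 * pi) = \<phi> t"
  shows "(\<Sum>k<4. integral {-1..1} (\<lambda>s. \<phi> (arctan s + real k * (pi / 2)) / (1 + s\<^sup>2))) = integral {0..2 * pi} \<phi>"
proof -
  have c: "continuous_on S \<phi>" for S using cont continuous_on_subset by blast
  have one: "integral {-1..1} (\<lambda>s. \<phi> (arctan s + x) / (1 + s\<^sup>2)) = integral {x - pi / 4..x + pi / 4} \<phi>" for x
  proof -
    have "((\<lambda>s. inverse (1 + s\<^sup>2) *\<^sub>R \<phi> (arctan s + x)) has_integral integral {arctan (-1) + x..arctan 1 + x} \<phi>) {-1..1}"
    proof (rule has_integral_substitution[where c = "- pi + x" and d = "pi + x"])
      show "arctan (- 1) + x \<le> arctan 1 + x" by (simp add: arctan_minus)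
      show "(\<lambda>s. arctan s + x) ` {- 1..1} \<subseteq> {- pi + x..pi + x}"
      proof (rule image_subsetI)
        fix s
        have "- pi + x \<le> arctan s + x" "arctan s + x \<le> pi + x"
          using arctan_lbound[of s] arctan_ubound[of s] pi_gt_zero by linarith+
        then show "arctan s + x \<in> {- pi + x..pi + x}" by simp
      qed
      show "((\<lambda>s. arctan s + x) has_real_derivative inverse (1 + s\<^sup>2)) (at s within {- 1..1})" for s
        by (auto intro!: derivative_eq_intros)
    qed (auto intro: c)
    moreover have "(\<lambda>s. inverse (1 + s\<^sup>2) *\<^sub>R \<phi> (arctan s + x)) = (\<lambda>s. \<phi> (arctan s + x) / (1 + s\<^sup>2))"
      by (simp add: divide_inverse mult.commute)
    moreover have "arctan (-1) + x = x - pi / 4" "arctan 1 + x = x + pi / 4" by (simp_all add: arctan_minus arctan_one)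
    ultimately have "((\<lambda>s. \<phi> (arctan s + x) / (1 + s\<^sup>2)) has_integral integral {x - pi / 4..x + pi / 4} \<phi>) {-1..1}"
      by (simp only:)
    then show ?thesis by (rule integral_unique)
  qed
  have i: "\<phi> integrable_on {a..b}" for a b by (rule integrable_continuous_real[OF c])
  have comb: "integral {a..b} \<phi> + integral {b..d} \<phi> = integral {a..d} \<phi>" if "a \<le> b" "b \<le> d" for a b d
    by (rule Henstock_Kurzweil_Integration.integral_combine[OF that i])
  have s4: "{..<4::nat} = {0, 1, 2, 3}" by auto
  have "(\<Sum>k<4. integral {-1..1} (\<lambda>s. \<phi> (arctan s + real k * (pi / 2)) / (1 + s\<^sup>2)))
    = integral {- (pi / 4)..pi / 4} \<phi> + integral {pi / 4..3 * pi / 4} \<phi> + integral {3 * pi / 4..5 * pi / 4} \<phi> + integral {5 * pi / 4..7 * pi / 4} \<phi>"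
    unfolding one s4 by (simp add: field_simps)
  also have "integral {- (pi / 4)..pi / 4} \<phi> + integral {pi / 4..3 * pi / 4} \<phi> = integral {- (pi / 4)..3 * pi / 4} \<phi>" by (rule comb) auto
  also have "\<dots> + integral {3 * pi / 4..5 * pi / 4} \<phi> = integral {- (pi / 4)..5 * pi / 4} \<phi>" by (rule comb) auto
  also have "\<dots> + integral {5 * pi / 4..7 * pi / 4} \<phi> = integral {- (pi / 4)..7 * pi / 4} \<phi>" by (rule comb) auto
  also have "\<dots> = integral {- (pi / 4)..0} \<phi> + integral {0..7 * pi / 4} \<phi>" by (rule comb[symmetric]) auto
  also have "integral {- (pi / 4)..0} \<phi> = integral {7 * pi / 4..2 * pi} \<phi>"
  proof -
    have "integral {- (pi / 4)..0} (\<phi> \<circ> (\<lambda>x. x + 2 * pi)) = integral {- (pi / 4) + 2 * pi..0 + 2 * pi} \<phi>"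
      by (rule integral_shift) (rule c)
    moreover have "\<phi> \<circ> (\<lambda>x. x + 2 * pi) = \<phi>" by (auto simp: per)
    ultimately show ?thesis by (simp add: field_simps)
  qed
  also have "integral {7 * pi / 4..2 * pi} \<phi> + integral {0..7 * pi / 4} \<phi> = integral {0..2 * pi} \<phi>"
    by (subst add.commute, rule comb) auto
  finally show ?thesis .
qed

text \<open>At slopes 1 and -1 the multiples \<open>n * s\<close> are integers, so each correction
  is exactly half the weight. It depends only on the weight on the ray and on the length of the ray,
  and both are the same before and after the rotation.\<close>

lemma edge_rotate:
  "edge (\<lambda>s. F (cis (arctan s))) (Xr r) \<rho> 1 = edge (\<lambda>s. F (\<i> * cis (arctan s))) (Xr (\<lambda>u. r (\<i> * u))) \<rho> (-1)"
proof -
  have "cis (pi / 2) * cis (- (pi / 4)) = cis (pi / 4)"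
    unfolding cis_mult by (rule arg_cong[of _ _ cis]) simp
  then have "\<i> * cis (arctan (-1)) = cis (arctan 1)"
    by (simp add: arctan_minus arctan_one)
  then show ?thesis by (simp add: edge_def edge_term_def Xr_def ceiling_minus)
qed

subsection \<open>Polygons with algebraic slopes\<close>

lemma small_sums_algebraic:
  assumes "algebraic a" "a \<notin> \<rat>" "\<epsilon> > 0"
  shows "small_sums \<epsilon> a"
proof -
  define \<delta> where "\<delta> = min \<epsilon> 1"
  have \<delta>: "0 < \<delta>" "\<delta> \<le> 1" "\<delta> \<le> \<epsilon>" using assms(3) by (auto simp: \<delta>_def)
  obtain c where c: "c > 0" "\<And>p q::int. q > 0 \<Longrightarrow> c * of_int q powr (- (2 + \<delta>)) \<le> \<bar>a - of_int p / of_int q\<bar>"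
    using roth[OF assms(1,2) \<delta>(1,2)] by blast
  obtain C where C: "C \<ge> 0" "\<And>N \<beta>. \<bar>\<Sum>n<N. sawtooth (real n * a + \<beta>)\<bar> \<le> C * real N powr \<delta>"
    using sawtooth_sum_bound[OF c(1) \<delta>(1) c(2)] by blast
  have "C * real N powr \<delta> \<le> C * real N powr \<epsilon>" for N
    using C(1) \<delta>(3) by (cases "N = 0") (auto intro!: mult_left_mono powr_mono)
  then show ?thesis unfolding small_sums_def using C by (meson order_trans)
qed

lemma alg_degree_irrational:
  assumes "alg_degree x \<ge> 2" shows "x \<notin> \<rat>"
proof
  assume "x \<in> \<rat>"
  then obtain a b :: int where ab: "b > 0" "x = of_int a / of_int b" by (elim Rats_cases') auto
  have "poly (map_poly of_int [:- a, b:]) x = 0" using ab by (simp add: map_poly_pCons)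
  moreover have "[:- a, b:] \<noteq> 0" "degree [:- a, b:] = 1" using ab(1) by simp_all
  ultimately have "alg_degree x \<le> 1" unfolding alg_degree_def by (intro Least_le) blast
  then show False using assms by simp
qed

definition algebraic_slope :: "complex \<Rightarrow> bool" where
  "algebraic_slope d \<longleftrightarrow> Re d \<noteq> 0 \<and> algebraic (Im d / Re d) \<and> Im d / Re d \<notin> \<rat>"

lemma algebraic_slope_side:
  assumes "algebraic (normal_ratio v w)" "alg_degree (normal_ratio v w) \<ge> 2"
  shows "algebraic_slope (w - v)"
proof -
  have irr: "normal_ratio v w \<notin> \<rat>" using assms(2) by (rule alg_degree_irrational)
  \<comment> \<open>For a vertical side \<open>normal_ratio\<close> is a division by 0, hence 0,
    which is rational.\<close>
  have R: "Re (w - v) \<noteq> 0" using irr unfolding normal_ratio_def by (metis Rats_0 div_by_0 minus_zero)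
  have e: "Im (w - v) / Re (w - v) = - normal_ratio v w" by (simp only: normal_ratio_def divide_minus_right minus_minus)
  show ?thesis unfolding algebraic_slope_def e using R irr algebraic_minus[OF assms(1)] by simp
qed

text \<open>The slope becomes its negative inverse; irrationality excludes slope 0 and passes to the
  inverse.\<close>

lemma algebraic_slope_rotate:
  assumes "algebraic_slope d" shows "algebraic_slope (- \<i> * d)"
proof -
  have d: "Re d \<noteq> 0" "algebraic (Im d / Re d)" "Im d / Re d \<notin> \<rat>" using assms by (auto simp: algebraic_slope_def)
  have I: "Im d \<noteq> 0" using d(3) by auto
  have e: "Im (- \<i> * d) / Re (- \<i> * d) = - inverse (Im d / Re d)" by simp
  have "inverse (Im d / Re d) \<notin> \<rat>" using d(3) Rats_inverse[of "inverse (Im d / Re d)"] by (metis inverse_inverse_eq)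
  then show ?thesis unfolding algebraic_slope_def e using I algebraic_minus[OF algebraic_inverse[OF d(2)]] by simp
qed

lemma algebraic_slope_rotate_power: "algebraic_slope d \<Longrightarrow> algebraic_slope ((- \<i>) ^ k * d)"
proof (induction k)
  case (Suc k)
  then show ?case using algebraic_slope_rotate[of "(- \<i>) ^ k * d"] by (simp only: power_Suc mult.assoc)
qed simp

lemma boundary_data_rotate_power:
  assumes "boundary_data r Seg"
  shows "boundary_data (\<lambda>u. r (\<i> ^ k * u)) ((\<lambda>(v, w). ((- \<i>) ^ k * v, (- \<i>) ^ k * w)) ` Seg)"
proof (induction k)
  case 0 then show ?case using assms by simp
next
  case (Suc k)
  have "(\<lambda>u. r (\<i> ^ k * (\<i> * u))) = (\<lambda>u. r (\<i> ^ Suc k * u))" by (simp only: power_Suc2 mult.assoc)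
  moreover have "(\<lambda>(v, w). (- \<i> * v, - \<i> * w)) ` (\<lambda>(v, w). ((- \<i>) ^ k * v, (- \<i>) ^ k * w)) ` Seg
    = (\<lambda>(v, w). ((- \<i>) ^ Suc k * v, (- \<i>) ^ Suc k * w)) ` Seg"
    unfolding image_image by (intro image_cong refl) (simp only: split_def fst_conv snd_conv power_Suc mult.assoc)
  ultimately show ?case using boundary_data_rotate[OF Suc] by (simp only:)
qed

section \<open>Star domains and their boundary\<close>

lemma star_domain_mem:
  assumes D: "D = {complex_of_real t * u | t u. u \<in> sphere 0 1 \<and> 0 \<le> t \<and> t \<le> r u}" and z: "z \<noteq> 0"
  shows "z \<in> D \<longleftrightarrow> cmod z \<le> r (sgn z)"
proof
  assume "z \<in> D"
  then obtain t u where tu: "z = of_real t * u" "cmod u = 1" "0 \<le> t" "t \<le> r u" using D by auto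
  have "t > 0" using tu z by (cases "t = 0") auto
  then have "sgn z = u" unfolding tu(1) using tu(2) by (rule sgn_of_real_mult)
  then show "cmod z \<le> r (sgn z)" using tu by (simp add: norm_mult)
next
  assume "cmod z \<le> r (sgn z)"
  moreover have "z = of_real (cmod z) * sgn z" using z by (simp add: sgn_eq)
  moreover have "sgn z \<in> sphere 0 1" using z by (simp add: norm_sgn)
  ultimately show "z \<in> D" unfolding D by (intro CollectI exI[of _ "cmod z"] exI[of _ "sgn z"]) auto
qed

text \<open>Away from 0, the points strictly within the radius form an open set by continuity of
  \<open>r\<close> in the direction; from a point at the radius, a slight move outwards along its
  ray leaves the domain.\<close>

lemma star_domain_frontier:
  assumes D: "D = {complex_of_real t * u | t u. u \<in> sphere 0 1 \<and> 0 \<le> t \<and> t \<le> r u}"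
    and cont: "continuous_on (sphere 0 1) r" and pos: "\<And>u. u \<in> sphere 0 1 \<Longrightarrow> r u > 0"
    and "closed D" "0 \<in> interior D"
  shows "frontier D = (\<lambda>u. of_real (r u) * u) ` sphere 0 1"
proof -
  have fr: "frontier D = D - interior D" using \<open>closed D\<close> by (simp add: frontier_def)
  have sp: "sgn z \<in> sphere 0 1" if "z \<noteq> 0" for z :: complex using that by (simp add: norm_sgn)
  show ?thesis
  proof (intro equalityI subsetI)
    fix z assume "z \<in> frontier D"
    then have z: "z \<in> D" "z \<notin> interior D" by (auto simp: fr)
    have z0: "z \<noteq> 0" using z(2) assms(5) by auto
    define U where "U = - {0} \<inter> (\<lambda>z. r (sgn z) - cmod z) -` {0<..}"
    have "continuous_on (- {0::complex}) (\<lambda>z. r (sgn z))"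
    proof (rule continuous_on_compose2[OF cont])
      show "sgn ` (- {0}) \<subseteq> sphere (0::complex) 1" using sp by blast
    qed (auto intro!: continuous_intros)
    then have "continuous_on (- {0}) (\<lambda>z. r (sgn z) - cmod z)" by (intro continuous_intros)
    then have "open U" unfolding U_def by (intro continuous_open_preimage) auto
    moreover have "U \<subseteq> D"
    proof
      fix x assume "x \<in> U"
      then have "x \<noteq> 0" "cmod x < r (sgn x)" by (auto simp: U_def)
      then show "x \<in> D" using star_domain_mem[OF D, of x] by simp
    qed
    ultimately have "z \<notin> U" using z(2) interiorI by blast
    then have "cmod z = r (sgn z)" using z0 star_domain_mem[OF D z0] z(1) by (auto simp: U_def)
    then have "z = of_real (r (sgn z)) * sgn z" using z0 by (simp add: sgn_eq)
    then show "z \<in> (\<lambda>u. of_real (r u) * u) ` sphere 0 1" using sp[OF z0] by blast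
  next
    fix z assume "z \<in> (\<lambda>u. of_real (r u) * u) ` sphere 0 1"
    then obtain u where u: "u \<in> sphere 0 1" "z = of_real (r u) * u" by blast
    have nu: "cmod u = 1" using u(1) by simp
    have "z \<in> D" unfolding D u(2) using u(1) pos[OF u(1)] by (intro CollectI exI[of _ "r u"] exI[of _ u]) auto
    moreover have "z \<notin> interior D"
    proof
      assume "z \<in> interior D"
      then obtain e where e: "e > 0" "ball z e \<subseteq> D" by (auto simp: mem_interior)
      define y where "y = of_real (r u + e / 2) * u"
      have ru: "r u + e / 2 > 0" using pos[OF u(1)] e(1) by simp
      have "dist z y = cmod (of_real (e / 2) * u)" by (simp add: dist_norm norm_minus_commute y_def u(2) algebra_simps)
      also have "\<dots> < e" using e(1) nu by (simp add: norm_mult)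
      finally have "y \<in> D" using e(2) by auto
      moreover have "cmod y = r u + e / 2" unfolding y_def using nu ru by (simp only: norm_mult norm_of_real) simp
      moreover have "sgn y = u" unfolding y_def using ru nu by (rule sgn_of_real_mult)
      moreover have "y \<noteq> 0" using \<open>cmod y = r u + e / 2\<close> ru by auto
      ultimately have "r u + e / 2 \<le> r u" using star_domain_mem[OF D, of y] by simp
      then show False using e(1) by simp
    qed
    ultimately show "z \<in> frontier D" by (simp add: fr)
  qed
qed

lemma boundary_data_polygon:
  assumes D: "D = {complex_of_real t * u | t u. u \<in> sphere 0 1 \<and> 0 \<le> t \<and> t \<le> r u}"
    and cont: "continuous_on (sphere 0 1) r" and pos: "\<And>u. u \<in> sphere 0 1 \<Longrightarrow> r u > 0"
    and "closed D" "0 \<in> interior D"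
    and fr: "frontier D = (\<Union>(v, w)\<in>Seg. closed_segment v w)" and Seg: "finite Seg" "\<And>v w. (v, w) \<in> Seg \<Longrightarrow> v \<noteq> w"
  shows "boundary_data r Seg"
proof -
  have fr': "(\<Union>(v, w)\<in>Seg. closed_segment v w) = (\<lambda>u. of_real (r u) * u) ` sphere 0 1"
    using star_domain_frontier[OF assms(1-5)] fr by simp
  have "\<exists>(v, w)\<in>Seg. of_real (r u) * u \<in> closed_segment v w" if "u \<in> sphere 0 1" for u
  proof -
    have "of_real (r u) * u \<in> (\<Union>(v, w)\<in>Seg. closed_segment v w)" unfolding fr' using that by (rule imageI)
    then show ?thesis by blast
  qed
  moreover have "z \<noteq> 0 \<and> z = of_real (r (sgn z)) * sgn z" if "(v, w) \<in> Seg" "z \<in> closed_segment v w" for v w z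
  proof -
    have "z \<in> (\<Union>(v, w)\<in>Seg. closed_segment v w)" using that by blast
    then obtain u where u: "u \<in> sphere 0 1" "z = of_real (r u) * u" unfolding fr' by blast
    have "sgn z = u" unfolding u(2) using pos[OF u(1)] u(1) by (intro sgn_of_real_mult) simp_all
    moreover have "z \<noteq> 0" using u pos[OF u(1)] by auto
    ultimately show ?thesis using u(2) by simp
  qed
  ultimately show ?thesis unfolding boundary_data_def using cont pos Seg by blast
qed

lemma imaginary_power_cis: "\<i> ^ k * cis t = cis (t + real k * (pi / 2))"
proof -
  have "\<i> ^ k = cis (real k * (pi / 2))" by (simp only: cis_pi_half[symmetric] Complex.DeMoivre)
  then show ?thesis by (simp only: cis_mult add.commute)
qed

lemma finite_lattice_bounded:
  assumes "\<And>z. z \<in> A \<Longrightarrow> Re z \<in> \<int> \<and> Im z \<in> \<int> \<and> cmod z \<le> R"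
  shows "finite A"
proof (rule finite_subset)
  show "A \<subseteq> (\<lambda>(a, b). Complex (of_int a) (of_int b)) ` ({- \<lceil>R\<rceil>..\<lceil>R\<rceil>} \<times> {- \<lceil>R\<rceil>..\<lceil>R\<rceil>})"
  proof
    fix z assume "z \<in> A"
    then have z: "Re z \<in> \<int>" "Im z \<in> \<int>" "cmod z \<le> R" using assms by auto
    obtain a b where ab: "Re z = of_int a" "Im z = of_int b" using z(1,2) by (auto elim!: Ints_cases)
    have "\<bar>real_of_int a\<bar> \<le> R" "\<bar>real_of_int b\<bar> \<le> R" using abs_Re_le_cmod[of z] abs_Im_le_cmod[of z] z(3) ab by linarith+
    then have "a \<in> {- \<lceil>R\<rceil>..\<lceil>R\<rceil>}" "b \<in> {- \<lceil>R\<rceil>..\<lceil>R\<rceil>}" by (simp_all, linarith+)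
    moreover have "z = Complex (of_int a) (of_int b)" using ab by (simp add: complex_eq_iff)
    ultimately show "z \<in> (\<lambda>(a, b). Complex (of_int a) (of_int b)) ` ({- \<lceil>R\<rceil>..\<lceil>R\<rceil>} \<times> {- \<lceil>R\<rceil>..\<lceil>R\<rceil>})" by auto
  qed
qed simp

text \<open>On the common boundary ray of two adjacent cones the two edge terms agree up to sign, so that they cancel
  around the circle.\<close>

lemma lattice_sum_asymptotics:
  fixes f r :: "complex \<Rightarrow> real"
  assumes bd: "boundary_data r Seg" and slope: "\<And>v w. (v, w) \<in> Seg \<Longrightarrow> algebraic_slope (w - v)"
    and smooth: "smooth_on_circle f" and \<epsilon>: "\<epsilon> > 0"
  shows "\<exists>C. \<forall>\<rho>\<ge>1. \<bar>(\<Sum>z | z \<noteq> 0 \<and> Re z \<in> \<int> \<and> Im z \<in> \<int> \<and> cmod z \<le> \<rho> * r (sgn z). f (sgn z))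
     - \<rho>\<^sup>2 / 2 * integral {0..2 * pi} (\<lambda>t. f (cis t) * (r (cis t))\<^sup>2)\<bar> \<le> C * \<rho> powr \<epsilon>"
proof -
  have rc: "continuous_on (sphere 0 1) r" and rp: "\<And>u. u \<in> sphere 0 1 \<Longrightarrow> r u > 0" using bd by (auto simp: boundary_data_def)
  have "bounded (r ` sphere 0 1)" by (intro compact_imp_bounded compact_continuous_image rc) simp
  then obtain XM where XM': "\<And>u. u \<in> sphere 0 1 \<Longrightarrow> \<bar>r u\<bar> \<le> XM" unfolding bounded_iff by (metis imageI real_norm_def)
  then have XM: "\<And>u. u \<in> sphere 0 1 \<Longrightarrow> r u \<le> XM" by (meson abs_le_D1)
  define R where "R k u = r (\<i> ^ k * u)" for k :: nat and u
  define S where "S k = (\<lambda>(v, w). ((- \<i>) ^ k * v, (- \<i>) ^ k * w)) ` Seg" for k :: nat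
  define g where "g k s = f (\<i> ^ k * cis (arctan s))" for k :: nat and s
  define I where "I k = integral {-1..1} (\<lambda>s. g k s * (Xr (R k) s)\<^sup>2)" for k
  have bdk: "boundary_data (R k) (S k)" for k
    using boundary_data_rotate_power[OF bd, of k] unfolding R_def[abs_def] S_def .
  have Xle: "Xr (R k) s \<le> XM" for k s
  proof -
    have sp: "\<i> ^ k * cis (arctan s) \<in> sphere 0 1" by (simp add: norm_mult norm_power)
    have XM0: "0 \<le> XM" using rp[OF sp] XM[OF sp] by simp
    have "1 \<le> sqrt (1 + s\<^sup>2)" by simp
    then have "XM * 1 \<le> XM * sqrt (1 + s\<^sup>2)" using XM0 by (rule mult_left_mono)
    then have "R k (cis (arctan s)) \<le> XM * sqrt (1 + s\<^sup>2)" using XM[OF sp] by (simp add: R_def)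
    then show ?thesis unfolding Xr_def using one_plus_square_pos[of s] by (intro mult_imp_div_pos_le) simp_all
  qed
  have gw: "weight_fun (g k)" for k
    using weight_fun_circle[OF smooth, of "real k * (pi / 2)"] unfolding g_def[abs_def] imaginary_power_cis .
  have "sector_ok \<epsilon> XM (g k) (Xr (R k)) (-1) 1" for k
  proof (rule cone_asymptotics[OF bdk \<epsilon> gw _ Xle])
    fix v w assume "(v, w) \<in> S k"
    then obtain v' w' where vw: "(v', w') \<in> Seg" "v = (- \<i>) ^ k * v'" "w = (- \<i>) ^ k * w'" by (auto simp: S_def)
    have "algebraic_slope ((- \<i>) ^ k * (w' - v'))" using slope[OF vw(1)] by (rule algebraic_slope_rotate_power)
    then have "algebraic_slope (w - v)" by (simp only: vw(2,3) right_diff_distrib)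
    then have d: "Re (w - v) \<noteq> 0" "algebraic (Im (w - v) / Re (w - v))" "Im (w - v) / Re (w - v) \<notin> \<rat>"
      by (auto simp only: algebraic_slope_def)
    have "- (Im (w - v) / Re (w - v)) \<notin> \<rat>" using d(3) by (metis Rats_minus_iff)
    then show "Re (w - v) \<noteq> 0 \<and> small_sums \<epsilon> (Im (w - v) / Re (w - v)) \<and> small_sums \<epsilon> (- (Im (w - v) / Re (w - v)))"
      using d small_sums_algebraic[OF _ _ \<epsilon>] algebraic_minus[OF d(2)] by blast
  qed
  then have "\<forall>k. \<exists>C. \<forall>\<rho>\<ge>1. \<bar>csum XM (g k) (Xr (R k)) (-1) 1 \<rho> - (\<rho>\<^sup>2 / 2 * I k + edge (g k) (Xr (R k)) \<rho> (-1) - edge (g k) (Xr (R k)) \<rho> 1)\<bar> \<le> C * \<rho> powr \<epsilon>"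
    unfolding sector_ok_def I_def by blast
  then obtain C where C: "\<And>k \<rho>. \<rho> \<ge> 1 \<Longrightarrow> \<bar>csum XM (g k) (Xr (R k)) (-1) 1 \<rho> - (\<rho>\<^sup>2 / 2 * I k + edge (g k) (Xr (R k)) \<rho> (-1) - edge (g k) (Xr (R k)) \<rho> 1)\<bar> \<le> C k * \<rho> powr \<epsilon>"
    by metis
  have Isum: "(\<Sum>k<4. I k) = integral {0..2 * pi} (\<lambda>t. f (cis t) * (r (cis t))\<^sup>2)"
  proof -
    define \<phi> where "\<phi> t = f (cis t) * (r (cis t))\<^sup>2" for t
    have "(\<lambda>t. f (cis t)) differentiable at x" for x using smooth unfolding smooth_on_circle_def by (metis funpow_0)
    then have "continuous_on UNIV (\<lambda>t. f (cis t))" by (meson continuous_at_imp_continuous_on differentiable_imp_continuous_within)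
    moreover have "continuous_on UNIV (\<lambda>t. r (cis t))"
      by (rule continuous_on_compose2[OF rc]) (auto intro!: continuous_intros)
    ultimately have "continuous_on UNIV \<phi>" unfolding \<phi>_def by (intro continuous_intros)
    moreover have "\<phi> (t + 2 * pi) = \<phi> t" for t by (simp add: \<phi>_def cis.ctr)
    ultimately have "(\<Sum>k<4. integral {-1..1} (\<lambda>s. \<phi> (arctan s + real k * (pi / 2)) / (1 + s\<^sup>2))) = integral {0..2 * pi} \<phi>"
      by (rule circle_integral_cones)
    \<comment> \<open>The Jacobian of \<open>arctan\<close> is already contained in the square of
      \<open>Xr\<close>.\<close>
    moreover have "g k s * (Xr (R k) s)\<^sup>2 = \<phi> (arctan s + real k * (pi / 2)) / (1 + s\<^sup>2)" for k s
      using one_plus_square_pos[of s] by (simp add: g_def R_def Xr_def \<phi>_def imaginary_power_cis power_divide)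
    ultimately show ?thesis by (simp add: I_def \<phi>_def[abs_def])
  qed
  have "\<bar>(\<Sum>z | z \<noteq> 0 \<and> Re z \<in> \<int> \<and> Im z \<in> \<int> \<and> cmod z \<le> \<rho> * r (sgn z). f (sgn z))
     - \<rho>\<^sup>2 / 2 * integral {0..2 * pi} (\<lambda>t. f (cis t) * (r (cis t))\<^sup>2)\<bar> \<le> (\<Sum>k<4. C k) * \<rho> powr \<epsilon>" if \<rho>: "\<rho> \<ge> 1" for \<rho>
  proof -
    define A where "A = {z. z \<noteq> 0 \<and> Re z \<in> \<int> \<and> Im z \<in> \<int> \<and> cmod z \<le> \<rho> * r (sgn z)}"
    define E where "E k s = edge (g k) (Xr (R k)) \<rho> s" for k s
    have "finite A"
    proof (rule finite_lattice_bounded[where R = "\<rho> * XM"])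
      fix z assume z: "z \<in> A"
      have "r (sgn z) \<le> XM" using z by (intro XM) (auto simp: A_def norm_sgn)
      then have "\<rho> * r (sgn z) \<le> \<rho> * XM" using \<rho> by (intro mult_left_mono) auto
      then show "Re z \<in> \<int> \<and> Im z \<in> \<int> \<and> cmod z \<le> \<rho> * XM" using z by (auto simp: A_def)
    qed
    then have "(\<Sum>z\<in>A. f (sgn z)) = (\<Sum>k<4. \<Sum>w\<in>cone_points (R k) \<rho>. f (\<i> ^ k * sgn w))"
      unfolding R_def[abs_def] using A_def by (rule lattice_sum_cones)
    also have "\<dots> = (\<Sum>k<4. csum XM (g k) (Xr (R k)) (-1) 1 \<rho>)"
    proof (intro sum.cong refl)
      fix k :: nat
      show "(\<Sum>w\<in>cone_points (R k) \<rho>. f (\<i> ^ k * sgn w)) = csum XM (g k) (Xr (R k)) (-1) 1 \<rho>"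
        using cone_sum_eq_csum[OF Xle \<rho>, where F = "\<lambda>u. f (\<i> ^ k * u)"] unfolding g_def[abs_def] .
    qed
    finally have cnt: "(\<Sum>z\<in>A. f (sgn z)) = (\<Sum>k<4. csum XM (g k) (Xr (R k)) (-1) 1 \<rho>)" .
    have rot: "E k 1 = E (Suc k) (-1)" for k
    proof -
      have "E k 1 = edge (\<lambda>s. f (\<i> ^ k * (\<i> * cis (arctan s)))) (Xr (\<lambda>u. R k (\<i> * u))) \<rho> (-1)"
        unfolding E_def g_def[abs_def] by (rule edge_rotate[where F = "\<lambda>u. f (\<i> ^ k * u)"])
      also have "\<dots> = E (Suc k) (-1)" unfolding E_def g_def[abs_def] R_def[abs_def] power_Suc2 mult.assoc ..
      finally show ?thesis .
    qed
    \<comment> \<open>The fourth rotation is the identity, so the telescoping sum over the cones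
      closes up to 0.\<close>
    have "E 4 (-1) = E 0 (-1)"
    proof -
      have "\<i> ^ 4 = 1" by (simp add: eval_nat_numeral)
      then show ?thesis by (simp add: E_def g_def[abs_def] R_def[abs_def])
    qed
    moreover have "(\<Sum>k<4. E k (-1) - E (Suc k) (-1)) = E 0 (-1) - E 4 (-1)" by (rule sum_lessThan_telescope')
    ultimately have tel: "(\<Sum>k<4. E k (-1) - E k 1) = 0" by (simp add: rot)
    have "(\<Sum>z\<in>A. f (sgn z)) - \<rho>\<^sup>2 / 2 * (\<Sum>k<4. I k)
      = (\<Sum>k<4. csum XM (g k) (Xr (R k)) (-1) 1 \<rho>) - \<rho>\<^sup>2 / 2 * (\<Sum>k<4. I k) - (\<Sum>k<4. E k (-1) - E k 1)" unfolding cnt tel by simp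
    also have "\<dots> = (\<Sum>k<4. csum XM (g k) (Xr (R k)) (-1) 1 \<rho> - (\<rho>\<^sup>2 / 2 * I k + E k (-1) - E k 1))"
      unfolding sum_distrib_left sum_subtractf[symmetric] by (intro sum.cong refl) linarith
    also have "\<bar>\<dots>\<bar> \<le> (\<Sum>k<4. C k * \<rho> powr \<epsilon>)"
      unfolding E_def by (intro order_trans[OF sum_abs] sum_mono C \<rho>)
    finally show ?thesis unfolding A_def Isum sum_distrib_right .
  qed
  then show ?thesis by blast
qed

lemma lattice_count_star_domain:
  assumes D: "D = {complex_of_real t * u | t u. u \<in> sphere 0 1 \<and> 0 \<le> t \<and> t \<le> r u}" and \<rho>: "\<rho> > 0"
  shows "lattice_count f D \<rho> = (\<Sum>z | z \<noteq> 0 \<and> Re z \<in> \<int> \<and> Im z \<in> \<int> \<and> cmod z \<le> \<rho> * r (sgn z). f (sgn z))"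
  unfolding lattice_count_def
proof (rule sum.cong)
  have "z \<in> (\<lambda>x. \<rho> *\<^sub>R x) ` D \<longleftrightarrow> cmod z \<le> \<rho> * r (sgn z)" if z: "z \<noteq> 0" for z
  proof -
    have "z \<in> (\<lambda>x. \<rho> *\<^sub>R x) ` D \<longleftrightarrow> inverse \<rho> *\<^sub>R z \<in> D"
    proof
      assume "inverse \<rho> *\<^sub>R z \<in> D"
      moreover have "z = \<rho> *\<^sub>R (inverse \<rho> *\<^sub>R z)" using \<rho> by simp
      ultimately show "z \<in> (\<lambda>x. \<rho> *\<^sub>R x) ` D" by blast
    qed (use \<rho> in auto)
    also have "\<dots> \<longleftrightarrow> cmod (inverse \<rho> *\<^sub>R z) \<le> r (sgn (inverse \<rho> *\<^sub>R z))"
      using star_domain_mem[OF D, of "inverse \<rho> *\<^sub>R z"] z \<rho> by simp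
    also have "sgn (inverse \<rho> *\<^sub>R z) = sgn z" using \<rho> by (simp add: sgn_scaleR)
    also have "cmod (inverse \<rho> *\<^sub>R z) = cmod z / \<rho>" using \<rho> by (simp add: divide_inverse mult.commute)
    finally show ?thesis using \<rho> by (simp add: pos_divide_le_eq mult.commute)
  qed
  then show "{z. z \<noteq> 0 \<and> Re z \<in> \<int> \<and> Im z \<in> \<int> \<and> z \<in> (\<lambda>x. \<rho> *\<^sub>R x) ` D}
    = {z. z \<noteq> 0 \<and> Re z \<in> \<int> \<and> Im z \<in> \<int> \<and> cmod z \<le> \<rho> * r (sgn z)}" by blast
  show "f (z / complex_of_real (cmod z)) = f (sgn z)" for z by (simp add: sgn_eq)
qed

theorem theoremC:
  fixes D :: "complex set" and m f :: "complex \<Rightarrow> real" and \<epsilon> :: real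
  assumes "compact D"
    and "0 \<in> interior D"
    and "\<forall>x\<in>D. closed_segment 0 x \<subseteq> D"
    and "continuous_on (sphere 0 1) m"
    and "\<forall>u\<in>sphere 0 1. m u > 0"
    and "D = {complex_of_real r * u | r u. u \<in> sphere 0 1 \<and> 0 \<le> r \<and> r \<le> sqrt (m u)}"
    and "algebraic_polygon D"
    and "smooth_on_circle f"
    and "\<epsilon> > 0"
  shows "(\<lambda>\<rho>. integral {0..2*pi} (\<lambda>t. f (cis t) * m (cis t)) - 2 / \<rho>\<^sup>2 * lattice_count f D \<rho>)
           \<in> O[at_top](\<lambda>\<rho>. \<rho> powr (\<epsilon> - 2))"
proof -
  obtain vs :: "complex list" where vs: "length vs \<ge> 3"
    "\<And>i. i < length vs \<Longrightarrow> vs ! i \<noteq> vs ! ((i + 1) mod length vs)"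
    "frontier D = (\<Union>i < length vs. closed_segment (vs ! i) (vs ! ((i + 1) mod length vs)))"
    "\<And>i. i < length vs \<Longrightarrow> algebraic (normal_ratio (vs ! i) (vs ! ((i + 1) mod length vs)))"
    "\<And>i. i < length vs \<Longrightarrow> alg_degree (normal_ratio (vs ! i) (vs ! ((i + 1) mod length vs))) \<ge> 2"
    using assms(7) unfolding algebraic_polygon_def by blast
  define Seg where "Seg = (\<lambda>i. (vs ! i, vs ! ((i + 1) mod length vs))) ` {..<length vs}"
  define r where "r u = sqrt (m u)" for u
  have D: "D = {complex_of_real t * u | t u. u \<in> sphere 0 1 \<and> 0 \<le> t \<and> t \<le> r u}" using assms(6) by (simp only: r_def)
  have bd: "boundary_data r Seg"
  proof (rule boundary_data_polygon[OF D])
    show "continuous_on (sphere 0 1) r" unfolding r_def[abs_def] by (intro continuous_intros assms(4))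
    show "\<And>u. u \<in> sphere 0 1 \<Longrightarrow> r u > 0" using assms(5) by (simp add: r_def)
    show "closed D" using assms(1) by (rule compact_imp_closed)
    show "frontier D = (\<Union>(v, w)\<in>Seg. closed_segment v w)" unfolding vs(3) Seg_def by auto
    show "finite Seg" by (simp add: Seg_def)
    show "\<And>v w. (v, w) \<in> Seg \<Longrightarrow> v \<noteq> w" using vs(2) by (auto simp: Seg_def)
  qed (rule assms(2))
  have slope: "algebraic_slope (w - v)" if vw: "(v, w) \<in> Seg" for v w
  proof -
    obtain i where i: "i < length vs" "v = vs ! i" "w = vs ! ((i + 1) mod length vs)" using vw by (auto simp: Seg_def)
    show ?thesis unfolding i(2,3) by (rule algebraic_slope_side[OF vs(4,5)[OF i(1)]])
  qed
  define J where "J = integral {0..2*pi} (\<lambda>t. f (cis t) * m (cis t))"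
  have "(\<lambda>t. f (cis t) * (r (cis t))\<^sup>2) = (\<lambda>t. f (cis t) * m (cis t))"
    using assms(5) by (intro ext) (simp add: r_def less_imp_le)
  moreover obtain C where "\<And>\<rho>. \<rho> \<ge> 1 \<Longrightarrow> \<bar>(\<Sum>z | z \<noteq> 0 \<and> Re z \<in> \<int> \<and> Im z \<in> \<int> \<and> cmod z \<le> \<rho> * r (sgn z). f (sgn z))
     - \<rho>\<^sup>2 / 2 * integral {0..2 * pi} (\<lambda>t. f (cis t) * (r (cis t))\<^sup>2)\<bar> \<le> C * \<rho> powr \<epsilon>"
    using lattice_sum_asymptotics[OF bd slope assms(8,9)] by blast
  ultimately have C: "\<bar>lattice_count f D \<rho> - \<rho>\<^sup>2 / 2 * J\<bar> \<le> C * \<rho> powr \<epsilon>" if "\<rho> \<ge> 1" for \<rho>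
    using lattice_count_star_domain[OF D, of \<rho> f] that unfolding J_def by simp
  have "norm (J - 2 / \<rho>\<^sup>2 * lattice_count f D \<rho>) \<le> (2 * C) * norm (\<rho> powr (\<epsilon> - 2))" if \<rho>: "\<rho> \<ge> 1" for \<rho>
  proof -
    have "J - 2 / \<rho>\<^sup>2 * lattice_count f D \<rho> = - (2 / \<rho>\<^sup>2 * (lattice_count f D \<rho> - \<rho>\<^sup>2 / 2 * J))"
      using \<rho> by (simp add: right_diff_distrib)
    then have "norm (J - 2 / \<rho>\<^sup>2 * lattice_count f D \<rho>) = 2 / \<rho>\<^sup>2 * \<bar>lattice_count f D \<rho> - \<rho>\<^sup>2 / 2 * J\<bar>"
      by (simp only: real_norm_def abs_minus_cancel abs_mult) simp
    also have "\<dots> \<le> 2 / \<rho>\<^sup>2 * (C * \<rho> powr \<epsilon>)" using C[OF \<rho>] by (intro mult_left_mono) auto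
    also have "\<dots> = (2 * C) * norm (\<rho> powr (\<epsilon> - 2))" using \<rho> by (simp add: powr_diff)
    finally show ?thesis .
  qed
  then have "\<forall>\<^sub>F \<rho> in at_top. norm (J - 2 / \<rho>\<^sup>2 * lattice_count f D \<rho>) \<le> (2 * C) * norm (\<rho> powr (\<epsilon> - 2))"
    by (intro eventually_mono[OF eventually_ge_at_top[of 1]])
  then show ?thesis unfolding J_def by (rule bigoI)
qed

end
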